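(* Let $\mathfrak{a}$ be a fractional ideal of $K$ and $u_0\in\mathbb{H}_3$. For $\gamma=\begin{pmatrix}a&b\\c&d\end{pmatrix}\in\Gamma$ put $\widehat{E}_{\chi,\mathfrak{a}}(\gamma)=\int_{u_0}^{\gamma u_0}\widehat{E}_{\chi,\mathfrak{a}}$. Then \[\widehat{E}_{\chi,\mathfrak{a}}(\gamma)=\chi(\mathfrak{a})^{-1}\begin{cases}I\!\left(\frac{a+d}{c}\right)G_2(\mathfrak{a})-D(a,c,\mathfrak{a}) & \text{if } c\neq0,\\[0.2cm] I\!\left(\frac{b}{d}\right)G_2(\mathfrak{a}) & \text{if } c=0.\end{cases}\] In particular $\chi(\mathfrak{a})\widehat{E}_{\chi,\mathfrak{a}}(\gamma)=\Phi_\mathfrak{a}(\gamma)$.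
   Context: $K\subset\mathbb{C}$ is an imaginary quadratic field with ring of integers $\mathscr{O}$, $\mathscr{O}^\times=\{\pm1\}$, and either class number one or discriminant $D\equiv1\pmod 8$. $\chi$ is a homomorphism from fractional ideals of $K$ to $\mathbb{C}^\times$ with $\chi((\alpha))=\alpha^{-2}$ for $\alpha\in K^\times$. $\mathbb{H}_3=\{u=z+jv:z\in\mathbb{C},v>0\}$ with $\operatorname{SL}_2(\mathbb{C})$ acting by $u\mapsto(au+b)(cu+d)^{-1}$; $\Gamma=\operatorname{SL}_2(\mathscr{O})$. With $\eta(u,c,d,s)=\dfrac{v^s[(\overline{cz+d})^2dz-(\bar cv)^2d\bar z+2(\overline{cz+d})\bar cv\,dv]}{(|cz+d|^2+|c|^2v^2)^{2+s}}$, $\widehat{E}_{\chi,\mathfrak{a}}$ is the value at $s=0$ of the analytic continuation of $\chi(\mathfrak{a})^{-1}\operatorname{N}(\mathfrak{a})^s\sum_{(c,d)\in(\mathfrak{a}\times\mathfrak{a})\setminus\{(0,0)\}}\eta(u,c,d,s)$; it is a closed $\Gamma$-invariant $1$-form, so the integral is independent of the path and of $u_0$. $I(z)=z-\bar z$. For a lattice $L\subset\mathbb{C}$ and $k\ge1$, $G_k(z,L)$ is the value at $\lambda=0$ of the analytic continuation of $\sum'_{\omega\in L}(z+\omega)^{-k}|z+\omega|^{-\lambda}$ (the prime omitting $\omega=-z$), and $G_k(L)=G_k(0,L)$. For $a,c\in\mathscr{O}$, $c\neq0$, and a lattice $L$ with $\{\lambda\in\mathbb{C}:\lambda L\subseteq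 L\}=\mathscr{O}$: $D(a,c,L)=\frac1c\sum_{r\in L/cL}G_1(\frac{ar}{c},L)G_1(\frac rc,L)$. Sczech's map $\Phi_L:\Gamma\to\mathbb{C}$ is $\Phi_L\begin{pmatrix}a&b\\c&d\end{pmatrix}=I(\frac{a+d}{c})G_2(L)-D(a,c,L)$ if $c\ne0$ and $I(\frac bd)G_2(L)$ if $c=0$; $\Phi_\mathfrak{a}=\Phi_L$ for $L=\mathfrak{a}$. *)

theory Defs
  imports "HOL-Complex_Analysis.Complex_Analysis"
          "HOL-Computational_Algebra.Polynomial"
          "HOL-Computational_Algebra.Squarefree"
begin

section \<open>The imaginary quadratic field K = Q(sqrt m), m < 0 squarefree, inside C\<close>

definition qgen :: "int \<Rightarrow> complex" where
  "qgen m = \<i> * complex_of_real (sqrt (real_of_int (- m)))"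

definition Kfield :: "int \<Rightarrow> complex set" where
  "Kfield m = {of_rat p + of_rat q * qgen m | p q. True}"

definition alg_int :: "complex \<Rightarrow> bool" where
  "alg_int x \<longleftrightarrow> (\<exists>p :: complex poly. lead_coeff p = 1 \<and> (\<forall>i. coeff p i \<in> \<int>) \<and> poly p x = 0)"

definition OK :: "int \<Rightarrow> complex set" where
  "OK m = {x \<in> Kfield m. alg_int x}"

definition qdisc :: "int \<Rightarrow> int" where
  "qdisc m = (if m mod 4 = 1 then m else 4 * m)"

definition frac_ideal :: "int \<Rightarrow> complex set \<Rightarrow> bool" where
  "frac_ideal m A \<longleftrightarrow> A \<subseteq> Kfield m \<and> 0 \<in> A \<and> A \<noteq> {0}
     \<and> (\<forall>x\<in>A. \<forall>y\<in>A. x + y \<in> A)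
     \<and> (\<forall>r\<in>OK m. \<forall>x\<in>A. r * x \<in> A)
     \<and> (\<exists>t\<in>OK m. t \<noteq> 0 \<and> (\<forall>x\<in>A. t * x \<in> OK m))"

definition ideal_mult :: "complex set \<Rightarrow> complex set \<Rightarrow> complex set" where
  "ideal_mult A B = {(\<Sum>i<n. x i * y i) | (n::nat) (x::nat \<Rightarrow> complex) (y::nat \<Rightarrow> complex). \<forall>i<n. x i \<in> A \<and> y i \<in> B}"

definition principal :: "int \<Rightarrow> complex \<Rightarrow> complex set" where
  "principal m \<alpha> = {\<alpha> * r | r. r \<in> OK m}"

definition class_number_one :: "int \<Rightarrow> bool" where
  "class_number_one m \<longleftrightarrow>
     (\<forall>A. frac_ideal m A \<longrightarrow> (\<exists>\<alpha>\<in>Kfield m. \<alpha> \<noteq> 0 \<and> A = principal m \<alpha>))"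

definition is_chi :: "int \<Rightarrow> (complex set \<Rightarrow> complex) \<Rightarrow> bool" where
  "is_chi m chi \<longleftrightarrow>
     (\<forall>A B. frac_ideal m A \<and> frac_ideal m B \<longrightarrow> chi (ideal_mult A B) = chi A * chi B)
   \<and> (\<forall>A. frac_ideal m A \<longrightarrow> chi A \<noteq> 0)
   \<and> (\<forall>\<alpha>\<in>Kfield m. \<alpha> \<noteq> 0 \<longrightarrow> chi (principal m \<alpha>) = inverse (\<alpha> ^ 2))"

definition covol :: "complex set \<Rightarrow> real" where
  "covol L = (THE A. \<exists>w1 w2. L = {of_int p * w1 + of_int q * w2 | p q. True}
                 \<and> Im (cnj w1 * w2) \<noteq> 0 \<and> A = \<bar>Im (cnj w1 * w2)\<bar>)"

definition ideal_norm :: "int \<Rightarrow> complex set \<Rightarrow> real" where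
  "ideal_norm m A = covol A / covol (OK m)"

definition acont0 :: "(complex \<Rightarrow> complex) \<Rightarrow> real \<Rightarrow> complex" where
  "acont0 F \<sigma> = (THE c. \<exists>U f. open U \<and> connected U \<and> 0 \<in> U \<and> {s. \<sigma> < Re s} \<subseteq> U
       \<and> f holomorphic_on U \<and> (\<forall>s. \<sigma> < Re s \<longrightarrow> f s = F s) \<and> f 0 = c)"

text \<open>G_k(z,L): value at lambda = 0 of the continuation of the series, absolutely
  convergent for Re lambda > 2 - k.\<close>
definition Gser :: "nat \<Rightarrow> complex \<Rightarrow> complex set \<Rightarrow> complex" where
  "Gser k z L = acont0
     (\<lambda>l. infsum (\<lambda>\<omega>. inverse ((z + \<omega>) ^ k) * (complex_of_real (cmod (z + \<omega>))) powr (- l))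
                  {\<omega> \<in> L. z + \<omega> \<noteq> 0})
     (2 - real k)"

definition G2 :: "complex set \<Rightarrow> complex" where
  "G2 L = Gser 2 0 L"

definition Dsum :: "complex \<Rightarrow> complex \<Rightarrow> complex set \<Rightarrow> complex" where
  "Dsum a c L = (1 / c) *
     (\<Sum>X \<in> L // {(x, y). x \<in> L \<and> y \<in> L \<and> x - y \<in> (\<lambda>\<omega>. c * \<omega>) ` L}.
        (let r = (SOME r. r \<in> X) in Gser 1 (a * r / c) L * Gser 1 (r / c) L))"

definition Iop :: "complex \<Rightarrow> complex" where
  "Iop z = z - cnj z"

definition Phi :: "complex set \<Rightarrow> complex \<Rightarrow> complex \<Rightarrow> complex \<Rightarrow> complex \<Rightarrow> complex" where
  "Phi L a b c d = (if c \<noteq> 0 then Iop ((a + d) / c) * G2 L - Dsum a c L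
                    else Iop (b / d) * G2 L)"

section \<open>Hyperbolic 3-space: u = z + j v represented as (z, v), v > 0\<close>

text \<open>(au+b)(cu+d)^(-1) written out in coordinates.\<close>
definition gact :: "complex \<Rightarrow> complex \<Rightarrow> complex \<Rightarrow> complex \<Rightarrow> complex \<times> real \<Rightarrow> complex \<times> real" where
  "gact a b c d u = (let z = fst u; v = snd u;
       den = (cmod (c * z + d))\<^sup>2 + (cmod c)\<^sup>2 * v\<^sup>2
     in (((a * z + b) * cnj (c * z + d) + a * cnj c * complex_of_real (v\<^sup>2)) / complex_of_real den,
         v / den))"

text \<open>Coefficients of eta(u,c,d,s) w.r.t. dz, d(conj z), dv.\<close>
definition eta_den :: "complex \<times> real \<Rightarrow> complex \<Rightarrow> complex \<Rightarrow> real" where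
  "eta_den u c d = (cmod (c * fst u + d))\<^sup>2 + (cmod c)\<^sup>2 * (snd u)\<^sup>2"

definition eta1 :: "complex \<times> real \<Rightarrow> complex \<Rightarrow> complex \<Rightarrow> complex \<Rightarrow> complex" where
  "eta1 u c d s = complex_of_real (snd u) powr s * (cnj (c * fst u + d))\<^sup>2
                  / complex_of_real (eta_den u c d) powr (2 + s)"

definition eta2 :: "complex \<times> real \<Rightarrow> complex \<Rightarrow> complex \<Rightarrow> complex \<Rightarrow> complex" where
  "eta2 u c d s = complex_of_real (snd u) powr s * (- (cnj c * complex_of_real (snd u))\<^sup>2)
                  / complex_of_real (eta_den u c d) powr (2 + s)"

definition eta3 :: "complex \<times> real \<Rightarrow> complex \<Rightarrow> complex \<Rightarrow> complex \<Rightarrow> complex" where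
  "eta3 u c d s = complex_of_real (snd u) powr s
                  * (2 * cnj (c * fst u + d) * cnj c * complex_of_real (snd u))
                  / complex_of_real (eta_den u c d) powr (2 + s)"

text \<open>Coefficients of the 1-form Ehat_{chi,a}; the lattice sum converges for Re s > 1.\<close>
definition Ehat_coeff ::
  "(complex \<times> real \<Rightarrow> complex \<Rightarrow> complex \<Rightarrow> complex \<Rightarrow> complex) \<Rightarrow> int \<Rightarrow> (complex set \<Rightarrow> complex)
     \<Rightarrow> complex set \<Rightarrow> complex \<times> real \<Rightarrow> complex" where
  "Ehat_coeff eta m chi A u = acont0
     (\<lambda>s. inverse (chi A) * complex_of_real (ideal_norm m A) powr s
          * infsum (\<lambda>(c, d). eta u c d s) (A \<times> A - {(0, 0)}))
     1"

text \<open>Integral of Ehat from u0 to gamma u0 (along the straight segment; the form is closed,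
  so the value is path independent).\<close>
definition Ehat_gamma ::
  "int \<Rightarrow> (complex set \<Rightarrow> complex) \<Rightarrow> complex set \<Rightarrow> complex \<times> real
     \<Rightarrow> complex \<Rightarrow> complex \<Rightarrow> complex \<Rightarrow> complex \<Rightarrow> complex" where
  "Ehat_gamma m chi A u0 a b c d =
     (let u1 = gact a b c d u0; dz = fst u1 - fst u0; dv = snd u1 - snd u0 in
      integral {0..1} (\<lambda>t::real.
        let p = (fst u0 + complex_of_real t * dz, snd u0 + t * dv) in
          Ehat_coeff eta1 m chi A p * dz + Ehat_coeff eta2 m chi A p * cnj dz
          + Ehat_coeff eta3 m chi A p * complex_of_real dv))"

end

(*
  The Eisenstein form has an explicit primitive on hyperbolic space.  Write w = x z + y and
  Q = |w|^2 + |x|^2 v^2 for lattice elements x, y.  Formally the form is the sum over (x, y) of the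
  differentials of -conj(w) / (x Q) (terms with x = 0 contribute G_2 dz), but this sum converges only
  conditionally.  It is therefore replaced by the Mellin integral of the theta series
  sum -conj(w)/x * exp(-t Q), which decays faster than every power of t at 0 because the lattice
  Gaussians are periodic analytic functions whose derivatives have mean zero.  This gives a primitive
  H = H_0 + G_2 z - kappa conj(z) with an unknown constant kappa from the conditional convergence.

  The form is invariant because its terms are the pullbacks of dz under matrices with bottom row (x, y);
  hence H(gamma u) - H(u) does not depend on u.  For u = (-d/c, v) with v -> infinity the
  point gamma u descends vertically to a/c; there H_0(u) tends to 0 and H_0(gamma u) to -D(a, c), so
  the constant is G_2 (a+d)/c - kappa conj((a+d)/c) - D(a, c).  Finally kappa = G_2: the matrix
  (1, -1; 1, 0) has a fixed point in hyperbolic space, so its period 0 equals G_2 - kappa - D(1, 1),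
  and D(1, 1) = G_1(0)^2 = 0.
*)

theory Submission
  imports Defs
begin

section \<open>Termwise operations on unconditional sums\<close>

text \<open>The cutoff explains the constant called kappa. Once damped by
  \<open>exp (-(e * Q))\<close>, the summand \<open>- cnj w / (x * Q)\<close> has as differential
  the corresponding summand of the form, multiplied by \<open>(1 + e * Q) * exp (-(e * Q))\<close>,
  plus \<open>cnj x / x * e * exp (-(e * Q))\<close> times d conj(z). Each such leftover vanishes as
  e tends to 0, but their sum does not: it tends to \<open>c0 * N0\<close>, where \<open>c0\<close>
  is the limit of t times the plain Gaussian sum and \<open>N0\<close> is a regularised sum of
  \<open>cnj x / x\<close>. Rapid decay needs care because the plain Gaussian sum
  \<open>th 0\<close> does not decay; only its dependence on the base point does. In the d conj(z)
  coefficient its value at the base point 0 is split off, and this part occurs multiplied by a sum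
  \<open>th 2\<close>, which is flat at t = 0. Hence no polar terms arise, the Mellin transforms are
  entire, and each value prescribed by continuation is a convergent integral over the half line.
  Invariance becomes a substitution in that integral. One torsion element determines the constant
  because the constant depends only on the lattice and every lattice is stable under integer
  matrices.\<close>

lemma acont0_eqI:
  assumes "f holomorphic_on UNIV" and eq: "\<And>s. \<sigma> < Re s \<Longrightarrow> f s = F s"
  shows "acont0 F \<sigma> = f 0"
  unfolding acont0_def
proof (rule the_equality)
  show "\<exists>U g. open U \<and> connected U \<and> 0 \<in> U \<and> {s. \<sigma> < Re s} \<subseteq> U
       \<and> g holomorphic_on U \<and> (\<forall>s. \<sigma> < Re s \<longrightarrow> g s = F s) \<and> g 0 = f 0"
    by (rule exI[of _ UNIV], rule exI[of _ f]) (use assms in auto)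
next
  fix w
  assume "\<exists>U g. open U \<and> connected U \<and> 0 \<in> U \<and> {s. \<sigma> < Re s} \<subseteq> U
       \<and> g holomorphic_on U \<and> (\<forall>s. \<sigma> < Re s \<longrightarrow> g s = F s) \<and> g 0 = w"
  then obtain U g where U: "open U" "connected U" "0 \<in> U" "{s. \<sigma> < Re s} \<subseteq> U"
    "g holomorphic_on U" "\<And>s. \<sigma> < Re s \<Longrightarrow> g s = F s" "g 0 = w" by blast
  have op: "open {s. \<sigma> < Re s}" by (rule open_halfspace_Re_gt)
  have "complex_of_real (\<sigma> + 1) \<in> {s. \<sigma> < Re s}" by simp
  then have ne: "{s. \<sigma> < Re s} \<noteq> {}" by blast
  \<comment> \<open>The half plane is a nonempty open subset of the connected domain
    \<open>U\<close>, so the identity theorem carries the equality of \<open>g\<close> and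
    \<open>f\<close> from there to 0.\<close>
  have "g 0 - f 0 = 0"
  proof (rule analytic_continuation_open[OF op U(1) ne U(2) U(4), of "\<lambda>s. g s - f s" "\<lambda>_. 0"])
    show "(\<lambda>s. g s - f s) holomorphic_on U"
      using U(5) assms(1) by (intro holomorphic_on_diff) (auto intro: holomorphic_on_subset)
  qed (use U eq in auto)
  then show "w = f 0" using U by simp
qed

lemma summable_on_diff':
  fixes f g :: "'i \<Rightarrow> 'b::banach"
  assumes "f summable_on I" "g summable_on I"
  shows "(\<lambda>i. f i - g i) summable_on I"
  using summable_on_add[OF assms(1) summable_on_uminus[THEN iffD2, OF assms(2)]] by simp

lemma infsum_diff':
  fixes f g :: "'i \<Rightarrow> 'b::banach"
  assumes "f summable_on I" "g summable_on I"
  shows "(\<Sum>\<^sub>\<infinity>i\<in>I. f i - g i) = infsum f I - infsum g I"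
  using infsum_add[OF assms(1) summable_on_uminus[THEN iffD2, OF assms(2)]] by (simp add: infsum_uminus)

text \<open>A summable bound on the derivatives suffices: by the mean value inequality on the convex
  set \<open>S\<close>, \<open>B i\<close> is a Lipschitz constant of the i-th term, so increments
  and linear parts are dominated by the same summable family.\<close>

lemma has_derivative_infsum:
  fixes f :: "'i \<Rightarrow> 'a::real_normed_vector \<Rightarrow> 'b::banach"
  assumes S: "convex S" and x: "x \<in> S"
    and der: "\<And>i y. i \<in> I \<Longrightarrow> y \<in> S \<Longrightarrow> (f i has_derivative f' i y) (at y within S)"
    and bd: "\<And>i y h. i \<in> I \<Longrightarrow> y \<in> S \<Longrightarrow> norm (f' i y h) \<le> B i * norm h"
    and B: "B summable_on I" and B0: "\<And>i. i \<in> I \<Longrightarrow> 0 \<le> B i"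
    and sm: "\<And>y. y \<in> S \<Longrightarrow> (\<lambda>i. f i y) summable_on I"
  shows "((\<lambda>y. \<Sum>\<^sub>\<infinity>i\<in>I. f i y) has_derivative (\<lambda>h. \<Sum>\<^sub>\<infinity>i\<in>I. f' i x h)) (at x within S)"
proof -
  have sm': "(\<lambda>i. norm (f' i x h)) summable_on I" for h
    by (rule Infinite_Sum.abs_summable_on_comparison_test'[where g = "\<lambda>i. B i * norm h"])
       (use bd x B in \<open>auto intro: summable_on_cmult_left\<close>)
  have smd: "(\<lambda>i. f' i x h) summable_on I" for h
    using sm' by (rule Infinite_Sum.abs_summable_summable)
  have lin: "i \<in> I \<Longrightarrow> bounded_linear (f' i x)" for i
    using der[OF _ x] by (rule has_derivative_bounded_linear)
  have Lip: "norm (f i y - f i x) \<le> B i * norm (y - x)" if "i \<in> I" "y \<in> S" for i y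
    by (rule differentiable_bound[OF S, of "f i" "f' i" "B i" y x])
       (use that x der bd B0 in \<open>auto intro!: onorm_bound\<close>)
  have bl: "bounded_linear (\<lambda>h. \<Sum>\<^sub>\<infinity>i\<in>I. f' i x h)"
  proof (rule bounded_linear_intro[where K = "infsum B I"])
    fix h k :: 'a
    show "(\<Sum>\<^sub>\<infinity>i\<in>I. f' i x (h + k)) = (\<Sum>\<^sub>\<infinity>i\<in>I. f' i x h) + (\<Sum>\<^sub>\<infinity>i\<in>I. f' i x k)"
      using smd by (subst infsum_add[symmetric])
        (auto intro!: infsum_cong simp: bounded_linear.linear[OF lin] linear_add)
  next
    fix r :: real and h :: 'a
    show "(\<Sum>\<^sub>\<infinity>i\<in>I. f' i x (r *\<^sub>R h)) = r *\<^sub>R (\<Sum>\<^sub>\<infinity>i\<in>I. f' i x h)"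
      by (subst infsum_scaleR_right[symmetric])
         (auto intro!: infsum_cong simp: bounded_linear.linear[OF lin] linear_cmul)
  next
    fix h :: 'a
    have "norm (\<Sum>\<^sub>\<infinity>i\<in>I. f' i x h) \<le> (\<Sum>\<^sub>\<infinity>i\<in>I. B i * norm h)"
      using bd x B by (intro norm_infsum_le[OF has_sum_infsum has_sum_infsum])
        (auto intro: summable_on_cmult_left smd)
    also have "\<dots> = norm h * infsum B I"
      using B by (subst infsum_cmult_left) (auto simp: mult.commute)
    finally show "norm (\<Sum>\<^sub>\<infinity>i\<in>I. f' i x h) \<le> norm h * infsum B I" .
  qed
  show ?thesis
    unfolding has_derivative_within_alt
  proof (intro conjI bl allI impI)
    fix e :: real assume e: "e > 0"
    \<comment> \<open>The tail enters twice, through the increments and through the linear parts, so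
      \<open>e/4\<close> yields \<open>e/2\<close>; the finite part supplies the other half.\<close>
    obtain F where F: "finite F" "F \<subseteq> I" and tail: "infsum B I - sum B F < e/4"
    proof -
      have "(B has_sum infsum B I) I" using B by (rule has_sum_infsum)
      then have "eventually (\<lambda>F. dist (sum B F) (infsum B I) < e/4) (finite_subsets_at_top I)"
        unfolding has_sum_def using e tendstoD[of _ _ _ "e/4"] by auto
      then obtain F where "finite F" "F \<subseteq> I" "dist (sum B F) (infsum B I) < e/4"
        by (auto simp: eventually_finite_subsets_at_top)
      then show ?thesis by (intro that[of F]) (auto simp: dist_real_def abs_if split: if_splits)
    qed
    have "((\<lambda>y. \<Sum>i\<in>F. f i y) has_derivative (\<lambda>h. \<Sum>i\<in>F. f' i x h)) (at x within S)"
      using F x der by (intro has_derivative_sum) auto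
    then obtain d where d: "d > 0" and
      dd: "\<And>y. y \<in> S \<Longrightarrow> norm (y - x) < d \<Longrightarrow>
        norm ((\<Sum>i\<in>F. f i y) - (\<Sum>i\<in>F. f i x) - (\<Sum>i\<in>F. f' i x (y - x))) \<le> e/2 * norm (y - x)"
      unfolding has_derivative_within_alt using e by (meson half_gt_zero)
    have BT: "B summable_on (I - F)" using B by (rule summable_on_subset_banach) auto
    have BTs: "infsum B (I - F) = infsum B I - sum B F"
      using B F by (subst infsum_Diff) auto
    show "\<exists>d>0. \<forall>y\<in>S. norm (y - x) < d \<longrightarrow>
      norm (infsum (\<lambda>i. f i y) I - infsum (\<lambda>i. f i x) I - (\<Sum>\<^sub>\<infinity>i\<in>I. f' i x (y - x))) \<le> e * norm (y - x)"
    proof (intro exI[of _ d] conjI d ballI impI)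
      fix y assume y: "y \<in> S" "norm (y - x) < d"
      define g where "g i = f i y - f i x - f' i x (y - x)" for i
      have gs: "g summable_on I"
        unfolding g_def using y x sm smd by (intro summable_on_diff') auto
      have "infsum (\<lambda>i. f i y) I - infsum (\<lambda>i. f i x) I - (\<Sum>\<^sub>\<infinity>i\<in>I. f' i x (y - x)) = infsum g I"
        unfolding g_def using y x sm smd by (simp add: infsum_diff' summable_on_diff')
      also have "\<dots> = sum g F + infsum g (I - F)"
        using infsum_Un_disjoint[of g F "I - F"] F gs summable_on_subset_banach[OF gs, of "I - F"]
        by (simp add: Un_absorb1)
      finally have eq: "infsum (\<lambda>i. f i y) I - infsum (\<lambda>i. f i x) I - (\<Sum>\<^sub>\<infinity>i\<in>I. f' i x (y - x))
          = sum g F + infsum g (I - F)" .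
      have 1: "norm (sum g F) \<le> e/2 * norm (y - x)"
        unfolding g_def using dd[OF y] by (simp add: sum_subtractf)
      have "norm (infsum g (I - F)) \<le> (\<Sum>\<^sub>\<infinity>i\<in>I-F. B i * (2 * norm (y - x)))"
      proof (intro norm_infsum_le[OF has_sum_infsum has_sum_infsum])
        show "g summable_on I - F" using summable_on_subset_banach[OF gs] by auto
        show "(\<lambda>i. B i * (2 * norm (y - x))) summable_on I - F"
          using BT by (rule summable_on_cmult_left)
        fix i assume "i \<in> I - F"
        then have "norm (f i y - f i x) \<le> B i * norm (y - x)" "norm (f' i x (y - x)) \<le> B i * norm (y - x)"
          using Lip[of i y] bd[of i x "y - x"] x y by auto
        then show "norm (g i) \<le> B i * (2 * norm (y - x))" unfolding g_def
          using norm_triangle_ineq4[of "f i y - f i x" "f' i x (y - x)"] by linarith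
      qed
      also have "\<dots> = infsum B (I - F) * (2 * norm (y - x))"
        using BT by (subst infsum_cmult_left) auto
      also have "\<dots> \<le> e/4 * (2 * norm (y - x))"
        using tail BTs by (intro mult_right_mono) auto
      finally have 2: "norm (infsum g (I - F)) \<le> e/2 * norm (y - x)" by simp
      show "norm (infsum (\<lambda>i. f i y) I - infsum (\<lambda>i. f i x) I - (\<Sum>\<^sub>\<infinity>i\<in>I. f' i x (y - x))) \<le> e * norm (y - x)"
        unfolding eq using 1 2 norm_triangle_ineq[of "sum g F" "infsum g (I - F)"] by (simp add: algebra_simps)
    qed
  qed
qed

text \<open>Weierstrass' theorem along the net of finite subsets: the partial sums converge
  uniformly by the M-test, and uniform limits of holomorphic functions may be differentiated any
  number of times.\<close>

lemma infsum_holomorphic: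
  fixes f :: "'i \<Rightarrow> complex \<Rightarrow> complex"
  assumes S: "open S" and hol: "\<And>i. i \<in> I \<Longrightarrow> f i holomorphic_on S"
    and bd: "\<And>i z. i \<in> I \<Longrightarrow> z \<in> S \<Longrightarrow> norm (f i z) \<le> B i" and B: "B summable_on I"
  shows "(\<lambda>z. \<Sum>\<^sub>\<infinity>i\<in>I. f i z) holomorphic_on S"
    and "z \<in> S \<Longrightarrow> ((\<lambda>i. (deriv ^^ k) (f i) z) has_sum (deriv ^^ k) (\<lambda>z. \<Sum>\<^sub>\<infinity>i\<in>I. f i z) z) I"
proof -
  have ul: "uniform_limit S (\<lambda>X y. \<Sum>x\<in>X. f x y) (\<lambda>y. \<Sum>\<^sub>\<infinity>x\<in>I. f x y) (finite_subsets_at_top I)"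
    using bd B by (rule Weierstrass_m_test_general)
  have ev: "\<forall>\<^sub>F X in finite_subsets_at_top I. (\<lambda>y. \<Sum>x\<in>X. f x y) holomorphic_on S"
    using hol by (auto simp: eventually_finite_subsets_at_top intro!: exI[of _ "{}"] holomorphic_on_sum)
  show "(\<lambda>z. \<Sum>\<^sub>\<infinity>i\<in>I. f i z) holomorphic_on S"
    unfolding holomorphic_on_open[OF S]
  proof
    fix z assume "z \<in> S"
    then obtain r where r: "r > 0" "cball z r \<subseteq> S" using S open_contains_cball by blast
    have "\<forall>\<^sub>F X in finite_subsets_at_top I. continuous_on (cball z r) (\<lambda>y. \<Sum>x\<in>X. f x y)
        \<and> (\<lambda>y. \<Sum>x\<in>X. f x y) holomorphic_on ball z r"
      using ev by eventually_elim
        (meson r(2) ball_subset_cball holomorphic_on_imp_continuous_on holomorphic_on_subset subset_trans)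
    then obtain "(\<lambda>z. \<Sum>\<^sub>\<infinity>i\<in>I. f i z) holomorphic_on ball z r"
      using holomorphic_uniform_limit[OF _ uniform_limit_on_subset[OF ul r(2)]] by auto
    then show "\<exists>f'. ((\<lambda>z. \<Sum>\<^sub>\<infinity>i\<in>I. f i z) has_field_derivative f') (at z)"
      using r(1) by (auto simp: holomorphic_on_open)
  qed
  assume z: "z \<in> S"
  have "((\<lambda>X. (deriv ^^ k) (\<lambda>y. \<Sum>x\<in>X. f x y) z) \<longlongrightarrow> (deriv ^^ k) (\<lambda>z. \<Sum>\<^sub>\<infinity>i\<in>I. f i z) z) (finite_subsets_at_top I)"
    by (rule higher_deriv_complex_uniform_limit[OF ul ev _ S z]) auto
  moreover have "\<forall>\<^sub>F X in finite_subsets_at_top I. (deriv ^^ k) (\<lambda>y. \<Sum>x\<in>X. f x y) z = (\<Sum>x\<in>X. (deriv ^^ k) (f x) z)"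
  proof -
    have "(deriv ^^ k) (\<lambda>y. \<Sum>x\<in>X. f x y) z = (\<Sum>x\<in>X. (deriv ^^ k) (f x) z)" if "finite X" "X \<subseteq> I" for X
      using that
    proof (induction X rule: finite_induct)
      case (insert x X)
      have "(deriv ^^ k) (\<lambda>y. f x y + (\<Sum>x\<in>X. f x y)) z = (deriv ^^ k) (f x) z + (deriv ^^ k) (\<lambda>y. \<Sum>x\<in>X. f x y) z"
        by (rule higher_deriv_add[OF _ _ S z]) (use insert hol in \<open>auto intro!: holomorphic_on_sum\<close>)
      then show ?case using insert by simp
    qed (simp add: higher_deriv_const)
    then show ?thesis by (auto simp: eventually_finite_subsets_at_top intro!: exI[of _ "{}"])
  qed
  ultimately show "((\<lambda>i. (deriv ^^ k) (f i) z) has_sum (deriv ^^ k) (\<lambda>z. \<Sum>\<^sub>\<infinity>i\<in>I. f i z) z) I"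
    unfolding has_sum_def by (rule Lim_transform_eventually)
qed

text \<open>Dominated interchange for series, transported along an enumeration of the countable
  index set. A finite \<open>I\<close> is not in bijection with the naturals and is treated
  separately.\<close>

lemma integral_infsum:
  fixes f :: "'i \<Rightarrow> 'a \<Rightarrow> complex"
  assumes I: "countable I" and int: "\<And>i. i \<in> I \<Longrightarrow> integrable M (f i)"
    and sm: "(\<lambda>i. \<integral>x. norm (f i x) \<partial>M) summable_on I"
    and ab: "\<And>x. x \<in> space M \<Longrightarrow> (\<lambda>i. norm (f i x)) summable_on I"
  shows "integrable M (\<lambda>x. \<Sum>\<^sub>\<infinity>i\<in>I. f i x)"
    and "((\<lambda>i. integral\<^sup>L M (f i)) has_sum (\<integral>x. (\<Sum>\<^sub>\<infinity>i\<in>I. f i x) \<partial>M)) I"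
proof -
  have "integrable M (\<lambda>x. \<Sum>\<^sub>\<infinity>i\<in>I. f i x) \<and>
    ((\<lambda>i. integral\<^sup>L M (f i)) has_sum (\<integral>x. (\<Sum>\<^sub>\<infinity>i\<in>I. f i x) \<partial>M)) I"
  proof (cases "finite I")
    case True
    then show ?thesis using int by (simp add: has_sum_finite_iff integral_sum)
  next
    case False
    define e where "e = from_nat_into I"
    have bij: "bij_betw e UNIV I" unfolding e_def
      using I False by (rule bij_betw_from_nat_into)
    have eI: "e n \<in> I" for n using bij by (auto simp: bij_betw_def)
    have sm': "summable (\<lambda>n. \<integral>x. norm (f (e n) x) \<partial>M)"
      using sm summable_on_reindex_bij_betw[OF bij, of "\<lambda>i. \<integral>x. norm (f i x) \<partial>M"]
      by (auto intro: summable_on_UNIV_nonneg_real_iff[THEN iffD1])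
    have ab': "summable (\<lambda>n. norm (f (e n) x))" if "x \<in> space M" for x
      using ab[OF that] summable_on_reindex_bij_betw[OF bij, of "\<lambda>i. norm (f i x)"]
      by (auto intro: summable_on_UNIV_nonneg_real_iff[THEN iffD1])
    have eq: "(\<Sum>\<^sub>\<infinity>i\<in>I. f i x) = (\<Sum>n. f (e n) x)" if "x \<in> space M" for x
    proof -
      have "((\<lambda>n. f (e n) x) has_sum (\<Sum>n. f (e n) x)) UNIV"
        by (rule norm_summable_imp_has_sum[OF ab'[OF that]])
           (use ab'[OF that] in \<open>auto intro: summable_sums summable_norm_cancel\<close>)
      then have "((\<lambda>i. f i x) has_sum (\<Sum>n. f (e n) x)) I"
        using has_sum_reindex_bij_betw[OF bij, of "\<lambda>i. f i x"] by simp
      then show ?thesis by (simp add: infsumI)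
    qed
    have a1: "AE x in M. summable (\<lambda>n. norm (f (e n) x))" using ab' by auto
    have i1: "integrable M (\<lambda>x. \<Sum>n. f (e n) x)"
      by (rule integrable_suminf[OF _ a1 sm']) (use int eI in auto)
    have i2: "(\<integral>x. (\<Sum>n. f (e n) x) \<partial>M) = (\<Sum>n. integral\<^sup>L M (f (e n)))"
      by (rule integral_suminf[OF _ a1 sm']) (use int eI in auto)
    have i0: "summable (\<lambda>n. norm (integral\<^sup>L M (f (e n))))"
      by (rule summable_comparison_test'[OF sm', of 0]) (simp add: integral_norm_bound)
    have "((\<lambda>n. integral\<^sup>L M (f (e n))) has_sum (\<integral>x. (\<Sum>n. f (e n) x) \<partial>M)) UNIV"
      unfolding i2 by (rule norm_summable_imp_has_sum[OF i0])
        (use i0 in \<open>auto intro: summable_sums summable_norm_cancel\<close>)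
    then have "((\<lambda>i. integral\<^sup>L M (f i)) has_sum (\<integral>x. (\<Sum>n. f (e n) x) \<partial>M)) I"
      using has_sum_reindex_bij_betw[OF bij, of "\<lambda>i. integral\<^sup>L M (f i)"] by simp
    moreover have "(\<integral>x. (\<Sum>n. f (e n) x) \<partial>M) = (\<integral>x. (\<Sum>\<^sub>\<infinity>i\<in>I. f i x) \<partial>M)"
      by (rule Bochner_Integration.integral_cong) (use eq in auto)
    moreover have "integrable M (\<lambda>x. \<Sum>\<^sub>\<infinity>i\<in>I. f i x)"
      using i1 by (rule Bochner_Integration.integrable_cong[THEN iffD1, rotated -1]) (use eq in auto)
    ultimately show ?thesis by simp
  qed
  then show "integrable M (\<lambda>x. \<Sum>\<^sub>\<infinity>i\<in>I. f i x)"
    and "((\<lambda>i. integral\<^sup>L M (f i)) has_sum (\<integral>x. (\<Sum>\<^sub>\<infinity>i\<in>I. f i x) \<partial>M)) I" by auto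
qed

lemma integral_infsum_on:
  fixes f :: "'i \<Rightarrow> 'a::euclidean_space \<Rightarrow> complex"
  assumes I: "countable I" and int: "\<And>i. i \<in> I \<Longrightarrow> f i absolutely_integrable_on S"
    and sm: "(\<lambda>i. integral S (\<lambda>x. norm (f i x))) summable_on I"
    and ab: "\<And>x. x \<in> S \<Longrightarrow> (\<lambda>i. f i x) summable_on I"
  shows "(\<lambda>x. \<Sum>\<^sub>\<infinity>i\<in>I. f i x) absolutely_integrable_on S"
    and "((\<lambda>i. integral S (f i)) has_sum integral S (\<lambda>x. \<Sum>\<^sub>\<infinity>i\<in>I. f i x)) I"
proof -
  \<comment> \<open>Extension by zero turns integrals over \<open>S\<close> into Lebesgue integrals
    over the whole space, where the previous lemma applies.\<close>
  define g where "g i x = indicator S x *\<^sub>R f i x" for i x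
  have int': "integrable lebesgue (g i)" if "i \<in> I" for i
    using int[OF that] unfolding g_def set_integrable_def .
  have ig: "integral\<^sup>L lebesgue (g i) = integral S (f i)" if "i \<in> I" for i
    using set_lebesgue_integral_eq_integral(2)[OF int[OF that]]
    unfolding g_def set_lebesgue_integral_def .
  have ign: "(\<integral>x. norm (g i x) \<partial>lebesgue) = integral S (\<lambda>x. norm (f i x))" if "i \<in> I" for i
  proof -
    have "(\<lambda>x. norm (f i x)) absolutely_integrable_on S"
      using int[OF that] by (rule set_integrable_norm)
    from set_lebesgue_integral_eq_integral(2)[OF this] show ?thesis
      unfolding g_def set_lebesgue_integral_def by simp
  qed
  have sm': "(\<lambda>i. \<integral>x. norm (g i x) \<partial>lebesgue) summable_on I"
    using sm ign by (simp cong: summable_on_cong)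
  have ab': "(\<lambda>i. norm (g i x)) summable_on I" for x
    using ab[of x] by (cases "x \<in> S") (auto simp: g_def summable_on_iff_abs_summable_on_complex)
  have gi: "(\<Sum>\<^sub>\<infinity>i\<in>I. g i x) = indicator S x *\<^sub>R (\<Sum>\<^sub>\<infinity>i\<in>I. f i x)" for x
    by (auto simp: g_def indicator_def)
  have 1: "integrable lebesgue (\<lambda>x. \<Sum>\<^sub>\<infinity>i\<in>I. g i x)"
    by (rule integral_infsum[OF I int' sm' ab'])
  then show *: "(\<lambda>x. \<Sum>\<^sub>\<infinity>i\<in>I. f i x) absolutely_integrable_on S"
    unfolding gi set_integrable_def .
  have "((\<lambda>i. integral\<^sup>L lebesgue (g i)) has_sum (\<integral>x. (\<Sum>\<^sub>\<infinity>i\<in>I. g i x) \<partial>lebesgue)) I"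
    by (rule integral_infsum[OF I int' sm' ab'])
  also have "(\<integral>x. (\<Sum>\<^sub>\<infinity>i\<in>I. g i x) \<partial>lebesgue) = integral S (\<lambda>x. \<Sum>\<^sub>\<infinity>i\<in>I. f i x)"
    using set_lebesgue_integral_eq_integral(2)[OF *] unfolding gi set_lebesgue_integral_def .
  finally show "((\<lambda>i. integral S (f i)) has_sum integral S (\<lambda>x. \<Sum>\<^sub>\<infinity>i\<in>I. f i x)) I"
    using ig by (simp cong: has_sum_cong)
qed

lemma absolutely_integrable_continuous_bound:
  fixes f :: "real \<Rightarrow> 'b::euclidean_space"
  assumes "continuous_on S f" "S \<in> sets borel" "g integrable_on S" "\<And>x. x \<in> S \<Longrightarrow> norm (f x) \<le> g x"
  shows "f absolutely_integrable_on S"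
proof (rule measurable_bounded_by_integrable_imp_absolutely_integrable[OF _ _ assms(3,4)])
  show "S \<in> sets lebesgue" using assms(2) by (simp add: sets_completionI_sets)
  then show "f \<in> borel_measurable (lebesgue_on S)"
    using assms(1) by (intro continuous_imp_measurable_on_sets_lebesgue) auto
qed

text \<open>The inequality \<open>y/K \<le> exp (y/K)\<close> raised to the power \<open>K\<close>.
  It converts exponential decay into decay of any prescribed order with an explicit constant, and so
  lets Gaussian sums be compared with convergent power sums.\<close>

lemma exp_minus_le_powr:
  fixes y K :: real
  assumes "y > 0" "K > 0"
  shows "exp (-y) \<le> K powr K * y powr (-K)"
proof -
  have "y/K \<le> exp (y/K)" using exp_ge_add_one_self[of "y/K"] by linarith
  then have "(y/K) powr K \<le> exp (y/K) powr K" using assms by (intro powr_mono2) auto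
  also have "\<dots> = exp y" using assms by (simp add: powr_def)
  finally have "y powr K / K powr K \<le> exp y" using assms by (simp add: powr_divide)
  then show ?thesis using assms
    by (simp add: exp_minus powr_minus field_simps)
qed

section \<open>Theta series and their Mellin transforms\<close>

text \<open>One shape for all theta series of the proof: rank two sums over a translated lattice,
  rank four sums over pairs, the series of the primitive, and sums over residue classes. The Mellin
  transform at \<open>s\<close> is formally Gamma(s) times the sum of
  \<open>p i * Q i powr (-s)\<close>.\<close>

definition thsum :: "'i set \<Rightarrow> ('i \<Rightarrow> complex) \<Rightarrow> ('i \<Rightarrow> real) \<Rightarrow> real \<Rightarrow> complex" where
  "thsum I p Q t = (\<Sum>\<^sub>\<infinity>i\<in>I. p i * of_real (exp (-(t * Q i))))"

text \<open>\<open>K\<close> is any exponent at which the Dirichlet series converges absolutely. By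
  \<open>exp_minus_le_powr\<close> it already forces absolute convergence of the theta series at
  every \<open>t > 0\<close>; the gap \<open>\<delta>\<close> gives exponential decay for large
  \<open>t\<close>.\<close>

locale theta_data =
  fixes I :: "'i set" and p :: "'i \<Rightarrow> complex" and Q :: "'i \<Rightarrow> real" and \<delta> K :: real
  assumes I: "countable I" and \<delta>: "\<delta> > 0" and Q: "\<And>i. i \<in> I \<Longrightarrow> Q i \<ge> \<delta>" and K: "K > 0"
    and sm: "(\<lambda>i. norm (p i) * Q i powr (-K)) summable_on I"
begin

abbreviation "\<Theta> \<equiv> thsum I p Q"

lemma Qpos: "i \<in> I \<Longrightarrow> Q i > 0" using Q \<delta> by force

lemma norm_exp_summable_bound:
  assumes "t > 0" "i \<in> I"
  shows "norm (p i) * exp (-(t * Q i)) \<le> K powr K * t powr (-K) * (norm (p i) * Q i powr (-K))"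
proof -
  have "exp (-(t * Q i)) \<le> K powr K * (t * Q i) powr (-K)"
    using exp_minus_le_powr[of "t * Q i" K] assms Qpos K by simp
  also have "\<dots> = K powr K * t powr (-K) * Q i powr (-K)"
    using assms Qpos[of i] by (simp add: powr_mult)
  finally have "norm (p i) * exp (-(t * Q i)) \<le> norm (p i) * (K powr K * t powr (-K) * Q i powr (-K))"
    by (rule mult_left_mono) simp
  then show ?thesis by (simp only: mult_ac)
qed

lemma norm_exp_summable: "t > 0 \<Longrightarrow> (\<lambda>i. norm (p i) * exp (-(t * Q i))) summable_on I"
  by (rule summable_on_comparison_test[OF summable_on_cmult_right[OF sm, of "K powr K * t powr (-K)"]])
     (use norm_exp_summable_bound in auto)

lemma term_summable: "t > 0 \<Longrightarrow> (\<lambda>i. p i * of_real (exp (-(t * Q i)))) summable_on I"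
  unfolding summable_on_iff_abs_summable_on_complex using norm_exp_summable[of t] by (simp add: norm_mult)

lemma norm_theta_le: 
  assumes "t > 0" shows "norm (\<Theta> t) \<le> (\<Sum>\<^sub>\<infinity>i\<in>I. norm (p i) * exp (-(t * Q i)))"
  unfolding thsum_def using norm_exp_summable[OF assms] term_summable[OF assms]
  by (intro norm_infsum_le[OF has_sum_infsum has_sum_infsum]) (auto simp: norm_mult)

text \<open>In \<open>t = 1 + (t - 1)\<close> the excess \<open>t - 1\<close> costs every term at
  least the factor \<open>exp (-(\<delta> * (t - 1)))\<close>, and what remains is the convergent
  sum at \<open>t = 1\<close>.\<close>

lemma norm_theta_large:
  assumes "t \<ge> 1"
  shows "norm (\<Theta> t) \<le> exp (-(\<delta> * (t - 1))) * (\<Sum>\<^sub>\<infinity>i\<in>I. norm (p i) * exp (-(Q i)))"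
proof -
  have "norm (\<Theta> t) \<le> (\<Sum>\<^sub>\<infinity>i\<in>I. norm (p i) * exp (-(t * Q i)))"
    using assms by (intro norm_theta_le) auto
  also have "\<dots> \<le> (\<Sum>\<^sub>\<infinity>i\<in>I. exp (-(\<delta> * (t - 1))) * (norm (p i) * exp (-(Q i))))"
  proof (rule infsum_mono)
    show "(\<lambda>i. norm (p i) * exp (- (t * Q i))) summable_on I" using assms by (intro norm_exp_summable) auto
    show "(\<lambda>i. exp (-(\<delta> * (t - 1))) * (norm (p i) * exp (- Q i))) summable_on I"
      using norm_exp_summable[of 1] by (intro summable_on_cmult_right) auto
    fix i assume i: "i \<in> I"
    have "\<delta> * (t - 1) \<le> Q i * (t - 1)" using Q[OF i] assms by (intro mult_right_mono) auto
    then have "-(t * Q i) \<le> -(\<delta> * (t - 1)) + - Q i" by (simp add: algebra_simps)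
    then have "exp (-(t * Q i)) \<le> exp (-(\<delta> * (t - 1))) * exp (- Q i)"
      by (simp flip: exp_add)
    then have "norm (p i) * exp (- (t * Q i)) \<le> norm (p i) * (exp (-(\<delta> * (t - 1))) * exp (- Q i))"
      by (rule mult_left_mono) simp
    then show "norm (p i) * exp (- (t * Q i)) \<le> exp (-(\<delta> * (t - 1))) * (norm (p i) * exp (- Q i))"
      by (simp only: mult_ac)
  qed
  also have "\<dots> = exp (-(\<delta> * (t - 1))) * (\<Sum>\<^sub>\<infinity>i\<in>I. norm (p i) * exp (-(Q i)))"
    by (rule infsum_cmult_right) (use norm_exp_summable[of 1] in auto)
  finally show ?thesis .
qed

lemma theta_continuous: "continuous_on {0<..} \<Theta>"
proof -
  have "continuous_on {a<..} \<Theta>" if a: "a > 0" for a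
  proof (rule uniform_limit_theorem)
    show "uniform_limit {a<..} (\<lambda>X t. \<Sum>i\<in>X. p i * of_real (exp (-(t * Q i)))) \<Theta> (finite_subsets_at_top I)"
      unfolding thsum_def
    proof (rule Weierstrass_m_test_general)
      show "(\<lambda>i. norm (p i) * exp (-(a * Q i))) summable_on I" by (rule norm_exp_summable[OF a])
      show "norm (p i * of_real (exp (-(t * Q i)))) \<le> norm (p i) * exp (-(a * Q i))"
        if "i \<in> I" "t \<in> {a<..}" for i t
        using that Qpos by (auto simp: norm_mult intro!: mult_left_mono)
    qed
  qed (auto intro!: always_eventually continuous_intros)
  then have "\<And>x. x > 0 \<Longrightarrow> isCont \<Theta> x"
    by (meson continuous_on_eq_continuous_at dense greaterThan_iff open_greaterThan)
  then show ?thesis by (simp add: continuous_at_imp_continuous_on)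
qed

text \<open>Fubini with a majorant. The weight \<open>\<phi>\<close> and the domain \<open>S\<close>
  are free so that the same lemma serves the full half line with weight
  \<open>t powr (s - 1)\<close> and the integrals cut off at \<open>e\<close>.\<close>

lemma theta_integral_swap:
  assumes S: "S \<subseteq> {0<..}" "S \<in> sets borel" and \<phi>: "continuous_on S \<phi>"
    and int: "\<And>i. i \<in> I \<Longrightarrow> (\<lambda>t. norm (\<phi> t) * exp (-(t * Q i))) integrable_on S"
    and bd: "\<And>i. i \<in> I \<Longrightarrow> integral S (\<lambda>t. norm (\<phi> t) * exp (-(t * Q i))) \<le> B i"
    and B: "(\<lambda>i. norm (p i) * B i) summable_on I"
  shows "(\<lambda>t. \<phi> t * \<Theta> t) absolutely_integrable_on S"
    and "((\<lambda>i. p i * integral S (\<lambda>t. \<phi> t * of_real (exp (-(t * Q i))))) has_sum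
            integral S (\<lambda>t. \<phi> t * \<Theta> t)) I"
proof -
  define f where "f i t = \<phi> t * (p i * of_real (exp (-(t * Q i))))" for i t
  have n: "norm (f i t) = norm (p i) * (norm (\<phi> t) * exp (-(t * Q i)))" for i t
    by (simp add: f_def norm_mult)
  have f1: "f i absolutely_integrable_on S" if "i \<in> I" for i
  proof (rule absolutely_integrable_continuous_bound[OF _ S(2)])
    show "continuous_on S (f i)" unfolding f_def using \<phi> by (intro continuous_intros) auto
    show "(\<lambda>t. norm (p i) * (norm (\<phi> t) * exp (-(t * Q i)))) integrable_on S"
      using int[OF that] by (rule integrable_on_mult_right)
  qed (simp add: n)
  have f2: "integral S (\<lambda>t. norm (f i t)) = norm (p i) * integral S (\<lambda>t. norm (\<phi> t) * exp (-(t * Q i)))" for i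
    unfolding n by simp
  have f2': "0 \<le> integral S (\<lambda>t. norm (\<phi> t) * exp (-(t * Q i)))" if "i \<in> I" for i
    by (rule integral_nonneg[OF int[OF that]]) auto
  have f3: "(\<lambda>i. integral S (\<lambda>t. norm (f i t))) summable_on I"
    unfolding f2 by (rule summable_on_comparison_test[OF B]) (use bd f2' in \<open>auto intro!: mult_left_mono\<close>)
  have f4: "(\<lambda>i. f i t) summable_on I" if "t \<in> S" for t
    unfolding f_def using that S by (intro summable_on_cmult_right term_summable) auto
  have eq: "(\<Sum>\<^sub>\<infinity>i\<in>I. f i t) = \<phi> t * \<Theta> t" if "t \<in> S" for t
    unfolding f_def thsum_def using that S by (intro infsum_cmult_right term_summable) auto
  have "(\<lambda>t. \<Sum>\<^sub>\<infinity>i\<in>I. f i t) absolutely_integrable_on S"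
    by (rule integral_infsum_on[OF I f1 f3 f4])
  then show "(\<lambda>t. \<phi> t * \<Theta> t) absolutely_integrable_on S"
    by (rule set_integrable_cong[THEN iffD1, OF refl refl, rotated]) (use eq in auto)
  have "((\<lambda>i. integral S (f i)) has_sum integral S (\<lambda>t. \<Sum>\<^sub>\<infinity>i\<in>I. f i t)) I"
    by (rule integral_infsum_on[OF I f1 f3 f4])
  moreover have "integral S (\<lambda>t. \<Sum>\<^sub>\<infinity>i\<in>I. f i t) = integral S (\<lambda>t. \<phi> t * \<Theta> t)"
    using eq by (intro integral_cong) auto
  moreover have "integral S (f i) = p i * integral S (\<lambda>t. \<phi> t * of_real (exp (-(t * Q i))))" for i
    unfolding f_def by (subst integral_mult_right[symmetric]) (simp add: mult_ac)
  ultimately show "((\<lambda>i. p i * integral S (\<lambda>t. \<phi> t * of_real (exp (-(t * Q i))))) has_sum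
            integral S (\<lambda>t. \<phi> t * \<Theta> t)) I" by simp
qed

end

lemma has_integral_scale_halfline:
  fixes f :: "real \<Rightarrow> complex"
  assumes f: "f absolutely_integrable_on {0<..}" and q: "q > 0"
  shows "((\<lambda>t. f (q * t)) has_integral integral {0<..} f / of_real q) {0<..}"
proof -
  have im: "(\<lambda>x. q * x) ` {0<..} = {0<..}"
  proof safe
    fix x :: real assume "x > 0"
    then show "x \<in> (*) q ` {0<..}" using q by (intro image_eqI[of _ _ "x/q"]) auto
  qed (use q in auto)
  \<comment> \<open>The substitution is carried out for real-valued functions; real and imaginary
    part of \<open>f\<close> are scaled separately and recombined.\<close>
  have real: "((\<lambda>t. h (q * t)) has_integral integral {0<..} h / q) {0<..}"
    if h: "h absolutely_integrable_on {0<..}" for h :: "real \<Rightarrow> real"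
  proof -
    have "(\<lambda>x. \<bar>q\<bar> * h (q * x)) absolutely_integrable_on {0<..} \<and>
           integral {0<..} (\<lambda>x. \<bar>q\<bar> * h (q * x)) = integral {0<..} h
     \<longleftrightarrow> h absolutely_integrable_on ((\<lambda>x. q * x) ` {0<..}) \<and> integral ((\<lambda>x. q * x) ` {0<..}) h = integral {0<..} h"
      by (rule has_absolute_integral_change_of_variables_1')
        (use q in \<open>auto intro!: derivative_eq_intros injI simp: inj_on_def\<close>)
    then have "(\<lambda>x. \<bar>q\<bar> * h (q * x)) integrable_on {0<..}"
      "integral {0<..} (\<lambda>x. \<bar>q\<bar> * h (q * x)) = integral {0<..} h"
      using h unfolding im by (auto simp: absolutely_integrable_on_def)
    then have "((\<lambda>x. \<bar>q\<bar> * h (q * x)) has_integral integral {0<..} h) {0<..}"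
      by (metis has_integral_integral)
    from has_integral_mult_right[OF this, of "1/q"] show ?thesis using q by simp
  qed
  have R: "(\<lambda>t. Re (f t)) absolutely_integrable_on {0<..}" "(\<lambda>t. Im (f t)) absolutely_integrable_on {0<..}"
    using absolutely_integrable_linear[OF f bounded_linear_Re] absolutely_integrable_linear[OF f bounded_linear_Im]
    by (simp_all add: o_def)
  have fi: "f integrable_on {0<..}" using f by (auto simp: absolutely_integrable_on_def)
  then have "(f has_integral integral {0<..} f) {0<..}" by (rule integrable_integral)
  then have "integral {0<..} (\<lambda>t. Re (f t)) = Re (integral {0<..} f)"
     "integral {0<..} (\<lambda>t. Im (f t)) = Im (integral {0<..} f)"
    by (auto intro!: integral_unique has_integral_Re has_integral_Im)
  then have "((\<lambda>t. of_real (Re (f (q * t))) + \<i> * of_real (Im (f (q * t)))) has_integral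
      of_real (Re (integral {0<..} f) / q) + \<i> * of_real (Im (integral {0<..} f) / q)) {0<..}"
    using real[OF R(1)] real[OF R(2)]
    by (intro has_integral_add has_integral_mult_right has_integral_of_real) auto
  moreover have "of_real (Re z / q) + \<i> * of_real (Im z / q) = z / of_real q" for z
    by (simp add: complex_eq_iff Re_divide_of_real Im_divide_of_real)
  moreover have "of_real (Re z) + \<i> * of_real (Im z) = z" for z by (simp add: complex_eq_iff)
  ultimately show ?thesis by simp
qed

lemma Gamma_integral_scaled:
  assumes s: "Re s > 0" and q: "q > 0"
  shows "((\<lambda>t. complex_of_real t powr (s - 1) * of_real (exp (-(t * q)))) has_integral
           Gamma s * of_real q powr (-s)) {0<..}"
proof -
  define f where "f t = complex_of_real t powr (s - 1) / of_real (exp t)" for t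
  have "f absolutely_integrable_on {0<..}"
    unfolding f_def by (rule absolutely_integrable_Gamma_integral'[OF s])
  from has_integral_scale_halfline[OF this q]
  have "((\<lambda>t. f (q * t)) has_integral Gamma s / of_real q) {0<..}"
    using integral_unique[OF Gamma_integral_complex'[OF s]] unfolding f_def by (simp only:)
  \<comment> \<open>This factor removes the \<open>q powr (s - 1)\<close> that scaling the argument
    of the power produces.\<close>
  from has_integral_mult_right[OF this, of "of_real q powr (1 - s)"]
  have "((\<lambda>t. of_real q powr (1 - s) * f (q * t)) has_integral of_real q powr (1 - s) * (Gamma s / of_real q)) {0<..}" .
  moreover have "of_real q powr (1 - s) * (Gamma s / of_real q) = Gamma s * of_real q powr (-s)"
    using q powr_add[of "complex_of_real q" 1 "-s"] by simp
  moreover have "of_real q powr (1 - s) * f (q * t) = complex_of_real t powr (s - 1) * of_real (exp (-(t * q)))"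
    if "t \<in> {0<..}" for t
  proof -
    have "complex_of_real (q * t) powr (s - 1) = of_real q powr (s - 1) * of_real t powr (s - 1)"
      using that q powr_times_real[of "of_real q" "of_real t" "s - 1"] by simp
    moreover have "complex_of_real q powr (1 - s) * of_real q powr (s - 1) = 1"
      using q by (simp flip: powr_add)
    ultimately show ?thesis
      by (simp add: f_def exp_minus field_simps)
  qed
  ultimately show ?thesis by (metis (no_types, lifting) has_integral_cong)
qed

text \<open>Flatness at 0, together with exponential decay at infinity, makes the Mellin integral
  converge for every \<open>s\<close>. No polar part has to be subtracted, and the continued values
  are the integrals themselves.\<close>

locale theta_rapid = theta_data +
  assumes rapid: "\<And>N::nat. \<exists>C. \<forall>t. 0 < t \<and> t \<le> 1 \<longrightarrow> norm (\<Theta> t) \<le> C * t ^ N"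
begin

text \<open>The constant is uniform in the exponent over a compact range, because holomorphy of the
  Mellin transform needs one integrable majorant for a whole disc of values of
  \<open>s\<close>.\<close>

lemma powr_theta_bound:
  fixes a b :: real
  obtains C where "C \<ge> 0" "\<And>t r. t > 0 \<Longrightarrow> a \<le> r \<Longrightarrow> r \<le> b \<Longrightarrow> t powr r * norm (\<Theta> t) \<le> C * exp (-(\<delta>/2 * t))"
proof -
  \<comment> \<open>Flatness of this order compensates the worst negative exponent \<open>a\<close>
    on \<open>0 < t \<le> 1\<close>.\<close>
  define N where "N = nat \<lceil>-a\<rceil>"
  have N: "real N \<ge> -a" unfolding N_def by linarith
  obtain C1 where C1: "\<And>t. 0 < t \<Longrightarrow> t \<le> 1 \<Longrightarrow> norm (\<Theta> t) \<le> C1 * t ^ N" using rapid[of N] by blast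
  have C1pos: "C1 \<ge> 0" using C1[of 1] order_trans[OF norm_ge_zero[of "\<Theta> 1"]] by simp
  define S1 where "S1 = (\<Sum>\<^sub>\<infinity>i\<in>I. norm (p i) * exp (-(Q i)))"
  have S1: "S1 \<ge> 0" unfolding S1_def by (intro infsum_nonneg) auto
  \<comment> \<open>\<open>exp_minus_le_powr\<close> needs a positive exponent, so \<open>b\<close>
    is raised to at least 1; for \<open>t > 1\<close> this only weakens the bound.\<close>
  define b' where "b' = max b 1"
  define C2 where "C2 = b' powr b' * (\<delta>/2) powr (-b') * exp \<delta> * S1"
  have C2: "C2 \<ge> 0" unfolding C2_def using S1 by simp
  define C where "C = C1 * exp (\<delta>/2) + C2"
  show ?thesis
  proof (rule that[of C])
    show "C \<ge> 0" using C1pos C2 by (simp add: C_def)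
    fix t r :: real assume t: "t > 0" and r: "a \<le> r" "r \<le> b"
    show "t powr r * norm (\<Theta> t) \<le> C * exp (-(\<delta>/2 * t))"
    proof (cases "t \<le> 1")
      case True
      have "t powr r * norm (\<Theta> t) \<le> t powr a * (C1 * t ^ N)"
        using C1[OF t True] True r t by (intro mult_mono powr_mono') auto
      also have "\<dots> = C1 * t powr (a + N)" using t by (simp add: powr_add powr_realpow)
      also have "\<dots> \<le> C1 * 1" using N True t C1pos by (intro mult_left_mono powr_le1) auto
      also have "\<dots> \<le> C1 * (exp (\<delta>/2) * exp (-(\<delta>/2 * t)))"
        using C1pos \<delta> True t by (intro mult_left_mono) (auto simp flip: exp_add)
      also have "\<dots> \<le> C * exp (-(\<delta>/2 * t))"
        using C2 by (simp add: C_def algebra_simps)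
      finally show ?thesis .
    next
      case False
      have "t powr r * norm (\<Theta> t) \<le> t powr b' * (exp (-(\<delta> * (t - 1))) * S1)"
        using norm_theta_large[of t] False r t unfolding S1_def b'_def
        by (intro mult_mono powr_mono) auto
      also have "\<dots> = (t powr b' * exp (-(\<delta>/2 * t))) * exp \<delta> * S1 * exp (-(\<delta>/2 * t))"
        by (simp add: algebra_simps flip: exp_add)
      also have "\<dots> \<le> (b' powr b' * (\<delta>/2) powr (-b')) * exp \<delta> * S1 * exp (-(\<delta>/2 * t))"
      proof -
        have "exp (-(\<delta>/2 * t)) \<le> b' powr b' * (\<delta>/2 * t) powr (-b')"
          using \<delta> t by (intro exp_minus_le_powr) (auto simp: b'_def)
        also have "\<dots> = b' powr b' * (\<delta>/2) powr (-b') * t powr (-b')"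
          using \<delta> t powr_mult[of "\<delta>/2" t "-b'"] by simp
        finally have "t powr b' * exp (-(\<delta>/2 * t)) \<le> t powr b' * (b' powr b' * (\<delta>/2) powr (-b') * t powr (-b'))"
          by (rule mult_left_mono) simp
        also have "\<dots> = b' powr b' * (\<delta>/2) powr (-b')"
          using t by (simp add: powr_minus field_simps)
        finally show ?thesis using S1 by (intro mult_right_mono) auto
      qed
      also have "\<dots> \<le> C * exp (-(\<delta>/2 * t))"
        using C1pos by (simp add: C_def C2_def algebra_simps)
      finally show ?thesis .
    qed
  qed
qed

lemma exp_int: "(\<lambda>t. C * exp (-(\<delta>/2 * t))) integrable_on {0<..}"
proof -
  have "(\<lambda>t. exp (-(\<delta>/2) * t)) integrable_on {0..}"
    using \<delta> by (intro integrable_on_exp_minus_to_infinity) auto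
  then have "(\<lambda>t. exp (-(\<delta>/2) * t)) integrable_on {0<..}"
    by (rule integrable_spike_set) (auto intro: negligible_subset[of "{0}"])
  from integrable_on_mult_right[OF this, of C] show ?thesis by simp
qed

lemma powr_theta_integrable:
  "(\<lambda>t. of_real t powr z * \<Theta> t) absolutely_integrable_on {0<..}"
proof -
  obtain C where C: "\<And>t r. t > 0 \<Longrightarrow> Re z \<le> r \<Longrightarrow> r \<le> Re z \<Longrightarrow> t powr r * norm (\<Theta> t) \<le> C * exp (-(\<delta>/2 * t))"
    using powr_theta_bound[of "Re z" "Re z"] by metis
  show ?thesis
  proof (rule absolutely_integrable_continuous_bound[OF _ _ exp_int[of C]])
    show "continuous_on {0<..} (\<lambda>t. of_real t powr z * \<Theta> t)"
      by (intro continuous_intros theta_continuous) auto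
    show "norm (of_real t powr z * \<Theta> t) \<le> C * exp (-(\<delta>/2 * t))" if "t \<in> {0<..}" for t
      using that C[of t "Re z"] by (simp add: norm_mult norm_powr_real_powr)
  qed auto
qed

definition mellin :: "complex \<Rightarrow> complex" where
  "mellin s = integral {0<..} (\<lambda>t. of_real t powr (s - 1) * \<Theta> t)"

text \<open>The integrals over \<open>[1/(n+1), n+1]\<close> are holomorphic by differentiation
  under the integral sign, and they converge uniformly on discs of radius 1.\<close>

lemma mellin_holomorphic: "mellin holomorphic_on UNIV"
proof -
  define F where "F n s = integral {1/(real n+1)..real n+1} (\<lambda>t. of_real t powr (s - 1) * \<Theta> t)" for n s
  \<comment> \<open>The mass of the majorant outside the n-th interval; it controls the truncation
    error for all \<open>s\<close> of a disc at once.\<close>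
  define e where "e n = integral {0<..} (\<lambda>t. if t \<in> {1/(real n+1)..real n+1} then 0 else exp (-(\<delta>/2 * t)))" for n
  have pos: "1/(real n+1) > 0" for n by simp
  have eint: "(\<lambda>t. if t \<in> {1/(real n+1)..real n+1} then 0 else exp (-(\<delta>/2 * t))) integrable_on {0<..}" for n
  proof -
    have "(\<lambda>t. if t \<in> {1/(real n+1)..real n+1} then exp (-(\<delta>/2 * t)) else 0) integrable_on {0<..}"
    proof -
      have eq: "{1/(real n+1)..real n+1} \<inter> {0<..} = {1/(real n+1)..real n+1}" using less_le_trans[OF pos[of n]] by auto
      show ?thesis unfolding integrable_restrict_Int eq
        by (intro integrable_continuous_interval continuous_intros)
    qed
    from integrable_diff[OF exp_int[of 1] this] show ?thesis
      by (rule integrable_cong[THEN iffD1, rotated]) auto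
  qed
  have e0: "e \<longlonglongrightarrow> 0"
  proof -
    have "(\<lambda>n. integral {0<..} (\<lambda>t. if t \<in> {1/(real n+1)..real n+1} then 0 else exp (-(\<delta>/2 * t))))
        \<longlonglongrightarrow> integral {0<..} (\<lambda>t::real. 0::real)"
    proof (rule dominated_convergence(2)[where h = "\<lambda>t. 1 * exp (-(\<delta>/2 * t))"])
      show "(\<lambda>t. if t \<in> {1/(real n+1)..real n+1} then 0 else exp (-(\<delta>/2 * t))) integrable_on {0<..}" for n by (rule eint)
      show "(\<lambda>t. 1 * exp (-(\<delta>/2 * t))) integrable_on {0<..}" by (rule exp_int)
    next
      fix t :: real assume "t \<in> {0<..}"
      then have t: "t > 0" by simp
      have "eventually (\<lambda>n. 1/(real n+1) < t) sequentially" "eventually (\<lambda>n. t < real n+1) sequentially"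
        using t by real_asymp+
      then have "eventually (\<lambda>n. (if t \<in> {1/(real n+1)..real n+1} then 0 else exp (-(\<delta>/2 * t))) = 0) sequentially"
        by eventually_elim auto
      then show "(\<lambda>n. (if t \<in> {1/(real n+1)..real n+1} then 0 else exp (-(\<delta>/2 * t)))) \<longlonglongrightarrow> 0"
        by (simp add: tendsto_eventually)
    qed auto
    then show ?thesis by (simp add: e_def[abs_def])
  qed
  have Fh: "F n holomorphic_on UNIV" for n
    unfolding F_def[abs_def] box_real(2)[symmetric]
  proof (rule leibniz_rule_holomorphic)
    fix s :: complex and t :: real assume t: "t \<in> cbox (1/(real n+1)) (real n+1)"
    then have "t > 0" using less_le_trans[OF pos[of n], of t] by simp
    then show "((\<lambda>s. of_real t powr (s - 1) * \<Theta> t) has_field_derivative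
        (ln (of_real t) * of_real t powr (s - 1) * \<Theta> t)) (at s within UNIV)"
      by (auto simp: powr_def intro!: derivative_eq_intros)
  next
    have sub: "{1/(real n+1)..real n+1} \<subseteq> {0<..}" using less_le_trans[OF pos[of n]] by auto
    show "(\<lambda>t. of_real t powr (s - 1) * \<Theta> t) integrable_on cbox (1/(real n+1)) (real n+1)" for s
      using sub by (auto intro!: integrable_continuous_interval continuous_intros continuous_on_subset[OF theta_continuous])
    show "continuous_on (UNIV \<times> cbox (1/(real n+1)) (real n+1))
       (\<lambda>(s, t). ln (of_real t) * of_real t powr (s - 1) * \<Theta> t)"
      using sub unfolding case_prod_unfold
      by (intro continuous_intros continuous_on_compose2[OF theta_continuous])
         (auto simp: complex_nonpos_Reals_iff intro: less_le_trans[OF pos])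
  qed auto
  show ?thesis
  proof (rule holomorphic_uniform_sequence[OF _ Fh])
    fix s0 :: complex
    \<comment> \<open>For \<open>s\<close> within distance 1 of \<open>s0\<close> the exponent
      \<open>Re s - 1\<close> stays between \<open>Re s0 - 2\<close> and
      \<open>Re s0\<close>.\<close>
    obtain C where C0: "C \<ge> 0" and C: "\<And>t r. t > 0 \<Longrightarrow> Re s0 - 2 \<le> r \<Longrightarrow> r \<le> Re s0 \<Longrightarrow> t powr r * norm (\<Theta> t) \<le> C * exp (-(\<delta>/2 * t))"
      using powr_theta_bound[of "Re s0 - 2" "Re s0"] by metis
    have bd: "norm (F n s - mellin s) \<le> C * e n" if "s \<in> cball s0 1" for n s
    proof -
      have sub: "{1/(real n+1)..real n+1} \<subseteq> {0<..}" using less_le_trans[OF pos[of n]] by auto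
      have re: "Re s0 - 2 \<le> Re s - 1" "Re s - 1 \<le> Re s0"
        using that abs_Re_le_cmod[of "s0 - s"] by (auto simp: dist_norm)
      have 1: "F n s = integral {0<..} (\<lambda>t. if t \<in> {1/(real n+1)..real n+1} then of_real t powr (s - 1) * \<Theta> t else 0)"
        unfolding F_def Henstock_Kurzweil_Integration.integral_restrict_Int using sub by (simp add: Int_absorb2)
      have i2: "(\<lambda>t. of_real t powr (s - 1) * \<Theta> t) integrable_on {0<..}"
        using powr_theta_integrable[of "s - 1"] set_lebesgue_integral_eq_integral(1) by blast
      have i1: "(\<lambda>t. if t \<in> {1/(real n+1)..real n+1} then of_real t powr (s - 1) * \<Theta> t else 0) integrable_on {0<..}"
        unfolding integrable_restrict_Int Int_absorb2[OF sub] using sub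
        by (auto intro!: integrable_continuous_interval continuous_intros continuous_on_subset[OF theta_continuous])
      have eq: "mellin s - F n s = integral {0<..} (\<lambda>t. if t \<in> {1/(real n+1)..real n+1} then 0 else of_real t powr (s - 1) * \<Theta> t)"
        unfolding mellin_def 1 integral_diff[OF i2 i1, symmetric] by (intro integral_cong) auto
      have "norm (mellin s - F n s) \<le> integral {0<..} (\<lambda>t. C * (if t \<in> {1/(real n+1)..real n+1} then 0 else exp (-(\<delta>/2 * t))))"
        unfolding eq
      proof (rule integral_norm_bound_integral)
        show "(\<lambda>t. if t \<in> {1/(real n+1)..real n+1} then 0 else of_real t powr (s - 1) * \<Theta> t) integrable_on {0<..}"
          using integrable_diff[OF i2 i1] by (rule integrable_cong[THEN iffD1, rotated]) auto
        show "(\<lambda>t. C * (if t \<in> {1/(real n+1)..real n+1} then 0 else exp (-(\<delta>/2 * t)))) integrable_on {0<..}"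
          by (rule integrable_on_mult_right[OF eint])
      qed (use C re in \<open>auto simp: norm_mult norm_powr_real_powr\<close>)
      also have "\<dots> = C * e n" unfolding e_def by simp
      finally show ?thesis by (simp add: norm_minus_commute)
    qed
    have "uniform_limit (cball s0 1) F mellin sequentially"
    proof (rule uniform_limitI)
      fix \<epsilon> :: real assume "\<epsilon> > 0"
      have "(\<lambda>n. C * e n) \<longlonglongrightarrow> C * 0" using e0 by (intro tendsto_intros)
      then have "eventually (\<lambda>n. C * e n < \<epsilon>) sequentially" using \<open>\<epsilon> > 0\<close> by (intro order_tendstoD) auto
      then show "\<forall>\<^sub>F n in sequentially. \<forall>s\<in>cball s0 1. dist (F n s) (mellin s) < \<epsilon>"
        by eventually_elim (metis bd dist_norm le_less_trans)
    qed
    then show "\<exists>d>0. cball s0 d \<subseteq> UNIV \<and> uniform_limit (cball s0 d) F mellin sequentially"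
      by (intro exI[of _ 1]) auto
  qed auto
qed

text \<open>The Gamma integral, term by term. Multiplying by \<open>rGamma\<close> instead of
  dividing by \<open>Gamma\<close> leaves a left-hand side that is holomorphic at every
  \<open>s\<close>.\<close>

lemma mellin_eq:
  assumes s: "Re s > 0" and sms: "(\<lambda>i. norm (p i) * Q i powr (- Re s)) summable_on I"
  shows "rGamma s * mellin s = (\<Sum>\<^sub>\<infinity>i\<in>I. p i * of_real (Q i) powr (-s))"
proof -
  have g: "((\<lambda>t. complex_of_real t powr (s - 1) * of_real (exp (-(t * Q i)))) has_integral
           Gamma s * of_real (Q i) powr (-s)) {0<..}" if "i \<in> I" for i
    using Gamma_integral_scaled[OF s Qpos[OF that]] .
  have gr: "((\<lambda>t. norm (complex_of_real t powr (s - 1)) * exp (-(t * Q i))) has_integral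
           Gamma (Re s) * Q i powr (-Re s)) {0<..}" if "i \<in> I" for i
  proof -
    have "((\<lambda>t. Re (complex_of_real t powr (of_real (Re s) - 1) * of_real (exp (-(t * Q i))))) has_integral
           Re (Gamma (of_real (Re s)) * of_real (Q i) powr (-of_real (Re s)))) {0<..}"
      by (intro has_integral_Re Gamma_integral_scaled) (use s Qpos[OF that] in auto)
    moreover have "Re (Gamma (of_real (Re s)) * complex_of_real (Q i) powr (-of_real (Re s))) = Gamma (Re s) * Q i powr (-Re s)"
      using Qpos[OF that] by (simp add: Gamma_complex_of_real powr_of_real flip: of_real_minus)
    moreover have "Re (complex_of_real t powr (of_real (Re s) - 1) * of_real (exp (-(t * Q i))))
        = norm (complex_of_real t powr (s - 1)) * exp (-(t * Q i))" if "t \<in> {0<..}" for t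
      using that powr_of_real[of t "Re s - 1"] by (simp add: norm_powr_real_powr)
    ultimately show ?thesis by (subst has_integral_cong[symmetric]) auto
  qed
  have "((\<lambda>i. p i * integral {0<..} (\<lambda>t. complex_of_real t powr (s - 1) * of_real (exp (-(t * Q i))))) has_sum
            integral {0<..} (\<lambda>t. of_real t powr (s - 1) * \<Theta> t)) I"
  proof (rule theta_integral_swap(2)[where B = "\<lambda>i. Gamma (Re s) * Q i powr (-Re s)"])
    show "(\<lambda>i. norm (p i) * (Gamma (Re s) * Q i powr - Re s)) summable_on I"
      using summable_on_cmult_right[OF sms, of "Gamma (Re s)"] by (simp add: mult_ac)
  qed (use gr integral_unique[OF gr] in \<open>auto intro!: continuous_intros simp: integrable_on_def complex_nonpos_Reals_iff\<close>)
  then have "((\<lambda>i. p i * (Gamma s * of_real (Q i) powr (-s))) has_sum mellin s) I"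
    unfolding mellin_def using integral_unique[OF g] by (simp cong: has_sum_cong)
  then have "((\<lambda>i. rGamma s * (p i * (Gamma s * of_real (Q i) powr (-s)))) has_sum rGamma s * mellin s) I"
    by (rule has_sum_cmult_right)
  moreover have "rGamma s * Gamma s = 1"
  proof -
    have "s \<notin> \<int>\<^sub>\<le>\<^sub>0" using s by (auto elim!: nonpos_Ints_cases)
    then have "rGamma s \<noteq> 0" by (simp add: rGamma_eq_zero_iff)
    then show ?thesis by (simp add: Gamma_def)
  qed
  then have "rGamma s * (p i * (Gamma s * of_real (Q i) powr (-s))) = p i * of_real (Q i) powr (-s)" for i
    by (metis mult.assoc mult.commute mult_1)
  ultimately have "((\<lambda>i. p i * of_real (Q i) powr (-s)) has_sum rGamma s * mellin s) I" by simp
  then show ?thesis by (simp add: infsumI)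
qed

lemma mellin_1: "mellin 1 = integral {0<..} \<Theta>"
  unfolding mellin_def by (intro integral_cong) auto

lemma mellin_2: "mellin 2 = integral {0<..} (\<lambda>t. of_real t * \<Theta> t)"
  unfolding mellin_def by (intro integral_cong) auto

end

section \<open>Sums over a planar lattice\<close>

lemma summable_on_int_inverse_square_powr:
  fixes b :: real
  assumes b: "b > 1/2"
  shows "(\<lambda>n::int. (1 + (real_of_int n)\<^sup>2) powr (-b)) summable_on UNIV"
proof -
  have "summable (\<lambda>n. real n powr (-(2*b)))" using b by (subst summable_real_powr_iff) auto
  then have nat: "(\<lambda>n::nat. (1 + (real n)\<^sup>2) powr (-b)) summable_on UNIV"
  proof (subst summable_on_UNIV_nonneg_real_iff, goal_cases)
    case 2
    show ?case
    proof (rule summable_comparison_test'[OF 2, of 1])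
      fix n :: nat assume "n \<ge> 1"
      then have "(1 + (real n)\<^sup>2) powr (-b) \<le> ((real n)\<^sup>2) powr (-b)"
        using b by (intro powr_mono2') auto
      also have "\<dots> = real n powr (-(2*b))" using \<open>n \<ge> 1\<close> by (simp add: powr_power powr_powr flip: powr_numeral)
      finally show "norm ((1 + (real n)\<^sup>2) powr (-b)) \<le> real n powr (-(2*b))" by simp
    qed
  qed auto
  have "(\<lambda>n::int. (1 + (real_of_int n)\<^sup>2) powr (-b)) summable_on (range int)"
    by (subst summable_on_reindex) (use nat in \<open>auto simp: o_def\<close>)
  moreover have "(\<lambda>n::int. (1 + (real_of_int n)\<^sup>2) powr (-b)) summable_on (range (\<lambda>n. - int n))"
    by (subst summable_on_reindex) (use nat in \<open>auto simp: o_def inj_on_def\<close>)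
  ultimately have "(\<lambda>n::int. (1 + (real_of_int n)\<^sup>2) powr (-b)) summable_on (range int \<union> range (\<lambda>n. - int n))"
    by (rule summable_on_union)
  moreover have "range int \<union> range (\<lambda>n. - int n) = UNIV"
    by (auto intro: int_cases2)
  ultimately show ?thesis by simp
qed

lemma summable_on_product_real:
  fixes f :: "'a \<Rightarrow> real" and g :: "'b \<Rightarrow> real"
  assumes "f summable_on A" "g summable_on B" "\<And>x. x \<in> A \<Longrightarrow> f x \<ge> 0" "\<And>y. y \<in> B \<Longrightarrow> g y \<ge> 0"
  shows "(\<lambda>(x, y). f x * g y) summable_on A \<times> B"
proof (rule summable_on_SigmaI[where g = "\<lambda>x. f x * infsum g B"])
  show "((\<lambda>y. case (x, y) of (x, y) \<Rightarrow> f x * g y) has_sum f x * infsum g B) B" for x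
    using has_sum_cmult_right[OF has_sum_infsum[OF assms(2)], of "f x"] by simp
  show "(\<lambda>x. f x * infsum g B) summable_on A"
    using assms(1) by (rule summable_on_cmult_left)
qed (use assms in auto)

locale lattice =
  fixes L :: "complex set" and w1 w2 :: complex
  assumes L_def: "L = {of_int p * w1 + of_int q * w2 | p q. True}"
    and indep: "Im (cnj w1 * w2) \<noteq> 0"
begin

text \<open>\<open>D0\<close> is the signed covolume, and \<open>R0\<close> bounds the norms of the
  points of the period parallelogram at the origin. \<open>\<kappa>\<close> is the constant of
  \<open>norm_lower\<close>; it is not the constant that the overview calls kappa.\<close>

definition D0 where "D0 = Im (cnj w1 * w2)"
definition R0 where "R0 = cmod w1 + cmod w2"
definition \<kappa> where "\<kappa> = D0\<^sup>2 / ((cmod w1)\<^sup>2 + (cmod w2)\<^sup>2)"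

lemma D0: "D0 \<noteq> 0" using indep by (simp add: D0_def)

lemma w_nz: "w1 \<noteq> 0" "w2 \<noteq> 0" using indep by auto

lemma \<kappa>: "\<kappa> > 0" unfolding \<kappa>_def using D0 w_nz by (intro divide_pos_pos add_pos_pos) auto

lemma R0: "R0 > 0" unfolding R0_def using w_nz by (simp add: add_pos_pos)

lemma coord: "of_real (Im (cnj w * w2) / D0) * w1 + of_real (Im (cnj w1 * w) / D0) * w2 = w"
proof -
  have "of_real (Im (cnj w * w2)) * w1 + of_real (Im (cnj w1 * w)) * w2 = of_real D0 * w"
    unfolding D0_def by (simp add: complex_eq_iff algebra_simps)
  moreover have "of_real (Im (cnj w * w2) / D0) * w1 + of_real (Im (cnj w1 * w) / D0) * w2
      = (of_real (Im (cnj w * w2)) * w1 + of_real (Im (cnj w1 * w)) * w2) / of_real D0"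
    by (simp add: add_divide_distrib)
  ultimately show ?thesis using D0 by simp
qed

text \<open>By Cramer's rule each coordinate times \<open>D0\<close> is the imaginary part of a
  product of a basis vector with \<open>w\<close>, one of them conjugated, hence at most the product
  of their lengths. Squaring and adding gives \<open>\<kappa>\<close>.\<close>

lemma norm_lower: "\<kappa> * (x\<^sup>2 + y\<^sup>2) \<le> (cmod (of_real x * w1 + of_real y * w2))\<^sup>2"
proof -
  define w where "w = of_real x * w1 + of_real y * w2"
  have "x * D0 = Im (cnj w * w2)" "y * D0 = Im (cnj w1 * w)"
    unfolding w_def D0_def by (simp_all add: algebra_simps)
  then have "\<bar>x * D0\<bar> \<le> cmod w * cmod w2" "\<bar>y * D0\<bar> \<le> cmod w1 * cmod w"
    using abs_Im_le_cmod[of "cnj w * w2"] abs_Im_le_cmod[of "cnj w1 * w"] by (simp_all add: norm_mult)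
  then have "(x * D0)\<^sup>2 \<le> (cmod w * cmod w2)\<^sup>2" "(y * D0)\<^sup>2 \<le> (cmod w1 * cmod w)\<^sup>2"
    by (metis abs_ge_zero power2_abs power_mono)+
  then have "D0\<^sup>2 * (x\<^sup>2 + y\<^sup>2) \<le> (cmod w)\<^sup>2 * ((cmod w1)\<^sup>2 + (cmod w2)\<^sup>2)"
    by (simp add: power_mult_distrib algebra_simps)
  moreover have "(cmod w1)\<^sup>2 + (cmod w2)\<^sup>2 > 0" using w_nz by (intro add_pos_pos) auto
  ultimately show ?thesis unfolding \<kappa>_def w_def by (simp add: field_simps)
qed

lemma L_iff: "w \<in> L \<longleftrightarrow> (\<exists>p q. w = of_int p * w1 + of_int q * w2)" by (auto simp: L_def)

lemma L_memI: "of_int p * w1 + of_int q * w2 \<in> L" by (auto simp: L_iff)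

lemma zero_in: "0 \<in> L" using L_memI[of 0 0] by simp
lemma w1_in: "w1 \<in> L" using L_memI[of 1 0] by simp
lemma w2_in: "w2 \<in> L" using L_memI[of 0 1] by simp

lemma add_in: assumes "x \<in> L" "y \<in> L" shows "x + y \<in> L"
proof -
  obtain p q p' q' where "x = of_int p * w1 + of_int q * w2" "y = of_int p' * w1 + of_int q' * w2"
    using assms by (auto simp: L_iff)
  then have "x + y = of_int (p+p') * w1 + of_int (q+q') * w2" by (simp add: algebra_simps)
  then show ?thesis unfolding L_iff by blast
qed

lemma uminus_in: assumes "x \<in> L" shows "- x \<in> L"
proof -
  obtain p q where "x = of_int p * w1 + of_int q * w2" using assms by (auto simp: L_iff)
  then have "- x = of_int (-p) * w1 + of_int (-q) * w2" by (simp add: algebra_simps)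
  then show ?thesis unfolding L_iff by blast
qed

lemma diff_in: "x \<in> L \<Longrightarrow> y \<in> L \<Longrightarrow> x - y \<in> L"
  using add_in[of x "- y"] uminus_in[of y] by simp

lemma bij_shift: "l \<in> L \<Longrightarrow> bij_betw (\<lambda>d. d + l) L L"
  by (rule bij_betwI[of _ _ _ "\<lambda>d. d - l"]) (auto intro: add_in diff_in)

lemma bij_uminus: "bij_betw uminus L L"
  by (rule bij_betwI[of _ _ _ uminus]) (auto intro: uminus_in)

lemma reduce: obtains l where "l \<in> L" "cmod (w - l) \<le> R0"
proof -
  define x where "x = Im (cnj w * w2) / D0"
  define y where "y = Im (cnj w1 * w) / D0"
  have "w - (of_int \<lfloor>x\<rfloor> * w1 + of_int \<lfloor>y\<rfloor> * w2) = of_real (frac x) * w1 + of_real (frac y) * w2"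
    using coord[of w] unfolding x_def[symmetric] y_def[symmetric] by (simp add: frac_def algebra_simps)
  also have "cmod \<dots> \<le> frac x * cmod w1 + frac y * cmod w2"
    by (rule order_trans[OF norm_triangle_ineq]) (simp add: norm_mult frac_ge_0)
  also have "\<dots> \<le> 1 * cmod w1 + 1 * cmod w2"
    by (intro add_mono mult_right_mono) (auto simp: frac_lt_1 less_imp_le)
  finally show ?thesis by (intro that[OF L_memI]) (simp add: R0_def)
qed

lemma bij_coord: "bij_betw (\<lambda>(p, q). of_int p * w1 + of_int q * w2) (UNIV :: (int \<times> int) set) L"
proof -
  have "(p, q) = (p', q')" if "of_int p * w1 + of_int q * w2 = of_int p' * w1 + of_int q' * w2" for p q p' q' :: int
  proof -
    have "of_real (of_int (p - p')) * w1 + of_real (of_int (q - q')) * w2 = 0" using that by (simp add: algebra_simps)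
    then have "\<kappa> * ((of_int (p-p'))\<^sup>2 + (of_int (q-q'))\<^sup>2) \<le> 0"
      using norm_lower[of "of_int (p - p')" "of_int (q - q')"] by simp
    then have "(real_of_int (p-p'))\<^sup>2 + (of_int (q-q'))\<^sup>2 \<le> 0" using \<kappa> by (simp add: mult_le_0_iff)
    then show ?thesis by (simp add: sum_power2_le_zero_iff)
  qed
  then have "inj (\<lambda>(p, q). of_int p * w1 + of_int q * w2 :: complex)" for p :: int
    by (auto intro!: injI)
  then show ?thesis unfolding bij_betw_def L_def by auto
qed

lemma countable_L: "countable L"
  using bij_betw_imp_surj_on[OF bij_coord] by (metis countableI_type countable_image)

text \<open>For \<open>P, Q \<ge> 1\<close> one has \<open>sqrt (P * Q) \<le> P + Q - 1\<close>, so
  the double sum is dominated by a product of two simple sums with exponent \<open>\<beta>/2\<close>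
  each, and these converge because \<open>\<beta>/2 > 1/2\<close>.\<close>

lemma summable_powr:
  assumes "\<beta> > 1"
  shows "(\<lambda>l. (1 + (cmod l)\<^sup>2) powr (-\<beta>)) summable_on L"
proof -
  define k where "k = min 1 \<kappa>"
  have k: "k > 0" "k \<le> 1" "k \<le> \<kappa>" using \<kappa> by (auto simp: k_def)
  have "(\<lambda>(p::int, q::int). (1 + (real_of_int p)\<^sup>2) powr (-(\<beta>/2)) * (1 + (real_of_int q)\<^sup>2) powr (-(\<beta>/2))) summable_on UNIV \<times> UNIV"
    using assms by (intro summable_on_product_real summable_on_int_inverse_square_powr) auto
  then have s: "(\<lambda>x. k powr (-\<beta>) * (case x of (p::int, q::int) \<Rightarrow> (1 + (real_of_int p)\<^sup>2) powr (-(\<beta>/2)) * (1 + (real_of_int q)\<^sup>2) powr (-(\<beta>/2)))) summable_on UNIV"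
    by (intro summable_on_cmult_right) simp
  have "(\<lambda>x. (1 + (cmod (case x of (p, q) \<Rightarrow> of_int p * w1 + of_int q * w2))\<^sup>2) powr (-\<beta>)) summable_on (UNIV :: (int\<times>int) set)"
  proof (rule summable_on_comparison_test[OF s])
    fix x :: "int \<times> int"
    obtain p q where x: "x = (p, q)" by force
    define P where "P = 1 + (real_of_int p)\<^sup>2" define Q where "Q = 1 + (real_of_int q)\<^sup>2"
    have PQ: "P \<ge> 1" "Q \<ge> 1" by (auto simp: P_def Q_def)
    have "k * (1 + ((real_of_int p)\<^sup>2 + (real_of_int q)\<^sup>2)) \<le> 1 + \<kappa> * ((real_of_int p)\<^sup>2 + (real_of_int q)\<^sup>2)"
      using k mult_right_mono[of k \<kappa> "(real_of_int p)\<^sup>2 + (real_of_int q)\<^sup>2"] by (simp add: algebra_simps)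
    also have "\<dots> \<le> 1 + (cmod (of_int p * w1 + of_int q * w2))\<^sup>2"
      using norm_lower[of "of_int p" "of_int q"] by simp
    finally have 1: "k * (P + Q - 1) \<le> 1 + (cmod (of_int p * w1 + of_int q * w2))\<^sup>2"
      by (simp add: P_def Q_def algebra_simps)
    have "sqrt (P * Q) \<le> P + Q - 1"
    proof (rule real_le_lsqrt)
      have "P * Q \<le> (P + Q - 1) * (P + Q - 1)" using PQ by (intro mult_mono) auto
      then show "P * Q \<le> (P + Q - 1)\<^sup>2" by (simp add: power2_eq_square)
    qed (use PQ in auto)
    then have "k * sqrt (P * Q) \<le> 1 + (cmod (of_int p * w1 + of_int q * w2))\<^sup>2"
      using 1 k mult_left_mono[of "sqrt (P*Q)" "P + Q - 1" k] by linarith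
    then have "(1 + (cmod (of_int p * w1 + of_int q * w2))\<^sup>2) powr (-\<beta>) \<le> (k * sqrt (P * Q)) powr (-\<beta>)"
      using k PQ assms by (intro powr_mono2') auto
    also have "\<dots> = k powr (-\<beta>) * (P powr (-(\<beta>/2)) * Q powr (-(\<beta>/2)))"
      using k PQ by (simp add: powr_mult real_sqrt_mult powr_half_sqrt[symmetric] powr_powr)
    finally show "(1 + (cmod (case x of (p, q) \<Rightarrow> of_int p * w1 + of_int q * w2))\<^sup>2) powr (-\<beta>) \<le>
        k powr (-\<beta>) * (case x of (p, q) \<Rightarrow> (1 + (real_of_int p)\<^sup>2) powr (-(\<beta>/2)) * (1 + (real_of_int q)\<^sup>2) powr (-(\<beta>/2)))"
      by (simp add: x P_def Q_def)
  qed auto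
  then show ?thesis using summable_on_reindex_bij_betw[OF bij_coord, of "\<lambda>l. (1 + (cmod l)\<^sup>2) powr (-\<beta>)"] by simp
qed

text \<open>The same splitting one level up: each rank two factor receives the exponent
  \<open>\<beta>/2\<close>, which exceeds 1.\<close>

lemma summable_powr4:
  assumes "\<beta> > 2"
  shows "(\<lambda>(x, y). (1 + (cmod x)\<^sup>2 + (cmod y)\<^sup>2) powr (-\<beta>)) summable_on L \<times> L"
proof -
  have s: "(\<lambda>(x, y). (1 + (cmod x)\<^sup>2) powr (-(\<beta>/2)) * (1 + (cmod y)\<^sup>2) powr (-(\<beta>/2))) summable_on L \<times> L"
    using assms by (intro summable_on_product_real summable_powr) auto
  show ?thesis
  proof (rule summable_on_comparison_test[OF s])
    fix z :: "complex \<times> complex"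
    obtain x y where z: "z = (x, y)" by force
    define P where "P = 1 + (cmod x)\<^sup>2" define Q where "Q = 1 + (cmod y)\<^sup>2"
    have PQ: "P \<ge> 1" "Q \<ge> 1" by (auto simp: P_def Q_def)
    have "sqrt (P * Q) \<le> P + Q - 1"
    proof (rule real_le_lsqrt)
      have "P * Q \<le> (P + Q - 1) * (P + Q - 1)" using PQ by (intro mult_mono) auto
      then show "P * Q \<le> (P + Q - 1)\<^sup>2" by (simp add: power2_eq_square)
    qed (use PQ in auto)
    then have "(P + Q - 1) powr (-\<beta>) \<le> (sqrt (P * Q)) powr (-\<beta>)"
      using PQ assms by (intro powr_mono2') auto
    also have "\<dots> = P powr (-(\<beta>/2)) * Q powr (-(\<beta>/2))"
      using PQ by (simp add: powr_mult real_sqrt_mult powr_half_sqrt[symmetric] powr_powr)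
    finally show "(case z of (x, y) \<Rightarrow> (1 + (cmod x)\<^sup>2 + (cmod y)\<^sup>2) powr (-\<beta>)) \<le>
       (case z of (x, y) \<Rightarrow> (1 + (cmod x)\<^sup>2) powr (-(\<beta>/2)) * (1 + (cmod y)\<^sup>2) powr (-(\<beta>/2)))"
      by (simp add: z P_def Q_def algebra_simps)
  qed auto
qed

lemma shift_bound:
  assumes "cmod w \<le> R"
  shows "1 + (cmod l)\<^sup>2 \<le> (2 + 2 * R\<^sup>2) * (1 + (cmod (w + l))\<^sup>2)"
proof -
  have "cmod l \<le> cmod (w + l) + R" using assms norm_triangle_ineq4[of "w + l" w] by simp
  then have "(cmod l)\<^sup>2 \<le> (cmod (w + l) + R)\<^sup>2" by (rule power_mono) simp
  also have "\<dots> \<le> 2 * (cmod (w + l))\<^sup>2 + 2 * R\<^sup>2"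
    using sum_squares_bound[of "cmod (w + l)" R] by (simp add: power2_sum)
  finally have "1 + (cmod l)\<^sup>2 \<le> 1 + 2 * (cmod (w + l))\<^sup>2 + 2 * R\<^sup>2" by simp
  also have "\<dots> \<le> (2 + 2 * R\<^sup>2) * (1 + (cmod (w + l))\<^sup>2)" by (simp add: algebra_simps)
  finally show ?thesis .
qed

lemma summable_powr_shift:
  assumes "\<beta> > 1"
  shows "(\<lambda>l. (1 + (cmod (w + l))\<^sup>2) powr (-\<beta>)) summable_on L"
proof (rule summable_on_comparison_test[OF summable_on_cmult_right[OF summable_powr[OF assms], of "(2 + 2 * (cmod w)\<^sup>2) powr \<beta>"]])
  fix l
  have "(1 + (cmod (w + l))\<^sup>2) powr (-\<beta>) \<le> ((1 + (cmod l)\<^sup>2) / (2 + 2 * (cmod w)\<^sup>2)) powr (-\<beta>)"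
    using shift_bound[of w "cmod w" l] assms
    by (intro powr_mono2') (auto simp: divide_simps add_nonneg_pos add_pos_nonneg mult.commute)
  also have "\<dots> = (2 + 2 * (cmod w)\<^sup>2) powr \<beta> * (1 + (cmod l)\<^sup>2) powr (-\<beta>)"
    by (simp add: powr_divide powr_minus divide_simps add_pos_nonneg)
  finally show "(1 + (cmod (w + l))\<^sup>2) powr (-\<beta>) \<le> (2 + 2 * (cmod w)\<^sup>2) powr \<beta> * (1 + (cmod l)\<^sup>2) powr (-\<beta>)" .
qed auto

lemma infsum_shift:
  fixes f :: "complex \<Rightarrow> 'b::{topological_comm_monoid_add, t2_space}"
  assumes "l \<in> L" shows "(\<Sum>\<^sub>\<infinity>d\<in>L. f (d + l)) = (\<Sum>\<^sub>\<infinity>d\<in>L. f d)"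
  by (rule infsum_reindex_bij_betw[OF bij_shift[OF assms]])

text \<open>The sum is periodic in \<open>w\<close>, so \<open>w\<close> may be replaced by a
  representative of norm at most \<open>R0\<close>, and there \<open>shift_bound\<close> holds with
  a constant independent of \<open>w\<close>.\<close>

lemma uniform_powr_bound:
  assumes "\<beta> > 1"
  obtains C where "\<And>w. (\<Sum>\<^sub>\<infinity>l\<in>L. (1 + (cmod (w + l))\<^sup>2) powr (-\<beta>)) \<le> C"
proof
  fix w
  obtain l0 where l0: "l0 \<in> L" "cmod (w - l0) \<le> R0" by (rule reduce)
  have "(\<Sum>\<^sub>\<infinity>l\<in>L. (1 + (cmod (w + l))\<^sup>2) powr (-\<beta>)) = (\<Sum>\<^sub>\<infinity>l\<in>L. (1 + (cmod ((w - l0) + (l + l0)))\<^sup>2) powr (-\<beta>))"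
    by simp
  also have "\<dots> = (\<Sum>\<^sub>\<infinity>l\<in>L. (1 + (cmod ((w - l0) + l))\<^sup>2) powr (-\<beta>))"
    by (rule infsum_shift[OF l0(1)])
  also have "\<dots> \<le> (\<Sum>\<^sub>\<infinity>l\<in>L. (2 + 2 * R0\<^sup>2) powr \<beta> * (1 + (cmod l)\<^sup>2) powr (-\<beta>))"
  proof (rule infsum_mono)
    show "(\<lambda>l. (1 + (cmod (w - l0 + l))\<^sup>2) powr - \<beta>) summable_on L" by (rule summable_powr_shift[OF assms])
    show "(\<lambda>l. (2 + 2 * R0\<^sup>2) powr \<beta> * (1 + (cmod l)\<^sup>2) powr - \<beta>) summable_on L"
      by (intro summable_on_cmult_right summable_powr assms)
    fix l
    have "(1 + (cmod (w - l0 + l))\<^sup>2) powr (-\<beta>) \<le> ((1 + (cmod l)\<^sup>2) / (2 + 2 * R0\<^sup>2)) powr (-\<beta>)"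
      using shift_bound[OF l0(2), of l] assms
      by (intro powr_mono2') (auto simp: divide_simps add_nonneg_pos add_pos_nonneg mult.commute)
    also have "\<dots> = (2 + 2 * R0\<^sup>2) powr \<beta> * (1 + (cmod l)\<^sup>2) powr (-\<beta>)"
      by (simp add: powr_divide powr_minus divide_simps add_pos_nonneg)
    finally show "(1 + (cmod (w - l0 + l))\<^sup>2) powr (-\<beta>) \<le> (2 + 2 * R0\<^sup>2) powr \<beta> * (1 + (cmod l)\<^sup>2) powr (-\<beta>)" .
  qed
  finally show "(\<Sum>\<^sub>\<infinity>l\<in>L. (1 + (cmod (w + l))\<^sup>2) powr (-\<beta>)) \<le> (\<Sum>\<^sub>\<infinity>l\<in>L. (2 + 2 * R0\<^sup>2) powr \<beta> * (1 + (cmod l)\<^sup>2) powr (-\<beta>))" .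
qed

lemma finite_ball: "finite {l \<in> L. cmod l \<le> r}"
proof (rule finite_subset)
  define N where "N = \<lceil>r\<^sup>2 / \<kappa>\<rceil>"
  show "{l \<in> L. cmod l \<le> r} \<subseteq> (\<lambda>(p, q). of_int p * w1 + of_int q * w2) ` ({-N..N} \<times> {-N..N})"
  proof
    fix l assume "l \<in> {l \<in> L. cmod l \<le> r}"
    then obtain p q where l: "l = of_int p * w1 + of_int q * w2" "cmod l \<le> r" by (auto simp: L_iff)
    have "\<kappa> * ((of_int p)\<^sup>2 + (of_int q)\<^sup>2) \<le> (cmod l)\<^sup>2"
      using norm_lower[of "of_int p" "of_int q"] by (simp add: l)
    also have "\<dots> \<le> r\<^sup>2" using l by (intro power_mono) auto
    finally have "(of_int p)\<^sup>2 + (of_int q)\<^sup>2 \<le> r\<^sup>2 / \<kappa>" using \<kappa> by (simp add: field_simps)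
    then have "(of_int p)\<^sup>2 + (of_int q)\<^sup>2 \<le> real_of_int N" unfolding N_def by linarith
    then have "p\<^sup>2 + q\<^sup>2 \<le> N" by (metis of_int_add of_int_le_iff of_int_power)
    moreover have "\<bar>x\<bar> \<le> x\<^sup>2" for x :: int
      using self_le_power[of "\<bar>x\<bar>" 2] by (cases "x = 0") auto
    ultimately have "\<bar>p\<bar> \<le> N" "\<bar>q\<bar> \<le> N"
      by (smt (verit) zero_le_power2)+
    then show "l \<in> (\<lambda>(p, q). of_int p * w1 + of_int q * w2) ` ({-N..N} \<times> {-N..N})"
      using l by (intro image_eqI[of _ _ "(p, q)"]) auto
  qed
qed auto

lemma min_norm: obtains \<mu> where "\<mu> > 0" "\<And>l. l \<in> L \<Longrightarrow> w + l \<noteq> 0 \<Longrightarrow> cmod (w + l) \<ge> \<mu>"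
proof -
  define S where "S = cmod ` ((\<lambda>l. w + l) ` {l \<in> L. cmod l \<le> cmod w + 1} - {0})"
  have fin: "finite S" unfolding S_def using finite_ball[of "cmod w + 1"] by auto
  \<comment> \<open>The entry 1 covers all lattice points outside the ball, and keeps the minimum
    defined when the ball contributes nothing.\<close>
  define \<mu> where "\<mu> = Min (insert 1 S)"
  show ?thesis
  proof
    show "\<mu> > 0" unfolding \<mu>_def using fin by (auto simp: S_def)
    fix l assume l: "l \<in> L" "w + l \<noteq> 0"
    show "cmod (w + l) \<ge> \<mu>"
    proof (cases "cmod l \<le> cmod w + 1")
      case True
      then have "cmod (w + l) \<in> S" using l unfolding S_def by auto
      then show ?thesis unfolding \<mu>_def using fin by auto
    next
      case False
      then have "cmod (w + l) \<ge> 1" using norm_triangle_ineq4[of "w + l" w] by simp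
      moreover have "\<mu> \<le> 1" unfolding \<mu>_def using fin by auto
      ultimately show ?thesis by simp
    qed
  qed
qed

end

lemma periodic_higher_deriv:
  fixes G :: "complex \<Rightarrow> complex"
  assumes "\<And>z. G (z + 1) = G z"
  shows "(deriv ^^ k) G (z + 1) = (deriv ^^ k) G z"
proof (induction k arbitrary: z)
  case (Suc k)
  have "(\<lambda>z. (deriv ^^ k) G (z + 1)) = (deriv ^^ k) G" using Suc by blast
  then have "deriv (\<lambda>z. (deriv ^^ k) G (z + 1)) z = deriv ((deriv ^^ k) G) z" by simp
  moreover have "deriv (\<lambda>z. g (z + 1)) z = deriv g (z + 1)" for g :: "complex \<Rightarrow> complex"
    by (simp add: deriv_def DERIV_shift)
  ultimately show ?case by (simp only: funpow.simps(2) o_apply)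
qed (use assms in simp)

section \<open>Rapid decay of the lattice theta series\<close>

text \<open>The derivative of a periodic function has mean zero, so it is controlled by its own derivative.\<close>

lemma periodic_deriv_le:
  fixes G :: "complex \<Rightarrow> complex"
  assumes hol: "G holomorphic_on UNIV" and per: "\<And>z. G (z + 1) = G z"
    and bd: "\<And>x. norm ((deriv ^^ Suc (Suc k)) G (of_real x)) \<le> B"
  shows "norm ((deriv ^^ Suc k) G (of_real x)) \<le> B"
proof -
  define P where "P = (deriv ^^ k) G"
  define h where "h = (deriv ^^ Suc k) G"
  have dP: "(P has_field_derivative h z) (at z within A)" for z A
    using holomorphic_derivI[OF holomorphic_higher_deriv[OF hol open_UNIV, of k] open_UNIV UNIV_I, of z]
    unfolding P_def h_def funpow.simps(2) o_def by (rule has_field_derivative_at_within)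
  have dh: "(h has_field_derivative (deriv ^^ Suc (Suc k)) G z) (at z within A)" for z A
    using holomorphic_derivI[OF holomorphic_higher_deriv[OF hol open_UNIV, of "Suc k"] open_UNIV UNIV_I, of z]
    unfolding h_def funpow.simps(2)[of "Suc k"] o_def by (rule has_field_derivative_at_within)
  define S where "S = complex_of_real ` {x..x+1}"
  have S: "convex S" unfolding S_def by (intro convex_linear_image) (auto simp: linear_iff scaleR_conv_of_real)
  have B: "B \<ge> 0" using bd[of 0] norm_ge_zero order_trans by blast
  have 1: "norm (h z - h (of_real x)) \<le> B" if "z \<in> S" for z
  proof -
    have "norm (h z - h (of_real x)) \<le> B * norm (z - of_real x)"
      by (rule field_differentiable_bound[OF S, of h "(deriv ^^ Suc (Suc k)) G"])
         (use dh bd that in \<open>auto simp: S_def simp del: funpow.simps\<close>)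
    also have "norm (z - of_real x) \<le> 1" using that by (auto simp: S_def simp flip: of_real_diff)
    then have "B * norm (z - of_real x) \<le> B * 1" using B by (rule mult_left_mono)
    finally show ?thesis by simp
  qed
  \<comment> \<open>\<open>P\<close> returns to its value after one period, so the increment of
    \<open>P z - z * h x\<close> over it is just \<open>- h x\<close>, while its derivative
    \<open>h z - h x\<close> is at most \<open>B\<close> by the preceding step.\<close>
  have "norm ((P (of_real (x+1)) - of_real (x+1) * h (of_real x)) - (P (of_real x) - of_real x * h (of_real x)))
      \<le> B * norm (of_real (x+1) - complex_of_real x)"
  proof (rule field_differentiable_bound[OF S, of "\<lambda>z. P z - z * h (of_real x)" "\<lambda>z. h z - h (of_real x)"])
    show "((\<lambda>z. P z - z * h (of_real x)) has_field_derivative h z - h (of_real x)) (at z within S)" for z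
      by (auto intro!: derivative_eq_intros dP)
  qed (use 1 in \<open>auto simp: S_def simp del: of_real_add\<close>)
  moreover have "P (of_real (x+1)) = P (of_real x)"
    using periodic_higher_deriv[of G, OF per, of k "of_real x"] by (simp add: P_def)
  ultimately show ?thesis by (simp add: h_def algebra_simps del: funpow.simps)
qed

text \<open>Downward induction from order \<open>k\<close>, stopping at order 1 because
  \<open>G\<close> itself need not have mean zero. Since the period has length 1, the constant does
  not grow on the way.\<close>

lemma periodic_deriv_le':
  fixes G :: "complex \<Rightarrow> complex"
  assumes hol: "G holomorphic_on UNIV" and per: "\<And>z. G (z + 1) = G z"
    and bd: "\<And>x. norm ((deriv ^^ k) G (of_real x)) \<le> B" and j: "1 \<le> j" "j \<le> k"
  shows "norm ((deriv ^^ j) G (of_real x)) \<le> B"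
  using j(2,1)
proof (induction j arbitrary: x rule: inc_induct)
  case (step n)
  then obtain m where "n = Suc m" by (cases n) auto
  have "norm ((deriv ^^ Suc n) G (complex_of_real y)) \<le> B" for y by (rule step.IH) auto
  then have "norm ((deriv ^^ Suc (Suc m)) G (complex_of_real y)) \<le> B" for y
    unfolding \<open>n = Suc m\<close> .
  then show ?case unfolding \<open>n = Suc m\<close> by (rule periodic_deriv_le[OF hol per])
qed (use bd in auto)

section \<open>Lattice Gaussians, continued analytically along a period\<close>

context lattice
begin

definition th :: "nat \<Rightarrow> complex \<Rightarrow> real \<Rightarrow> complex" where
  "th k w t = (\<Sum>\<^sub>\<infinity>d\<in>L. cnj (w + d) ^ k * of_real (exp (-(t * (cmod (w + d))\<^sup>2))))"

text \<open>From \<open>exp (-y) = exp 1 * exp (-(1 + y))\<close> and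
  \<open>exp_minus_le_powr\<close> with exponent 3 comes the constant \<open>27 * exp 1\<close>.
  Replacing \<open>1 + t * r^2\<close> by \<open>(1 + r^2) / (1 + 1/t)\<close> costs the factor
  \<open>(1 + 1/t) ^ 3\<close>, and \<open>r ^ j \<le> 1 + r^2\<close> uses up one of the three
  powers.\<close>

lemma gauss_le:
  fixes t r :: real
  assumes "t > 0" "j \<le> 2" "r \<ge> 0"
  shows "r ^ j * exp (-(t * r\<^sup>2)) \<le> 27 * exp 1 * (1 + 1/t) ^ 3 * (1 + r\<^sup>2) powr (-2)"
proof -
  define q where "q = 1 + 1/t"
  have q: "q > 0" using assms add_pos_pos[of 1 "1/t"] by (simp add: q_def)
  have r2: "1 + r\<^sup>2 > 0" by (simp add: add_pos_nonneg)
  have "exp (-(t * r\<^sup>2)) = exp 1 * exp (-(1 + t * r\<^sup>2))" by (simp flip: exp_add)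
  also have "exp (-(1 + t * r\<^sup>2)) \<le> 3 powr 3 * (1 + t * r\<^sup>2) powr (-3)"
    using assms by (intro exp_minus_le_powr) (auto simp: add_pos_nonneg)
  also have "(1 + t * r\<^sup>2) powr (-3) \<le> ((1 + r\<^sup>2) / q) powr (-3)"
  proof (rule powr_mono2')
    have "1 + r\<^sup>2 \<le> (1 + t * r\<^sup>2) * q" using assms by (simp add: q_def field_simps)
    then show "(1 + r\<^sup>2) / q \<le> 1 + t * r\<^sup>2" using q by (simp add: field_simps)
  qed (use q r2 in auto)
  also have "((1 + r\<^sup>2) / q) powr (-3) = q ^ 3 * (1 + r\<^sup>2) powr (-3)"
    using q r2 by (simp add: powr_divide powr_minus powr_numeral divide_simps)
  finally have 1: "exp (-(t * r\<^sup>2)) \<le> 27 * exp 1 * q ^ 3 * (1 + r\<^sup>2) powr (-3)"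
    by (simp add: powr_numeral mult_ac)
  have "r ^ j \<le> 1 + r\<^sup>2"
  proof -
    consider "j = 0" | "j = 1" | "j = 2" using assms by linarith
    then show ?thesis
    proof cases
      case 2
      have "0 \<le> (r - 1)\<^sup>2" by simp
      then show ?thesis using 2 assms by (simp add: power2_eq_square algebra_simps)
    qed auto
  qed
  then have "r ^ j * exp (-(t * r\<^sup>2)) \<le> (1 + r\<^sup>2) * (27 * exp 1 * q ^ 3 * (1 + r\<^sup>2) powr (-3))"
    using 1 r2 by (intro mult_mono) auto
  also have "\<dots> = 27 * exp 1 * q ^ 3 * ((1 + r\<^sup>2) powr 1 * (1 + r\<^sup>2) powr (-3))"
    using r2 by simp
  also have "(1 + r\<^sup>2) powr 1 * (1 + r\<^sup>2) powr (-3) = (1 + r\<^sup>2) powr (-2)"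
    by (subst powr_add[symmetric]) simp
  finally show ?thesis by (simp add: q_def)
qed

lemma gauss_summable:
  assumes "t > 0" "j \<le> 2"
  shows "(\<lambda>d. cmod (w + d) ^ j * exp (-(t * (cmod (w + d))\<^sup>2))) summable_on L"
  by (rule summable_on_comparison_test[OF summable_on_cmult_right[OF summable_powr_shift[of 2 w], of "27 * exp 1 * (1 + 1/t) ^ 3"]])
     (use gauss_le[OF assms] in auto)

text \<open>Uniform in \<open>w\<close> by \<open>uniform_powr_bound\<close>. The order 3 in
  \<open>1/t\<close> is crude, but a polynomial loss is harmless: it will always be multiplied by
  something that decays faster than every power of \<open>t\<close>.\<close>

lemma gauss_moment:
  obtains C where "C \<ge> 0" "\<And>w t j. t > 0 \<Longrightarrow> j \<le> 2 \<Longrightarrow>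
     (\<Sum>\<^sub>\<infinity>d\<in>L. cmod (w + d) ^ j * exp (-(t * (cmod (w + d))\<^sup>2))) \<le> C * (1 + 1/t) ^ 3"
proof -
  obtain C where C: "\<And>w. (\<Sum>\<^sub>\<infinity>l\<in>L. (1 + (cmod (w + l))\<^sup>2) powr (-2)) \<le> C"
    using uniform_powr_bound[of 2] by auto
  have "0 \<le> (\<Sum>\<^sub>\<infinity>l\<in>L. (1 + (cmod (0 + l))\<^sup>2) powr (-2))" by (rule infsum_nonneg) auto
  then have C0: "C \<ge> 0" using C[of 0] by linarith
  show ?thesis
  proof (rule that[of "27 * exp 1 * C"])
    fix w t and j :: nat assume a: "(t::real) > 0" "j \<le> 2"
    have "(\<Sum>\<^sub>\<infinity>d\<in>L. cmod (w + d) ^ j * exp (-(t * (cmod (w + d))\<^sup>2)))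
        \<le> (\<Sum>\<^sub>\<infinity>d\<in>L. 27 * exp 1 * (1 + 1/t) ^ 3 * (1 + (cmod (w + d))\<^sup>2) powr (-2))"
      by (intro infsum_mono gauss_summable a summable_on_cmult_right summable_powr_shift gauss_le) auto
    also have "\<dots> = 27 * exp 1 * (1 + 1/t) ^ 3 * (\<Sum>\<^sub>\<infinity>d\<in>L. (1 + (cmod (w + d))\<^sup>2) powr (-2))"
      by (rule infsum_cmult_right) (intro summable_powr_shift, simp)
    also have "\<dots> \<le> 27 * exp 1 * (1 + 1/t) ^ 3 * C"
      using a by (intro mult_left_mono C) auto
    finally show "(\<Sum>\<^sub>\<infinity>d\<in>L. cmod (w + d) ^ j * exp (-(t * (cmod (w + d))\<^sup>2))) \<le> 27 * exp 1 * C * (1 + 1/t) ^ 3"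
      by (simp add: mult_ac)
  qed (use C0 in auto)
qed

lemma th_summable:
  assumes "t > 0" "k \<le> 2"
  shows "(\<lambda>d. cnj (w + d) ^ k * of_real (exp (-(t * (cmod (w + d))\<^sup>2)))) summable_on L"
  unfolding summable_on_iff_abs_summable_on_complex
  using gauss_summable[OF assms, of w] by (simp add: norm_mult norm_power del: complex_cnj_add)

text \<open>On real \<open>z\<close> this is the Gaussian at the point
  \<open>w + d + z * \<omega>\<close>; writing its squared modulus as a product of two linear
  functions of \<open>z\<close> makes it entire. Replacing \<open>z\<close> by \<open>z + 1\<close>
  shifts \<open>d\<close> by the period \<open>\<omega>\<close>, which is why the lattice sum
  \<open>GG\<close> is periodic.\<close>

definition Gf :: "complex \<Rightarrow> complex \<Rightarrow> real \<Rightarrow> complex \<Rightarrow> complex \<Rightarrow> complex" where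
  "Gf \<omega> w t d z = exp (-(of_real t * ((w + d) + z * \<omega>) * (cnj (w + d) + z * cnj \<omega>)))"

definition GG :: "complex \<Rightarrow> complex \<Rightarrow> real \<Rightarrow> complex \<Rightarrow> complex" where
  "GG \<omega> w t z = (\<Sum>\<^sub>\<infinity>d\<in>L. Gf \<omega> w t d z)"

text \<open>Off the real line the Gaussian grows by the factor
  \<open>exp (t * (Im z)^2 * (cmod \<omega>)^2)\<close>. This stays bounded as long as
  \<open>Im z\<close> is at most \<open>1 / sqrt t\<close>, which dictates the radius of the Cauchy
  estimate below.\<close>

lemma norm_Gf:
  "norm (Gf \<omega> w t d z) = exp (-(t * (cmod (w + of_real (Re z) * \<omega> + d))\<^sup>2)) * exp (t * (Im z)\<^sup>2 * (cmod \<omega>)\<^sup>2)"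
proof -
  define a where "a = w + d"
  have Re_mult_of_real: "Re (of_real x * Z) = x * Re Z" for x Z by simp
  have "Re (((w + d) + z * \<omega>) * (cnj (w + d) + z * cnj \<omega>))
     = (cmod (w + of_real (Re z) * \<omega> + d))\<^sup>2 - (Im z)\<^sup>2 * (cmod \<omega>)\<^sup>2"
    unfolding cmod_power2 by (simp add: power2_eq_square algebra_simps)
  then have "Re (of_real t * (((w + d) + z * \<omega>) * (cnj (w + d) + z * cnj \<omega>)))
     = t * ((cmod (w + of_real (Re z) * \<omega> + d))\<^sup>2 - (Im z)\<^sup>2 * (cmod \<omega>)\<^sup>2)"
    by (metis Re_mult_of_real)
  then show ?thesis unfolding Gf_def norm_exp_eq_Re exp_add[symmetric]
    by (simp only: uminus_complex.sel mult.assoc) (simp add: algebra_simps)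
qed

text \<open>Half of the Gaussian is given up to absorb the shift by \<open>z * \<omega>\<close>; the
  remaining half is a majorant on the disc that is summable over the lattice.\<close>

lemma Gf_bound:
  assumes "t > 0" "norm z < R"
  shows "norm (Gf \<omega> w t d z) \<le> exp (2 * t * R\<^sup>2 * (cmod \<omega>)\<^sup>2) * exp (-(t/2 * (cmod (w + d))\<^sup>2))"
proof -
  define v where "v = w + of_real (Re z) * \<omega> + d"
  have "cmod (w + d) \<le> cmod v + \<bar>Re z\<bar> * cmod \<omega>"
    using norm_triangle_ineq4[of v "of_real (Re z) * \<omega>"] by (simp add: v_def norm_mult)
  also have "\<dots> \<le> cmod v + R * cmod \<omega>" using assms abs_Re_le_cmod[of z]
    by (intro add_left_mono mult_right_mono) auto
  finally have "(cmod (w + d))\<^sup>2 \<le> (cmod v + R * cmod \<omega>)\<^sup>2" by (rule power_mono) simp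
  also have "\<dots> \<le> 2 * (cmod v)\<^sup>2 + 2 * (R * cmod \<omega>)\<^sup>2"
    using sum_squares_bound[of "cmod v" "R * cmod \<omega>"] by (simp add: power2_sum)
  finally have 1: "(cmod (w + d))\<^sup>2 / 2 \<le> (cmod v)\<^sup>2 + R\<^sup>2 * (cmod \<omega>)\<^sup>2" by (simp add: power_mult_distrib)
  have "\<bar>Im z\<bar> \<le> R" using assms abs_Im_le_cmod[of z] by linarith
  then have "(Im z)\<^sup>2 \<le> R\<^sup>2" by (metis abs_ge_zero power2_abs power_mono)
  then have 2: "(Im z)\<^sup>2 * (cmod \<omega>)\<^sup>2 \<le> R\<^sup>2 * (cmod \<omega>)\<^sup>2" by (rule mult_right_mono) simp
  have "t * ((Im z)\<^sup>2 * (cmod \<omega>)\<^sup>2 - (cmod v)\<^sup>2) \<le> t * (2 * (R\<^sup>2 * (cmod \<omega>)\<^sup>2) - (cmod (w + d))\<^sup>2 / 2)"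
    using 1 2 assms by (intro mult_left_mono) auto
  then show ?thesis unfolding norm_Gf v_def[symmetric] exp_add[symmetric] by (simp add: algebra_simps)
qed

lemma Gf_bound_summable:
  "t > 0 \<Longrightarrow> (\<lambda>d. K * exp (-(t/2 * (cmod (w + d))\<^sup>2))) summable_on L"
  using gauss_summable[of "t/2" 0 w] by (intro summable_on_cmult_right) auto

lemma Gf_holomorphic: "Gf \<omega> w t d holomorphic_on A"
  unfolding Gf_def[abs_def] by (intro holomorphic_intros)

lemma GG_holomorphic: assumes "t > 0" shows "GG \<omega> w t holomorphic_on UNIV"
proof -
  have "GG \<omega> w t holomorphic_on ball 0 R" for R
    unfolding GG_def[abs_def]
    by (rule infsum_holomorphic(1)[OF open_ball _ _ Gf_bound_summable[OF assms, of "exp (2 * t * R\<^sup>2 * (cmod \<omega>)\<^sup>2)" w]])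
       (use Gf_bound[OF assms] in \<open>auto intro: Gf_holomorphic\<close>)
  moreover have "z \<in> ball 0 (norm z + 1)" for z :: complex by simp
  ultimately show ?thesis
    unfolding holomorphic_on_open[OF open_UNIV] by (metis holomorphic_on_open open_ball)
qed

lemma GG_higher_deriv:
  assumes "t > 0"
  shows "((\<lambda>d. (deriv ^^ k) (Gf \<omega> w t d) 0) has_sum (deriv ^^ k) (GG \<omega> w t) 0) L"
  unfolding GG_def[abs_def]
  by (rule infsum_holomorphic(2)[where S = "ball 0 1", OF open_ball _ _ Gf_bound_summable[OF assms, of "exp (2 * t * 1\<^sup>2 * (cmod \<omega>)\<^sup>2)" w]])
     (use Gf_bound[OF assms, of _ 1] in \<open>auto intro: Gf_holomorphic\<close>)

lemma GG_periodic:
  assumes "\<omega> \<in> L" shows "GG \<omega> w t (z + 1) = GG \<omega> w t z"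
proof -
  have "GG \<omega> w t (z + 1) = (\<Sum>\<^sub>\<infinity>d\<in>L. Gf \<omega> w t (d + \<omega>) z)"
    unfolding GG_def by (intro infsum_cong) (simp add: Gf_def algebra_simps)
  also have "\<dots> = GG \<omega> w t z" unfolding GG_def by (rule infsum_shift[OF assms])
  finally show ?thesis .
qed

lemma GG_real: "GG \<omega> w t (of_real x) = th 0 (w + of_real x * \<omega>) t"
  unfolding GG_def th_def
proof (rule infsum_cong)
  fix d
  have "((w + d) + of_real x * \<omega>) * (cnj (w + d) + of_real x * cnj \<omega>) = of_real ((cmod (w + of_real x * \<omega> + d))\<^sup>2)"
    using complex_norm_square[of "w + of_real x * \<omega> + d"] by (simp add: algebra_simps)
  then have "Gf \<omega> w t d (of_real x) = exp (of_real (-(t * (cmod (w + of_real x * \<omega> + d))\<^sup>2)))"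
    unfolding Gf_def mult.assoc by simp
  then show "Gf \<omega> w t d (of_real x) = cnj (w + of_real x * \<omega> + d) ^ 0 * of_real (exp (-(t * (cmod (w + of_real x * \<omega> + d))\<^sup>2)))"
    by (simp only: exp_of_real) simp
qed

lemma norm_GG:
  assumes C: "\<And>w t j. t > 0 \<Longrightarrow> j \<le> 2 \<Longrightarrow>
     (\<Sum>\<^sub>\<infinity>d\<in>L. cmod (w + d) ^ j * exp (-(t * (cmod (w + d))\<^sup>2))) \<le> C * (1 + 1/t) ^ 3"
    and t: "t > 0"
  shows "norm (GG \<omega> w t z) \<le> C * (1 + 1/t) ^ 3 * exp (t * (Im z)\<^sup>2 * (cmod \<omega>)\<^sup>2)"
proof -
  define e where "e = exp (t * (Im z)\<^sup>2 * (cmod \<omega>)\<^sup>2)"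
  have s: "(\<lambda>d. exp (-(t * (cmod (w + of_real (Re z) * \<omega> + d))\<^sup>2))) summable_on L"
    using gauss_summable[OF t, of 0] by simp
  have "norm (GG \<omega> w t z) \<le> (\<Sum>\<^sub>\<infinity>d\<in>L. exp (-(t * (cmod (w + of_real (Re z) * \<omega> + d))\<^sup>2)) * e)"
    unfolding GG_def
  proof (rule norm_infsum_le[OF has_sum_infsum has_sum_infsum])
    show "(\<lambda>d. exp (-(t * (cmod (w + of_real (Re z) * \<omega> + d))\<^sup>2)) * e) summable_on L"
      using s by (rule summable_on_cmult_left)
    then show "(\<lambda>d. Gf \<omega> w t d z) summable_on L"
      unfolding summable_on_iff_abs_summable_on_complex norm_Gf e_def .
  qed (simp add: norm_Gf e_def)
  also have "\<dots> = (\<Sum>\<^sub>\<infinity>d\<in>L. exp (-(t * (cmod (w + of_real (Re z) * \<omega> + d))\<^sup>2))) * e"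
    by (rule infsum_cmult_left) (use s in auto)
  also have "\<dots> \<le> C * (1 + 1/t) ^ 3 * e"
    using C[OF t, of 0] by (intro mult_right_mono) (auto simp: e_def)
  finally show ?thesis by (simp add: e_def)
qed

text \<open>Cauchy's inequality on circles of radius \<open>1 / sqrt t\<close> gains
  \<open>t ^ n\<close> for the derivative of order \<open>2*n\<close> and loses only the polynomial
  factor \<open>8 / t ^ 3\<close> of the moment bound. Periodicity then brings this bound down
  unchanged to orders 1 and 2.\<close>

lemma GG_deriv_rapid:
  assumes \<omega>: "\<omega> \<in> L"
  obtains C where "C \<ge> 0" "\<And>w t j x. 0 < t \<Longrightarrow> t \<le> 1 \<Longrightarrow> 1 \<le> j \<Longrightarrow> j \<le> 2 \<Longrightarrow>
      norm ((deriv ^^ j) (GG \<omega> w t) (of_real x)) \<le> C * t ^ N"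
proof -
  obtain C0 where C0: "C0 \<ge> 0" "\<And>w t j. t > 0 \<Longrightarrow> j \<le> 2 \<Longrightarrow>
     (\<Sum>\<^sub>\<infinity>d\<in>L. cmod (w + d) ^ j * exp (-(t * (cmod (w + d))\<^sup>2))) \<le> C0 * (1 + 1/t) ^ 3"
    by (rule gauss_moment) (rule that; blast)
  \<comment> \<open>Three of the powers gained pay for \<open>1 / t ^ 3\<close>.\<close>
  define n where "n = N + 3"
  define C where "C = fact (2*n) * (8 * C0 * exp ((cmod \<omega>)\<^sup>2))"
  show ?thesis
  proof (rule that[of C])
    show "C \<ge> 0" using C0 by (simp add: C_def)
    fix w t x and j :: nat assume t: "0 < (t::real)" "t \<le> 1" and j: "1 \<le> j" "j \<le> 2"
    define r where "r = 1 / sqrt t"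
    have r: "r > 0" "r\<^sup>2 = 1/t" using t by (auto simp: r_def power_divide)
    have hol: "GG \<omega> w t holomorphic_on A" for A
      using GG_holomorphic[OF t(1)] by (rule holomorphic_on_subset) auto
    have "norm ((deriv ^^ (2*n)) (GG \<omega> w t) (of_real y)) \<le> C * t ^ N" for y
    proof -
      have "norm ((deriv ^^ (2*n)) (GG \<omega> w t) (of_real y)) \<le> fact (2*n) * (8 * C0 / t ^ 3 * exp ((cmod \<omega>)\<^sup>2)) / r ^ (2*n)"
      proof (rule Cauchy_inequality)
        show "GG \<omega> w t holomorphic_on ball (of_real y) r" by (rule hol)
        show "continuous_on (cball (of_real y) r) (GG \<omega> w t)" by (rule holomorphic_on_imp_continuous_on[OF hol])
        fix z assume "norm (complex_of_real y - z) = r"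
        then have "\<bar>Im z\<bar> \<le> r" using abs_Im_le_cmod[of "complex_of_real y - z"] by simp
        then have "(Im z)\<^sup>2 \<le> r\<^sup>2" by (metis abs_ge_zero power2_abs power_mono)
        then have "t * (Im z)\<^sup>2 \<le> 1" using r t by (simp add: field_simps)
        then have e: "t * (Im z)\<^sup>2 * (cmod \<omega>)\<^sup>2 \<le> 1 * (cmod \<omega>)\<^sup>2" by (rule mult_right_mono) simp
        have "norm (GG \<omega> w t z) \<le> C0 * (1 + 1/t) ^ 3 * exp (t * (Im z)\<^sup>2 * (cmod \<omega>)\<^sup>2)"
          by (rule norm_GG[OF C0(2) t(1)])
        also have "\<dots> \<le> C0 * (2/t) ^ 3 * exp ((cmod \<omega>)\<^sup>2)"
          using C0 t e by (intro mult_mono mult_left_mono power_mono) (auto simp: field_simps)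
        finally show "norm (GG \<omega> w t z) \<le> 8 * C0 / t ^ 3 * exp ((cmod \<omega>)\<^sup>2)"
          by (simp add: power_divide mult_ac)
      qed (use r in auto)
      also have "r ^ (2*n) = 1 / t ^ n" unfolding power_mult r by (simp add: power_divide)
      also have "fact (2*n) * (8 * C0 / t ^ 3 * exp ((cmod \<omega>)\<^sup>2)) / (1 / t ^ n) = C * t ^ N"
        using t by (simp add: C_def n_def power_add)
      finally show ?thesis .
    qed
    then show "norm ((deriv ^^ j) (GG \<omega> w t) (of_real x)) \<le> C * t ^ N"
      by (rule periodic_deriv_le'[OF hol GG_periodic[OF \<omega>] _ j(1)]) (use j in \<open>auto simp: n_def\<close>)
  qed
qed

lemma Gf_has_deriv:
  "(Gf \<omega> w t d has_field_derivative
     (- of_real t * (\<omega> * (cnj (w + d) + z * cnj \<omega>) + cnj \<omega> * ((w + d) + z * \<omega>))) * Gf \<omega> w t d z) (at z)"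
  unfolding Gf_def[abs_def] by (auto intro!: derivative_eq_intros simp: algebra_simps)

lemma Gf_deriv1: "deriv (Gf \<omega> w t d) = (\<lambda>z.
     (- of_real t * (\<omega> * (cnj (w + d) + z * cnj \<omega>) + cnj \<omega> * ((w + d) + z * \<omega>))) * Gf \<omega> w t d z)"
  by (rule ext) (rule DERIV_imp_deriv[OF Gf_has_deriv])

lemma Gf_0: "Gf \<omega> w t d 0 = of_real (exp (-(t * (cmod (w + d))\<^sup>2)))"
proof -
  have "Gf \<omega> w t d 0 = exp (of_real (-(t * (cmod (w + d))\<^sup>2)))"
    using complex_norm_square[of "w + d"] by (simp add: Gf_def mult.assoc del: complex_cnj_add)
  then show ?thesis by (simp only: exp_of_real)
qed

lemma Gf_deriv2_0: "deriv (deriv (Gf \<omega> w t d)) 0 =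
   of_real t * ((of_real t * (\<omega> * cnj (w + d) + cnj \<omega> * (w + d))\<^sup>2 - 2 * \<omega> * cnj \<omega>)
      * of_real (exp (-(t * (cmod (w + d))\<^sup>2))))"
proof -
  have "((\<lambda>z. - of_real t * (\<omega> * (cnj (w + d) + z * cnj \<omega>) + cnj \<omega> * ((w + d) + z * \<omega>)))
      has_field_derivative (- of_real t * (2 * \<omega> * cnj \<omega>))) (at 0)"
    by (auto intro!: derivative_eq_intros simp: algebra_simps)
  from DERIV_imp_deriv[OF DERIV_mult[OF this Gf_has_deriv[of \<omega> w t d 0]]]
  show ?thesis unfolding Gf_deriv1 Gf_0[of \<omega> w t d, symmetric]
    by (simp add: power2_eq_square algebra_simps)
qed

text \<open>The derivative of \<open>cmod (v + x * \<omega>) ^ 2\<close> with respect to real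
  \<open>x\<close> at 0, hence the factor that differentiation along a period brings down from the
  Gaussian.\<close>

definition X :: "complex \<Rightarrow> complex \<Rightarrow> complex" where "X \<omega> v = \<omega> * cnj v + cnj \<omega> * v"

lemma norm_th_le:
  assumes "t > 0" "k \<le> 2"
  shows "norm (th k w t) \<le> (\<Sum>\<^sub>\<infinity>d\<in>L. cmod (w + d) ^ k * exp (-(t * (cmod (w + d))\<^sup>2)))"
  unfolding th_def
  by (rule norm_infsum_le[OF has_sum_infsum has_sum_infsum])
     (use th_summable[OF assms] gauss_summable[OF assms] in \<open>auto simp: norm_mult norm_power simp del: complex_cnj_add\<close>)

text \<open>The first two bounds are the derivatives of \<open>GG\<close> at 0 written out as sums;
  both contain an explicit factor \<open>t\<close>, so the decay is taken one order higher and
  divided by \<open>t\<close>. The third bound integrates the first derivative along the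
  segment.\<close>

lemma period_rapid:
  assumes \<omega>: "\<omega> \<in> L"
  obtains C where "C \<ge> 0"
    "\<And>w t. 0 < t \<Longrightarrow> t \<le> 1 \<Longrightarrow> norm (\<Sum>\<^sub>\<infinity>d\<in>L. X \<omega> (w + d) * of_real (exp (-(t * (cmod (w + d))\<^sup>2)))) \<le> C * t ^ N"
    "\<And>w t. 0 < t \<Longrightarrow> t \<le> 1 \<Longrightarrow> norm (\<Sum>\<^sub>\<infinity>d\<in>L. (of_real t * (X \<omega> (w + d))\<^sup>2 - 2 * \<omega> * cnj \<omega>) * of_real (exp (-(t * (cmod (w + d))\<^sup>2)))) \<le> C * t ^ N"
    "\<And>w t x. 0 < t \<Longrightarrow> t \<le> 1 \<Longrightarrow> 0 \<le> x \<Longrightarrow> x \<le> 1 \<Longrightarrow> norm (th 0 (w + of_real x * \<omega>) t - th 0 w t) \<le> C * t ^ N"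
proof -
  obtain C where C0: "C \<ge> 0" and C: "\<And>w t j x. 0 < t \<Longrightarrow> t \<le> 1 \<Longrightarrow> 1 \<le> j \<Longrightarrow> j \<le> 2 \<Longrightarrow>
      norm ((deriv ^^ j) (GG \<omega> w t) (of_real x)) \<le> C * t ^ Suc N"
    by (rule GG_deriv_rapid[OF \<omega>, of "Suc N"]) (rule that; blast)
  show ?thesis
  proof (rule that[OF C0])
    fix w t assume t: "0 < (t::real)" "t \<le> 1"
    define S where "S = (\<Sum>\<^sub>\<infinity>d\<in>L. X \<omega> (w + d) * of_real (exp (-(t * (cmod (w + d))\<^sup>2))))"
    have "((\<lambda>d. deriv (Gf \<omega> w t d) 0) has_sum deriv (GG \<omega> w t) 0) L"
      using GG_higher_deriv[OF t(1), of 1 \<omega> w] by simp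
    then have "((\<lambda>d. - of_real t * (X \<omega> (w + d) * of_real (exp (-(t * (cmod (w + d))\<^sup>2))))) has_sum deriv (GG \<omega> w t) 0) L"
      by (simp add: Gf_deriv1 Gf_0 X_def mult.assoc)
    then have "deriv (GG \<omega> w t) 0 = (\<Sum>\<^sub>\<infinity>d\<in>L. - of_real t * (X \<omega> (w + d) * of_real (exp (-(t * (cmod (w + d))\<^sup>2)))))"
      by (simp add: infsumI)
    also have "\<dots> = - of_real t * S" unfolding S_def by (rule infsum_cmult_right') 
    finally have "norm (deriv (GG \<omega> w t) 0) = t * norm S" using t by (simp add: norm_mult)
    moreover have "norm (deriv (GG \<omega> w t) 0) \<le> C * t ^ Suc N" using C[OF t, of 1 w 0] by simp
    ultimately have "t * norm S \<le> t * (C * t ^ N)" by (simp add: mult_ac)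
    then show "norm S \<le> C * t ^ N" using t by simp
  next
    fix w t assume t: "0 < (t::real)" "t \<le> 1"
    define S where "S = (\<Sum>\<^sub>\<infinity>d\<in>L. (of_real t * (X \<omega> (w + d))\<^sup>2 - 2 * \<omega> * cnj \<omega>) * of_real (exp (-(t * (cmod (w + d))\<^sup>2))))"
    have "((\<lambda>d. deriv (deriv (Gf \<omega> w t d)) 0) has_sum deriv (deriv (GG \<omega> w t)) 0) L"
      using GG_higher_deriv[OF t(1), of 2 \<omega> w] by (simp add: numeral_2_eq_2)
    then have "deriv (deriv (GG \<omega> w t)) 0 = of_real t * S"
      unfolding S_def X_def Gf_deriv2_0 by (subst infsum_cmult_right'[symmetric]) (simp add: infsumI)
    then have "norm (deriv (deriv (GG \<omega> w t)) 0) = t * norm S" using t by (simp add: norm_mult)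
    moreover have "norm (deriv (deriv (GG \<omega> w t)) 0) \<le> C * t ^ Suc N"
      using C[OF t, of 2 w 0] by (simp add: numeral_2_eq_2)
    ultimately have "t * norm S \<le> t * (C * t ^ N)" by (simp add: mult_ac)
    then show "norm S \<le> C * t ^ N" using t by simp
  next
    fix w t x assume t: "0 < (t::real)" "t \<le> 1" and x: "0 \<le> (x::real)" "x \<le> 1"
    define S where "S = complex_of_real ` {0..1}"
    have S: "convex S" unfolding S_def by (intro convex_linear_image) (auto simp: linear_iff scaleR_conv_of_real)
    have "norm (GG \<omega> w t (of_real x) - GG \<omega> w t (of_real 0)) \<le> C * t ^ Suc N * norm (of_real x - complex_of_real 0)"
    proof (rule field_differentiable_bound[OF S])
      show "(GG \<omega> w t has_field_derivative deriv (GG \<omega> w t) z) (at z within S)" for z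
        by (rule has_field_derivative_at_within[OF holomorphic_derivI[OF GG_holomorphic[OF t(1)] open_UNIV UNIV_I]])
      show "norm (deriv (GG \<omega> w t) z) \<le> C * t ^ Suc N" if "z \<in> S" for z
        using that C[OF t, of 1 w] by (auto simp: S_def)
    qed (use x in \<open>auto simp: S_def\<close>)
    also have "\<dots> \<le> C * t ^ N * 1" using C0 t x by (intro mult_mono mult_left_mono) (auto simp: mult_le_cancel_right1)
    finally show "norm (th 0 (w + of_real x * \<omega>) t - th 0 w t) \<le> C * t ^ N"
      unfolding GG_real by simp
  qed
qed

text \<open>\<open>psi t\<close> is the derivative of \<open>t * th 0 0 t\<close>, so its decay yields the limit of \<open>t * th 0 0 t\<close> at \<open>0\<close>.\<close>

definition psi :: "real \<Rightarrow> complex" where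
  "psi t = (\<Sum>\<^sub>\<infinity>d\<in>L. (1 - of_real (t * (cmod d)\<^sup>2)) * of_real (exp (-(t * (cmod d)\<^sup>2))))"

lemma th_shift: "l \<in> L \<Longrightarrow> th k (w + l) t = th k w t"
  unfolding th_def
  using infsum_shift[of l "\<lambda>d. cnj (w + d) ^ k * of_real (exp (-(t * (cmod (w + d))\<^sup>2)))"]
  by (simp add: algebra_simps)

lemma basis_conj_det_nz: "w1 * cnj w2 - cnj w1 * w2 \<noteq> 0"
proof
  assume "w1 * cnj w2 - cnj w1 * w2 = 0"
  then have "Im (w1 * cnj w2 - cnj w1 * w2) = 0" by simp
  then show False using indep by simp
qed

lemma poly_gauss_summable:
  assumes "t > 0"
  shows "(\<lambda>d. (a + b * cnj (w + d) + c * (w + d) + e * (cnj (w + d))\<^sup>2 + f * (w + d)\<^sup>2 + g * (cnj (w + d) * (w + d)))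
      * of_real (exp (-(t * (cmod (w + d))\<^sup>2)))) summable_on L"
proof -
  define E where "E d = complex_of_real (exp (-(t * (cmod (w + d))\<^sup>2)))" for d
  have base: "(\<lambda>d. h d * E d) summable_on L" if "\<And>d. norm (h d) = cmod (w + d) ^ k" "k \<le> 2" for h k
    unfolding summable_on_iff_abs_summable_on_complex E_def
    using gauss_summable[OF assms that(2), of w] by (simp add: norm_mult that(1))
  have "(\<lambda>d. a * E d + b * (cnj (w + d) * E d) + c * ((w + d) * E d) + e * ((cnj (w + d))\<^sup>2 * E d)
      + f * ((w + d)\<^sup>2 * E d) + g * ((cnj (w + d) * (w + d)) * E d)) summable_on L"
  proof -
    have n: "norm (cnj v) = cmod v ^ 1" "norm v = cmod v ^ 1" "norm ((cnj v)\<^sup>2) = cmod v ^ 2"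
      "norm (v\<^sup>2) = cmod v ^ 2" "norm (cnj v * v) = cmod v ^ 2" for v
      by (simp_all add: norm_power norm_mult power2_eq_square)
    have "E summable_on L" using base[of "\<lambda>_. 1" 0] by simp
    moreover have "(\<lambda>d. cnj (w + d) * E d) summable_on L" by (rule base[where k=1], rule n) simp
    moreover have "(\<lambda>d. (w + d) * E d) summable_on L" by (rule base[where k=1], rule n) simp
    moreover have "(\<lambda>d. (cnj (w + d))\<^sup>2 * E d) summable_on L" by (rule base[where k=2], rule n) simp
    moreover have "(\<lambda>d. (w + d)\<^sup>2 * E d) summable_on L" by (rule base[where k=2], rule n) simp
    moreover have "(\<lambda>d. (cnj (w + d) * (w + d)) * E d) summable_on L" by (rule base[where k=2], rule n) simp
    ultimately show ?thesis by (intro summable_on_add summable_on_cmult_right)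
  qed
  then show ?thesis unfolding E_def by (simp add: algebra_simps)
qed

text \<open>The second-order bounds of \<open>period_rapid\<close> for the periods \<open>w1\<close>, \<open>w2\<close>, \<open>w1 + w2\<close> form a nondegenerate
  linear system for \<open>th 2\<close>, its conjugate and \<open>psi\<close>.\<close>

lemma th_rapid_small:
  obtains C where "C \<ge> 0"
    "\<And>w t. 0 < t \<Longrightarrow> t \<le> 1 \<Longrightarrow> norm (th 1 w t) \<le> C * t ^ N"
    "\<And>w t. 0 < t \<Longrightarrow> t \<le> 1 \<Longrightarrow> norm (th 2 w t) \<le> C * t ^ N"
    "\<And>w t. 0 < t \<Longrightarrow> t \<le> 1 \<Longrightarrow> norm (th 0 w t - th 0 0 t) \<le> C * t ^ N"
    "\<And>t. 0 < t \<Longrightarrow> t \<le> 1 \<Longrightarrow> norm (psi t) \<le> C * t ^ N"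
proof -
  obtain C1 where C1: "C1 \<ge> 0"
    "\<And>w t. 0 < t \<Longrightarrow> t \<le> 1 \<Longrightarrow> norm (\<Sum>\<^sub>\<infinity>d\<in>L. X w1 (w + d) * of_real (exp (-(t * (cmod (w + d))\<^sup>2)))) \<le> C1 * t ^ Suc N"
    "\<And>w t. 0 < t \<Longrightarrow> t \<le> 1 \<Longrightarrow> norm (\<Sum>\<^sub>\<infinity>d\<in>L. (of_real t * (X w1 (w + d))\<^sup>2 - 2 * w1 * cnj w1) * of_real (exp (-(t * (cmod (w + d))\<^sup>2)))) \<le> C1 * t ^ Suc N"
    "\<And>w t x. 0 < t \<Longrightarrow> t \<le> 1 \<Longrightarrow> 0 \<le> x \<Longrightarrow> x \<le> 1 \<Longrightarrow> norm (th 0 (w + of_real x * w1) t - th 0 w t) \<le> C1 * t ^ Suc N"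
    by (rule period_rapid[OF w1_in, of "Suc N"]) (rule that; blast)
  obtain C2 where C2: "C2 \<ge> 0"
    "\<And>w t. 0 < t \<Longrightarrow> t \<le> 1 \<Longrightarrow> norm (\<Sum>\<^sub>\<infinity>d\<in>L. X w2 (w + d) * of_real (exp (-(t * (cmod (w + d))\<^sup>2)))) \<le> C2 * t ^ Suc N"
    "\<And>w t. 0 < t \<Longrightarrow> t \<le> 1 \<Longrightarrow> norm (\<Sum>\<^sub>\<infinity>d\<in>L. (of_real t * (X w2 (w + d))\<^sup>2 - 2 * w2 * cnj w2) * of_real (exp (-(t * (cmod (w + d))\<^sup>2)))) \<le> C2 * t ^ Suc N"
    "\<And>w t x. 0 < t \<Longrightarrow> t \<le> 1 \<Longrightarrow> 0 \<le> x \<Longrightarrow> x \<le> 1 \<Longrightarrow> norm (th 0 (w + of_real x * w2) t - th 0 w t) \<le> C2 * t ^ Suc N"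
    by (rule period_rapid[OF w2_in, of "Suc N"]) (rule that; blast)
  obtain C3 where C3: "C3 \<ge> 0"
    "\<And>w t. 0 < t \<Longrightarrow> t \<le> 1 \<Longrightarrow> norm (\<Sum>\<^sub>\<infinity>d\<in>L. (of_real t * (X (w1+w2) (w + d))\<^sup>2 - 2 * (w1+w2) * cnj (w1+w2)) * of_real (exp (-(t * (cmod (w + d))\<^sup>2)))) \<le> C3 * t ^ Suc N"
    by (rule period_rapid[OF add_in[OF w1_in w2_in], of "Suc N"]) (rule that; blast)
  define D where "D = w1 * cnj w2 - cnj w1 * w2"
  have D: "D \<noteq> 0" using basis_conj_det_nz by (simp add: D_def)
  have D2: "norm (D\<^sup>2) > 0" using D by simp
  define Y where "Y t \<omega> v = of_real t * (X \<omega> v)\<^sup>2 - 2 * \<omega> * cnj \<omega>" for t \<omega> v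
  define E where "E t v = complex_of_real (exp (-(t * (cmod v)\<^sup>2)))" for t v
  define M where "M = cmod w1 + cmod w2 + (cmod w1)\<^sup>2 + (cmod w2)\<^sup>2 + cmod w1 * cmod w2"
  have M: "M \<ge> 0" by (simp add: M_def)
  have Mb: "norm (cnj w1) \<le> M" "norm (cnj w2) \<le> M" "norm ((cnj w1)\<^sup>2) \<le> M" "norm ((cnj w2)\<^sup>2) \<le> M"
     "norm (cnj w1 * cnj w2) \<le> M" "norm (2 * w2 * cnj w2) \<le> 2 * M" "norm (2 * w1 * cnj w1) \<le> 2 * M"
     "norm (w1 * cnj w2 + cnj w1 * w2) \<le> 2 * M"
    using norm_triangle_ineq[of "w1 * cnj w2" "cnj w1 * w2"]
      mult_nonneg_nonneg[OF norm_ge_zero norm_ge_zero, of w1 w1] mult_nonneg_nonneg[OF norm_ge_zero norm_ge_zero, of w2 w2]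
      mult_nonneg_nonneg[OF norm_ge_zero norm_ge_zero, of w1 w2] norm_ge_zero[of w1] norm_ge_zero[of w2]
    unfolding M_def norm_mult norm_power power2_eq_square complex_mod_cnj norm_numeral mult.assoc distrib_left by - (linarith+)
  define Z where "Z = C1 + C2 + C3"
  have Z: "Z \<ge> 0" "C1 \<le> Z" "C2 \<le> Z" "C3 \<le> Z" using C1(1) C2(1) C3(1) by (auto simp: Z_def)
  define C where "C = 2 * M * Z / norm D + 10 * M * Z / norm (D\<^sup>2) + 2 * Z"
  have XS: "(\<lambda>d. X \<omega> (w + d) * E t (w + d)) summable_on L" if "t > 0" for \<omega> w t
    using poly_gauss_summable[OF that, of 0 \<omega> w "cnj \<omega>" 0 0 0] by (simp add: X_def E_def)
  have YS: "(\<lambda>d. Y t \<omega> (w + d) * E t (w + d)) summable_on L" if "t > 0" for \<omega> w t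
  proof -
    have "(of_real t * (X \<omega> v)\<^sup>2 - 2 * \<omega> * cnj \<omega>) = - 2 * \<omega> * cnj \<omega> + 0 * cnj v + 0 * v + (of_real t * \<omega>\<^sup>2) * (cnj v)\<^sup>2
        + (of_real t * (cnj \<omega>)\<^sup>2) * v\<^sup>2 + (2 * of_real t * \<omega> * cnj \<omega>) * (cnj v * v)" for v
      by (simp add: X_def power2_eq_square algebra_simps)
    then show ?thesis unfolding Y_def E_def
      by (simp only:) (rule poly_gauss_summable[OF that])
  qed
  have XX: "norm (\<Sum>\<^sub>\<infinity>d\<in>L. X w1 (w + d) * E t (w + d)) \<le> Z * t ^ Suc N"
           "norm (\<Sum>\<^sub>\<infinity>d\<in>L. X w2 (w + d) * E t (w + d)) \<le> Z * t ^ Suc N"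
           "norm (\<Sum>\<^sub>\<infinity>d\<in>L. Y t w1 (w + d) * E t (w + d)) \<le> Z * t ^ Suc N"
           "norm (\<Sum>\<^sub>\<infinity>d\<in>L. Y t w2 (w + d) * E t (w + d)) \<le> Z * t ^ Suc N"
           "norm (\<Sum>\<^sub>\<infinity>d\<in>L. Y t (w1 + w2) (w + d) * E t (w + d)) \<le> Z * t ^ Suc N"
    if t: "0 < t" "t \<le> 1" for w t
  proof -
    have le: "A \<le> Z * t ^ Suc N" if "A \<le> c * t ^ Suc N" "c \<le> Z" for A c :: real
      by (rule order_trans[OF that(1) mult_right_mono[OF that(2)]]) (use t in simp)
    show "norm (\<Sum>\<^sub>\<infinity>d\<in>L. X w1 (w + d) * E t (w + d)) \<le> Z * t ^ Suc N"
      unfolding E_def by (rule le[OF C1(2)[OF t] Z(2)])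
    show "norm (\<Sum>\<^sub>\<infinity>d\<in>L. X w2 (w + d) * E t (w + d)) \<le> Z * t ^ Suc N"
      unfolding E_def by (rule le[OF C2(2)[OF t] Z(3)])
    show "norm (\<Sum>\<^sub>\<infinity>d\<in>L. Y t w1 (w + d) * E t (w + d)) \<le> Z * t ^ Suc N"
      unfolding E_def Y_def by (rule le[OF C1(3)[OF t] Z(2)])
    show "norm (\<Sum>\<^sub>\<infinity>d\<in>L. Y t w2 (w + d) * E t (w + d)) \<le> Z * t ^ Suc N"
      unfolding E_def Y_def by (rule le[OF C2(3)[OF t] Z(3)])
    show "norm (\<Sum>\<^sub>\<infinity>d\<in>L. Y t (w1 + w2) (w + d) * E t (w + d)) \<le> Z * t ^ Suc N"
      unfolding E_def Y_def by (rule le[OF C3(2)[OF t] Z(4)])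
  qed
  have tN: "t ^ Suc N \<le> t ^ N" if "0 < t" "t \<le> 1" for t :: real
    using that by (intro power_decreasing) auto
  have mulE: "x * e = A * (Y1 * e) + B * (Y2 * e) + C * (Y3 * e)"
    if "x = A * Y1 + B * Y2 + C * Y3" for x e A B C Y1 Y2 Y3 :: complex
    unfolding that by (simp add: algebra_simps)
  have comb3: "norm (a * S1 + b * S2 + c * S3) \<le> K * B"
    if "norm a + norm b + norm c \<le> K" "norm S1 \<le> B" "norm S2 \<le> B" "norm S3 \<le> B" for a b c S1 S2 S3 :: complex and K B
  proof -
    have B: "B \<ge> 0" using that(2) norm_ge_zero order_trans by blast
    have "norm (a * S1 + b * S2 + c * S3) \<le> norm a * norm S1 + norm b * norm S2 + norm c * norm S3"
      using norm_triangle_ineq[of "a * S1 + b * S2" "c * S3"] norm_triangle_ineq[of "a * S1" "b * S2"]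
      by (simp add: norm_mult)
    also have "\<dots> \<le> norm a * B + norm b * B + norm c * B"
      using that by (intro add_mono mult_left_mono) auto
    also have "\<dots> = (norm a + norm b + norm c) * B" by (simp add: algebra_simps)
    also have "\<dots> \<le> K * B" using that B by (intro mult_right_mono) auto
    finally show ?thesis .
  qed
  show ?thesis
  proof (rule that[of C])
    show "C \<ge> 0" unfolding C_def using M Z by (intro add_nonneg_nonneg divide_nonneg_nonneg mult_nonneg_nonneg) auto
  next
    fix w t assume t: "0 < (t::real)" "t \<le> 1"
    \<comment> \<open>The elimination identity is
      \<open>cnj w2 * X w1 v - cnj w1 * X w2 v = D * cnj v\<close>.\<close>
    have "th 1 w t * D = (\<Sum>\<^sub>\<infinity>d\<in>L. cnj (w + d) * E t (w + d) * D)"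
      unfolding th_def E_def by (subst infsum_cmult_left'[symmetric]) simp
    also have "\<dots> = (\<Sum>\<^sub>\<infinity>d\<in>L. cnj w2 * (X w1 (w + d) * E t (w + d)) + (- cnj w1) * (X w2 (w + d) * E t (w + d)))"
      by (intro infsum_cong) (simp add: D_def X_def algebra_simps)
    also have "\<dots> = cnj w2 * (\<Sum>\<^sub>\<infinity>d\<in>L. X w1 (w + d) * E t (w + d)) + (- cnj w1) * (\<Sum>\<^sub>\<infinity>d\<in>L. X w2 (w + d) * E t (w + d))"
      by (subst infsum_add) (intro summable_on_cmult_right XS t infsum_cmult_right' | simp only: infsum_cmult_right')+
    finally have "norm (th 1 w t) * norm D = norm (cnj w2 * (\<Sum>\<^sub>\<infinity>d\<in>L. X w1 (w + d) * E t (w + d)) + (- cnj w1) * (\<Sum>\<^sub>\<infinity>d\<in>L. X w2 (w + d) * E t (w + d)) + 0 * 0)"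
      by (metis norm_mult add.right_neutral mult_zero_left)
    also have "\<dots> \<le> (2 * M) * (Z * t ^ Suc N)"
      by (rule comb3) (use XX[OF t, of w] Mb(1,2) Z t in auto)
    also have "\<dots> \<le> 2 * M * (Z * t ^ N)" using M Z tN[OF t] by (intro mult_left_mono) auto
    finally have "norm (th 1 w t) \<le> (2 * M * Z / norm D) * t ^ N" using D by (simp add: field_simps)
    also have "\<dots> \<le> C * t ^ N" unfolding C_def using M Z t by (intro mult_right_mono) auto
    finally show "norm (th 1 w t) \<le> C * t ^ N" .
  next
    fix w t assume t: "0 < (t::real)" "t \<le> 1"
    \<comment> \<open>The coefficients arise by squaring
      \<open>cnj w2 * X w1 v - cnj w1 * X w2 v = D * cnj v\<close> and expressing the mixed product
      through the value at \<open>w1 + w2\<close> by polarisation; the constants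
      \<open>2 * \<omega> * cnj \<omega>\<close> cancel.\<close>
    have "of_real t * (th 2 w t * D\<^sup>2) = (\<Sum>\<^sub>\<infinity>d\<in>L. of_real t * ((cnj (w + d))\<^sup>2 * E t (w + d) * D\<^sup>2))"
      unfolding th_def E_def by (simp only: infsum_cmult_left' infsum_cmult_right')
    also have "\<dots> = (\<Sum>\<^sub>\<infinity>d\<in>L. ((cnj w2)\<^sup>2 + cnj w1 * cnj w2) * (Y t w1 (w + d) * E t (w + d))
        + ((cnj w1)\<^sup>2 + cnj w1 * cnj w2) * (Y t w2 (w + d) * E t (w + d)) + (- (cnj w1 * cnj w2)) * (Y t (w1 + w2) (w + d) * E t (w + d)))"
    proof (rule infsum_cong)
      fix d
      have "of_real t * ((cnj v)\<^sup>2 * D\<^sup>2) = ((cnj w2)\<^sup>2 + cnj w1 * cnj w2) * Y t w1 v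
        + ((cnj w1)\<^sup>2 + cnj w1 * cnj w2) * Y t w2 v + (- (cnj w1 * cnj w2)) * Y t (w1 + w2) v" for v
        unfolding D_def Y_def X_def complex_cnj_add by algebra
      note vv = this
      show "of_real t * ((cnj (w + d))\<^sup>2 * E t (w + d) * D\<^sup>2) = ((cnj w2)\<^sup>2 + cnj w1 * cnj w2) * (Y t w1 (w + d) * E t (w + d))
        + ((cnj w1)\<^sup>2 + cnj w1 * cnj w2) * (Y t w2 (w + d) * E t (w + d)) + (- (cnj w1 * cnj w2)) * (Y t (w1 + w2) (w + d) * E t (w + d))"
        using mulE[of _ _ _ _ _ _ _ "E t (w + d)", OF vv[of "w + d"]] by (simp only: mult_ac)
    qed
    also have "\<dots> = ((cnj w2)\<^sup>2 + cnj w1 * cnj w2) * (\<Sum>\<^sub>\<infinity>d\<in>L. Y t w1 (w + d) * E t (w + d))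
        + ((cnj w1)\<^sup>2 + cnj w1 * cnj w2) * (\<Sum>\<^sub>\<infinity>d\<in>L. Y t w2 (w + d) * E t (w + d)) + (- (cnj w1 * cnj w2)) * (\<Sum>\<^sub>\<infinity>d\<in>L. Y t (w1 + w2) (w + d) * E t (w + d))"
      by (subst infsum_add) (intro summable_on_add summable_on_cmult_right YS t | simp only: infsum_add infsum_cmult_right' summable_on_cmult_right YS t)+
    finally have eq: "of_real t * (th 2 w t * D\<^sup>2) = \<dots>" .
    have "norm (of_real t * (th 2 w t * D\<^sup>2)) \<le> (10 * M) * (Z * t ^ Suc N)"
      unfolding eq
    proof (rule comb3)
      show "norm ((cnj w2)\<^sup>2 + cnj w1 * cnj w2) + norm ((cnj w1)\<^sup>2 + cnj w1 * cnj w2) + norm (- (cnj w1 * cnj w2)) \<le> 10 * M"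
        using Mb(3,4,5) M norm_triangle_ineq[of "(cnj w2)\<^sup>2" "cnj w1 * cnj w2"] norm_triangle_ineq[of "(cnj w1)\<^sup>2" "cnj w1 * cnj w2"]
        unfolding norm_minus_cancel by linarith
    qed (use XX[OF t, of w] in auto)
    then have "t * (norm (th 2 w t) * norm (D\<^sup>2)) \<le> t * (10 * M * Z * t ^ N)"
      using t by (simp only: norm_mult norm_of_real abs_of_pos power_Suc mult_ac)
    then have "norm (th 2 w t) * norm (D\<^sup>2) \<le> 10 * M * Z * t ^ N" using t by simp
    then have "norm (th 2 w t) \<le> (10 * M * Z / norm (D\<^sup>2)) * t ^ N" using D2 by (simp add: field_simps)
    also have "\<dots> \<le> C * t ^ N" unfolding C_def using M Z t by (intro mult_right_mono) auto
    finally show "norm (th 2 w t) \<le> C * t ^ N" .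
  next
    fix t assume t: "0 < (t::real)" "t \<le> 1"
    \<comment> \<open>Here the elimination identity is multiplied by its conjugate instead of being
      squared, which produces \<open>v * cnj v\<close>. The factor -2 clears the one half of the
      polarisation.\<close>
    have "-2 * (psi t * D\<^sup>2) = (\<Sum>\<^sub>\<infinity>d\<in>L. -2 * ((1 - of_real (t * (cmod d)\<^sup>2)) * E t d * D\<^sup>2))"
      unfolding psi_def E_def by (simp only: infsum_cmult_left' infsum_cmult_right')
    also have "\<dots> = (\<Sum>\<^sub>\<infinity>d\<in>L. (-(2 * w2 * cnj w2) - (w1 * cnj w2 + cnj w1 * w2)) * (Y t w1 (0 + d) * E t (0 + d))
        + (-(2 * w1 * cnj w1) - (w1 * cnj w2 + cnj w1 * w2)) * (Y t w2 (0 + d) * E t (0 + d)) + (w1 * cnj w2 + cnj w1 * w2) * (Y t (w1 + w2) (0 + d) * E t (0 + d)))"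
    proof (rule infsum_cong)
      fix d
      have "-2 * ((1 - of_real t * (v * cnj v)) * D\<^sup>2) = (-(2 * w2 * cnj w2) - (w1 * cnj w2 + cnj w1 * w2)) * Y t w1 v
        + (-(2 * w1 * cnj w1) - (w1 * cnj w2 + cnj w1 * w2)) * Y t w2 v + (w1 * cnj w2 + cnj w1 * w2) * Y t (w1 + w2) v" for v
        unfolding D_def Y_def X_def complex_cnj_add by algebra
      then have "-2 * ((1 - of_real (t * (cmod d)\<^sup>2)) * D\<^sup>2) = (-(2 * w2 * cnj w2) - (w1 * cnj w2 + cnj w1 * w2)) * Y t w1 d
        + (-(2 * w1 * cnj w1) - (w1 * cnj w2 + cnj w1 * w2)) * Y t w2 d + (w1 * cnj w2 + cnj w1 * w2) * Y t (w1 + w2) d"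
        using complex_norm_square[of d] by simp
      note vv = this
      show "-2 * ((1 - of_real (t * (cmod d)\<^sup>2)) * E t d * D\<^sup>2) = (-(2 * w2 * cnj w2) - (w1 * cnj w2 + cnj w1 * w2)) * (Y t w1 (0 + d) * E t (0 + d))
        + (-(2 * w1 * cnj w1) - (w1 * cnj w2 + cnj w1 * w2)) * (Y t w2 (0 + d) * E t (0 + d)) + (w1 * cnj w2 + cnj w1 * w2) * (Y t (w1 + w2) (0 + d) * E t (0 + d))"
        using mulE[of _ _ _ _ _ _ _ "E t d", OF vv] unfolding add_0 by (simp only: mult_ac)
    qed
    also have "\<dots> = (-(2 * w2 * cnj w2) - (w1 * cnj w2 + cnj w1 * w2)) * (\<Sum>\<^sub>\<infinity>d\<in>L. Y t w1 (0 + d) * E t (0 + d))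
        + (-(2 * w1 * cnj w1) - (w1 * cnj w2 + cnj w1 * w2)) * (\<Sum>\<^sub>\<infinity>d\<in>L. Y t w2 (0 + d) * E t (0 + d)) + (w1 * cnj w2 + cnj w1 * w2) * (\<Sum>\<^sub>\<infinity>d\<in>L. Y t (w1 + w2) (0 + d) * E t (0 + d))"
      by (subst infsum_add) (intro summable_on_add summable_on_cmult_right YS t | simp only: infsum_add infsum_cmult_right' summable_on_cmult_right YS t)+
    finally have eq: "-2 * (psi t * D\<^sup>2) = \<dots>" .
    have "norm (-2 * (psi t * D\<^sup>2)) \<le> (10 * M) * (Z * t ^ Suc N)"
      unfolding eq
    proof (rule comb3)
      have "norm (-(2 * w2 * cnj w2) - (w1 * cnj w2 + cnj w1 * w2)) \<le> 4 * M"
           "norm (-(2 * w1 * cnj w1) - (w1 * cnj w2 + cnj w1 * w2)) \<le> 4 * M"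
        using Mb(6,7,8) norm_triangle_ineq4[of "-(2 * w2 * cnj w2)" "w1 * cnj w2 + cnj w1 * w2"]
          norm_triangle_ineq4[of "-(2 * w1 * cnj w1)" "w1 * cnj w2 + cnj w1 * w2"]
        unfolding norm_minus_cancel by linarith+
      then show "norm (-(2 * w2 * cnj w2) - (w1 * cnj w2 + cnj w1 * w2)) + norm (-(2 * w1 * cnj w1) - (w1 * cnj w2 + cnj w1 * w2)) + norm (w1 * cnj w2 + cnj w1 * w2) \<le> 10 * M"
        using Mb(8) by linarith
    qed (use XX[OF t, of 0] in auto)
    then have "2 * (norm (psi t) * norm (D\<^sup>2)) \<le> 10 * M * Z * t ^ Suc N"
      by (simp add: norm_mult mult_ac)
    also have "\<dots> \<le> 10 * M * Z * t ^ N" using M Z tN[OF t] by (intro mult_left_mono) auto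
    finally have "norm (psi t) * norm (D\<^sup>2) \<le> 10 * M * Z * t ^ N"
      using mult_nonneg_nonneg[OF norm_ge_zero[of "psi t"] norm_ge_zero[of "D\<^sup>2"]] by linarith
    then have "norm (psi t) \<le> (10 * M * Z / norm (D\<^sup>2)) * t ^ N" using D2 by (simp add: field_simps)
    also have "\<dots> \<le> C * t ^ N" unfolding C_def using M Z t by (intro mult_right_mono) auto
    finally show "norm (psi t) \<le> C * t ^ N" .
  next
    fix w t assume t: "0 < (t::real)" "t \<le> 1"
    \<comment> \<open>The way from 0 to \<open>w\<close> consists of a fraction of
      \<open>w1\<close>, a fraction of \<open>w2\<close> and a lattice vector. The last leg leaves
      \<open>th 0\<close> unchanged, the other two change it by rapidly decaying amounts.\<close>
    define x where "x = Im (cnj w * w2) / D0"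
    define y where "y = Im (cnj w1 * w) / D0"
    define l where "l = of_int \<lfloor>x\<rfloor> * w1 + of_int \<lfloor>y\<rfloor> * w2"
    define u where "u = 0 + of_real (frac x) * w1"
    have w: "w = u + of_real (frac y) * w2 + l"
      using coord[of w] unfolding x_def[symmetric] y_def[symmetric] by (simp add: frac_def algebra_simps l_def u_def)
    have "l \<in> L" unfolding l_def by (rule L_memI)
    then have "th 0 w t = th 0 (u + of_real (frac y) * w2) t" unfolding w by (rule th_shift)
    then have "norm (th 0 w t - th 0 0 t) \<le> norm (th 0 (u + of_real (frac y) * w2) t - th 0 u t) + norm (th 0 u t - th 0 0 t)"
      using norm_triangle_ineq[of "th 0 (u + of_real (frac y) * w2) t - th 0 u t" "th 0 u t - th 0 0 t"] by simp
    also have "\<dots> \<le> C2 * t ^ Suc N + C1 * t ^ Suc N"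
      unfolding u_def by (intro add_mono C2(4) C1(4) t) (auto simp: frac_ge_0 frac_lt_1 less_imp_le)
    also have "\<dots> \<le> (2 * Z) * t ^ Suc N"
      using Z t by (simp only: distrib_right[symmetric]) (intro mult_right_mono, auto)
    also have "\<dots> \<le> (2 * Z) * t ^ N" using Z tN[OF t] by (intro mult_left_mono) auto
    also have "\<dots> \<le> C * t ^ N" unfolding C_def using M Z t by (intro mult_right_mono) auto
    finally show "norm (th 0 w t - th 0 0 t) \<le> C * t ^ N" .
  qed
qed

text \<open>For \<open>t \<ge> 1\<close> the moment bound is a constant and
  \<open>t ^ N \<ge> 1\<close>, so the estimates extend to all positive \<open>t\<close>. This is
  convenient where the argument is rescaled, as in \<open>th 2 0 (t * v^2)\<close>.\<close>

lemma th_rapid: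
  obtains C where "C \<ge> 0"
    "\<And>w t. 0 < t \<Longrightarrow> norm (th 1 w t) \<le> C * t ^ N"
    "\<And>w t. 0 < t \<Longrightarrow> norm (th 2 w t) \<le> C * t ^ N"
    "\<And>w t. 0 < t \<Longrightarrow> norm (th 0 w t - th 0 0 t) \<le> C * t ^ N"
proof -
  obtain C where C: "C \<ge> 0"
    "\<And>w t. 0 < t \<Longrightarrow> t \<le> 1 \<Longrightarrow> norm (th 1 w t) \<le> C * t ^ N"
    "\<And>w t. 0 < t \<Longrightarrow> t \<le> 1 \<Longrightarrow> norm (th 2 w t) \<le> C * t ^ N"
    "\<And>w t. 0 < t \<Longrightarrow> t \<le> 1 \<Longrightarrow> norm (th 0 w t - th 0 0 t) \<le> C * t ^ N"
    by (rule th_rapid_small[of N]) (rule that; blast)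
  obtain C0 where C0: "C0 \<ge> 0" "\<And>w t j. t > 0 \<Longrightarrow> j \<le> 2 \<Longrightarrow>
     (\<Sum>\<^sub>\<infinity>d\<in>L. cmod (w + d) ^ j * exp (-(t * (cmod (w + d))\<^sup>2))) \<le> C0 * (1 + 1/t) ^ 3"
    by (rule gauss_moment) (rule that; blast)
  have big: "norm (th k w t) \<le> (8 * C0) * t ^ N" if "t \<ge> 1" "k \<le> 2" for k w t
  proof -
    have "norm (th k w t) \<le> C0 * (1 + 1/t) ^ 3"
      using norm_th_le[of t k w] C0(2)[of t k w] that by auto
    also have "\<dots> \<le> C0 * 2 ^ 3" using C0(1) that by (intro mult_left_mono power_mono) auto
    also have "\<dots> \<le> (8 * C0) * t ^ N" using C0(1) that by (simp add: mult_le_cancel_left1)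
    finally show ?thesis .
  qed
  define K where "K = C + 16 * C0"
  have small: "C * t ^ N \<le> K * t ^ N" "8 * C0 * t ^ N \<le> K * t ^ N" "16 * C0 * t ^ N \<le> K * t ^ N" if "t > 0" for t :: real
    using that C(1) C0(1) by (auto simp: K_def intro!: mult_right_mono)
  show ?thesis
  proof (rule that[of K])
    show "K \<ge> 0" using C(1) C0(1) by (simp add: K_def)
    fix w t assume t: "(t::real) > 0"
    show "norm (th 1 w t) \<le> K * t ^ N"
    proof (cases "t \<le> 1")
      case True
      show ?thesis by (rule order_trans[OF C(2)[OF t True] small(1)[OF t]])
    next
      case False
      then show ?thesis by (intro order_trans[OF big small(2)[OF t]]) auto
    qed
    show "norm (th 2 w t) \<le> K * t ^ N"
    proof (cases "t \<le> 1")
      case True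
      show ?thesis by (rule order_trans[OF C(3)[OF t True] small(1)[OF t]])
    next
      case False
      then show ?thesis by (intro order_trans[OF big small(2)[OF t]]) auto
    qed
    show "norm (th 0 w t - th 0 0 t) \<le> K * t ^ N"
    proof (cases "t \<le> 1")
      case False
      then have "norm (th 0 w t) \<le> 8 * C0 * t ^ N" "norm (th 0 0 t) \<le> 8 * C0 * t ^ N"
        using big[of t 0 w] big[of t 0 0] by auto
      then show ?thesis using norm_triangle_ineq4[of "th 0 w t" "th 0 0 t"] small(3)[OF t] by linarith
    qed (use C(4)[OF t, of w] small[OF t] in auto)
  qed
qed

text \<open>\<open>psi\<close> is bounded on the unit interval, so \<open>t * th 0 0 t\<close> is
  Lipschitz there and its values along \<open>1 / (n + 1)\<close> form a Cauchy sequence.\<close>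

lemma c0_exists: "\<exists>c. (\<lambda>n. of_real (1 / (real n + 1)) * th 0 0 (1 / (real n + 1))) \<longlonglongrightarrow> c"
proof -
  obtain C where C: "C \<ge> 0" "\<And>t. 0 < t \<Longrightarrow> t \<le> 1 \<Longrightarrow> norm (psi t) \<le> C * t ^ 0"
    by (rule th_rapid_small[of 0]) (rule that; blast)
  define f where "f t = of_real t * th 0 0 t" for t
  have der: "(f has_vector_derivative psi t) (at t within {a..1})" if t: "t \<in> {a..1}" and a: "a > 0" for t a
  proof -
    define g where "g d t = complex_of_real (t * exp (-(t * (cmod d)\<^sup>2)))" for d t
    define g' where "g' d t = (1 - complex_of_real (t * (cmod d)\<^sup>2)) * of_real (exp (-(t * (cmod d)\<^sup>2)))" for d t
    have s0: "(\<lambda>d. complex_of_real (exp (-(t * (cmod d)\<^sup>2)))) summable_on L" if "t > 0" for t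
      using th_summable[OF that, of 0 0] by simp
    have "((\<lambda>t. \<Sum>\<^sub>\<infinity>d\<in>L. g d t) has_derivative (\<lambda>h. \<Sum>\<^sub>\<infinity>d\<in>L. h *\<^sub>R g' d t)) (at t within {a..1})"
    proof (rule has_derivative_infsum[where B = "\<lambda>d. exp (-(a * (cmod d)\<^sup>2)) + (cmod d)\<^sup>2 * exp (-(a * (cmod d)\<^sup>2))"])
      show "(g d has_derivative (\<lambda>h. h *\<^sub>R g' d y)) (at y within {a..1})" for d y
      proof -
        have "((\<lambda>t. t * exp (-(t * (cmod d)\<^sup>2))) has_real_derivative (1 - y * (cmod d)\<^sup>2) * exp (-(y * (cmod d)\<^sup>2))) (at y within {a..1})"
          by (auto intro!: derivative_eq_intros simp: algebra_simps)
        from has_vector_derivative_of_real[OF this]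
        show ?thesis unfolding g_def g'_def has_vector_derivative_def by simp
      qed
      show "norm (h *\<^sub>R g' d y) \<le> (exp (-(a * (cmod d)\<^sup>2)) + (cmod d)\<^sup>2 * exp (-(a * (cmod d)\<^sup>2))) * norm h"
        if y: "y \<in> {a..1}" for d y h
      proof -
        have "norm (g' d y) = \<bar>1 - y * (cmod d)\<^sup>2\<bar> * exp (-(y * (cmod d)\<^sup>2))"
        proof -
          have "g' d y = of_real ((1 - y * (cmod d)\<^sup>2) * exp (-(y * (cmod d)\<^sup>2)))" unfolding g'_def by simp
          then show ?thesis by (simp only: norm_of_real abs_mult abs_exp_cancel)
        qed
        also have "\<dots> \<le> (1 + (cmod d)\<^sup>2) * exp (-(a * (cmod d)\<^sup>2))"
        proof (rule mult_mono)
          have "0 \<le> y * (cmod d)\<^sup>2" "y * (cmod d)\<^sup>2 \<le> 1 * (cmod d)\<^sup>2" using y a mult_right_mono[of y 1 "(cmod d)\<^sup>2"] by auto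
          then show "\<bar>1 - y * (cmod d)\<^sup>2\<bar> \<le> 1 + (cmod d)\<^sup>2" by linarith
        qed (use y in \<open>auto intro!: mult_right_mono\<close>)
        finally have "norm (g' d y) \<le> exp (-(a * (cmod d)\<^sup>2)) + (cmod d)\<^sup>2 * exp (-(a * (cmod d)\<^sup>2))"
          by (simp add: algebra_simps)
        from mult_right_mono[OF this norm_ge_zero[of h]] show ?thesis by (simp add: mult.commute)
      qed
      show "(\<lambda>d. exp (-(a * (cmod d)\<^sup>2)) + (cmod d)\<^sup>2 * exp (-(a * (cmod d)\<^sup>2))) summable_on L"
        using gauss_summable[OF a, of 0 0] gauss_summable[OF a, of 2 0] by (intro summable_on_add) auto
      show "(\<lambda>d. g d y) summable_on L" if "y \<in> {a..1}" for y
        unfolding g_def of_real_mult using that a by (intro summable_on_cmult_right s0) auto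
    qed (use t in auto)
    moreover have "(\<Sum>\<^sub>\<infinity>d\<in>L. g d t) = f t" for t
      unfolding f_def th_def g_def by (simp add: infsum_cmult_right')
    moreover have "(\<Sum>\<^sub>\<infinity>d\<in>L. h *\<^sub>R g' d t) = h *\<^sub>R psi t" for h
      unfolding psi_def g'_def by (rule infsum_scaleR_right)
    ultimately show ?thesis unfolding has_vector_derivative_def by simp
  qed
  have lip: "norm (f x - f y) \<le> C * \<bar>x - y\<bar>" if "0 < x" "x \<le> 1" "0 < y" "y \<le> 1" for x y
  proof -
    have "norm (f x - f y) \<le> C * norm (x - y)"
    proof (rule differentiable_bound[of "{min x y..1}" f "\<lambda>t h. h *\<^sub>R psi t"])
      show "(f has_derivative (\<lambda>h. h *\<^sub>R psi t)) (at t within {min x y..1})" if "t \<in> {min x y..1}" for t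
        using der[OF that] \<open>0 < x\<close> \<open>0 < y\<close> unfolding has_vector_derivative_def by simp
      show "onorm (\<lambda>h. h *\<^sub>R psi t) \<le> C" if "t \<in> {min x y..1}" for t
      proof (rule onorm_bound[OF C(1)])
        have "norm (psi t) \<le> C" using C(2)[of t] that \<open>0 < x\<close> \<open>0 < y\<close> by auto
        from mult_left_mono[OF this abs_ge_zero] show "norm (h *\<^sub>R psi t) \<le> C * norm h" for h :: real
          by (simp add: mult.commute)
      qed
    qed (use that in auto)
    then show ?thesis by simp
  qed
  have "Cauchy (\<lambda>n. f (1 / (real n + 1)))"
  proof (rule metric_CauchyI)
    fix e :: real assume e: "e > 0"
    have "convergent (\<lambda>n. 1 / (real n + 1))"
      by (rule convergentI[of _ 0]) real_asymp
    then have "Cauchy (\<lambda>n. 1 / (real n + 1))" by (rule convergent_Cauchy)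
    then obtain M where M: "\<And>m n. m \<ge> M \<Longrightarrow> n \<ge> M \<Longrightarrow> dist (1 / (real m + 1)) (1 / (real n + 1)) < e / (C + 1)"
      using metric_CauchyD[of _ "e / (C + 1)"] e C(1) by (metis add_nonneg_pos divide_pos_pos zero_less_one)
    show "\<exists>M. \<forall>m\<ge>M. \<forall>n\<ge>M. dist (f (1 / (real m + 1))) (f (1 / (real n + 1))) < e"
    proof (intro exI[of _ M] allI impI)
      fix m n assume mn: "m \<ge> M" "n \<ge> M"
      have "dist (f (1 / (real m + 1))) (f (1 / (real n + 1))) \<le> C * \<bar>1 / (real m + 1) - 1 / (real n + 1)\<bar>"
        unfolding dist_norm by (rule lip) auto
      also have "\<dots> \<le> C * (e / (C + 1))"
        using M[OF mn] C(1) by (intro mult_left_mono) (auto simp: dist_real_def)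
      also have "\<dots> < e" using e C(1) by (simp add: field_simps)
      finally show "dist (f (1 / (real m + 1))) (f (1 / (real n + 1))) < e" .
    qed
  qed
  then show ?thesis unfolding f_def using Cauchy_convergent convergent_def by blast
qed

end

section \<open>Eisenstein--Kronecker numbers as Mellin integrals\<close>

text \<open>The value is the incomplete Gamma function at exponent 2. It tends to
  \<open>1 / q^2\<close> as \<open>e\<close> tends to 0 and decays exponentially in
  \<open>q\<close>, so it is the regularisation of \<open>1 / q^2\<close> belonging to the cutoff at
  \<open>e\<close>.\<close>

lemma has_integral_mult_exp_to_infinity:
  fixes q :: real
  assumes q: "q > 0" and e: "e \<ge> 0"
  shows "((\<lambda>t. t * exp (-(t * q))) has_integral (1 + e * q) * exp (-(e * q)) / q\<^sup>2) {e..}"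
proof (intro has_integral_to_inf integrable_continuous_interval continuous_intros)
  define F where "F t = -((1 + t * q) * exp (-(t * q)) / q\<^sup>2)" for t
  have "((\<lambda>t. t * exp (-(t * q))) has_integral (F y - F e)) {e..y}" if "y \<ge> e" for y
    using that q unfolding F_def
    by (intro fundamental_theorem_of_calculus)
       (auto intro!: derivative_eq_intros simp: field_simps power2_eq_square
             simp flip: has_real_derivative_iff_has_vector_derivative)
  then have "\<forall>\<^sub>F y in at_top. integral {e..y} (\<lambda>t. t * exp (-(t * q))) = F y - F e"
    using eventually_at_top_linorder[of "\<lambda>y. integral {e..y} (\<lambda>t. t * exp (-(t * q))) = F y - F e"] by auto
  moreover have "((\<lambda>y. F y - F e) \<longlongrightarrow> 0 - F e) at_top"
    unfolding F_def using q by (intro tendsto_diff tendsto_const) real_asymp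
  ultimately show "((\<lambda>y. integral {e..y} (\<lambda>t. t * exp (-(t * q)))) \<longlongrightarrow> (1 + e * q) * exp (-(e * q)) / q\<^sup>2) at_top"
    by (simp add: filterlim_cong F_def)
qed (use e in auto)

lemma has_integral_exp_to_infinity':
  fixes q :: real
  assumes q: "q > 0"
  shows "((\<lambda>t. exp (-(t * q))) has_integral exp (-(e * q)) / q) {e..}"
  using has_integral_exp_minus_to_infinity[OF q, of e] by (simp add: mult.commute)

lemma integral_near_zero:
  fixes f :: "real \<Rightarrow> complex"
  assumes f: "f absolutely_integrable_on {0<..}" and e: "e > 0" and C: "C \<ge> 0"
    and bd: "\<And>t. 0 < t \<Longrightarrow> t < e \<Longrightarrow> norm (f t) \<le> C"
  shows "norm (integral {0<..} f - integral {e..} f) \<le> C * e"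
proof -
  have s: "f absolutely_integrable_on {e..}" "f absolutely_integrable_on {0<..<e}"
    using e by (auto intro!: set_integrable_subset[OF f])
  have i: "f integrable_on {0<..<e}" "f integrable_on {e..}"
    using s by (auto simp: absolutely_integrable_on_def)
  have "{0<..<e} \<inter> {e..} = {}" by auto
  then have "(f has_integral (integral {0<..<e} f + integral {e..} f)) ({0<..<e} \<union> {e..})"
    by (intro has_integral_Un) (use i in \<open>auto intro: integrable_integral\<close>)
  moreover have "{0<..<e} \<union> {e..} = {0<..}" using e by auto
  ultimately have "integral {0<..} f = integral {0<..<e} f + integral {e..} f"
    by (metis integral_unique)
  moreover have "norm (integral {0<..<e} f) \<le> C * e"
  proof -
    have "((\<lambda>t. if t \<in> {0<..<e} then f t else 0) has_integral integral {0<..<e} f) {0..e}"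
      using i(1) by (subst has_integral_restrict) (auto intro: integrable_integral)
    then have "((\<lambda>t. if t \<in> {0<..<e} then f t else 0) has_integral integral {0<..<e} f) (cbox 0 e)"
      by simp
    then have "norm (integral {0<..<e} f) \<le> C * measure lborel (cbox 0 e)"
      by (rule has_integral_bound[OF C]) (use bd C in auto)
    then show ?thesis using e by simp
  qed
  ultimately show ?thesis by simp
qed

section \<open>Truncated Mellin integrals as absolutely convergent series\<close>

context theta_data
begin

text \<open>Away from 0 the theta series may be integrated term by term at exponent 1, although the
  sum of \<open>p i / Q i\<close> itself may diverge: the cutoff supplies the convergence factor
  \<open>exp (-(e * Q i))\<close>.\<close>

lemma integral_theta_from:
  assumes e: "e > 0"
  shows "\<Theta> absolutely_integrable_on {e..}"
    and "((\<lambda>i. p i * of_real (exp (-(e * Q i)) / Q i)) has_sum integral {e..} \<Theta>) I"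
proof -
  note h = has_integral_exp_to_infinity'[OF Qpos, of _ e]
  have sm': "(\<lambda>i. cmod (p i) * (exp (- (e * Q i)) / Q i)) summable_on I"
  proof (rule summable_on_comparison_test[OF summable_on_cmult_right[OF norm_exp_summable[OF e], of "1/\<delta>"]])
    fix i assume i: "i \<in> I"
    have "exp (- (e * Q i)) / Q i \<le> exp (- (e * Q i)) / \<delta>"
      using Q[OF i] \<delta> by (intro divide_left_mono) auto
    then have "cmod (p i) * (exp (- (e * Q i)) / Q i) \<le> cmod (p i) * (exp (- (e * Q i)) / \<delta>)"
      by (rule mult_left_mono) simp
    then show "cmod (p i) * (exp (- (e * Q i)) / Q i) \<le> 1/\<delta> * (cmod (p i) * exp (- (e * Q i)))"
      by simp
    show "0 \<le> cmod (p i) * (exp (- (e * Q i)) / Q i)" using Qpos[OF i] less_imp_le by simp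
  qed
  have h': "((\<lambda>t. norm (1::complex) * exp (-(t * Q i))) has_integral exp (-(e * Q i)) / Q i) {e..}" if "i \<in> I" for i
    using h[OF that] by simp
  have S: "{e..} \<subseteq> {0<..}" "{e..} \<in> sets borel" using e by auto
  note sw = theta_integral_swap[OF S continuous_on_const, of 1, OF has_integral_integrable[OF h'] eq_refl[OF integral_unique[OF h']] sm']
  have "integral {e..} (\<lambda>t. complex_of_real (exp (-(t * Q i)))) = of_real (exp (-(e * Q i)) / Q i)" if "i \<in> I" for i
    using integral_unique[OF has_integral_of_real[OF h[OF that]]] .
  then show "\<Theta> absolutely_integrable_on {e..}"
    "((\<lambda>i. p i * of_real (exp (-(e * Q i)) / Q i)) has_sum integral {e..} \<Theta>) I"
    using sw[unfolded mult_1] by (simp_all cong: has_sum_cong)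
qed

lemma integral_t_theta_from:
  assumes e: "e > 0"
  shows "(\<lambda>t. of_real t * \<Theta> t) absolutely_integrable_on {e..}"
    and "((\<lambda>i. p i * of_real ((1 + e * Q i) * exp (-(e * Q i)) / (Q i)\<^sup>2)) has_sum integral {e..} (\<lambda>t. of_real t * \<Theta> t)) I"
proof -
  note h = has_integral_mult_exp_to_infinity[OF Qpos less_imp_le[OF e]]
  have eq: "integral {e..} (\<lambda>t. of_real t * complex_of_real (exp (-(t * Q i)))) = of_real ((1 + e * Q i) * exp (-(e * Q i)) / (Q i)\<^sup>2)" if "i \<in> I" for i
    using integral_unique[OF has_integral_of_real[OF h[OF that]]] unfolding of_real_mult[symmetric] .
  have sm': "(\<lambda>i. cmod (p i) * ((1 + e * Q i) * exp (- (e * Q i)) / (Q i)\<^sup>2)) summable_on I"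
  proof (rule summable_on_comparison_test[OF summable_on_cmult_right[OF norm_exp_summable[OF e], of "1/\<delta>\<^sup>2 + e/\<delta>"]])
    fix i assume i: "i \<in> I"
    have "(1 + e * Q i) / (Q i)\<^sup>2 = 1 / (Q i)\<^sup>2 + e / Q i"
      using Qpos[OF i] by (simp add: field_simps power2_eq_square)
    also have "\<dots> \<le> 1/\<delta>\<^sup>2 + e/\<delta>"
      using Q[OF i] \<delta> e by (intro add_mono divide_left_mono power_mono) auto
    finally have "(1 + e * Q i) / (Q i)\<^sup>2 * (cmod (p i) * exp (- (e * Q i))) \<le> (1/\<delta>\<^sup>2 + e/\<delta>) * (cmod (p i) * exp (- (e * Q i)))"
      by (rule mult_right_mono) simp
    then show "cmod (p i) * ((1 + e * Q i) * exp (- (e * Q i)) / (Q i)\<^sup>2) \<le> (1/\<delta>\<^sup>2 + e/\<delta>) * (cmod (p i) * exp (- (e * Q i)))"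
      by (simp add: mult_ac)
    show "0 \<le> cmod (p i) * ((1 + e * Q i) * exp (- (e * Q i)) / (Q i)\<^sup>2)" using Qpos[OF i] e by simp
  qed
  have h': "((\<lambda>t. cmod (complex_of_real t) * exp (- (t * Q i))) has_integral (1 + e * Q i) * exp (- (e * Q i)) / (Q i)\<^sup>2) {e..}" if "i \<in> I" for i
    by (rule has_integral_eq[OF _ h[OF that]]) (use e in auto)
  have S: "{e..} \<subseteq> {0<..}" "{e..} \<in> sets borel" using e by auto
  have c: "continuous_on {e..} complex_of_real" by (intro continuous_intros)
  note sw = theta_integral_swap[OF S c has_integral_integrable[OF h'] eq_refl[OF integral_unique[OF h']] sm']
  show "(\<lambda>t. of_real t * \<Theta> t) absolutely_integrable_on {e..}" using sw(1) .
  show "((\<lambda>i. p i * of_real ((1 + e * Q i) * exp (-(e * Q i)) / (Q i)\<^sup>2)) has_sum integral {e..} (\<lambda>t. of_real t * \<Theta> t)) I"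
    using sw(2) eq by (simp cong: has_sum_cong)
qed

end

lemma (in theta_rapid) theta_int0: "\<Theta> absolutely_integrable_on {0<..}"
  by (rule set_integrable_cong[THEN iffD1, OF refl refl _ powr_theta_integrable[of 0]]) auto

lemma (in theta_rapid) theta_int1: "(\<lambda>t. of_real t * \<Theta> t) absolutely_integrable_on {0<..}"
  by (rule set_integrable_cong[THEN iffD1, OF refl refl _ powr_theta_integrable[of 1]]) auto

text \<open>The function is \<open>rGamma s * mellin s\<close>. The points 1 and 2 are singled out
  because the continued values of G_1, of G_2 and of the form sit there; \<open>rGamma\<close>
  equals 1 at both.\<close>

lemma (in theta_rapid) mellin_entire:
  "\<exists>f. f holomorphic_on UNIV \<and>
    (\<forall>s. Re s > 0 \<longrightarrow> (\<lambda>i. norm (p i) * Q i powr (- Re s)) summable_on I \<longrightarrow>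
        f s = (\<Sum>\<^sub>\<infinity>i\<in>I. p i * of_real (Q i) powr (-s))) \<and>
    f 1 = integral {0<..} \<Theta> \<and> f 2 = integral {0<..} (\<lambda>t. of_real t * \<Theta> t)"
proof (intro exI[of _ "\<lambda>s. rGamma s * mellin s"] conjI allI impI)
  show "(\<lambda>s. rGamma s * mellin s) holomorphic_on UNIV"
    by (intro holomorphic_intros mellin_holomorphic) 
  show "rGamma 1 * mellin 1 = integral {0<..} \<Theta>" by (simp add: mellin_1)
  have "rGamma (2::complex) = 1" using rGamma_plus1[of "1::complex"] by simp
  then show "rGamma 2 * mellin 2 = integral {0<..} (\<lambda>t. of_real t * \<Theta> t)" by (simp add: mellin_2)
qed (use mellin_eq in auto)

section \<open>Rank two series: the numbers G_1 and G_2\<close>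

context lattice
begin

definition Ish where "Ish z = {l \<in> L. z + l \<noteq> 0}"

lemma rank2_summable:
  assumes s: "\<sigma> > 1 + real k / 2"
  shows "(\<lambda>l. norm (cnj (z + l) ^ k) * ((cmod (z + l))\<^sup>2) powr (-\<sigma>)) summable_on Ish z"
proof -
  obtain \<mu> where \<mu>: "\<mu> > 0" "\<And>l. l \<in> L \<Longrightarrow> z + l \<noteq> 0 \<Longrightarrow> cmod (z + l) \<ge> \<mu>" by (rule min_norm[of z]) (rule that; blast)
  define \<beta> where "\<beta> = \<sigma> - real k / 2"
  have \<beta>: "\<beta> > 1" using s by (simp add: \<beta>_def)
  \<comment> \<open>From \<open>r \<ge> \<mu>\<close> follows \<open>1 + r^2 \<le> M * r^2\<close>,
    which allows comparison with the sums of \<open>summable_powr_shift\<close>.\<close>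
  define M where "M = 1 + 1/\<mu>\<^sup>2"
  have M: "M > 0" unfolding M_def by (simp add: add_pos_nonneg)
  have "(\<lambda>l. M powr \<beta> * (1 + (cmod (z + l))\<^sup>2) powr (-\<beta>)) summable_on Ish z"
    by (rule summable_on_subset_banach[OF summable_on_cmult_right[OF summable_powr_shift[OF \<beta>]]]) (auto simp: Ish_def)
  then show ?thesis
  proof (rule summable_on_comparison_test)
    fix l assume l: "l \<in> Ish z"
    define r where "r = cmod (z + l)"
    have r: "r \<ge> \<mu>" "r > 0" using l \<mu> by (auto simp: Ish_def r_def)
    have "norm (cnj (z + l) ^ k) * ((cmod (z + l))\<^sup>2) powr (-\<sigma>) = r ^ k * (r\<^sup>2) powr (-\<sigma>)"
      by (simp add: r_def norm_power del: complex_cnj_add)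
    also have "\<dots> = (r\<^sup>2) powr (-\<beta>)"
    proof -
      have "r ^ k = (r\<^sup>2) powr (real k / 2)" using r by (simp add: powr_powr powr_realpow flip: powr_numeral)
      then show ?thesis by (simp add: \<beta>_def flip: powr_add)
    qed
    also have "\<dots> \<le> ((1 + r\<^sup>2) / M) powr (-\<beta>)"
    proof (rule powr_mono2')
      have "1 \<le> r\<^sup>2 / \<mu>\<^sup>2" using r \<mu> power_mono[of \<mu> r 2] by (simp add: field_simps)
      then have "1 + r\<^sup>2 \<le> M * r\<^sup>2" by (simp add: M_def algebra_simps)
      then show "(1 + r\<^sup>2) / M \<le> r\<^sup>2" using M by (simp add: field_simps)
    qed (use \<beta> M in \<open>auto simp: add_pos_nonneg\<close>)
    also have "\<dots> = M powr \<beta> * (1 + r\<^sup>2) powr (-\<beta>)"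
      using M by (simp add: powr_divide powr_minus divide_simps add_pos_nonneg)
    finally show "norm (cnj (z + l) ^ k) * ((cmod (z + l))\<^sup>2) powr (-\<sigma>) \<le> M powr \<beta> * (1 + (cmod (z + l))\<^sup>2) powr (-\<beta>)"
      by (simp add: r_def)
  qed auto
qed

text \<open>The omitted term has \<open>z + l = 0\<close> and numerator \<open>0 ^ k\<close>, which
  vanishes because \<open>k \<ge> 1\<close>.\<close>

lemma rank2_theta:
  assumes k: "1 \<le> k" "k \<le> 2"
  shows "thsum (Ish z) (\<lambda>l. cnj (z + l) ^ k) (\<lambda>l. (cmod (z + l))\<^sup>2) t = th k z t"
  unfolding thsum_def th_def
  by (rule infsum_cong_neutral) (use k in \<open>auto simp: Ish_def simp del: complex_cnj_add\<close>)

lemma rank2_data: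
  assumes k: "k \<le> 2"
  obtains \<delta> where "theta_data (Ish z) (\<lambda>l. cnj (z + l) ^ k) (\<lambda>l. (cmod (z + l))\<^sup>2) \<delta> 3"
proof -
  obtain \<mu> where \<mu>: "\<mu> > 0" "\<And>l. l \<in> L \<Longrightarrow> z + l \<noteq> 0 \<Longrightarrow> cmod (z + l) \<ge> \<mu>" by (rule min_norm[of z]) (rule that; blast)
  show ?thesis
  proof (rule that[of "\<mu>\<^sup>2"], unfold_locales)
    show "countable (Ish z)" unfolding Ish_def using countable_L by (rule countable_subset[rotated]) auto
    show "(cmod (z + l))\<^sup>2 \<ge> \<mu>\<^sup>2" if "l \<in> Ish z" for l
      using that \<mu> by (intro power_mono) (auto simp: Ish_def)
    show "(\<lambda>l. cmod (cnj (z + l) ^ k) * ((cmod (z + l))\<^sup>2) powr - 3) summable_on Ish z"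
      by (rule rank2_summable) (use k in auto)
  qed (use \<mu> in auto)
qed

lemma rank2_rapid:
  assumes k: "k = 1 \<or> k = 2"
  obtains \<delta> where "theta_rapid (Ish z) (\<lambda>l. cnj (z + l) ^ k) (\<lambda>l. (cmod (z + l))\<^sup>2) \<delta> 3"
proof -
  have k2: "1 \<le> k" "k \<le> 2" using k by auto
  obtain \<delta> where "theta_data (Ish z) (\<lambda>l. cnj (z + l) ^ k) (\<lambda>l. (cmod (z + l))\<^sup>2) \<delta> 3"
    by (rule rank2_data[OF k2(2)])
  moreover have "\<exists>C. \<forall>t. 0 < t \<and> t \<le> 1 \<longrightarrow> norm (th k z t) \<le> C * t ^ N" for N
  proof -
    obtain C where "\<And>w t. 0 < t \<Longrightarrow> norm (th 1 w t) \<le> C * t ^ N" "\<And>w t. 0 < t \<Longrightarrow> norm (th 2 w t) \<le> C * t ^ N"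
      by (rule th_rapid[of N]) (rule that; blast)
    then show ?thesis using k by blast
  qed
  ultimately show ?thesis
    by (intro that[of \<delta>]) (simp add: theta_rapid_def theta_rapid_axioms_def rank2_theta[OF k2] del: complex_cnj_add)
qed

lemma th_integrable:
  assumes k: "k = 1 \<or> k = 2"
  shows "th k z absolutely_integrable_on {0<..}" "(\<lambda>t. of_real t * th k z t) absolutely_integrable_on {0<..}"
    "continuous_on {0<..} (th k z)"
proof -
  have k2: "1 \<le> k" "k \<le> 2" using k by auto
  obtain \<delta> where r: "theta_rapid (Ish z) (\<lambda>l. cnj (z + l) ^ k) (\<lambda>l. (cmod (z + l))\<^sup>2) \<delta> 3"
    by (rule rank2_rapid[OF k])
  interpret theta_rapid "Ish z" "\<lambda>l. cnj (z + l) ^ k" "\<lambda>l. (cmod (z + l))\<^sup>2" \<delta> 3 by (rule r)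
  have "\<Theta> = th k z" using rank2_theta[OF k2] by blast
  then show "th k z absolutely_integrable_on {0<..}" "(\<lambda>t. of_real t * th k z t) absolutely_integrable_on {0<..}"
    "continuous_on {0<..} (th k z)"
    using theta_int0 theta_int1 theta_continuous by simp_all
qed

text \<open>Multiplying numerator and denominator by \<open>cnj (z + d) ^ k\<close> turns the term
  into \<open>cnj (z + d) ^ k\<close> times the power \<open>-(k + l/2)\<close> of the squared
  modulus. So \<open>l = 0\<close> corresponds to the exponent \<open>s = k\<close> of the Mellin
  transform.\<close>

lemma Gser_eq:
  assumes k: "k = 1 \<or> k = 2"
  shows "Gser k z L = integral {0<..} (\<lambda>t. of_real t ^ (k - 1) * th k z t)"
proof -
  have k2: "1 \<le> k" "k \<le> 2" using k by auto
  obtain \<delta> where r: "theta_rapid (Ish z) (\<lambda>l. cnj (z + l) ^ k) (\<lambda>l. (cmod (z + l))\<^sup>2) \<delta> 3"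
    by (rule rank2_rapid[OF k])
  interpret theta_rapid "Ish z" "\<lambda>l. cnj (z + l) ^ k" "\<lambda>l. (cmod (z + l))\<^sup>2" \<delta> 3 by (rule r)
  have Th: "\<Theta> = th k z" using rank2_theta[OF k2] by blast
  obtain f where f: "f holomorphic_on UNIV"
    "\<And>s. Re s > 0 \<Longrightarrow> (\<lambda>l. norm (cnj (z + l) ^ k) * ((cmod (z + l))\<^sup>2) powr (- Re s)) summable_on Ish z \<Longrightarrow>
        f s = (\<Sum>\<^sub>\<infinity>l\<in>Ish z. cnj (z + l) ^ k * of_real ((cmod (z + l))\<^sup>2) powr (-s))"
    "f 1 = integral {0<..} \<Theta>" "f 2 = integral {0<..} (\<lambda>t. of_real t * \<Theta> t)"
    using mellin_entire by blast
  have "Gser k z L = f (of_nat k + 0 / 2)"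
    unfolding Gser_def
  proof (rule acont0_eqI[where f = "\<lambda>l. f (of_nat k + l / 2)"])
    show "(\<lambda>l. f (of_nat k + l / 2)) holomorphic_on UNIV"
    proof -
      have "(f \<circ> (\<lambda>l. of_nat k + l / 2)) holomorphic_on UNIV"
        by (rule holomorphic_on_compose) (auto intro!: holomorphic_intros intro: holomorphic_on_subset[OF f(1)])
      then show ?thesis by (simp add: o_def)
    qed
    fix l :: complex assume l: "2 - real k < Re l"
    have re: "Re (of_nat k + l / 2) = real k + Re l / 2" by simp
    have "f (of_nat k + l / 2) = (\<Sum>\<^sub>\<infinity>d\<in>Ish z. cnj (z + d) ^ k * of_real ((cmod (z + d))\<^sup>2) powr (-(of_nat k + l / 2)))"
    proof (rule f(2))
      show "Re (of_nat k + l / 2) > 0" using l k2 unfolding re by (auto simp: field_simps)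
      show "(\<lambda>d. cmod (cnj (z + d) ^ k) * ((cmod (z + d))\<^sup>2) powr - Re (of_nat k + l / 2)) summable_on Ish z"
        unfolding re by (rule rank2_summable) (use l in \<open>auto simp: field_simps\<close>)
    qed
    also have "\<dots> = (\<Sum>\<^sub>\<infinity>d\<in>Ish z. inverse ((z + d) ^ k) * complex_of_real (cmod (z + d)) powr (- l))"
    proof (rule infsum_cong)
      fix d assume "d \<in> Ish z"
      then have nz: "z + d \<noteq> 0" by (simp add: Ish_def)
      define w where "w = z + d"
      have w: "w \<noteq> 0" using nz by (simp add: w_def)
      define r where "r = cmod w"
      have r: "r > 0" using w by (simp add: r_def)
      have "complex_of_real (r\<^sup>2) powr (-(of_nat k + l / 2)) = exp (-(of_nat k + l / 2) * (2 * of_real (ln r)))"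
        using r by (simp add: powr_def Ln_of_real ln_realpow flip: of_real_power)
      also have "\<dots> = exp (- (of_nat k * (2 * of_real (ln r)))) * exp (- l * of_real (ln r))"
        by (subst exp_add[symmetric]) (rule arg_cong[where f = exp], simp add: algebra_simps)
      also have "exp (- l * of_real (ln r)) = of_real r powr (- l)"
        using r by (simp add: powr_def Ln_of_real)
      also have "exp (- (of_nat k * (2 * complex_of_real (ln r)))) = inverse ((complex_of_real r)\<^sup>2 ^ k)"
        using r by (simp add: exp_minus exp_of_nat_mult exp_double exp_of_real)
      also have "(complex_of_real r)\<^sup>2 = w * cnj w" unfolding r_def using complex_norm_square[of w] by simp
      finally have "complex_of_real (r\<^sup>2) powr (-(of_nat k + l / 2)) = inverse (w ^ k * cnj w ^ k) * of_real r powr (- l)"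
        by (simp add: power_mult_distrib)
      then have "cnj w ^ k * complex_of_real (r\<^sup>2) powr (-(of_nat k + l / 2)) = inverse (w ^ k) * of_real r powr (- l)"
        using w by (simp add: field_simps)
      then show "cnj (z + d) ^ k * of_real ((cmod (z + d))\<^sup>2) powr (-(of_nat k + l / 2))
        = inverse ((z + d) ^ k) * complex_of_real (cmod (z + d)) powr (- l)"
        unfolding w_def r_def .
    qed
    finally show "f (of_nat k + l / 2) = (\<Sum>\<^sub>\<infinity>d\<in>{d \<in> L. z + d \<noteq> 0}. inverse ((z + d) ^ k) * complex_of_real (cmod (z + d)) powr (- l))"
      unfolding Ish_def .
  qed
  then show ?thesis using k f(3,4) unfolding Th by auto
qed

lemma Gser1: "Gser 1 z L = integral {0<..} (th 1 z)"
  using Gser_eq[of 1 z] by simp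

lemma G2_eq: "G2 L = integral {0<..} (\<lambda>t. of_real t * th 2 0 t)"
  using Gser_eq[of 2 0] by (simp add: G2_def)

end

section \<open>Theta series attached to pairs of lattice elements\<close>

lemma has_sum_diff':
  fixes f g :: "'i \<Rightarrow> complex"
  assumes "(f has_sum a) I" "(g has_sum b) I"
  shows "((\<lambda>i. f i - g i) has_sum (a - b)) I"
  using has_sum_add[OF assms(1) has_sum_cmult_right[OF assms(2), of "-1"]] by simp

context lattice
begin

lemma summable_exp_weight:
  assumes "\<tau> > 0"
  shows "(\<lambda>x. (1 + (cmod x)\<^sup>2) * exp (-(\<tau> * (cmod x)\<^sup>2))) summable_on L"
  using summable_on_add[OF gauss_summable[OF assms, of 0 0] gauss_summable[OF assms, of 2 0]]
  by (simp add: algebra_simps)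

lemma infsum_exp_weight:
  obtains C where "C \<ge> 0" "\<And>\<tau>. \<tau> > 0 \<Longrightarrow> (\<Sum>\<^sub>\<infinity>x\<in>L. (1 + (cmod x)\<^sup>2) * exp (-(\<tau> * (cmod x)\<^sup>2))) \<le> C * (1 + 1/\<tau>) ^ 3"
proof -
  obtain C0 where C0: "C0 \<ge> 0" "\<And>w t j. t > 0 \<Longrightarrow> j \<le> 2 \<Longrightarrow>
     (\<Sum>\<^sub>\<infinity>d\<in>L. cmod (w + d) ^ j * exp (-(t * (cmod (w + d))\<^sup>2))) \<le> C0 * (1 + 1/t) ^ 3"
    by (rule gauss_moment) (rule that; blast)
  show ?thesis
  proof (rule that[of "2 * C0"])
    fix \<tau> :: real assume t: "\<tau> > 0"
    have "(\<Sum>\<^sub>\<infinity>x\<in>L. (1 + (cmod x)\<^sup>2) * exp (-(\<tau> * (cmod x)\<^sup>2)))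
       = (\<Sum>\<^sub>\<infinity>x\<in>L. cmod (0 + x) ^ 0 * exp (-(\<tau> * (cmod (0 + x))\<^sup>2))) + (\<Sum>\<^sub>\<infinity>x\<in>L. cmod (0 + x) ^ 2 * exp (-(\<tau> * (cmod (0 + x))\<^sup>2)))"
      by (subst infsum_add[symmetric]) (use gauss_summable[OF t, of 0 0] gauss_summable[OF t, of 2 0] in \<open>auto simp: algebra_simps\<close>)
    also have "\<dots> \<le> C0 * (1 + 1/\<tau>) ^ 3 + C0 * (1 + 1/\<tau>) ^ 3"
      by (intro add_mono C0 t) auto
    finally show "(\<Sum>\<^sub>\<infinity>x\<in>L. (1 + (cmod x)\<^sup>2) * exp (-(\<tau> * (cmod x)\<^sup>2))) \<le> 2 * C0 * (1 + 1/\<tau>) ^ 3" by simp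
  qed (use C0 in auto)
qed

text \<open>The part of \<open>exp (-(t * Q))\<close> that depends on \<open>x\<close> alone. The
  other part is a Gaussian in \<open>y\<close> with base point \<open>x * z\<close>, and its sum
  over \<open>y\<close> is a value of \<open>th\<close>.\<close>

definition wt :: "complex \<Rightarrow> real \<Rightarrow> real \<Rightarrow> complex" where
  "wt x v t = of_real (exp (-(t * (cmod x * v)\<^sup>2)))"

lemma norm_wt: "norm (wt x v t) = exp (-(t * (cmod x * v)\<^sup>2))"
  by (simp add: wt_def)

lemma norm_wt_le:
  assumes "0 < va" "va \<le> v" "t > 0"
  shows "norm (wt x v t) \<le> exp (-(t * va\<^sup>2 * (cmod x)\<^sup>2))"
proof -
  have "va\<^sup>2 \<le> v\<^sup>2" using assms by (intro power_mono) auto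
  then have "t * (va\<^sup>2 * (cmod x)\<^sup>2) \<le> t * (v\<^sup>2 * (cmod x)\<^sup>2)" using assms by (intro mult_left_mono mult_right_mono) auto
  then show ?thesis unfolding norm_wt by (simp add: power_mult_distrib mult_ac)
qed

text \<open>The majorant involves only the lower bound \<open>va\<close> of the height, and
  coefficients may grow quadratically in \<open>x\<close>; the Gaussian in \<open>x\<close> absorbs
  both.\<close>

lemma wt_sum:
  assumes v: "0 < va" "va \<le> v" and t: "t > 0" and S: "S \<subseteq> L" and G: "G \<ge> 0"
    and g: "\<And>x. x \<in> S \<Longrightarrow> norm (g x) \<le> G * (1 + (cmod x)\<^sup>2)"
  shows "(\<lambda>x. wt x v t * g x) summable_on S"
    and "norm (\<Sum>\<^sub>\<infinity>x\<in>S. wt x v t * g x) \<le> G * (\<Sum>\<^sub>\<infinity>x\<in>L. (1 + (cmod x)\<^sup>2) * exp (-(t * va\<^sup>2 * (cmod x)\<^sup>2)))"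
proof -
  have t': "t * va\<^sup>2 > 0" using v t by simp
  note s = summable_exp_weight[OF t']
  have sS: "(\<lambda>x. G * ((1 + (cmod x)\<^sup>2) * exp (-(t * va\<^sup>2 * (cmod x)\<^sup>2)))) summable_on S"
    using summable_on_subset_banach[OF s S] by (rule summable_on_cmult_right)
  have le: "norm (wt x v t * g x) \<le> G * ((1 + (cmod x)\<^sup>2) * exp (-(t * va\<^sup>2 * (cmod x)\<^sup>2)))" if "x \<in> S" for x
    using mult_mono[OF g[OF that] norm_wt_le[OF v t, of x]] G by (simp add: norm_mult mult_ac)
  show *: "(\<lambda>x. wt x v t * g x) summable_on S"
    unfolding summable_on_iff_abs_summable_on_complex
    by (rule Infinite_Sum.abs_summable_on_comparison_test'[OF sS le])
  have "norm (\<Sum>\<^sub>\<infinity>x\<in>S. wt x v t * g x) \<le> (\<Sum>\<^sub>\<infinity>x\<in>S. G * ((1 + (cmod x)\<^sup>2) * exp (-(t * va\<^sup>2 * (cmod x)\<^sup>2))))"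
    using * sS le by (intro norm_infsum_le[OF has_sum_infsum has_sum_infsum])
  also have "\<dots> \<le> (\<Sum>\<^sub>\<infinity>x\<in>L. G * ((1 + (cmod x)\<^sup>2) * exp (-(t * va\<^sup>2 * (cmod x)\<^sup>2))))"
    using sS s S G by (intro infsum_mono_neutral) (auto intro!: summable_on_cmult_right)
  also have "\<dots> = G * (\<Sum>\<^sub>\<infinity>x\<in>L. (1 + (cmod x)\<^sup>2) * exp (-(t * va\<^sup>2 * (cmod x)\<^sup>2)))"
    by (rule infsum_cmult_right) (use s in auto)
  finally show "norm (\<Sum>\<^sub>\<infinity>x\<in>S. wt x v t * g x) \<le> G * (\<Sum>\<^sub>\<infinity>x\<in>L. (1 + (cmod x)\<^sup>2) * exp (-(t * va\<^sup>2 * (cmod x)\<^sup>2)))" .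
qed

lemma exp_eta_den:
  "complex_of_real (exp (-(t * eta_den (z, v) x y))) = wt x v t * of_real (exp (-(t * (cmod (x * z + y))\<^sup>2)))"
  by (simp add: wt_def eta_den_def algebra_simps power_mult_distrib flip: of_real_mult exp_add)

text \<open>Fubini for the rank four sums. The inner sum over \<open>y\<close> is
  \<open>th k (x * z) t\<close>, so the decay proved in rank two enters the rank four series
  uniformly in \<open>x\<close>.\<close>

lemma iter_sum:
  assumes v: "v > 0" and t: "t > 0" and S: "S \<subseteq> L" and G: "G \<ge> 0" and k: "k \<le> 2"
    and a: "\<And>x. x \<in> S \<Longrightarrow> norm (a x) \<le> G * (1 + (cmod x)\<^sup>2)"
  shows "((\<lambda>(x, y). a x * cnj (x * z + y) ^ k * of_real (exp (-(t * eta_den (z, v) x y)))) has_sum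
           (\<Sum>\<^sub>\<infinity>x\<in>S. wt x v t * (a x * th k (x * z) t))) (S \<times> L)"
proof -
  define F where "F = (\<lambda>(x, y). a x * cnj (x * z + y) ^ k * complex_of_real (exp (-(t * eta_den (z, v) x y))))"
  have Feq: "F (x, y) = wt x v t * a x * (cnj (x * z + y) ^ k * of_real (exp (-(t * (cmod (x * z + y))\<^sup>2))))" for x y
    unfolding F_def exp_eta_den by simp
  obtain C0 where C0: "C0 \<ge> 0" "\<And>w t j. t > 0 \<Longrightarrow> j \<le> 2 \<Longrightarrow>
     (\<Sum>\<^sub>\<infinity>d\<in>L. cmod (w + d) ^ j * exp (-(t * (cmod (w + d))\<^sup>2))) \<le> C0 * (1 + 1/t) ^ 3"
    by (rule gauss_moment) (rule that; blast)
  have gs: "(\<lambda>d. cmod (w + d) ^ k * exp (-(t * (cmod (w + d))\<^sup>2))) summable_on L" for w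
    by (rule gauss_summable[OF t k])
  have "(\<lambda>p. norm (F p)) summable_on S \<times> L"
  proof (rule summable_on_SigmaI[where g = "\<lambda>x. norm (wt x v t * a x) * (\<Sum>\<^sub>\<infinity>d\<in>L. cmod (x * z + d) ^ k * exp (-(t * (cmod (x * z + d))\<^sup>2)))"])
    fix x
    show "((\<lambda>y. norm (F (x, y))) has_sum norm (wt x v t * a x) * (\<Sum>\<^sub>\<infinity>d\<in>L. cmod (x * z + d) ^ k * exp (-(t * (cmod (x * z + d))\<^sup>2)))) L"
      using has_sum_cmult_right[OF has_sum_infsum[OF gs[of "x * z"]], of "norm (wt x v t * a x)"]
      unfolding Feq by (simp add: norm_mult norm_power del: complex_cnj_add)
  next
    define c where "c = C0 * (1 + 1/t) ^ 3"
    have c: "c \<ge> 0" unfolding c_def using C0(1) t by simp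
    have "(\<lambda>x. wt x v t * (a x * of_real c)) summable_on S"
    proof (rule wt_sum(1)[OF v order_refl t S, of "G * c"])
      show "cmod (a x * complex_of_real c) \<le> G * c * (1 + (cmod x)\<^sup>2)" if "x \<in> S" for x
        using mult_right_mono[OF a[OF that] c] c by (simp add: norm_mult mult_ac)
    qed (use G c in auto)
    then have "(\<lambda>x. norm (wt x v t * a x) * c) summable_on S"
      unfolding summable_on_iff_abs_summable_on_complex norm_mult norm_of_real mult.assoc
      using c by simp
    then have "(\<lambda>x. norm (wt x v t * a x) * (C0 * (1 + 1/t) ^ 3)) summable_on S" unfolding c_def .
    then show "(\<lambda>x. norm (wt x v t * a x) * (\<Sum>\<^sub>\<infinity>d\<in>L. cmod (x * z + d) ^ k * exp (-(t * (cmod (x * z + d))\<^sup>2)))) summable_on S"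
      by (rule summable_on_comparison_test)
         (use C0(2)[OF t k] in \<open>auto intro!: mult_left_mono infsum_nonneg mult_nonneg_nonneg\<close>)
  qed auto
  then have Fs: "F summable_on S \<times> L" by (simp add: summable_on_iff_abs_summable_on_complex)
  have "infsum F (S \<times> L) = (\<Sum>\<^sub>\<infinity>x\<in>S. \<Sum>\<^sub>\<infinity>y\<in>L. F (x, y))"
    using infsum_Sigma_banach[OF Fs] by simp
  also have "\<dots> = (\<Sum>\<^sub>\<infinity>x\<in>S. wt x v t * (a x * th k (x * z) t))"
    unfolding Feq th_def by (simp only: infsum_cmult_right' mult.assoc)
  finally show ?thesis using has_sum_infsum[OF Fs] unfolding F_def by simp
qed

text \<open>\<open>I4\<close> indexes the Eisenstein series. \<open>J\<close> keeps the pairs with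
  nonzero first entry, for which the formal primitive with its division by \<open>x\<close> makes
  sense.\<close>

definition J where "J = (L - {0}) \<times> L"
definition I4 where "I4 = L \<times> L - {(0, 0)}"

text \<open>\<open>Pf u \<alpha> \<beta> \<gamma>\<close> collects the numerators of the three coefficients of \<open>\<eta>\<close>.\<close>

definition Pf :: "complex \<times> real \<Rightarrow> complex \<Rightarrow> complex \<Rightarrow> complex \<Rightarrow> complex \<times> complex \<Rightarrow> complex" where
  "Pf u \<alpha> \<beta> \<gamma> p = \<alpha> * (cnj (fst p * fst u + snd p))\<^sup>2 - \<beta> * (cnj (fst p) * of_real (snd u))\<^sup>2
     + \<gamma> * (2 * cnj (fst p * fst u + snd p) * cnj (fst p) * of_real (snd u))"

definition Qf :: "complex \<times> real \<Rightarrow> complex \<times> complex \<Rightarrow> real" where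
  "Qf u p = eta_den u (fst p) (snd p)"

definition ThJ :: "complex \<times> real \<Rightarrow> complex \<Rightarrow> complex \<Rightarrow> complex \<Rightarrow> real \<Rightarrow> complex" where
  "ThJ u \<alpha> \<beta> \<gamma> = thsum J (Pf u \<alpha> \<beta> \<gamma>) (Qf u)"

lemma Qf_alt: "Qf (z, v) (x, y) = (cmod (x * z + y))\<^sup>2 + (cmod x * v)\<^sup>2"
  by (simp add: Qf_def eta_den_def power_mult_distrib)

text \<open>The numerators are quadratic in \<open>w = x * z + y\<close> and \<open>x * v\<close>,
  and \<open>Qf\<close> is the sum of their squared moduli; the mixed term is covered by the
  inequality between 2ab and the sum of squares.\<close>

lemma norm_Pf:
  assumes "v > 0"
  shows "norm (Pf (z, v) \<alpha> \<beta> \<gamma> (x, y)) \<le> (cmod \<alpha> + cmod \<beta> + cmod \<gamma>) * Qf (z, v) (x, y)"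
proof -
  define w where "w = x * z + y"
  define q where "q = Qf (z, v) (x, y)"
  have q: "q = (cmod w)\<^sup>2 + (cmod x * v)\<^sup>2" by (simp add: q_def Qf_alt w_def)
  have 1: "(cmod w)\<^sup>2 \<le> q" "(cmod x * v)\<^sup>2 \<le> q" unfolding q by auto
  have 2: "2 * cmod w * (cmod x * v) \<le> q" unfolding q using sum_squares_bound[of "cmod w" "cmod x * v"] by simp
  have "norm (Pf (z, v) \<alpha> \<beta> \<gamma> (x, y)) \<le> norm (\<alpha> * (cnj w)\<^sup>2) + norm (\<beta> * (cnj x * of_real v)\<^sup>2) + norm (\<gamma> * (2 * cnj w * cnj x * of_real v))"
    unfolding Pf_def fst_conv snd_conv w_def[symmetric]
    using norm_triangle_ineq[of "\<alpha> * (cnj w)\<^sup>2 - \<beta> * (cnj x * of_real v)\<^sup>2" "\<gamma> * (2 * cnj w * cnj x * of_real v)"]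
      norm_triangle_ineq4[of "\<alpha> * (cnj w)\<^sup>2" "\<beta> * (cnj x * of_real v)\<^sup>2"] by linarith
  also have "\<dots> = cmod \<alpha> * (cmod w)\<^sup>2 + cmod \<beta> * (cmod x * v)\<^sup>2 + cmod \<gamma> * (2 * cmod w * (cmod x * v))"
    using assms by (simp add: norm_mult norm_power mult_ac)
  also have "\<dots> \<le> cmod \<alpha> * q + cmod \<beta> * q + cmod \<gamma> * q"
    using 1 2 by (intro add_mono mult_left_mono) auto
  finally show ?thesis by (simp add: q_def algebra_simps)
qed

text \<open>\<open>cmod x * v\<close> controls \<open>x\<close>, and then \<open>y\<close> is
  controlled as the difference of \<open>x * z + y\<close> and \<open>x * z\<close>. The constant
  depends only on bounds for \<open>v\<close> and \<open>z\<close>, as local domination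
  requires.\<close>

lemma Qf_lower:
  assumes "0 < va" "va \<le> v" "cmod z \<le> R"
  shows "(cmod x)\<^sup>2 + (cmod y)\<^sup>2 \<le> (1/va\<^sup>2 + (1 + R/va)\<^sup>2) * Qf (z, v) (x, y)"
proof -
  define q where "q = Qf (z, v) (x, y)"
  have q: "q = (cmod (x * z + y))\<^sup>2 + (cmod x * v)\<^sup>2" by (simp add: q_def Qf_alt)
  have q0: "q \<ge> 0" unfolding q by simp
  have "cmod x * va \<le> cmod x * v" using assms by (intro mult_left_mono) auto
  also have "cmod x * v \<le> sqrt q" unfolding q by (rule real_le_rsqrt) simp
  finally have x: "cmod x \<le> sqrt q / va" using assms by (simp add: field_simps)
  have "cmod y \<le> cmod (x * z + y) + cmod x * cmod z"
    using norm_triangle_ineq4[of "x * z + y" "x * z"] by (simp add: norm_mult)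
  also have "cmod (x * z + y) \<le> sqrt q" unfolding q by (rule real_le_rsqrt) simp
  also have "cmod x * cmod z \<le> sqrt q / va * R" using x assms by (intro mult_mono) (auto intro: order_trans[OF norm_ge_zero])
  finally have y: "cmod y \<le> (1 + R/va) * sqrt q" by (simp add: algebra_simps)
  have "(cmod x)\<^sup>2 + (cmod y)\<^sup>2 \<le> (sqrt q / va)\<^sup>2 + ((1 + R/va) * sqrt q)\<^sup>2"
    using x y by (intro add_mono power_mono) auto
  also have "\<dots> = (1/va\<^sup>2 + (1 + R/va)\<^sup>2) * q"
    by (simp only: power_mult_distrib power_divide real_sqrt_pow2[OF q0]) (simp add: algebra_simps)
  finally show ?thesis by (simp add: q_def)
qed

lemma L_min: obtains \<mu> where "\<mu> > 0" "\<And>x. x \<in> L \<Longrightarrow> x \<noteq> 0 \<Longrightarrow> cmod x \<ge> \<mu>"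
proof -
  obtain \<mu> where "\<mu> > 0" "\<And>l. l \<in> L \<Longrightarrow> 0 + l \<noteq> 0 \<Longrightarrow> cmod (0 + l) \<ge> \<mu>"
    by (rule min_norm[of 0]) (rule that; blast)
  then show ?thesis by (intro that[of \<mu>]) auto
qed

lemma Qf_powr_summable:
  assumes v: "v > 0" and \<beta>: "\<beta> > 2"
  shows "(\<lambda>p. Qf (z, v) p powr (-\<beta>)) summable_on I4"
    and "\<exists>\<delta>>0. \<forall>p\<in>I4. \<delta> \<le> Qf (z, v) p"
proof -
  obtain \<mu> where \<mu>: "\<mu> > 0" "\<And>x. x \<in> L \<Longrightarrow> x \<noteq> 0 \<Longrightarrow> cmod x \<ge> \<mu>" by (rule L_min) (rule that; blast)
  define M where "M = 1/v\<^sup>2 + (1 + cmod z/v)\<^sup>2"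
  have M: "M > 0" unfolding M_def using v by (intro add_pos_nonneg) auto
  have low: "(cmod x)\<^sup>2 + (cmod y)\<^sup>2 \<le> M * Qf (z, v) (x, y)" for x y
    unfolding M_def by (rule Qf_lower[OF v]) auto
  have mu: "\<mu>\<^sup>2 \<le> (cmod x)\<^sup>2 + (cmod y)\<^sup>2" if "(x, y) \<in> I4" for x y
  proof -
    have "x \<in> L" "y \<in> L" "x \<noteq> 0 \<or> y \<noteq> 0" using that by (auto simp: I4_def)
    then have "\<mu>\<^sup>2 \<le> (cmod x)\<^sup>2 \<or> \<mu>\<^sup>2 \<le> (cmod y)\<^sup>2" using \<mu> by (meson less_imp_le power_mono)
    then show ?thesis by (auto intro: add_increasing add_increasing2)
  qed
  show "\<exists>\<delta>>0. \<forall>p\<in>I4. \<delta> \<le> Qf (z, v) p"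
  proof (intro exI[of _ "\<mu>\<^sup>2 / M"] conjI ballI)
    fix p assume p: "p \<in> I4"
    obtain x y where xy: "p = (x, y)" by force
    show "\<mu>\<^sup>2 / M \<le> Qf (z, v) p" using order_trans[OF mu low, of x y] p M by (simp add: xy field_simps)
  qed (use \<mu> M in auto)
  define M' where "M' = M * (1 + 1/\<mu>\<^sup>2)"
  have M': "M' > 0" unfolding M'_def using M by (intro mult_pos_pos add_pos_nonneg) auto
  have "(\<lambda>p. M' powr \<beta> * (case p of (x, y) \<Rightarrow> (1 + (cmod x)\<^sup>2 + (cmod y)\<^sup>2) powr (-\<beta>))) summable_on I4"
    by (rule summable_on_subset_banach[OF summable_on_cmult_right[OF summable_powr4[OF \<beta>]]]) (auto simp: I4_def)
  then show "(\<lambda>p. Qf (z, v) p powr (-\<beta>)) summable_on I4"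
  proof (rule summable_on_comparison_test)
    fix p assume p: "p \<in> I4"
    obtain x y where xy: "p = (x, y)" by force
    define s where "s = (cmod x)\<^sup>2 + (cmod y)\<^sup>2"
    have "1 \<le> s / \<mu>\<^sup>2" using mu[of x y] p xy \<mu> by (simp add: s_def field_simps)
    then have "1 + s \<le> (1 + 1/\<mu>\<^sup>2) * s" by (simp add: algebra_simps)
    also have "\<dots> \<le> (1 + 1/\<mu>\<^sup>2) * (M * Qf (z, v) p)"
      unfolding s_def xy by (intro mult_left_mono low) (simp add: add_nonneg_nonneg)
    finally have "(1 + s) / M' \<le> Qf (z, v) p" using M' by (simp add: M'_def field_simps)
    moreover have s0: "s \<ge> 0" by (simp add: s_def)
    ultimately have "Qf (z, v) p powr (-\<beta>) \<le> ((1 + s) / M') powr (-\<beta>)"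
      using M' \<beta> by (intro powr_mono2') auto
    also have "\<dots> = M' powr \<beta> * (1 + s) powr (-\<beta>)"
      using M' s0 by (simp add: powr_divide powr_minus divide_simps)
    finally show "Qf (z, v) p powr (-\<beta>) \<le> M' powr \<beta> * (case p of (x, y) \<Rightarrow> (1 + (cmod x)\<^sup>2 + (cmod y)\<^sup>2) powr (-\<beta>))"
      by (simp add: xy s_def add.assoc)
  qed auto
qed

lemma countable_I4: "countable I4"
  unfolding I4_def by (intro countable_Diff countable_SIGMA countable_L)

lemma J_sub: "J \<subseteq> I4" by (auto simp: J_def I4_def)

text \<open>\<open>Pf\<close> is at most of the size of \<open>Qf\<close>, so one unit of the
  exponent is lost against the rank four bound 2.\<close>

lemma Pf_summable:
  assumes v: "v > 0" and \<sigma>: "\<sigma> > 3"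
  shows "(\<lambda>p. norm (Pf (z, v) \<alpha> \<beta> \<gamma> p) * Qf (z, v) p powr (-\<sigma>)) summable_on I4"
proof -
  have \<sigma>2: "\<sigma> - 1 > 2" using \<sigma> by simp
  obtain \<delta> where \<delta>: "\<delta> > 0" "\<And>p. p \<in> I4 \<Longrightarrow> \<delta> \<le> Qf (z, v) p"
    using Qf_powr_summable(2)[OF v \<sigma>2, of z] by blast
  show ?thesis
  proof (rule summable_on_comparison_test[OF summable_on_cmult_right[OF Qf_powr_summable(1)[OF v \<sigma>2], of "cmod \<alpha> + cmod \<beta> + cmod \<gamma>"]])
    fix p assume p: "p \<in> I4"
    have q: "Qf (z, v) p > 0" using \<delta>(1) \<delta>(2)[OF p] by linarith
    have "norm (Pf (z, v) \<alpha> \<beta> \<gamma> p) \<le> (cmod \<alpha> + cmod \<beta> + cmod \<gamma>) * Qf (z, v) p"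
      using norm_Pf[OF v] by (metis surj_pair)
    then have "norm (Pf (z, v) \<alpha> \<beta> \<gamma> p) * Qf (z, v) p powr (-\<sigma>) \<le> (cmod \<alpha> + cmod \<beta> + cmod \<gamma>) * Qf (z, v) p * Qf (z, v) p powr (-\<sigma>)"
      by (rule mult_right_mono) simp
    also have "\<dots> = (cmod \<alpha> + cmod \<beta> + cmod \<gamma>) * (Qf (z, v) p powr 1 * Qf (z, v) p powr (-\<sigma>))" using q by simp
    also have "Qf (z, v) p powr 1 * Qf (z, v) p powr (-\<sigma>) = Qf (z, v) p powr (-(\<sigma> - 1))" by (subst powr_add[symmetric]) simp
    finally show "norm (Pf (z, v) \<alpha> \<beta> \<gamma> p) * Qf (z, v) p powr (-\<sigma>) \<le> (cmod \<alpha> + cmod \<beta> + cmod \<gamma>) * Qf (z, v) p powr (-(\<sigma> - 1))" .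
  qed auto
qed

lemma Pf_data:
  assumes v: "v > 0" and S: "S \<subseteq> I4"
  obtains \<delta> where "theta_data S (Pf (z, v) \<alpha> \<beta> \<gamma>) (Qf (z, v)) \<delta> 4"
proof -
  obtain \<delta> where \<delta>: "\<delta> > 0" "\<And>p. p \<in> I4 \<Longrightarrow> \<delta> \<le> Qf (z, v) p"
    using Qf_powr_summable(2)[OF v, of 3 z] by auto
  show ?thesis
  proof (rule that[of \<delta>], unfold_locales)
    show "countable S" using countable_I4 S by (rule countable_subset[rotated])
    show "(\<lambda>i. cmod (Pf (z, v) \<alpha> \<beta> \<gamma> i) * Qf (z, v) i powr - 4) summable_on S"
      by (rule summable_on_subset_banach[OF Pf_summable[OF v] S]) auto
  qed (use \<delta> S in auto)
qed

text \<open>\<open>th 0\<close> does not decay at \<open>t = 0\<close>, but its deviation from the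
  base point 0 does. The part split off factors into \<open>th 0 0 t\<close> and a sum of
  \<open>(cnj x)^2\<close> against a Gaussian in \<open>x\<close>, which is
  \<open>th 2 0 (t * v^2)\<close> and hence rapidly decaying as well.\<close>

lemma ThJ_eq:
  assumes v: "v > 0" and t: "t > 0"
  shows "ThJ (z, v) \<alpha> \<beta> \<gamma> t = (\<Sum>\<^sub>\<infinity>x\<in>L-{0}. wt x v t * (\<alpha> * th 2 (x * z) t
      + 2 * \<gamma> * cnj x * of_real v * th 1 (x * z) t - \<beta> * (cnj x * of_real v)\<^sup>2 * (th 0 (x * z) t - th 0 0 t)))
      - \<beta> * (of_real v)\<^sup>2 * th 0 0 t * th 2 0 (t * v\<^sup>2)"
proof -
  define E where "E p = complex_of_real (exp (-(t * Qf (z, v) p)))" for p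
  have sub: "L - {0} \<subseteq> L" by auto
  have ax: "cmod x \<le> 1 + (cmod x)\<^sup>2" for x
    using sum_squares_bound[of 1 "cmod x"] by (simp add: power2_eq_square) (smt (verit) norm_ge_zero)
  have h2: "((\<lambda>(x, y). \<alpha> * cnj (x * z + y) ^ 2 * of_real (exp (-(t * eta_den (z, v) x y)))) has_sum
           (\<Sum>\<^sub>\<infinity>x\<in>L-{0}. wt x v t * (\<alpha> * th 2 (x * z) t))) J"
    unfolding J_def by (rule iter_sum[OF v t sub, of "cmod \<alpha>"]) (auto simp: mult_le_cancel_left1)
  have h1: "((\<lambda>(x, y). 2 * \<gamma> * cnj x * of_real v * cnj (x * z + y) ^ 1 * of_real (exp (-(t * eta_den (z, v) x y)))) has_sum
           (\<Sum>\<^sub>\<infinity>x\<in>L-{0}. wt x v t * (2 * \<gamma> * cnj x * of_real v * th 1 (x * z) t))) J"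
    unfolding J_def
  proof (rule iter_sum[OF v t sub, of "2 * cmod \<gamma> * v"])
    fix x show "cmod (2 * \<gamma> * cnj x * complex_of_real v) \<le> 2 * cmod \<gamma> * v * (1 + (cmod x)\<^sup>2)"
      using mult_left_mono[OF ax[of x], of "2 * cmod \<gamma> * v"] v by (simp add: norm_mult mult_ac)
  qed (use v in auto)
  have b0: "cmod (\<beta> * (cnj x * complex_of_real v)\<^sup>2) \<le> cmod \<beta> * v\<^sup>2 * (1 + (cmod x)\<^sup>2)" for x
    using v by (simp add: norm_mult norm_power power_mult_distrib algebra_simps)
  have h0: "((\<lambda>(x, y). \<beta> * (cnj x * of_real v)\<^sup>2 * cnj (x * z + y) ^ 0 * of_real (exp (-(t * eta_den (z, v) x y)))) has_sum
           (\<Sum>\<^sub>\<infinity>x\<in>L-{0}. wt x v t * (\<beta> * (cnj x * of_real v)\<^sup>2 * th 0 (x * z) t))) J"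
    unfolding J_def by (rule iter_sum[OF v t sub, of "cmod \<beta> * v\<^sup>2"]) (use b0 in auto)
  have "((\<lambda>p. Pf (z, v) \<alpha> \<beta> \<gamma> p * E p) has_sum
      ((\<Sum>\<^sub>\<infinity>x\<in>L-{0}. wt x v t * (\<alpha> * th 2 (x * z) t)) + (\<Sum>\<^sub>\<infinity>x\<in>L-{0}. wt x v t * (2 * \<gamma> * cnj x * of_real v * th 1 (x * z) t))
       - (\<Sum>\<^sub>\<infinity>x\<in>L-{0}. wt x v t * (\<beta> * (cnj x * of_real v)\<^sup>2 * th 0 (x * z) t)))) J"
  proof (rule has_sum_cong[THEN iffD1, OF _ has_sum_diff'[OF has_sum_add[OF h2 h1] h0]])
    fix p assume "p \<in> J"
    show "(case p of (x, y) \<Rightarrow> \<alpha> * cnj (x * z + y) ^ 2 * of_real (exp (-(t * eta_den (z, v) x y))))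
     + (case p of (x, y) \<Rightarrow> 2 * \<gamma> * cnj x * of_real v * cnj (x * z + y) ^ 1 * of_real (exp (-(t * eta_den (z, v) x y))))
     - (case p of (x, y) \<Rightarrow> \<beta> * (cnj x * of_real v)\<^sup>2 * cnj (x * z + y) ^ 0 * of_real (exp (-(t * eta_den (z, v) x y))))
     = Pf (z, v) \<alpha> \<beta> \<gamma> p * E p"
      by (cases p) (simp add: Pf_def E_def Qf_def algebra_simps del: complex_cnj_add)
  qed
  then have T1: "ThJ (z, v) \<alpha> \<beta> \<gamma> t = (\<Sum>\<^sub>\<infinity>x\<in>L-{0}. wt x v t * (\<alpha> * th 2 (x * z) t)) + (\<Sum>\<^sub>\<infinity>x\<in>L-{0}. wt x v t * (2 * \<gamma> * cnj x * of_real v * th 1 (x * z) t))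
       - (\<Sum>\<^sub>\<infinity>x\<in>L-{0}. wt x v t * (\<beta> * (cnj x * of_real v)\<^sup>2 * th 0 (x * z) t))"
    unfolding ThJ_def thsum_def E_def by (rule infsumI)
  obtain C where C: "C \<ge> 0"
    "\<And>w t. 0 < t \<Longrightarrow> norm (th 1 w t) \<le> C * t ^ 0"
    "\<And>w t. 0 < t \<Longrightarrow> norm (th 2 w t) \<le> C * t ^ 0"
    "\<And>w t. 0 < t \<Longrightarrow> norm (th 0 w t - th 0 0 t) \<le> C * t ^ 0"
    by (rule th_rapid[of 0]) (rule that; blast)
  note C' = C(2-4)[OF t, simplified]
  have s2: "(\<lambda>x. wt x v t * (\<alpha> * th 2 (x * z) t)) summable_on L-{0}"
  proof (rule wt_sum(1)[OF v order_refl t sub, of "cmod \<alpha> * C"])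
    show "cmod (\<alpha> * th 2 (x * z) t) \<le> cmod \<alpha> * C * (1 + (cmod x)\<^sup>2)" for x
    proof -
      have "cmod (\<alpha> * th 2 (x * z) t) \<le> cmod \<alpha> * C * 1" using C'(2)[of "x * z"] by (simp add: norm_mult mult_left_mono)
      also have "\<dots> \<le> cmod \<alpha> * C * (1 + (cmod x)\<^sup>2)" using C(1) by (intro mult_left_mono) auto
      finally show ?thesis .
    qed
  qed (use C in auto)
  have s1: "(\<lambda>x. wt x v t * (2 * \<gamma> * cnj x * of_real v * th 1 (x * z) t)) summable_on L-{0}"
  proof (rule wt_sum(1)[OF v order_refl t sub, of "2 * cmod \<gamma> * v * C"])
    show "cmod (2 * \<gamma> * cnj x * complex_of_real v * th 1 (x * z) t) \<le> 2 * cmod \<gamma> * v * C * (1 + (cmod x)\<^sup>2)" for x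
    proof -
      have "cmod (2 * \<gamma> * cnj x * complex_of_real v * th 1 (x * z) t) = (2 * cmod \<gamma> * v) * (cmod (th 1 (x * z) t) * cmod x)"
        using v by (simp add: norm_mult mult_ac)
      also have "\<dots> \<le> (2 * cmod \<gamma> * v) * (C * (1 + (cmod x)\<^sup>2))"
        using C'(1)[of "x * z"] ax[of x] C(1) v by (intro mult_left_mono mult_mono) auto
      finally show ?thesis by (simp add: mult_ac)
    qed
  qed (use C v in auto)
  have s0: "(\<lambda>x. wt x v t * (\<beta> * (cnj x * of_real v)\<^sup>2 * (th 0 (x * z) t - th 0 0 t))) summable_on L-{0}"
  proof (rule wt_sum(1)[OF v order_refl t sub, of "cmod \<beta> * v\<^sup>2 * C"])
    show "cmod (\<beta> * (cnj x * of_real v)\<^sup>2 * (th 0 (x * z) t - th 0 0 t)) \<le> cmod \<beta> * v\<^sup>2 * C * (1 + (cmod x)\<^sup>2)" for x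
      using mult_mono[OF b0[of x] C'(3)[of "x * z"]] C(1) by (simp add: norm_mult mult_ac)
  qed (use C v in auto)
  have s00: "(\<lambda>x. wt x v t * (\<beta> * (cnj x * of_real v)\<^sup>2)) summable_on L-{0}"
    by (rule wt_sum(1)[OF v order_refl t sub, of "cmod \<beta> * v\<^sup>2"]) (use b0 in auto)
  have "(\<Sum>\<^sub>\<infinity>x\<in>L-{0}. wt x v t * (\<beta> * (cnj x * of_real v)\<^sup>2 * th 0 (x * z) t))
      = (\<Sum>\<^sub>\<infinity>x\<in>L-{0}. wt x v t * (\<beta> * (cnj x * of_real v)\<^sup>2 * (th 0 (x * z) t - th 0 0 t)) + wt x v t * (\<beta> * (cnj x * of_real v)\<^sup>2) * th 0 0 t)"
    by (intro infsum_cong) (simp add: algebra_simps)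
  also have "\<dots> = (\<Sum>\<^sub>\<infinity>x\<in>L-{0}. wt x v t * (\<beta> * (cnj x * of_real v)\<^sup>2 * (th 0 (x * z) t - th 0 0 t))) + (\<Sum>\<^sub>\<infinity>x\<in>L-{0}. wt x v t * (\<beta> * (cnj x * of_real v)\<^sup>2)) * th 0 0 t"
    by (simp add: infsum_add[OF s0 summable_on_cmult_left[OF s00]] infsum_cmult_left')
  also have "(\<Sum>\<^sub>\<infinity>x\<in>L-{0}. wt x v t * (\<beta> * (cnj x * of_real v)\<^sup>2)) = \<beta> * (of_real v)\<^sup>2 * th 2 0 (t * v\<^sup>2)"
  proof -
    have "th 2 0 (t * v\<^sup>2) = (\<Sum>\<^sub>\<infinity>x\<in>L-{0}. cnj x ^ 2 * wt x v t)"
      unfolding th_def wt_def by (rule infsum_cong_neutral) (auto simp: power_mult_distrib mult_ac)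
    then show ?thesis by (simp add: infsum_cmult_right'[symmetric] power_mult_distrib mult_ac)
  qed
  finally have T2: "(\<Sum>\<^sub>\<infinity>x\<in>L-{0}. wt x v t * (\<beta> * (cnj x * of_real v)\<^sup>2 * th 0 (x * z) t))
     = (\<Sum>\<^sub>\<infinity>x\<in>L-{0}. wt x v t * (\<beta> * (cnj x * of_real v)\<^sup>2 * (th 0 (x * z) t - th 0 0 t))) + \<beta> * (of_real v)\<^sup>2 * th 2 0 (t * v\<^sup>2) * th 0 0 t" .
  have T3: "(\<Sum>\<^sub>\<infinity>x\<in>L-{0}. wt x v t * (\<alpha> * th 2 (x * z) t
      + 2 * \<gamma> * cnj x * of_real v * th 1 (x * z) t - \<beta> * (cnj x * of_real v)\<^sup>2 * (th 0 (x * z) t - th 0 0 t)))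
    = (\<Sum>\<^sub>\<infinity>x\<in>L-{0}. wt x v t * (\<alpha> * th 2 (x * z) t)) + (\<Sum>\<^sub>\<infinity>x\<in>L-{0}. wt x v t * (2 * \<gamma> * cnj x * of_real v * th 1 (x * z) t))
       - (\<Sum>\<^sub>\<infinity>x\<in>L-{0}. wt x v t * (\<beta> * (cnj x * of_real v)\<^sup>2 * (th 0 (x * z) t - th 0 0 t)))"
    by (simp only: right_diff_distrib[of "wt _ _ _"] distrib_left[of "wt _ _ _"] infsum_diff'[OF summable_on_add[OF s2 s1] s0] infsum_add[OF s2 s1])
  show ?thesis unfolding T1 T2 T3 by (simp add: mult_ac)
qed

text \<open>Each contribution in \<open>ThJ_eq\<close> is a rapidly decaying factor times a quantity
  of order \<open>1 / t ^ 3\<close>. The bound is linear in the tangent vector and uniform in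
  \<open>z\<close> and on \<open>va \<le> v \<le> vb\<close>, which is the uniformity needed to
  differentiate the limit.\<close>

lemma ThJ_rapid:
  assumes va: "0 < va"
  obtains C where "C \<ge> 0"
    "\<And>z v \<alpha> \<beta> \<gamma> t. va \<le> v \<Longrightarrow> v \<le> vb \<Longrightarrow> 0 < t \<Longrightarrow> t \<le> 1 \<Longrightarrow> norm (ThJ (z, v) \<alpha> \<beta> \<gamma> t) \<le> C * (cmod \<alpha> + cmod \<beta> + cmod \<gamma>) * t ^ N"
proof -
  \<comment> \<open>The three extra powers pay for the sum over \<open>x\<close> in one contribution
    and for \<open>th 0 0 t\<close> in the other.\<close>
  define n where "n = N + 3"
  obtain C where C: "C \<ge> 0"
    "\<And>w t. 0 < t \<Longrightarrow> norm (th 1 w t) \<le> C * t ^ n"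
    "\<And>w t. 0 < t \<Longrightarrow> norm (th 2 w t) \<le> C * t ^ n"
    "\<And>w t. 0 < t \<Longrightarrow> norm (th 0 w t - th 0 0 t) \<le> C * t ^ n"
    by (rule th_rapid[of n]) (rule that; blast)
  obtain Cw where Cw: "Cw \<ge> 0" "\<And>\<tau>. \<tau> > 0 \<Longrightarrow> (\<Sum>\<^sub>\<infinity>x\<in>L. (1 + (cmod x)\<^sup>2) * exp (-(\<tau> * (cmod x)\<^sup>2))) \<le> Cw * (1 + 1/\<tau>) ^ 3"
    by (rule infsum_exp_weight) (rule that; blast)
  obtain C0 where C0: "C0 \<ge> 0" "\<And>w t j. t > 0 \<Longrightarrow> j \<le> 2 \<Longrightarrow>
     (\<Sum>\<^sub>\<infinity>d\<in>L. cmod (w + d) ^ j * exp (-(t * (cmod (w + d))\<^sup>2))) \<le> C0 * (1 + 1/t) ^ 3"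
    by (rule gauss_moment) (rule that; blast)
  define V where "V = 1 + 2 * \<bar>vb\<bar> + vb\<^sup>2"
  define K where "K = V * C * (Cw * (1 + 1/va\<^sup>2) ^ 3) + vb\<^sup>2 * (C0 * 8) * (C * (vb\<^sup>2) ^ n)"
  have V: "V \<ge> 0" "1 \<le> V" "vb\<^sup>2 \<le> V" "2 * \<bar>vb\<bar> \<le> V" by (auto simp: V_def)
  have ax: "cmod x \<le> 1 + (cmod x)\<^sup>2" for x
    using sum_squares_bound[of 1 "cmod x"] by (simp add: power2_eq_square) (smt (verit) norm_ge_zero)
  show ?thesis
  proof (rule that[of K])
    show "K \<ge> 0" unfolding K_def using C C0 Cw V by (intro add_nonneg_nonneg mult_nonneg_nonneg) auto
    fix z v \<alpha> \<beta> \<gamma> t assume v: "va \<le> v" "v \<le> vb" and t: "0 < (t::real)" "t \<le> 1"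
    have v0: "v > 0" "vb > 0" using v va by auto
    define s where "s = cmod \<alpha> + cmod \<beta> + cmod \<gamma>"
    have s: "s \<ge> 0" "cmod \<alpha> \<le> s" "cmod \<beta> \<le> s" "cmod \<gamma> \<le> s" by (auto simp: s_def)
    have v2: "v\<^sup>2 \<le> vb\<^sup>2" using v v0 by (intro power_mono) auto
    define g where "g x = \<alpha> * th 2 (x * z) t
      + 2 * \<gamma> * cnj x * of_real v * th 1 (x * z) t - \<beta> * (cnj x * of_real v)\<^sup>2 * (th 0 (x * z) t - th 0 0 t)" for x
    have g: "norm (g x) \<le> (s * V * C * t ^ n) * (1 + (cmod x)\<^sup>2)" for x
    proof -
      have "norm (g x) \<le> norm (\<alpha> * th 2 (x * z) t) + norm (2 * \<gamma> * cnj x * of_real v * th 1 (x * z) t) + norm (\<beta> * (cnj x * of_real v)\<^sup>2 * (th 0 (x * z) t - th 0 0 t))"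
        unfolding g_def
        using norm_triangle_ineq4[of "\<alpha> * th 2 (x * z) t + 2 * \<gamma> * cnj x * of_real v * th 1 (x * z) t" "\<beta> * (cnj x * of_real v)\<^sup>2 * (th 0 (x * z) t - th 0 0 t)"]
          norm_triangle_ineq[of "\<alpha> * th 2 (x * z) t" "2 * \<gamma> * cnj x * of_real v * th 1 (x * z) t"] by linarith
      also have "\<dots> = cmod \<alpha> * cmod (th 2 (x * z) t) + cmod \<gamma> * (2 * v * cmod x * cmod (th 1 (x * z) t)) + cmod \<beta> * (v\<^sup>2 * (cmod x)\<^sup>2 * cmod (th 0 (x * z) t - th 0 0 t))"
        using v0 by (simp add: norm_mult norm_power power_mult_distrib mult_ac)
      also have "\<dots> \<le> cmod \<alpha> * (V * (1 + (cmod x)\<^sup>2) * (C * t ^ n)) + cmod \<gamma> * (V * (1 + (cmod x)\<^sup>2) * (C * t ^ n)) + cmod \<beta> * (V * (1 + (cmod x)\<^sup>2) * (C * t ^ n))"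
      proof (intro add_mono mult_left_mono)
        have "1 * cmod (th 2 (x * z) t) \<le> (V * (1 + (cmod x)\<^sup>2)) * (C * t ^ n)"
          using V C t mult_mono[of 1 V 1 "1 + (cmod x)\<^sup>2"] by (intro mult_mono C(3)) auto
        then show "cmod (th 2 (x * z) t) \<le> V * (1 + (cmod x)\<^sup>2) * (C * t ^ n)" by simp
        show "2 * v * cmod x * cmod (th 1 (x * z) t) \<le> V * (1 + (cmod x)\<^sup>2) * (C * t ^ n)"
          using V C t v v0 ax by (intro mult_mono C(2)) auto
        show "v\<^sup>2 * (cmod x)\<^sup>2 * cmod (th 0 (x * z) t - th 0 0 t) \<le> V * (1 + (cmod x)\<^sup>2) * (C * t ^ n)"
        proof (rule mult_mono[OF mult_mono C(4)[OF t(1)]])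
          show "v\<^sup>2 \<le> V" using v2 V(3) by linarith
        qed (use V in auto)
      qed auto
      also have "\<dots> = (s * V * C * t ^ n) * (1 + (cmod x)\<^sup>2)" by (simp add: s_def algebra_simps)
      finally show ?thesis .
    qed
    have tn: "t ^ n * (1 / t ^ 3) = t ^ N" using t by (simp add: n_def power_add)
    have A: "norm (\<Sum>\<^sub>\<infinity>x\<in>L-{0}. wt x v t * g x) \<le> s * (V * C * (Cw * (1 + 1/va\<^sup>2) ^ 3)) * t ^ N"
    proof -
      have "norm (\<Sum>\<^sub>\<infinity>x\<in>L-{0}. wt x v t * g x) \<le> (s * V * C * t ^ n) * (\<Sum>\<^sub>\<infinity>x\<in>L. (1 + (cmod x)\<^sup>2) * exp (-(t * va\<^sup>2 * (cmod x)\<^sup>2)))"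
        using s V C t by (intro wt_sum(2)[OF va v(1) t(1)] g) auto
      also have "\<dots> \<le> (s * V * C * t ^ n) * (Cw * ((1 + 1/va\<^sup>2) / t) ^ 3)"
      proof (rule mult_left_mono)
        have "(\<Sum>\<^sub>\<infinity>x\<in>L. (1 + (cmod x)\<^sup>2) * exp (-(t * va\<^sup>2 * (cmod x)\<^sup>2))) \<le> Cw * (1 + 1/(t * va\<^sup>2)) ^ 3"
          using va t by (intro Cw(2)) auto
        also have "\<dots> \<le> Cw * ((1 + 1/va\<^sup>2) / t) ^ 3"
          using va t Cw(1) by (intro mult_left_mono power_mono) (auto simp: field_simps)
        finally show "(\<Sum>\<^sub>\<infinity>x\<in>L. (1 + (cmod x)\<^sup>2) * exp (-(t * va\<^sup>2 * (cmod x)\<^sup>2))) \<le> Cw * ((1 + 1/va\<^sup>2) / t) ^ 3" .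
      qed (use s V C t in auto)
      also have "\<dots> = s * (V * C * (Cw * (1 + 1/va\<^sup>2) ^ 3)) * (t ^ n * (1 / t ^ 3))"
        by (simp add: power_divide)
      finally show ?thesis unfolding tn .
    qed
    have B: "norm (\<beta> * (of_real v)\<^sup>2 * th 0 0 t * th 2 0 (t * v\<^sup>2)) \<le> s * (vb\<^sup>2 * (C0 * 8) * (C * (vb\<^sup>2) ^ n)) * t ^ N"
    proof -
      have "norm (th 0 0 t) \<le> C0 * (1 + 1/t) ^ 3"
        using norm_th_le[OF t(1), of 0 0] C0(2)[OF t(1), of 0 0] by simp
      also have "\<dots> \<le> C0 * (2/t) ^ 3" using C0 t by (intro mult_left_mono power_mono) (auto simp: field_simps)
      finally have 1: "norm (th 0 0 t) \<le> C0 * 8 * (1 / t ^ 3)" by (simp add: power_divide)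
      have "norm (th 2 0 (t * v\<^sup>2)) \<le> C * (t * v\<^sup>2) ^ n" using t v0 by (intro C) auto
      also have "\<dots> \<le> C * (t * vb\<^sup>2) ^ n" using C t v2 mult_left_mono[OF v2, of t] by (intro mult_left_mono power_mono[of "t * v\<^sup>2"]) auto
      finally have 2: "norm (th 2 0 (t * v\<^sup>2)) \<le> C * (vb\<^sup>2) ^ n * t ^ n" by (simp add: power_mult_distrib mult_ac)
      have "norm (\<beta> * (of_real v)\<^sup>2 * th 0 0 t * th 2 0 (t * v\<^sup>2)) = cmod \<beta> * v\<^sup>2 * norm (th 0 0 t) * norm (th 2 0 (t * v\<^sup>2))"
        by (simp add: norm_mult norm_power)
      also have "\<dots> \<le> s * vb\<^sup>2 * (C0 * 8 * (1 / t ^ 3)) * (C * (vb\<^sup>2) ^ n * t ^ n)"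
        using s v2 1 2 C0 t by (intro mult_mono) auto
      also have "\<dots> = s * (vb\<^sup>2 * (C0 * 8) * (C * (vb\<^sup>2) ^ n)) * (t ^ n * (1 / t ^ 3))" by simp
      finally show ?thesis unfolding tn .
    qed
    have "norm (ThJ (z, v) \<alpha> \<beta> \<gamma> t) \<le> norm (\<Sum>\<^sub>\<infinity>x\<in>L-{0}. wt x v t * g x) + norm (\<beta> * (of_real v)\<^sup>2 * th 0 0 t * th 2 0 (t * v\<^sup>2))"
      unfolding ThJ_eq[OF v0(1) t(1)] g_def by (rule norm_triangle_ineq4)
    also have "\<dots> \<le> s * (V * C * (Cw * (1 + 1/va\<^sup>2) ^ 3)) * t ^ N + s * (vb\<^sup>2 * (C0 * 8) * (C * (vb\<^sup>2) ^ n)) * t ^ N"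
      by (rule add_mono[OF A B])
    also have "\<dots> = K * s * t ^ N" by (simp add: K_def algebra_simps)
    finally show "norm (ThJ (z, v) \<alpha> \<beta> \<gamma> t) \<le> K * (cmod \<alpha> + cmod \<beta> + cmod \<gamma>) * t ^ N" by (simp add: s_def)
  qed
qed

text \<open>Formally the sum of \<open>Mf u p / Qf u p\<close> over \<open>p\<close> is a primitive of the part of the Eisenstein form coming
  from \<open>J\<close>; \<open>Mth\<close> is the theta series that makes sense of this conditionally convergent sum.\<close>

definition Mf :: "complex \<times> real \<Rightarrow> complex \<times> complex \<Rightarrow> complex" where
  "Mf u p = - (1 / fst p) * cnj (fst p * fst u + snd p)"

definition Mth :: "complex \<times> real \<Rightarrow> real \<Rightarrow> complex" where
  "Mth u = thsum J (Mf u) (Qf u)"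

definition H0 :: "complex \<times> real \<Rightarrow> complex" where
  "H0 u = integral {0<..} (Mth u)"

lemma L0_sub: "L - {0} \<subseteq> L" by auto

lemma Mth_eq:
  assumes v: "v > 0" and t: "t > 0"
  shows "Mth (z, v) t = (\<Sum>\<^sub>\<infinity>x\<in>L-{0}. wt x v t * (- (1/x) * th 1 (x * z) t))"
proof -
  obtain \<mu> where \<mu>: "\<mu> > 0" "\<And>x. x \<in> L \<Longrightarrow> x \<noteq> 0 \<Longrightarrow> cmod x \<ge> \<mu>" by (rule L_min) (rule that; blast)
  have "((\<lambda>(x, y). - (1/x) * cnj (x * z + y) ^ 1 * of_real (exp (-(t * eta_den (z, v) x y)))) has_sum
           (\<Sum>\<^sub>\<infinity>x\<in>L-{0}. wt x v t * (- (1/x) * th 1 (x * z) t))) J"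
    unfolding J_def
  proof (rule iter_sum[OF v t L0_sub, of "1/\<mu>"])
    fix x assume "x \<in> L - {0}"
    then have "1 / cmod x \<le> 1/\<mu>" using \<mu> by (intro divide_left_mono) auto
    also have "\<dots> \<le> 1/\<mu> * (1 + (cmod x)\<^sup>2)" using \<mu>(1) by (simp add: field_simps)
    finally show "cmod (- (1/x)) \<le> 1/\<mu> * (1 + (cmod x)\<^sup>2)" by (simp add: norm_divide)
  qed (use \<mu> in auto)
  from infsumI[OF this] show ?thesis
    unfolding Mth_def thsum_def Mf_def Qf_def by (simp add: case_prod_unfold)
qed

lemma Mf_data:
  assumes v: "v > 0"
  obtains \<delta> where "theta_data J (Mf (z, v)) (Qf (z, v)) \<delta> 4"
proof -
  obtain \<mu> where \<mu>: "\<mu> > 0" "\<And>x. x \<in> L \<Longrightarrow> x \<noteq> 0 \<Longrightarrow> cmod x \<ge> \<mu>" by (rule L_min) (rule that; blast)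
  obtain \<delta> where \<delta>: "\<delta> > 0" "\<And>p. p \<in> I4 \<Longrightarrow> \<delta> \<le> Qf (z, v) p"
    using Qf_powr_summable(2)[OF v, of 3 z] by auto
  show ?thesis
  proof (rule that[of \<delta>], unfold_locales)
    show "countable J" using countable_I4 J_sub by (rule countable_subset[rotated])
    have "(\<lambda>p. 1/\<mu> * (1 / sqrt \<delta>) * Qf (z, v) p powr (-3)) summable_on J"
      by (rule summable_on_subset_banach[OF summable_on_cmult_right[OF Qf_powr_summable(1)[OF v]] J_sub]) auto
    then show "(\<lambda>p. cmod (Mf (z, v) p) * Qf (z, v) p powr - 4) summable_on J"
    proof (rule summable_on_comparison_test)
      fix p assume p: "p \<in> J"
      obtain x y where xy: "p = (x, y)" by force
      define q where "q = Qf (z, v) p"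
      have q: "q \<ge> \<delta>" "q > 0" using \<delta>(1) \<delta>(2)[of p] p J_sub by (force simp: q_def)+
      have "x \<in> L" "x \<noteq> 0" using p by (auto simp: xy J_def)
      then have 1: "1 / cmod x \<le> 1/\<mu>" using \<mu> by (intro divide_left_mono) auto
      have "cmod (x * z + y) \<le> sqrt q" unfolding q_def xy Qf_alt by (rule real_le_rsqrt) simp
      \<comment> \<open>Trading the square root for a full power of \<open>q\<close> is wasteful,
        but lets the convergence at exponent 3 be reused.\<close>
      also have "sqrt q \<le> (1 / sqrt \<delta>) * q"
      proof -
        have "sqrt \<delta> \<le> sqrt q" using q by simp
        then have "sqrt \<delta> * sqrt q \<le> sqrt q * sqrt q" by (rule mult_right_mono) (use q in simp)
        then show ?thesis using \<delta> q by (simp add: field_simps)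
      qed
      finally have "1 / cmod x * cmod (x * z + y) \<le> 1/\<mu> * ((1 / sqrt \<delta>) * q)"
        using 1 \<mu>(1) by (intro mult_mono) auto
      then have "cmod (Mf (z, v) p) \<le> 1/\<mu> * (1 / sqrt \<delta>) * q"
        by (simp add: xy Mf_def norm_mult norm_divide del: complex_cnj_add complex_cnj_mult)
      then have "cmod (Mf (z, v) p) * q powr (-4) \<le> 1/\<mu> * (1 / sqrt \<delta>) * q * q powr (-4)"
        by (rule mult_right_mono) simp
      also have "\<dots> = 1/\<mu> * (1 / sqrt \<delta>) * (q powr 1 * q powr (-4))" using q by simp
      also have "q powr 1 * q powr (-4) = q powr (-3)" by (subst powr_add[symmetric]) simp
      finally show "cmod (Mf (z, v) p) * Qf (z, v) p powr - 4 \<le> 1/\<mu> * (1 / sqrt \<delta>) * Qf (z, v) p powr (-3)"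
        by (simp add: q_def)
    qed auto
  qed (use \<delta> J_sub in auto)
qed

text \<open>The series involves \<open>th 1\<close> alone, and larger heights only strengthen the
  Gaussian in \<open>x\<close>; so one constant serves all \<open>v \<ge> va\<close>.\<close>

lemma Mth_rapid:
  assumes va: "0 < va"
  obtains C where "C \<ge> 0"
    "\<And>z v t. va \<le> v \<Longrightarrow> 0 < t \<Longrightarrow> t \<le> 1 \<Longrightarrow> norm (Mth (z, v) t) \<le> C * t ^ N"
proof -
  obtain \<mu> where \<mu>: "\<mu> > 0" "\<And>x. x \<in> L \<Longrightarrow> x \<noteq> 0 \<Longrightarrow> cmod x \<ge> \<mu>" by (rule L_min) (rule that; blast)
  define n where "n = N + 3"
  obtain C where C: "C \<ge> 0" "\<And>w t. 0 < t \<Longrightarrow> norm (th 1 w t) \<le> C * t ^ n"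
    by (rule th_rapid[of n]) (rule that; blast)
  obtain Cw where Cw: "Cw \<ge> 0" "\<And>\<tau>. \<tau> > 0 \<Longrightarrow> (\<Sum>\<^sub>\<infinity>x\<in>L. (1 + (cmod x)\<^sup>2) * exp (-(\<tau> * (cmod x)\<^sup>2))) \<le> Cw * (1 + 1/\<tau>) ^ 3"
    by (rule infsum_exp_weight) (rule that; blast)
  define K where "K = 1/\<mu> * C * (Cw * (1 + 1/va\<^sup>2) ^ 3)"
  show ?thesis
  proof (rule that[of K])
    show "K \<ge> 0" unfolding K_def using C Cw \<mu> by (intro mult_nonneg_nonneg) auto
    fix z v t assume v: "va \<le> v" and t: "0 < (t::real)" "t \<le> 1"
    have g: "norm (- (1/x) * th 1 (x * z) t) \<le> (1/\<mu> * C * t ^ n) * (1 + (cmod x)\<^sup>2)" if "x \<in> L - {0}" for x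
    proof -
      have "1 / cmod x \<le> 1/\<mu>" using \<mu> that by (intro divide_left_mono) auto
      then have "norm (- (1/x) * th 1 (x * z) t) \<le> 1/\<mu> * (C * t ^ n)"
        unfolding norm_mult norm_minus_cancel norm_divide norm_one using \<mu>(1) C t by (intro mult_mono) auto
      also have "\<dots> = (1/\<mu> * C * t ^ n) * 1" by simp
      also have "\<dots> \<le> (1/\<mu> * C * t ^ n) * (1 + (cmod x)\<^sup>2)"
        using \<mu>(1) C t by (intro mult_left_mono) auto
      finally show ?thesis .
    qed
    have v0: "v > 0" using v va by simp
    have tn: "t ^ n * (1 / t ^ 3) = t ^ N" using t by (simp add: n_def power_add)
    have "norm (Mth (z, v) t) \<le> (1/\<mu> * C * t ^ n) * (\<Sum>\<^sub>\<infinity>x\<in>L. (1 + (cmod x)\<^sup>2) * exp (-(t * va\<^sup>2 * (cmod x)\<^sup>2)))"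
      unfolding Mth_eq[OF v0 t(1)] using \<mu>(1) C t by (intro wt_sum(2)[OF va v t(1) L0_sub] g) auto
    also have "\<dots> \<le> (1/\<mu> * C * t ^ n) * (Cw * ((1 + 1/va\<^sup>2) / t) ^ 3)"
    proof (rule mult_left_mono)
      have "(\<Sum>\<^sub>\<infinity>x\<in>L. (1 + (cmod x)\<^sup>2) * exp (-(t * va\<^sup>2 * (cmod x)\<^sup>2))) \<le> Cw * (1 + 1/(t * va\<^sup>2)) ^ 3"
        using va t by (intro Cw(2)) auto
      also have "\<dots> \<le> Cw * ((1 + 1/va\<^sup>2) / t) ^ 3"
        using va t Cw(1) by (intro mult_left_mono power_mono) (auto simp: field_simps)
      finally show "(\<Sum>\<^sub>\<infinity>x\<in>L. (1 + (cmod x)\<^sup>2) * exp (-(t * va\<^sup>2 * (cmod x)\<^sup>2))) \<le> Cw * ((1 + 1/va\<^sup>2) / t) ^ 3" .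
    qed (use \<mu>(1) C t in auto)
    also have "\<dots> = K * (t ^ n * (1 / t ^ 3))"
      by (simp add: power_divide K_def)
    finally show "norm (Mth (z, v) t) \<le> K * t ^ N" unfolding tn .
  qed
qed

lemma Mth_theta_rapid:
  assumes v: "v > 0"
  obtains \<delta> where "theta_rapid J (Mf (z, v)) (Qf (z, v)) \<delta> 4"
proof -
  obtain \<delta> where "theta_data J (Mf (z, v)) (Qf (z, v)) \<delta> 4" by (rule Mf_data[OF v])
  moreover have "\<exists>C. \<forall>t. 0 < t \<and> t \<le> 1 \<longrightarrow> norm (thsum J (Mf (z, v)) (Qf (z, v)) t) \<le> C * t ^ N" for N
  proof -
    obtain C where "\<And>z' v' t. v \<le> v' \<Longrightarrow> 0 < t \<Longrightarrow> t \<le> 1 \<Longrightarrow> norm (Mth (z', v') t) \<le> C * t ^ N"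
      by (rule Mth_rapid[OF v, of N]) (rule that; blast)
    then show ?thesis unfolding Mth_def by blast
  qed
  ultimately show ?thesis
    by (intro that[of \<delta>]) (simp add: theta_rapid_def theta_rapid_axioms_def)
qed

text \<open>Cutting the Mellin integral off at \<open>e\<close> turns it into an absolutely convergent series.\<close>

definition Hreg :: "real \<Rightarrow> complex \<times> real \<Rightarrow> complex" where
  "Hreg e u = (\<Sum>\<^sub>\<infinity>p\<in>J. Mf u p * of_real (exp (-(e * Qf u p)) / Qf u p))"

lemma Mth_integrable: "v > 0 \<Longrightarrow> Mth (z, v) absolutely_integrable_on {0<..}"
proof -
  assume v: "v > 0"
  obtain \<delta> where r: "theta_rapid J (Mf (z, v)) (Qf (z, v)) \<delta> 4" by (rule Mth_theta_rapid[OF v])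
  show ?thesis unfolding Mth_def by (rule theta_rapid.theta_int0[OF r])
qed

lemma Hreg_eq:
  assumes v: "v > 0" and e: "e > 0"
  shows "(\<lambda>p. Mf (z, v) p * of_real (exp (-(e * Qf (z, v) p)) / Qf (z, v) p)) summable_on J"
    and "Hreg e (z, v) = integral {e..} (Mth (z, v))"
proof -
  obtain \<delta> where r: "theta_data J (Mf (z, v)) (Qf (z, v)) \<delta> 4" by (rule Mf_data[OF v])
  have h: "((\<lambda>i. Mf (z, v) i * of_real (exp (-(e * Qf (z, v) i)) / Qf (z, v) i)) has_sum integral {e..} (Mth (z, v))) J"
    using theta_data.integral_theta_from(2)[OF r e] unfolding Mth_def .
  then show "(\<lambda>p. Mf (z, v) p * of_real (exp (-(e * Qf (z, v) p)) / Qf (z, v) p)) summable_on J"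
    by (auto simp: summable_on_def)
  show "Hreg e (z, v) = integral {e..} (Mth (z, v))" unfolding Hreg_def by (rule infsumI[OF h])
qed

lemma Hreg_tendsto:
  assumes v: "v > 0"
  shows "(\<lambda>n. Hreg (1 / (real n + 1)) (z, v)) \<longlonglongrightarrow> H0 (z, v)"
proof -
  obtain C where C: "C \<ge> 0" "\<And>z' v' t. v \<le> v' \<Longrightarrow> 0 < t \<Longrightarrow> t \<le> 1 \<Longrightarrow> norm (Mth (z', v') t) \<le> C * t ^ 0"
    by (rule Mth_rapid[OF v, of 0]) (rule that; blast)
  have bd: "norm (Mth (z, v) t) \<le> C" if "0 < t" "t < 1 / (real n + 1)" for t n
  proof -
    have "1 / (real n + 1) \<le> 1" by simp
    then have "t \<le> 1" using that by linarith
    then show ?thesis using C(2)[of v t z] that by simp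
  qed
  have A: "norm (H0 (z, v) - Hreg (1 / (real n + 1)) (z, v)) \<le> C * (1 / (real n + 1))" for n
    unfolding H0_def by (subst Hreg_eq(2)[OF v], simp, rule integral_near_zero[OF Mth_integrable[OF v] _ C(1)])
      (use bd in auto)
  have b: "(\<lambda>n. C * (1 / (real n + 1))) \<longlonglongrightarrow> 0"
    by (rule tendsto_mult_right_zero) real_asymp
  have "(\<lambda>n. H0 (z, v) - Hreg (1 / (real n + 1)) (z, v)) \<longlonglongrightarrow> 0"
    by (rule Lim_null_comparison[OF _ b]) (rule always_eventually, rule allI, rule A)
  then have "(\<lambda>n. H0 (z, v) - (H0 (z, v) - Hreg (1 / (real n + 1)) (z, v))) \<longlonglongrightarrow> H0 (z, v) - 0"
    by (intro tendsto_diff tendsto_const)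
  then show ?thesis by simp
qed

text \<open>The value of the \<open>J\<close> part of the form on a tangent vector with components
  \<open>\<alpha>\<close>, \<open>\<beta>\<close>, \<open>\<gamma>\<close> along dz, d conj(z) and
  dv: the regularised sum of \<open>Pf / Qf^2\<close>. \<open>AJ\<close> is its truncation at
  \<open>e\<close>, weighted by incomplete Gamma values.\<close>

definition VJ :: "complex \<times> real \<Rightarrow> complex \<Rightarrow> complex \<Rightarrow> complex \<Rightarrow> complex" where
  "VJ u \<alpha> \<beta> \<gamma> = integral {0<..} (\<lambda>t. of_real t * ThJ u \<alpha> \<beta> \<gamma> t)"

definition AJ :: "real \<Rightarrow> complex \<times> real \<Rightarrow> complex \<Rightarrow> complex \<Rightarrow> complex \<Rightarrow> complex" where
  "AJ e u \<alpha> \<beta> \<gamma> = (\<Sum>\<^sub>\<infinity>p\<in>J. Pf u \<alpha> \<beta> \<gamma> p * of_real ((1 + e * Qf u p) * exp (-(e * Qf u p)) / (Qf u p)\<^sup>2))"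

lemma ThJ_theta_rapid:
  assumes v: "v > 0"
  obtains \<delta> where "theta_rapid J (Pf (z, v) \<alpha> \<beta> \<gamma>) (Qf (z, v)) \<delta> 4"
proof -
  obtain \<delta> where "theta_data J (Pf (z, v) \<alpha> \<beta> \<gamma>) (Qf (z, v)) \<delta> 4" by (rule Pf_data[OF v J_sub])
  moreover have "\<exists>C. \<forall>t. 0 < t \<and> t \<le> 1 \<longrightarrow> norm (thsum J (Pf (z, v) \<alpha> \<beta> \<gamma>) (Qf (z, v)) t) \<le> C * t ^ N" for N
  proof -
    obtain C where "\<And>z' v' \<alpha> \<beta> \<gamma> t. v \<le> v' \<Longrightarrow> v' \<le> v \<Longrightarrow> 0 < t \<Longrightarrow> t \<le> 1 \<Longrightarrow> norm (ThJ (z', v') \<alpha> \<beta> \<gamma> t) \<le> C * (cmod \<alpha> + cmod \<beta> + cmod \<gamma>) * t ^ N"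
      by (rule ThJ_rapid[OF v, of v N]) (rule that; blast)
    then show ?thesis unfolding ThJ_def by blast
  qed
  ultimately show ?thesis
    by (intro that[of \<delta>]) (simp add: theta_rapid_def theta_rapid_axioms_def)
qed

lemma AJ_eq:
  assumes v: "v > 0" and e: "e > 0"
  shows "(\<lambda>p. Pf (z, v) \<alpha> \<beta> \<gamma> p * of_real ((1 + e * Qf (z, v) p) * exp (-(e * Qf (z, v) p)) / (Qf (z, v) p)\<^sup>2)) summable_on J"
    and "AJ e (z, v) \<alpha> \<beta> \<gamma> = integral {e..} (\<lambda>t. of_real t * ThJ (z, v) \<alpha> \<beta> \<gamma> t)"
proof -
  obtain \<delta> where r: "theta_data J (Pf (z, v) \<alpha> \<beta> \<gamma>) (Qf (z, v)) \<delta> 4" by (rule Pf_data[OF v J_sub])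
  note h = theta_data.integral_t_theta_from(2)[OF r e]
  show "(\<lambda>p. Pf (z, v) \<alpha> \<beta> \<gamma> p * of_real ((1 + e * Qf (z, v) p) * exp (-(e * Qf (z, v) p)) / (Qf (z, v) p)\<^sup>2)) summable_on J"
    using h by (auto simp: summable_on_def)
  show "AJ e (z, v) \<alpha> \<beta> \<gamma> = integral {e..} (\<lambda>t. of_real t * ThJ (z, v) \<alpha> \<beta> \<gamma> t)"
    unfolding AJ_def ThJ_def by (rule infsumI[OF h])
qed

lemma tThJ_integrable: "v > 0 \<Longrightarrow> (\<lambda>t. of_real t * ThJ (z, v) \<alpha> \<beta> \<gamma> t) absolutely_integrable_on {0<..}"
proof -
  assume v: "v > 0"
  obtain \<delta> where r: "theta_rapid J (Pf (z, v) \<alpha> \<beta> \<gamma>) (Qf (z, v)) \<delta> 4" by (rule ThJ_theta_rapid[OF v])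
  show ?thesis unfolding ThJ_def by (rule theta_rapid.theta_int1[OF r])
qed

text \<open>Linear in the size of the tangent vector and uniform on slabs in \<open>v\<close>: the
  form of convergence under which derivatives pass to the limit \<open>e = 0\<close>.\<close>

lemma AJ_VJ:
  assumes va: "0 < va"
  obtains C where "C \<ge> 0"
    "\<And>z v \<alpha> \<beta> \<gamma> e. va \<le> v \<Longrightarrow> v \<le> vb \<Longrightarrow> 0 < e \<Longrightarrow> e \<le> 1 \<Longrightarrow> norm (AJ e (z, v) \<alpha> \<beta> \<gamma> - VJ (z, v) \<alpha> \<beta> \<gamma>) \<le> C * (cmod \<alpha> + cmod \<beta> + cmod \<gamma>) * e"
proof -
  obtain C where C: "C \<ge> 0"
    "\<And>z v \<alpha> \<beta> \<gamma> t. va \<le> v \<Longrightarrow> v \<le> vb \<Longrightarrow> 0 < t \<Longrightarrow> t \<le> 1 \<Longrightarrow> norm (ThJ (z, v) \<alpha> \<beta> \<gamma> t) \<le> C * (cmod \<alpha> + cmod \<beta> + cmod \<gamma>) * t ^ 0"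
    by (rule ThJ_rapid[OF va, of vb 0]) (rule that; blast)
  show ?thesis
  proof (rule that[OF C(1)])
    fix z v \<alpha> \<beta> \<gamma> e assume v: "va \<le> v" "v \<le> vb" and e: "0 < (e::real)" "e \<le> 1"
    have v0: "v > 0" using v va by simp
    define s where "s = C * (cmod \<alpha> + cmod \<beta> + cmod \<gamma>)"
    have s: "s \<ge> 0" unfolding s_def using C(1) by (intro mult_nonneg_nonneg) auto
    have "norm (VJ (z, v) \<alpha> \<beta> \<gamma> - AJ e (z, v) \<alpha> \<beta> \<gamma>) \<le> s * e"
      unfolding VJ_def AJ_eq(2)[OF v0 e(1)]
    proof (rule integral_near_zero[OF tThJ_integrable[OF v0] e(1) s])
      fix t assume t: "0 < t" "t < e"
      have "norm (ThJ (z, v) \<alpha> \<beta> \<gamma> t) \<le> s" using C(2)[OF v t(1)] t e by (simp add: s_def)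
      then have "t * norm (ThJ (z, v) \<alpha> \<beta> \<gamma> t) \<le> 1 * s" using t e by (intro mult_mono) auto
      then show "norm (of_real t * ThJ (z, v) \<alpha> \<beta> \<gamma> t) \<le> s" using t by (simp add: norm_mult)
    qed
    then show "norm (AJ e (z, v) \<alpha> \<beta> \<gamma> - VJ (z, v) \<alpha> \<beta> \<gamma>) \<le> C * (cmod \<alpha> + cmod \<beta> + cmod \<gamma>) * e"
      by (simp add: norm_minus_commute s_def)
  qed
qed

text \<open>The regularised sum of \<open>cnj x / x\<close> over nonzero \<open>x\<close>, since
  \<open>(cnj x)^2 / (cmod x)^2 = cnj x / x\<close>.\<close>

definition N0 :: complex where "N0 = integral {0<..} (th 2 0)"

text \<open>The coefficient of d conj(z) left over when the truncated primitive is differentiated.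
  Every term tends to 0 with \<open>e\<close>; the sum tends to \<open>c0 * N0\<close>, and this is
  where conditional convergence becomes visible.\<close>

definition NJ :: "real \<Rightarrow> complex \<times> real \<Rightarrow> complex" where
  "NJ e u = (\<Sum>\<^sub>\<infinity>p\<in>J. cnj (fst p) / fst p * of_real (e * exp (-(e * Qf u p))))"

text \<open>Poisson summation would give \<open>c0 = pi / covol L\<close>; only the existence of the limit is used.\<close>

definition c0 :: complex where
  "c0 = lim (\<lambda>n. of_real (1 / (real n + 1)) * th 0 0 (1 / (real n + 1)))"

lemma c0: "(\<lambda>n. of_real (1 / (real n + 1)) * th 0 0 (1 / (real n + 1))) \<longlonglongrightarrow> c0"
  unfolding c0_def using c0_exists by (auto simp: convergent_def convergent_LIMSEQ_iff[symmetric])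

text \<open>By \<open>(cnj x)^2 / (cmod x)^2 = cnj x / x\<close> the sum is the truncated Mellin
  integral of \<open>th 2 0\<close>, with \<open>e * v^2\<close> as the cutoff.\<close>

lemma wt_inverse_sum:
  assumes v: "v > 0" and e: "e > 0"
  shows "(\<Sum>\<^sub>\<infinity>x\<in>L-{0}. wt x v e * (cnj x / x)) = integral {e * v\<^sup>2..} (th 2 0)"
proof -
  obtain \<delta> where r: "theta_data (Ish 0) (\<lambda>l. cnj (0 + l) ^ 2) (\<lambda>l. (cmod (0 + l))\<^sup>2) \<delta> 3"
    by (rule rank2_data[of 2 0]) auto
  have ev: "e * v\<^sup>2 > 0" using e v by simp
  have Th: "thsum (Ish 0) (\<lambda>l. cnj (0 + l) ^ 2) (\<lambda>l. (cmod (0 + l))\<^sup>2) = th 2 0"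
    by (rule ext, rule rank2_theta) auto
  have "((\<lambda>l. cnj (0 + l) ^ 2 * of_real (exp (-(e * v\<^sup>2 * (cmod (0 + l))\<^sup>2)) / (cmod (0 + l))\<^sup>2)) has_sum integral {e * v\<^sup>2..} (th 2 0)) (Ish 0)"
    using theta_data.integral_theta_from(2)[OF r ev] unfolding Th .
  then have "(\<Sum>\<^sub>\<infinity>l\<in>Ish 0. cnj (0 + l) ^ 2 * of_real (exp (-(e * v\<^sup>2 * (cmod (0 + l))\<^sup>2)) / (cmod (0 + l))\<^sup>2)) = integral {e * v\<^sup>2..} (th 2 0)"
    by (rule infsumI)
  moreover have "Ish 0 = L - {0}" by (auto simp: Ish_def)
  moreover have "cnj (0 + x) ^ 2 * of_real (exp (-(e * v\<^sup>2 * (cmod (0 + x))\<^sup>2)) / (cmod (0 + x))\<^sup>2) = wt x v e * (cnj x / x)"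
    if "x \<in> L - {0}" for x
  proof -
    have "of_real ((cmod x)\<^sup>2) = x * cnj x" by (rule complex_norm_square)
    then show ?thesis using that by (simp add: wt_def power_mult_distrib power2_eq_square field_simps)
  qed
  ultimately show ?thesis by (metis (no_types, lifting) infsum_cong)
qed

text \<open>Summing over \<open>y\<close> first yields \<open>th 0 (x * z) e\<close>, which may be
  replaced by \<open>th 0 0 e\<close> at negligible cost. Then \<open>e * th 0 0 e\<close> tends to
  \<open>c0\<close>, and the remaining sum over \<open>x\<close> tends to \<open>N0\<close>. The
  rate \<open>d\<close> depends on neither \<open>z\<close> nor \<open>v\<close> within the
  slab.\<close>

lemma NJ_limit:
  assumes va: "0 < va"
  shows "\<exists>d. d \<longlonglongrightarrow> 0 \<and> (\<forall>n z v. va \<le> v \<longrightarrow> v \<le> vb \<longrightarrow> norm (NJ (1 / (real n + 1)) (z, v) - c0 * N0) \<le> d n)"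
proof -
  obtain C where C: "C \<ge> 0"
    "\<And>w t. 0 < t \<Longrightarrow> norm (th 2 w t) \<le> C * t ^ 0"
    by (rule th_rapid[of 0]) (rule that; blast)
  \<comment> \<open>Order 3 cancels the \<open>1 / e ^ 3\<close> of the sum over \<open>x\<close>,
    so after multiplication by \<open>e\<close> the replacement error is of order
    \<open>e\<close>.\<close>
  obtain C3 where C3: "C3 \<ge> 0" "\<And>w t. 0 < t \<Longrightarrow> norm (th 0 w t - th 0 0 t) \<le> C3 * t ^ 3"
    by (rule th_rapid[of 3]) (rule that; blast)
  obtain Cw where Cw: "Cw \<ge> 0" "\<And>\<tau>. \<tau> > 0 \<Longrightarrow> (\<Sum>\<^sub>\<infinity>x\<in>L. (1 + (cmod x)\<^sup>2) * exp (-(\<tau> * (cmod x)\<^sup>2))) \<le> Cw * (1 + 1/\<tau>) ^ 3"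
    by (rule infsum_exp_weight) (rule that; blast)
  define ep where "ep n = 1 / (real n + 1)" for n
  have ep: "ep n > 0" "ep n \<le> 1" for n by (auto simp: ep_def)
  define f where "f n = of_real (ep n) * th 0 0 (ep n)" for n
  have f: "f \<longlonglongrightarrow> c0" using c0 unfolding f_def ep_def .
  define K where "K = C3 * (Cw * (1 + 1/va\<^sup>2) ^ 3)"
  define d where "d n = norm (f n) * (C * vb\<^sup>2 * ep n) + norm (f n - c0) * norm N0 + K * ep n" for n
  have ep0: "ep \<longlonglongrightarrow> 0" unfolding ep_def by real_asymp
  have "d \<longlonglongrightarrow> norm c0 * (C * vb\<^sup>2 * 0) + norm (c0 - c0) * norm N0 + K * 0"
    unfolding d_def by (intro tendsto_intros f ep0)
  then have d0: "d \<longlonglongrightarrow> 0" by simp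
  have "norm (NJ (ep n) (z, v) - c0 * N0) \<le> d n" if v: "va \<le> v" "v \<le> vb" for n z v
  proof -
    define e where "e = ep n"
    have e: "e > 0" "e \<le> 1" using ep by (auto simp: e_def)
    have v0: "v > 0" using v va by simp
    have v2: "v\<^sup>2 \<le> vb\<^sup>2" using v v0 by (intro power_mono) auto
    have n1: "cmod (cnj x / x) \<le> 1 * (1 + (cmod x)\<^sup>2)" for x
      by (cases "x = 0") (auto simp: norm_divide)
    have "((\<lambda>(x, y). cnj x / x * cnj (x * z + y) ^ 0 * of_real (exp (-(e * eta_den (z, v) x y)))) has_sum
           (\<Sum>\<^sub>\<infinity>x\<in>L-{0}. wt x v e * (cnj x / x * th 0 (x * z) e))) J"
      unfolding J_def by (rule iter_sum[OF v0 e(1) L0_sub, of 1]) (use n1 in auto)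
    from has_sum_cmult_right[OF this, of "of_real e"]
    have "((\<lambda>p. cnj (fst p) / fst p * of_real (e * exp (-(e * Qf (z, v) p)))) has_sum
           of_real e * (\<Sum>\<^sub>\<infinity>x\<in>L-{0}. wt x v e * (cnj x / x * th 0 (x * z) e))) J"
      by (simp add: case_prod_unfold Qf_def mult_ac)
    then have 1: "NJ e (z, v) = of_real e * (\<Sum>\<^sub>\<infinity>x\<in>L-{0}. wt x v e * (cnj x / x * th 0 (x * z) e))"
      unfolding NJ_def by (rule infsumI)
    have gb: "norm (cnj x / x * (th 0 (x * z) e - th 0 0 e)) \<le> C3 * e ^ 3 * (1 + (cmod x)\<^sup>2)" for x
    proof -
      have "cmod (cnj x / x) * cmod (th 0 (x * z) e - th 0 0 e) \<le> (1 * (1 + (cmod x)\<^sup>2)) * (C3 * e ^ 3)"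
        using C3(2)[OF e(1), of "x * z"] by (intro mult_mono n1) auto
      then show ?thesis unfolding norm_mult[of "cnj x / x"] by (simp only: mult_1 mult_ac)
    qed
    have sA: "(\<lambda>x. wt x v e * (cnj x / x * (th 0 (x * z) e - th 0 0 e))) summable_on L-{0}"
      by (rule wt_sum(1)[OF v0 order_refl e(1) L0_sub _ gb]) (use C3 e in auto)
    have sB: "(\<lambda>x. wt x v e * (cnj x / x)) summable_on L-{0}"
      by (rule wt_sum(1)[OF v0 order_refl e(1) L0_sub _ n1]) auto
    define A where "A = (\<Sum>\<^sub>\<infinity>x\<in>L-{0}. wt x v e * (cnj x / x * (th 0 (x * z) e - th 0 0 e)))"
    have "(\<Sum>\<^sub>\<infinity>x\<in>L-{0}. wt x v e * (cnj x / x * th 0 (x * z) e))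
       = (\<Sum>\<^sub>\<infinity>x\<in>L-{0}. wt x v e * (cnj x / x * (th 0 (x * z) e - th 0 0 e)) + wt x v e * (cnj x / x) * th 0 0 e)"
      by (intro infsum_cong) (simp add: algebra_simps)
    also have "\<dots> = A + integral {e * v\<^sup>2..} (th 2 0) * th 0 0 e"
      unfolding A_def wt_inverse_sum[OF v0 e(1), symmetric]
      by (simp only: infsum_add[OF sA summable_on_cmult_left[OF sB]] infsum_cmult_left')
    finally have 2: "NJ e (z, v) = of_real e * A + f n * integral {e * v\<^sup>2..} (th 2 0)"
      unfolding 1 f_def e_def[symmetric] by (simp add: algebra_simps)
    have nA: "norm (of_real e * A) \<le> K * e"
    proof -
      have "norm A \<le> C3 * e ^ 3 * (\<Sum>\<^sub>\<infinity>x\<in>L. (1 + (cmod x)\<^sup>2) * exp (-(e * va\<^sup>2 * (cmod x)\<^sup>2)))"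
        unfolding A_def by (rule wt_sum(2)[OF va v(1) e(1) L0_sub _ gb]) (use C3 e in auto)
      also have "\<dots> \<le> C3 * e ^ 3 * (Cw * ((1 + 1/va\<^sup>2) / e) ^ 3)"
      proof (rule mult_left_mono)
        have "(\<Sum>\<^sub>\<infinity>x\<in>L. (1 + (cmod x)\<^sup>2) * exp (-(e * va\<^sup>2 * (cmod x)\<^sup>2))) \<le> Cw * (1 + 1/(e * va\<^sup>2)) ^ 3"
          using va e by (intro Cw(2)) auto
        also have "\<dots> \<le> Cw * ((1 + 1/va\<^sup>2) / e) ^ 3"
          using va e Cw(1) by (intro mult_left_mono power_mono) (auto simp: field_simps)
        finally show "(\<Sum>\<^sub>\<infinity>x\<in>L. (1 + (cmod x)\<^sup>2) * exp (-(e * va\<^sup>2 * (cmod x)\<^sup>2))) \<le> Cw * ((1 + 1/va\<^sup>2) / e) ^ 3" .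
      qed (use C3 e in auto)
      also have "\<dots> = K" using e by (simp add: K_def power_divide)
      finally have "e * norm A \<le> e * K" using e by (intro mult_left_mono) auto
      then show ?thesis using e by (simp add: norm_mult mult.commute)
    qed
    have nB: "norm (N0 - integral {e * v\<^sup>2..} (th 2 0)) \<le> C * vb\<^sup>2 * e"
    proof -
      have "norm (N0 - integral {e * v\<^sup>2..} (th 2 0)) \<le> C * (e * v\<^sup>2)"
        unfolding N0_def
        by (rule integral_near_zero[OF th_integrable(1)]) (use C e v0 in auto)
      also have "\<dots> \<le> C * (e * vb\<^sup>2)" using C e v2 by (intro mult_left_mono) auto
      finally show ?thesis by (simp add: mult_ac)
    qed
    \<comment> \<open>Three errors: replacing the base point, cutting off \<open>N0\<close>, and the
      distance of \<open>f n = e * th 0 0 e\<close> from its limit.\<close>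
    have dec: "NJ e (z, v) - c0 * N0 = of_real e * A + - (f n * (N0 - integral {e * v\<^sup>2..} (th 2 0))) + (f n - c0) * N0"
      unfolding 2 by (simp add: algebra_simps)
    have "norm (of_real e * A + - (f n * (N0 - integral {e * v\<^sup>2..} (th 2 0))) + (f n - c0) * N0)
      \<le> norm (of_real e * A) + norm (f n) * norm (N0 - integral {e * v\<^sup>2..} (th 2 0)) + norm (f n - c0) * norm N0"
      using norm_triangle_ineq[of "of_real e * A + - (f n * (N0 - integral {e * v\<^sup>2..} (th 2 0)))" "(f n - c0) * N0"]
        norm_triangle_ineq[of "of_real e * A" "- (f n * (N0 - integral {e * v\<^sup>2..} (th 2 0)))"]
      unfolding norm_minus_cancel norm_mult[of "f n"] norm_mult[of "f n - c0"] by linarith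
    also have "\<dots> \<le> K * e + norm (f n) * (C * vb\<^sup>2 * e) + norm (f n - c0) * norm N0"
      by (intro add_mono mult_left_mono nA nB) auto
    also have "\<dots> = d n" unfolding d_def e_def[symmetric] by simp
    finally show ?thesis using dec unfolding e_def by simp
  qed
  then show ?thesis using d0 unfolding ep_def by blast
qed

end

section \<open>A primitive of the Eisenstein form\<close>

lemma eta_den_pos:
  assumes "v > 0" "x \<noteq> 0" shows "eta_den (z, v) x y > 0"
  using assms by (simp add: eta_den_def add_nonneg_pos)

lemma has_derivative_Qf_aux:
  fixes x y :: complex and u :: "complex \<times> real"
  shows "((\<lambda>u. eta_den u x y) has_derivative
     (\<lambda>h. 2 * Re (cnj (x * fst u + y) * x * fst h) + 2 * (cmod x)\<^sup>2 * snd u * snd h)) (at u within S)"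
proof -
  have eq: "eta_den u x y = (Re (x * fst u + y))\<^sup>2 + (Im (x * fst u + y))\<^sup>2 + (cmod x)\<^sup>2 * (snd u)\<^sup>2" for u
    by (simp add: eta_den_def cmod_power2)
  show ?thesis unfolding eq
    by (rule derivative_eq_intros refl)+ (simp add: algebra_simps power2_eq_square)
qed

text \<open>Without damping, the d conj(z) contributions of \<open>cnj w\<close> and
  \<open>1 / Q\<close> combine through \<open>Q = w * cnj w + x * cnj x * v^2\<close> to the
  coefficient of \<open>\<eta>\<close>. With the factor \<open>exp (-(e * Q))\<close> the
  cancellation is incomplete, and the last summand is what remains.\<close>

lemma primitive_derivative:
  fixes u :: "complex \<times> real"
  assumes v: "snd u > 0" and x: "x \<noteq> 0"
  shows "((\<lambda>u. - (1 / x) * cnj (x * fst u + y) * of_real (exp (-(e * eta_den u x y)) / eta_den u x y)) has_derivative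
    (\<lambda>h. ((cnj (x * fst u + y))\<^sup>2 * fst h - (cnj x * of_real (snd u))\<^sup>2 * cnj (fst h)
           + 2 * cnj (x * fst u + y) * cnj x * of_real (snd u) * of_real (snd h))
         * of_real ((1 + e * eta_den u x y) * exp (-(e * eta_den u x y)) / (eta_den u x y)\<^sup>2)
       + cnj x / x * cnj (fst h) * of_real (e * exp (-(e * eta_den u x y))))) (at u within S)"
proof -
  define q where "q = eta_den u x y"
  have q: "q > 0" using eta_den_pos[OF v x, of "fst u" y] by (simp add: q_def)
  define E where "E = exp (-(e * q))"
  define W where "W = cnj (x * fst u + y)"
  define dQ where "dQ h = 2 * Re (W * x * fst h) + 2 * (cmod x)\<^sup>2 * snd u * snd h" for h :: "complex \<times> real"
  have dq: "((\<lambda>u. eta_den u x y) has_derivative dQ) (at u within S)"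
    unfolding dQ_def[abs_def] W_def by (rule has_derivative_Qf_aux)
  have "((\<lambda>u. exp (-(e * eta_den u x y)) / eta_den u x y) has_derivative
     (\<lambda>h. - ((1 + e * q) * E / q\<^sup>2) * dQ h)) (at u within S)"
  proof -
    have "((\<lambda>q. exp (-(e * q)) / q) has_real_derivative (- ((1 + e * q) * E / q\<^sup>2))) (at q)"
      using q by (auto intro!: derivative_eq_intros simp: E_def field_simps power2_eq_square)
    then have "((\<lambda>q. exp (-(e * q)) / q) has_derivative (\<lambda>h. - ((1 + e * q) * E / q\<^sup>2) * h)) (at (eta_den u x y))"
      unfolding has_field_derivative_def q_def .
    from has_derivative_compose[OF dq this] show ?thesis by simp
  qed
  then have d1: "((\<lambda>u. complex_of_real (exp (-(e * eta_den u x y)) / eta_den u x y)) has_derivative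
     (\<lambda>h. of_real (- ((1 + e * q) * E / q\<^sup>2) * dQ h))) (at u within S)"
    by (rule has_derivative_of_real)
  have d2: "((\<lambda>u. - (1 / x) * cnj (x * fst u + y)) has_derivative (\<lambda>h. - (1 / x) * cnj (x * fst h))) (at u within S)"
    by (rule derivative_eq_intros bounded_linear.has_derivative[OF bounded_linear_cnj] refl)+ simp
  have prod: "((\<lambda>u. - (1 / x) * cnj (x * fst u + y) * complex_of_real (exp (-(e * eta_den u x y)) / eta_den u x y)) has_derivative
     (\<lambda>h. - (1 / x) * W * of_real (- ((1 + e * q) * E / q\<^sup>2) * dQ h) + - (1 / x) * cnj (x * fst h) * of_real (E / q))) (at u within S)"
    using has_derivative_mult[OF d2 d1] unfolding W_def[symmetric] q_def[symmetric] E_def[symmetric] .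
  have "- (1 / x) * W * of_real (- ((1 + e * q) * E / q\<^sup>2) * dQ h) + - (1 / x) * cnj (x * fst h) * of_real (E / q)
     = (W\<^sup>2 * fst h - (cnj x * of_real (snd u))\<^sup>2 * cnj (fst h) + 2 * W * cnj x * of_real (snd u) * of_real (snd h))
         * of_real ((1 + e * q) * E / q\<^sup>2)
       + cnj x / x * cnj (fst h) * of_real (e * E)" for h :: "complex \<times> real"
  proof -
    define X where "X = cnj x" define H where "H = fst h" define H' where "H' = cnj H"
    define k where "k = complex_of_real (snd h)" define V where "V = complex_of_real (snd u)"
    define qc where "qc = complex_of_real q" define Ec where "Ec = complex_of_real E" define ec where "ec = complex_of_real e"
    define w where "w = cnj W"
    \<comment> \<open>Conjugates are treated as independent variables; this relation is all that
      links them, and after clearing denominators the claim is a polynomial identity modulo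
      it.\<close>
    have rel: "qc = w * W + x * X * V\<^sup>2"
      unfolding qc_def q_def eta_den_def w_def W_def X_def V_def
      using complex_norm_square[of "x * fst u + y"] complex_norm_square[of x] by (simp add: mult.commute)
    have dQc: "complex_of_real (dQ h) = W * x * H + w * X * H' + 2 * x * X * V * k"
    proof -
      have "complex_of_real (2 * Re (W * x * fst h)) = W * x * fst h + cnj (W * x * fst h)"
        by (rule complex_add_cnj[symmetric])
      also have "\<dots> = W * x * H + w * X * H'" by (simp add: w_def X_def H'_def H_def)
      finally have "complex_of_real (2 * Re (W * x * fst h)) = W * x * H + w * X * H'" .
      then show ?thesis using complex_norm_square[of x] by (simp add: dQ_def V_def k_def X_def mult_ac)
    qed
    have qn: "qc \<noteq> 0" using q by (simp add: qc_def)
    have "- (1 / x) * W * (- ((1 + ec * qc) * Ec / qc\<^sup>2) * (W * x * H + w * X * H' + 2 * x * X * V * k)) + - (1 / x) * (X * H') * (Ec / qc)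
     = (W\<^sup>2 * H - (X * V)\<^sup>2 * H' + 2 * W * X * V * k) * ((1 + ec * qc) * Ec / qc\<^sup>2) + X / x * H' * (ec * Ec)" (is "?l = ?r")
    proof -
      have "x * qc\<^sup>2 * ?l = W * (1 + ec * qc) * Ec * (W * x * H + w * X * H' + 2 * x * X * V * k) - X * H' * Ec * qc"
        using x qn by (simp add: field_simps power2_eq_square)
      moreover have "x * qc\<^sup>2 * ?r = x * (W\<^sup>2 * H - (X * V)\<^sup>2 * H' + 2 * W * X * V * k) * (1 + ec * qc) * Ec + X * H' * ec * Ec * qc\<^sup>2"
        using x qn by (simp add: field_simps power2_eq_square)
      moreover have "W * (1 + ec * qc) * Ec * (W * x * H + w * X * H' + 2 * x * X * V * k) - X * H' * Ec * qc
         = x * (W\<^sup>2 * H - (X * V)\<^sup>2 * H' + 2 * W * X * V * k) * (1 + ec * qc) * Ec + X * H' * ec * Ec * qc\<^sup>2"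
        using rel by algebra
      ultimately have "x * qc\<^sup>2 * ?l = x * qc\<^sup>2 * ?r" by simp
      then show ?thesis using x qn by simp
    qed
    then show ?thesis
      by (simp add: dQc X_def H_def H'_def k_def V_def qc_def Ec_def ec_def)
  qed
  then show ?thesis using prod unfolding W_def[symmetric] q_def[symmetric] E_def[symmetric] by simp
qed

section \<open>Differentiating the regularised primitive\<close>

context lattice
begin

text \<open>At fixed \<open>e > 0\<close> everything converges like a Gaussian in the pair.
  Restricting to a bounded box away from \<open>v = 0\<close> provides the common majorant for
  termwise differentiation.\<close>

lemma Hreg_derivative:
  assumes va: "0 < va" and R: "R > 0" and e: "e > 0" and u: "u \<in> ball 0 R \<times> {va<..<vb}"
  shows "(Hreg e has_derivative (\<lambda>h. AJ e u (fst h) (cnj (fst h)) (of_real (snd h)) + cnj (fst h) * NJ e u))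
           (at u within ball 0 R \<times> {va<..<vb})"
proof -
  define S where "S = ball (0::complex) R \<times> {va<..<vb}"
  obtain z v where uzv: "u = (z, v)" by force
  have v0: "v > 0" using u va by (auto simp: uzv)
  obtain \<mu> where \<mu>: "\<mu> > 0" "\<And>x. x \<in> L \<Longrightarrow> x \<noteq> 0 \<Longrightarrow> cmod x \<ge> \<mu>" by (rule L_min) (rule that; blast)
  define k where "k = 1 / (1/va\<^sup>2 + (1 + R/va)\<^sup>2)"
  have kd: "1/va\<^sup>2 + (1 + R/va)\<^sup>2 > 0" using va by (intro add_pos_nonneg) auto
  have k: "k > 0" unfolding k_def using kd by simp
  have low: "k * ((cmod (fst p))\<^sup>2 + (cmod (snd p))\<^sup>2) \<le> Qf y p" if "y \<in> S" for y p
  proof -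
    obtain z' v' x' y' where "y = (z', v')" "p = (x', y')" by force
    then show ?thesis using Qf_lower[OF va, of v' z' R x' y'] that kd by (simp add: S_def k_def field_simps)
  qed
  have low2: "k * \<mu>\<^sup>2 \<le> Qf y p" if "y \<in> S" "p \<in> J" for y p
  proof -
    have "fst p \<in> L" "fst p \<noteq> 0" using that(2) by (auto simp: J_def)
    then have "\<mu>\<^sup>2 \<le> (cmod (fst p))\<^sup>2" using \<mu> by (intro power_mono) auto
    then have "\<mu>\<^sup>2 \<le> (cmod (fst p))\<^sup>2 + (cmod (snd p))\<^sup>2" by (simp add: add_increasing2)
    then have "k * \<mu>\<^sup>2 \<le> k * ((cmod (fst p))\<^sup>2 + (cmod (snd p))\<^sup>2)" using k by (intro mult_left_mono) auto
    then show ?thesis using low[OF that(1), of p] by linarith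
  qed
  define m where "m = k * \<mu>\<^sup>2"
  have m: "m > 0" using k \<mu> by (simp add: m_def)
  \<comment> \<open>\<open>norm_Pf\<close> gives \<open>3 * norm h * Qf\<close>, and
    \<open>(1 + e * Qf) / Qf\<close> is at most \<open>1/m + e\<close> since
    \<open>Qf \<ge> m\<close>; the last \<open>e\<close> comes from the leftover term. The Gaussian
    in the pair comes from the lower bound \<open>low\<close>.\<close>
  define B where "B p = (3 * (1/m + e) + e) * (exp (-(e * k * (cmod (fst p))\<^sup>2)) * exp (-(e * k * (cmod (snd p))\<^sup>2)))" for p :: "complex \<times> complex"
  define f' where "f' p u h = Pf u (fst h) (cnj (fst h)) (of_real (snd h)) p * of_real ((1 + e * Qf u p) * exp (-(e * Qf u p)) / (Qf u p)\<^sup>2)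
      + cnj (fst p) / fst p * cnj (fst h) * of_real (e * exp (-(e * Qf u p)))" for p u and h :: "complex \<times> real"
  have expS: "(\<lambda>x. exp (-(e * k * (cmod x)\<^sup>2))) summable_on L"
    using gauss_summable[of "e * k" 0 0] e k by simp
  have Bs: "B summable_on J"
  proof -
    have "(\<lambda>(x, y). exp (-(e * k * (cmod x)\<^sup>2)) * exp (-(e * k * (cmod y)\<^sup>2))) summable_on L \<times> L"
      by (intro summable_on_product_real expS) auto
    then have "(\<lambda>p. exp (-(e * k * (cmod (fst p))\<^sup>2)) * exp (-(e * k * (cmod (snd p))\<^sup>2))) summable_on J"
      unfolding case_prod_unfold by (rule summable_on_subset_banach) (auto simp: J_def)
    then show ?thesis unfolding B_def[abs_def] by (rule summable_on_cmult_right)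
  qed
  have bd: "norm (f' p y h) \<le> B p * norm h" if p: "p \<in> J" and y: "y \<in> S" for p y h
  proof -
    define q where "q = Qf y p"
    have q: "q \<ge> m" "q > 0" using low2[OF y p] m by (auto simp: q_def m_def)
    have v: "snd y > 0" using y va by (auto simp: S_def)
    have hf: "cmod (fst h) \<le> norm h" "\<bar>snd h\<bar> \<le> norm h" using norm_fst_le[of "fst h" "snd h"] norm_snd_le[of "snd h" "fst h"] by simp_all
    have "norm (Pf y (fst h) (cnj (fst h)) (of_real (snd h)) p) \<le> (cmod (fst h) + cmod (fst h) + \<bar>snd h\<bar>) * q"
      using norm_Pf[of "snd y" "fst y" "fst h" "cnj (fst h)" "of_real (snd h)" "fst p" "snd p"] v by (simp add: q_def)
    also have "\<dots> \<le> (3 * norm h) * q" using hf q by (intro mult_right_mono) auto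
    finally have 1: "norm (Pf y (fst h) (cnj (fst h)) (of_real (snd h)) p) \<le> (3 * norm h) * q" .
    define E where "E = exp (-(e * q))"
    have E: "E \<le> exp (-(e * k * (cmod (fst p))\<^sup>2)) * exp (-(e * k * (cmod (snd p))\<^sup>2))"
      using mult_left_mono[OF low[OF y, of p], of e] e by (simp add: E_def q_def algebra_simps flip: exp_add)
    have E0: "E > 0" by (simp add: E_def)
    have "norm (f' p y h) \<le> norm (Pf y (fst h) (cnj (fst h)) (of_real (snd h)) p) * ((1 + e * q) * E / q\<^sup>2) + norm (cnj (fst p) / fst p) * norm (fst h) * (e * E)"
    proof -
      have r0: "(1 + e * q) * E / q\<^sup>2 \<ge> 0" using e q E0 by simp
      have r1: "norm (complex_of_real ((1 + e * q) * E / q\<^sup>2)) = (1 + e * q) * E / q\<^sup>2"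
        unfolding norm_of_real by (rule abs_of_nonneg[OF r0])
      have r2: "norm (complex_of_real (e * E)) = e * E"
        unfolding norm_of_real using e E0 by (intro abs_of_nonneg) simp
      show ?thesis unfolding f'_def q_def[symmetric] E_def[symmetric]
        by (rule order_trans[OF norm_triangle_ineq]) (simp only: norm_mult r1 r2 complex_mod_cnj order_refl)
    qed
    also have "\<dots> \<le> (3 * norm h) * q * ((1 + e * q) * E / q\<^sup>2) + 1 * norm h * (e * E)"
      using 1 hf e q E0 p by (intro add_mono mult_right_mono mult_mono) (auto simp: norm_divide J_def)
    also have "\<dots> = norm h * (3 * (1/q + e) + e) * E"
      using q by (simp add: field_simps power2_eq_square)
    also have "\<dots> \<le> norm h * (3 * (1/m + e) + e) * E"
    proof -
      have "1/q \<le> 1/m" using q m by (intro divide_left_mono) auto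
      then show ?thesis using E0 by (intro mult_right_mono mult_left_mono) auto
    qed
    also have "\<dots> \<le> norm h * (3 * (1/m + e) + e) * (exp (-(e * k * (cmod (fst p))\<^sup>2)) * exp (-(e * k * (cmod (snd p))\<^sup>2)))"
      using E m e by (intro mult_left_mono) auto
    finally show ?thesis by (simp add: B_def mult_ac)
  qed
  have "((\<lambda>u. \<Sum>\<^sub>\<infinity>p\<in>J. Mf u p * of_real (exp (-(e * Qf u p)) / Qf u p)) has_derivative (\<lambda>h. \<Sum>\<^sub>\<infinity>p\<in>J. f' p u h)) (at u within S)"
  proof (rule has_derivative_infsum[where B = B])
    show "convex S" unfolding S_def by (intro convex_Times) auto
    show "u \<in> S" using u by (simp add: S_def)
    show "((\<lambda>u. Mf u p * of_real (exp (-(e * Qf u p)) / Qf u p)) has_derivative f' p y) (at y within S)" if "p \<in> J" "y \<in> S" for p y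
    proof -
      have "snd y > 0" "fst p \<noteq> 0" using that va by (auto simp: S_def J_def)
      from primitive_derivative[OF this, of "snd p" e S] show ?thesis
        unfolding Mf_def Qf_def f'_def[abs_def] Pf_def by (simp add: mult_ac)
    qed
    show "B summable_on J" by (rule Bs)
    show "0 \<le> B p" for p unfolding B_def using m e by simp
    show "(\<lambda>p. Mf y p * of_real (exp (-(e * Qf y p)) / Qf y p)) summable_on J" if "y \<in> S" for y
      using Hreg_eq(1)[of "snd y" e "fst y"] that va e by (auto simp: S_def)
  qed (use bd in auto)
  moreover have "(\<Sum>\<^sub>\<infinity>p\<in>J. f' p u h) = AJ e u (fst h) (cnj (fst h)) (of_real (snd h)) + cnj (fst h) * NJ e u" for h
  proof -
    have s1: "(\<lambda>p. Pf u (fst h) (cnj (fst h)) (of_real (snd h)) p * of_real ((1 + e * Qf u p) * exp (-(e * Qf u p)) / (Qf u p)\<^sup>2)) summable_on J"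
      unfolding uzv by (rule AJ_eq(1)[OF v0 e])
    have s2: "(\<lambda>p. f' p u h) summable_on J"
      unfolding summable_on_iff_abs_summable_on_complex
      by (rule Infinite_Sum.abs_summable_on_comparison_test'[OF summable_on_cmult_left[OF Bs, of "norm h"]])
         (use bd u in \<open>auto simp: S_def\<close>)
    have s3: "(\<lambda>p. cnj (fst h) * (cnj (fst p) / fst p * of_real (e * exp (-(e * Qf u p))))) summable_on J"
      using summable_on_diff'[OF s2 s1] by (simp add: f'_def mult_ac)
    have "(\<Sum>\<^sub>\<infinity>p\<in>J. f' p u h) = (\<Sum>\<^sub>\<infinity>p\<in>J. Pf u (fst h) (cnj (fst h)) (of_real (snd h)) p * of_real ((1 + e * Qf u p) * exp (-(e * Qf u p)) / (Qf u p)\<^sup>2)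
       + cnj (fst h) * (cnj (fst p) / fst p * of_real (e * exp (-(e * Qf u p)))))"
      by (intro infsum_cong) (simp add: f'_def)
    also have "\<dots> = AJ e u (fst h) (cnj (fst h)) (of_real (snd h)) + cnj (fst h) * NJ e u"
      unfolding infsum_add[OF s1 s3] AJ_def NJ_def infsum_cmult_right' ..
    finally show ?thesis .
  qed
  ultimately show ?thesis unfolding Hreg_def[abs_def] S_def by simp
qed

text \<open>The truncations converge pointwise and their derivatives converge uniformly on a box, so
  the derivative passes to the limit. The limit of \<open>NJ\<close> survives as the term with
  \<open>c0 * N0\<close>: \<open>H0\<close> alone is not a primitive.\<close>

lemma H0_derivative:
  assumes v: "v > 0"
  shows "(H0 has_derivative (\<lambda>h. VJ (z, v) (fst h) (cnj (fst h)) (of_real (snd h)) + cnj (fst h) * (c0 * N0))) (at (z, v))"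
proof -
  define va where "va = v / 2" define vb where "vb = 2 * v" define R where "R = cmod z + 1"
  have va: "0 < va" "va < v" "v < vb" and R: "R > 0" "cmod z < R"
    using v by (auto simp: va_def vb_def R_def add_nonneg_pos)
  define S where "S = ball (0::complex) R \<times> {va<..<vb}"
  have uS: "(z, v) \<in> S" using va R by (simp add: S_def)
  obtain C where C: "C \<ge> 0"
    "\<And>z v \<alpha> \<beta> \<gamma> e. va \<le> v \<Longrightarrow> v \<le> vb \<Longrightarrow> 0 < e \<Longrightarrow> e \<le> 1 \<Longrightarrow> norm (AJ e (z, v) \<alpha> \<beta> \<gamma> - VJ (z, v) \<alpha> \<beta> \<gamma>) \<le> C * (cmod \<alpha> + cmod \<beta> + cmod \<gamma>) * e"
    by (rule AJ_VJ[OF va(1), of vb]) (rule that; blast)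
  obtain d where d: "d \<longlonglongrightarrow> 0" "\<And>n z v. va \<le> v \<Longrightarrow> v \<le> vb \<Longrightarrow> norm (NJ (1 / (real n + 1)) (z, v) - c0 * N0) \<le> d n"
    using NJ_limit[OF va(1), of vb] by blast
  define g' where "g' u h = VJ u (fst h) (cnj (fst h)) (of_real (snd h)) + cnj (fst h) * (c0 * N0)" for u :: "complex \<times> real" and h :: "complex \<times> real"
  have "\<exists>g. \<forall>u\<in>S. (\<lambda>n. Hreg (1 / (real n + 1)) u) \<longlonglongrightarrow> g u \<and> (g has_derivative g' u) (at u within S)"
  proof (rule has_derivative_sequence)
    show "convex S" unfolding S_def by (intro convex_Times) auto
    show "(Hreg (1 / (real n + 1)) has_derivative (\<lambda>h. AJ (1 / (real n + 1)) u (fst h) (cnj (fst h)) (of_real (snd h)) + cnj (fst h) * NJ (1 / (real n + 1)) u)) (at u within S)"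
      if "u \<in> S" for n u
      unfolding S_def by (rule Hreg_derivative[OF va(1) R(1)]) (use that in \<open>auto simp: S_def\<close>)
    show "(z, v) \<in> S" by (rule uS)
    show "(\<lambda>n. Hreg (1 / (real n + 1)) (z, v)) \<longlonglongrightarrow> H0 (z, v)" by (rule Hreg_tendsto[OF v])
    fix e :: real assume e: "e > 0"
    have "(\<lambda>n. 3 * C * (1 / (real n + 1)) + d n) \<longlonglongrightarrow> 3 * C * 0 + 0"
      by (intro tendsto_intros d) real_asymp
    then have "eventually (\<lambda>n. 3 * C * (1 / (real n + 1)) + d n < e) sequentially"
      using e by (intro order_tendstoD) auto
    then show "\<forall>\<^sub>F n in sequentially. \<forall>u\<in>S. \<forall>h. norm (AJ (1 / (real n + 1)) u (fst h) (cnj (fst h)) (of_real (snd h)) + cnj (fst h) * NJ (1 / (real n + 1)) u - g' u h) \<le> e * norm h"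
    proof eventually_elim
      case (elim n)
      show ?case
      proof (intro ballI allI)
        fix u h assume u: "u \<in> S"
        obtain z' v' where uzv: "u = (z', v')" by force
        have vv: "va \<le> v'" "v' \<le> vb" using u by (auto simp: S_def uzv)
        have hf: "cmod (fst h) \<le> norm h" "\<bar>snd h\<bar> \<le> norm h" using norm_fst_le[of "fst h" "snd h"] norm_snd_le[of "snd h" "fst h"] by simp_all
        have "norm (AJ (1 / (real n + 1)) u (fst h) (cnj (fst h)) (of_real (snd h)) - VJ u (fst h) (cnj (fst h)) (of_real (snd h)))
           \<le> C * (cmod (fst h) + cmod (cnj (fst h)) + cmod (of_real (snd h))) * (1 / (real n + 1))"
          unfolding uzv by (rule C(2)[OF vv]) auto
        also have "\<dots> \<le> C * (3 * norm h) * (1 / (real n + 1))"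
          using hf C(1) by (intro mult_right_mono mult_left_mono) auto
        finally have 1: "norm (AJ (1 / (real n + 1)) u (fst h) (cnj (fst h)) (of_real (snd h)) - VJ u (fst h) (cnj (fst h)) (of_real (snd h))) \<le> 3 * C * (1 / (real n + 1)) * norm h"
          by (simp add: mult_ac)
        have "norm (cnj (fst h)) * norm (NJ (1 / (real n + 1)) u - c0 * N0) \<le> norm h * d n"
          unfolding uzv using hf d(2)[OF vv] by (intro mult_mono) auto
        then have 2: "norm (cnj (fst h) * (NJ (1 / (real n + 1)) u - c0 * N0)) \<le> d n * norm h"
          unfolding norm_mult by (simp only: mult.commute)
        have "norm (AJ (1 / (real n + 1)) u (fst h) (cnj (fst h)) (of_real (snd h)) + cnj (fst h) * NJ (1 / (real n + 1)) u - g' u h)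
          = norm ((AJ (1 / (real n + 1)) u (fst h) (cnj (fst h)) (of_real (snd h)) - VJ u (fst h) (cnj (fst h)) (of_real (snd h))) + cnj (fst h) * (NJ (1 / (real n + 1)) u - c0 * N0))"
          unfolding g'_def by (simp add: algebra_simps)
        also have "\<dots> \<le> 3 * C * (1 / (real n + 1)) * norm h + d n * norm h"
          by (rule order_trans[OF norm_triangle_ineq add_mono[OF 1 2]])
        also have "\<dots> = (3 * C * (1 / (real n + 1)) + d n) * norm h" by (simp only: distrib_right)
        also have "\<dots> \<le> e * norm h" using elim by (intro mult_right_mono) auto
        finally show "norm (AJ (1 / (real n + 1)) u (fst h) (cnj (fst h)) (of_real (snd h)) + cnj (fst h) * NJ (1 / (real n + 1)) u - g' u h) \<le> e * norm h" .
      qed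
    qed
  qed
  then obtain g where g: "\<And>u. u \<in> S \<Longrightarrow> (\<lambda>n. Hreg (1 / (real n + 1)) u) \<longlonglongrightarrow> g u"
     "\<And>u. u \<in> S \<Longrightarrow> (g has_derivative g' u) (at u within S)" by blast
  have gH: "g u = H0 u" if "u \<in> S" for u
  proof -
    have "snd u > 0" using that va by (auto simp: S_def)
    then have "(\<lambda>n. Hreg (1 / (real n + 1)) u) \<longlonglongrightarrow> H0 u"
      using Hreg_tendsto[of "snd u" "fst u"] by simp
    then show ?thesis by (rule LIMSEQ_unique[OF g(1)[OF that]])
  qed
  have "open S" unfolding S_def by (intro open_Times) auto
  moreover have "(H0 has_derivative g' (z, v)) (at (z, v) within S)"
    by (rule has_derivative_transform[OF uS _ g(2)[OF uS]]) (use gH in auto)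
  ultimately show ?thesis using uS at_within_open[OF uS] unfolding g'_def by simp
qed

end

section \<open>Equivariance under the modular group\<close>

lemma gact_simps:
  "fst (gact a b c d u) = ((a * fst u + b) * cnj (c * fst u + d) + a * cnj c * of_real ((snd u)\<^sup>2)) / of_real (eta_den u c d)"
  "snd (gact a b c d u) = snd u / eta_den u c d"
  by (simp_all add: gact_def eta_den_def Let_def)

lemma eta_den_complex:
  "complex_of_real (eta_den u x y) = (x * fst u + y) * cnj (x * fst u + y) + x * cnj x * (of_real (snd u))\<^sup>2"
  unfolding eta_den_def using complex_norm_square[of "x * fst u + y"] complex_norm_square[of x] by simp

lemma eta_den_pos':
  assumes "snd u > 0" "x \<noteq> 0 \<or> y \<noteq> 0" shows "eta_den u x y > 0"
proof (cases "x = 0")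
  case True
  then show ?thesis using assms by (simp add: eta_den_def)
next
  case False
  then show ?thesis using eta_den_pos[of "snd u" x "fst u" y] assms by simp
qed

lemma row_nz: "(c \<noteq> 0 \<or> d \<noteq> (0::complex))" if "a * d - b * c = 1"
  using that by auto

lemma gact_snd_pos: "snd u > 0 \<Longrightarrow> a * d - b * c = 1 \<Longrightarrow> snd (gact a b c d u) > 0"
  unfolding gact_simps using eta_den_pos'[OF _ row_nz, of u a d b c] by simp

text \<open>\<open>snd u / eta_den u c d\<close> is the height of the image point, so this is the
  multiplicativity of the height factor, that is, of the Hermitian norm of the row
  \<open>(x, y)\<close> moved by the matrix.\<close>

lemma gact_eta_den:
  assumes v: "snd u > 0" and det: "a * d - b * c = 1"
  shows "eta_den (gact a b c d u) x y = eta_den u (x * a + y * c) (x * b + y * d) / eta_den u c d"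
proof -
  define z where "z = fst u" define V where "V = complex_of_real (snd u)"
  define C where "C = c * z + d" define C' where "C' = cnj C" define c' where "c' = cnj c"
  define dn where "dn = complex_of_real (eta_den u c d)"
  have dn0: "dn \<noteq> 0" using eta_den_pos'[OF v row_nz[OF det]] by (simp add: dn_def)
  have dn: "dn = C * C' + c * c' * V\<^sup>2" unfolding dn_def eta_den_complex C_def C'_def c'_def V_def z_def ..
  define W where "W = (x * a + y * c) * z + (x * b + y * d)" define W' where "W' = cnj W"
  define X where "X = x * a + y * c" define X' where "X' = cnj X" define x' where "x' = cnj x"
  \<comment> \<open>The determinant condition enters only here; with this relation and its conjugate
    the rest is an identity in commuting variables.\<close>
  have rel: "W * c - X * C = - x" unfolding W_def X_def C_def using det by algebra
  then have "cnj (W * c - X * C) = cnj (- x)" by simp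
  then have rel': "W' * c' - X' * C' = - x'" by (simp add: W'_def c'_def X'_def C'_def x'_def)
  define wn where "wn = W * C' + X * c' * V\<^sup>2" define wn' where "wn' = W' * C + X' * c * V\<^sup>2"
  have cn: "cnj wn = wn'" by (simp add: wn_def wn'_def W'_def C'_def X'_def c'_def V_def)
  have w: "x * fst (gact a b c d u) + y = wn / dn"
  proof -
    have "x * ((a * z + b) * C' + a * c' * V\<^sup>2) + y * dn = wn"
      unfolding wn_def dn W_def X_def C_def by algebra
    then have "x * (((a * z + b) * C' + a * c' * V\<^sup>2) / dn) + y = wn / dn" using dn0 by (simp add: field_simps)
    then show ?thesis unfolding gact_simps(1) dn_def[symmetric] C'_def C_def c'_def V_def z_def by simp
  qed
  have "complex_of_real (eta_den (gact a b c d u) x y) = wn / dn * cnj (wn / dn) + x * x' * (V / dn)\<^sup>2"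
    unfolding eta_den_complex w x'_def by (simp add: gact_simps(2) V_def dn_def)
  also have "cnj (wn / dn) = wn' / dn" using cn by (simp add: dn_def)
  also have "wn / dn * (wn' / dn) + x * x' * (V / dn)\<^sup>2 = (wn * wn' + x * x' * V\<^sup>2) / dn\<^sup>2"
    using dn0 by (simp add: field_simps power2_eq_square)
  also have "wn * wn' + x * x' * V\<^sup>2 = (W * W' + X * X' * V\<^sup>2) * dn"
  proof -
    have "wn * wn' + (W * c - X * C) * (W' * c' - X' * C') * V\<^sup>2 = (W * W' + X * X' * V\<^sup>2) * dn"
      unfolding wn_def wn'_def dn by algebra
    then show ?thesis unfolding rel rel' by simp
  qed
  also have "(W * W' + X * X' * V\<^sup>2) * dn / dn\<^sup>2 = (W * W' + X * X' * V\<^sup>2) / dn"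
    using dn0 by (simp add: power2_eq_square)
  also have "\<dots> = complex_of_real (eta_den u (x * a + y * c) (x * b + y * d) / eta_den u c d)"
    unfolding of_real_divide dn_def eta_den_complex[of u "x * a + y * c"] W_def W'_def X_def X'_def V_def z_def ..
  finally show ?thesis unfolding of_real_eq_iff .
qed

text \<open>The composition law is needed for the complex coordinate alone, because the form is
  recovered as the differential of that coordinate.\<close>

lemma gact_fst_comp:
  assumes v: "snd u > 0" and det: "a * d - b * c = 1"
  shows "fst (gact a' b' x y (gact a b c d u)) = fst (gact (a' * a + b' * c) (a' * b + b' * d) (x * a + y * c) (x * b + y * d) u)"
proof -
  define z where "z = fst u" define V where "V = complex_of_real (snd u)"
  define C where "C = c * z + d" define C' where "C' = cnj C" define c' where "c' = cnj c"
  define dn where "dn = complex_of_real (eta_den u c d)"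
  have dn0: "dn \<noteq> 0" using eta_den_pos'[OF v row_nz[OF det]] by (simp add: dn_def)
  have dn: "dn = C * C' + c * c' * V\<^sup>2" unfolding dn_def eta_den_complex C_def C'_def c'_def V_def z_def ..
  define W where "W = (x * a + y * c) * z + (x * b + y * d)" define W' where "W' = cnj W"
  define X where "X = x * a + y * c" define X' where "X' = cnj X" define x' where "x' = cnj x"
  define A where "A = (a' * a + b' * c) * z + (a' * b + b' * d)" define A1 where "A1 = a' * a + b' * c"
  have rel: "W * c - X * C = - x" unfolding W_def X_def C_def using det by algebra
  then have "cnj (W * c - X * C) = cnj (- x)" by simp
  then have rel': "W' * c' - X' * C' = - x'" by (simp add: W'_def c'_def X'_def C'_def x'_def)
  have relA: "A * c - A1 * C = - a'" unfolding A_def A1_def C_def using det by algebra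
  define wn where "wn = W * C' + X * c' * V\<^sup>2" define wn' where "wn' = W' * C + X' * c * V\<^sup>2"
  define An where "An = A * C' + A1 * c' * V\<^sup>2"
  have cn: "cnj wn = wn'" by (simp add: wn_def wn'_def W'_def C'_def X'_def c'_def V_def)
  have lin: "p * fst (gact a b c d u) + q = ((p * (a * z + b) + q * C) * C' + (p * a + q * c) * c' * V\<^sup>2) / dn" for p q
  proof -
    have "p * ((a * z + b) * C' + a * c' * V\<^sup>2) + q * dn = (p * (a * z + b) + q * C) * C' + (p * a + q * c) * c' * V\<^sup>2"
      unfolding dn by algebra
    then have "p * (((a * z + b) * C' + a * c' * V\<^sup>2) / dn) + q = ((p * (a * z + b) + q * C) * C' + (p * a + q * c) * c' * V\<^sup>2) / dn"
      using dn0 by (simp add: field_simps)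
    then show ?thesis unfolding gact_simps(1) dn_def[symmetric] C'_def C_def c'_def V_def z_def by simp
  qed
  have w: "x * fst (gact a b c d u) + y = wn / dn"
    unfolding lin wn_def W_def X_def C_def by (simp add: algebra_simps)
  have w2: "a' * fst (gact a b c d u) + b' = An / dn"
    unfolding lin An_def A_def A1_def C_def by (simp add: algebra_simps)
  define Q where "Q = complex_of_real (eta_den u (x * a + y * c) (x * b + y * d))"
  have key: "An * wn' + a' * x' * V\<^sup>2 = (A * W' + A1 * X' * V\<^sup>2) * dn"
  proof -
    have "An * wn' - (A * c - A1 * C) * - (W' * c' - X' * C') * V\<^sup>2 = (A * W' + A1 * X' * V\<^sup>2) * dn"
      unfolding An_def wn'_def dn by algebra
    then show ?thesis unfolding relA rel' by simp
  qed
  have "fst (gact a' b' x y (gact a b c d u)) = (An / dn * cnj (wn / dn) + a' * x' * (V / dn)\<^sup>2) / (Q / dn)"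
    unfolding gact_simps(1)[of a' b' x y] gact_eta_den[OF v det] w w2 x'_def
    by (simp add: gact_simps(2) V_def dn_def Q_def)
  also have "cnj (wn / dn) = wn' / dn" using cn by (simp add: dn_def)
  also have "(An / dn * (wn' / dn) + a' * x' * (V / dn)\<^sup>2) = (An * wn' + a' * x' * V\<^sup>2) / dn\<^sup>2"
    using dn0 by (simp add: field_simps power2_eq_square)
  also have "(An * wn' + a' * x' * V\<^sup>2) / dn\<^sup>2 / (Q / dn) = (A * W' + A1 * X' * V\<^sup>2) / Q"
    unfolding key using dn0 by (simp add: power2_eq_square)
  also have "\<dots> = fst (gact (a' * a + b' * c) (a' * b + b' * d) (x * a + y * c) (x * b + y * d) u)"
    unfolding gact_simps(1) Q_def A_def A1_def W'_def W_def X'_def X_def V_def z_def by simp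
  finally show ?thesis .
qed

text \<open>In the quotient rule the top row occurs only through
  \<open>a' * (x * z + y) - x * (a' * z + b')\<close>, which is 1. Hence the differential depends on
  the bottom row only, and it is the coefficient form of \<open>\<eta>\<close> at
  \<open>s = 0\<close>.\<close>

lemma fst_gact_derivative:
  assumes v: "snd u > 0" and det: "a' * y - b' * x = 1"
  shows "((\<lambda>u. fst (gact a' b' x y u)) has_derivative
     (\<lambda>h. ((cnj (x * fst u + y))\<^sup>2 * fst h - (cnj x * of_real (snd u))\<^sup>2 * cnj (fst h)
           + 2 * cnj (x * fst u + y) * cnj x * of_real (snd u) * of_real (snd h)) / (of_real (eta_den u x y))\<^sup>2)) (at u)"
proof -
  define z where "z = fst u" define V where "V = complex_of_real (snd u)"
  define x' where "x' = cnj x" define A where "A = a' * z + b'" define w where "w = x * z + y" define W where "W = cnj w"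
  define q where "q = complex_of_real (eta_den u x y)"
  have q0: "q \<noteq> 0" using eta_den_pos'[OF v row_nz[OF det]] by (simp add: q_def)
  have q: "q = w * W + x * x' * V\<^sup>2" unfolding q_def eta_den_complex w_def W_def x'_def V_def z_def ..
  define dN where "dN h = a' * fst h * W + A * (x' * cnj (fst h)) + 2 * a' * x' * V * of_real (snd h)" for h :: "complex \<times> real"
  define dQ where "dQ h = 2 * Re (cnj (x * fst u + y) * x * fst h) + 2 * (cmod x)\<^sup>2 * snd u * snd h" for h :: "complex \<times> real"
  have dQc: "complex_of_real (dQ h) = W * x * fst h + w * x' * cnj (fst h) + 2 * x * x' * V * of_real (snd h)" for h
  proof -
    have "complex_of_real (2 * Re (W * x * fst h)) = W * x * fst h + cnj (W * x * fst h)"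
      by (rule complex_add_cnj[symmetric])
    also have "\<dots> = W * x * fst h + w * x' * cnj (fst h)" by (simp add: W_def x'_def)
    finally show ?thesis using complex_norm_square[of x]
      by (simp add: dQ_def V_def x'_def W_def w_def z_def mult_ac)
  qed
  have 1: "((\<lambda>u. (a' * fst u + b') * cnj (x * fst u + y) + a' * cnj x * of_real ((snd u)\<^sup>2)) has_derivative dN) (at u)"
    unfolding dN_def[abs_def] W_def w_def x'_def A_def V_def z_def
    by (rule derivative_eq_intros bounded_linear.has_derivative[OF bounded_linear_cnj] refl)+ (simp add: algebra_simps)
  have 2: "((\<lambda>u. complex_of_real (eta_den u x y)) has_derivative (\<lambda>h. of_real (dQ h))) (at u)"
    unfolding dQ_def by (rule has_derivative_of_real[OF has_derivative_Qf_aux])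
  define N where "N = A * W + a' * x' * V\<^sup>2"
  have "((\<lambda>u. fst (gact a' b' x y u)) has_derivative (\<lambda>h. (dN h * q - N * of_real (dQ h)) / (q * q))) (at u)"
    unfolding gact_simps(1)
    using has_derivative_divide'[OF 1 2] q0
    unfolding q_def[symmetric] N_def A_def W_def w_def x'_def V_def z_def by simp
  moreover have "(dN h * q - N * of_real (dQ h)) / (q * q) = ((cnj (x * fst u + y))\<^sup>2 * fst h - (cnj x * of_real (snd u))\<^sup>2 * cnj (fst h)
           + 2 * cnj (x * fst u + y) * cnj x * of_real (snd u) * of_real (snd h)) / (of_real (eta_den u x y))\<^sup>2" for h
  proof -
    define H where "H = fst h" define H' where "H' = cnj H" define k where "k = complex_of_real (snd h)"
    have "a' * w - A * x = 1" unfolding w_def A_def using det by algebra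
    then have "(a' * H * W + A * (x' * H') + 2 * a' * x' * V * k) * q - N * (W * x * H + w * x' * H' + 2 * x * x' * V * k)
       = W\<^sup>2 * H - (x' * V)\<^sup>2 * H' + 2 * W * x' * V * k"
      unfolding q N_def by algebra
    then show ?thesis
      unfolding dQc dN_def H_def H'_def k_def q_def[symmetric] W_def w_def x'_def V_def z_def
      by (simp add: power2_eq_square)
  qed
  ultimately show ?thesis by simp
qed

lemma gact_differentiable:
  assumes v: "snd u > 0" and det: "a * d - b * c = 1"
  shows "\<exists>D. (gact a b c d has_derivative D) (at u)"
proof -
  obtain D1 where D1: "((\<lambda>u. fst (gact a b c d u)) has_derivative D1) (at u)"
    using fst_gact_derivative[OF v det] by blast
  have "eta_den u c d \<noteq> 0" using eta_den_pos'[OF v row_nz[OF det]] by simp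
  then obtain D2 where D2: "((\<lambda>u. snd (gact a b c d u)) has_derivative D2) (at u)"
    unfolding gact_simps(2)
    using has_derivative_divide'[OF has_derivative_snd[OF has_derivative_ident] has_derivative_Qf_aux[of c d u UNIV]] by auto
  have "((\<lambda>u. (fst (gact a b c d u), snd (gact a b c d u))) has_derivative (\<lambda>h. (D1 h, D2 h))) (at u)"
    by (rule has_derivative_Pair[OF D1 D2])
  then show ?thesis by auto
qed

text \<open>The coefficient form of \<open>\<eta>\<close> at the row \<open>(x, y)\<close> is the differential of \<open>u \<mapsto> z(M u)\<close> for any
  \<open>M \<in> SL\<^sub>2(\<complex>)\<close> with bottom row \<open>(x, y)\<close>, so its equivariance is the chain rule.\<close>

lemma form_equivariance:
  assumes v: "snd u > 0" and det: "a * d - b * c = 1" and D: "(gact a b c d has_derivative D) (at u)"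
    and xy: "x \<noteq> 0 \<or> y \<noteq> 0"
  shows "((cnj (x * fst (gact a b c d u) + y))\<^sup>2 * fst (D h) - (cnj x * of_real (snd (gact a b c d u)))\<^sup>2 * cnj (fst (D h))
           + 2 * cnj (x * fst (gact a b c d u) + y) * cnj x * of_real (snd (gact a b c d u)) * of_real (snd (D h))) / (of_real (eta_den (gact a b c d u) x y))\<^sup>2
     = ((cnj ((x * a + y * c) * fst u + (x * b + y * d)))\<^sup>2 * fst h - (cnj (x * a + y * c) * of_real (snd u))\<^sup>2 * cnj (fst h)
           + 2 * cnj ((x * a + y * c) * fst u + (x * b + y * d)) * cnj (x * a + y * c) * of_real (snd u) * of_real (snd h)) / (of_real (eta_den u (x * a + y * c) (x * b + y * d)))\<^sup>2"
proof -
  \<comment> \<open>Any nonzero row can be completed to a complex matrix of determinant one; the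
    choice does not affect the differential.\<close>
  obtain a' b' where det': "a' * y - b' * x = 1"
  proof (cases "x = 0")
    case True
    then show ?thesis using xy that[of "1/y" 0] by simp
  next
    case False
    then show ?thesis using that[of 0 "-1/x"] by simp
  qed
  have det2: "(a' * a + b' * c) * (x * b + y * d) - (a' * b + b' * d) * (x * a + y * c) = 1"
    using det det' by algebra
  have v': "snd (gact a b c d u) > 0" by (rule gact_snd_pos[OF v det])
  note d1 = has_derivative_compose[OF D fst_gact_derivative[OF v' det']]
  note d2 = fst_gact_derivative[OF v det2]
  have op: "open {u :: complex \<times> real. snd u > 0}"
    by (intro open_Collect_less continuous_intros)
  have "((\<lambda>u. fst (gact a' b' x y (gact a b c d u))) has_derivative
     (\<lambda>h. ((cnj ((x * a + y * c) * fst u + (x * b + y * d)))\<^sup>2 * fst h - (cnj (x * a + y * c) * of_real (snd u))\<^sup>2 * cnj (fst h)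
           + 2 * cnj ((x * a + y * c) * fst u + (x * b + y * d)) * cnj (x * a + y * c) * of_real (snd u) * of_real (snd h)) / (of_real (eta_den u (x * a + y * c) (x * b + y * d)))\<^sup>2)) (at u)"
    by (rule has_derivative_transform_within_open[OF d2 op]) (use v gact_fst_comp[OF _ det] in auto)
  from has_derivative_unique[OF d1 this] show ?thesis by meson
qed

section \<open>The full Eisenstein form and its primitive\<close>

context lattice
begin

definition ThI :: "complex \<times> real \<Rightarrow> complex \<Rightarrow> complex \<Rightarrow> complex \<Rightarrow> real \<Rightarrow> complex" where
  "ThI u \<alpha> \<beta> \<gamma> = thsum I4 (Pf u \<alpha> \<beta> \<gamma>) (Qf u)"

definition VI :: "complex \<times> real \<Rightarrow> complex \<Rightarrow> complex \<Rightarrow> complex \<Rightarrow> complex" where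
  "VI u \<alpha> \<beta> \<gamma> = integral {0<..} (\<lambda>t. of_real t * ThI u \<alpha> \<beta> \<gamma> t)"

text \<open>For rows \<open>(0, y)\<close> one has \<open>Qf = (cmod y)^2\<close>, and only the dz
  numerator survives; they sum to the theta series behind G_2.\<close>

lemma ThI_eq:
  assumes v: "v > 0" and t: "t > 0"
  shows "ThI (z, v) \<alpha> \<beta> \<gamma> t = ThJ (z, v) \<alpha> \<beta> \<gamma> t + \<alpha> * th 2 0 t"
proof -
  define F where "F p = Pf (z, v) \<alpha> \<beta> \<gamma> p * complex_of_real (exp (-(t * Qf (z, v) p)))" for p
  obtain \<delta> where r: "theta_data I4 (Pf (z, v) \<alpha> \<beta> \<gamma>) (Qf (z, v)) \<delta> 4" by (rule Pf_data[OF v order_refl])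
  have s: "F summable_on I4" unfolding F_def using theta_data.term_summable[OF r t] .
  have I: "I4 = J \<union> Pair 0 ` (L - {0})" "J \<inter> Pair 0 ` (L - {0}) = {}"
    using zero_in by (auto simp: I4_def J_def)
  have "infsum F I4 = infsum F J + infsum F (Pair 0 ` (L - {0}))"
    unfolding I(1) using s I
    by (intro infsum_Un_disjoint) (auto intro: summable_on_subset_banach)
  also have "infsum F (Pair 0 ` (L - {0})) = (\<Sum>\<^sub>\<infinity>y\<in>L-{0}. F (0, y))"
    by (subst infsum_reindex) (auto simp: inj_on_def o_def)
  also have "\<dots> = (\<Sum>\<^sub>\<infinity>y\<in>L. \<alpha> * (cnj (0 + y) ^ 2 * of_real (exp (-(t * (cmod (0 + y))\<^sup>2)))))"
    by (rule infsum_cong_neutral) (auto simp: F_def Pf_def Qf_def eta_den_def)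
  also have "\<dots> = \<alpha> * th 2 0 t" unfolding th_def by (rule infsum_cmult_right')
  finally show ?thesis unfolding ThI_def ThJ_def thsum_def F_def .
qed

lemma ThI_theta_rapid:
  assumes v: "v > 0"
  obtains \<delta> where "theta_rapid I4 (Pf (z, v) \<alpha> \<beta> \<gamma>) (Qf (z, v)) \<delta> 4"
proof -
  obtain \<delta> where "theta_data I4 (Pf (z, v) \<alpha> \<beta> \<gamma>) (Qf (z, v)) \<delta> 4" by (rule Pf_data[OF v order_refl])
  moreover have "\<exists>C. \<forall>t. 0 < t \<and> t \<le> 1 \<longrightarrow> norm (thsum I4 (Pf (z, v) \<alpha> \<beta> \<gamma>) (Qf (z, v)) t) \<le> C * t ^ N" for N
  proof -
    obtain C where C: "\<And>z' v' \<alpha> \<beta> \<gamma> t. v \<le> v' \<Longrightarrow> v' \<le> v \<Longrightarrow> 0 < t \<Longrightarrow> t \<le> 1 \<Longrightarrow> norm (ThJ (z', v') \<alpha> \<beta> \<gamma> t) \<le> C * (cmod \<alpha> + cmod \<beta> + cmod \<gamma>) * t ^ N"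
      by (rule ThJ_rapid[OF v, of v N]) (rule that; blast)
    obtain C' where C': "\<And>w t. 0 < t \<Longrightarrow> norm (th 2 w t) \<le> C' * t ^ N"
      by (rule th_rapid[of N]) (rule that; blast)
    have "norm (ThI (z, v) \<alpha> \<beta> \<gamma> t) \<le> (C * (cmod \<alpha> + cmod \<beta> + cmod \<gamma>) + cmod \<alpha> * C') * t ^ N" if t: "0 < t" "t \<le> 1" for t
    proof -
      have "norm (ThI (z, v) \<alpha> \<beta> \<gamma> t) \<le> norm (ThJ (z, v) \<alpha> \<beta> \<gamma> t) + cmod \<alpha> * norm (th 2 0 t)"
        unfolding ThI_eq[OF v t(1)] norm_mult[symmetric] by (rule norm_triangle_ineq)
      also have "\<dots> \<le> C * (cmod \<alpha> + cmod \<beta> + cmod \<gamma>) * t ^ N + cmod \<alpha> * (C' * t ^ N)"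
        using t by (intro add_mono mult_left_mono C C') auto
      finally show ?thesis by (simp add: algebra_simps)
    qed
    then show ?thesis unfolding ThI_def by blast
  qed
  ultimately show ?thesis
    by (intro that[of \<delta>]) (simp add: theta_rapid_def theta_rapid_axioms_def)
qed

lemma tThI_integrable:
  assumes v: "v > 0" shows "(\<lambda>t. of_real t * ThI (z, v) \<alpha> \<beta> \<gamma> t) absolutely_integrable_on {0<..}"
proof -
  obtain \<delta> where r: "theta_rapid I4 (Pf (z, v) \<alpha> \<beta> \<gamma>) (Qf (z, v)) \<delta> 4" by (rule ThI_theta_rapid[OF v])
  show ?thesis unfolding ThI_def by (rule theta_rapid.theta_int1[OF r])
qed

lemma VI_eq:
  assumes v: "v > 0"
  shows "VI (z, v) \<alpha> \<beta> \<gamma> = VJ (z, v) \<alpha> \<beta> \<gamma> + \<alpha> * G2 L"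
proof -
  have i1: "(\<lambda>t. of_real t * ThJ (z, v) \<alpha> \<beta> \<gamma> t) integrable_on {0<..}"
    using tThJ_integrable[OF v] by (auto simp: absolutely_integrable_on_def)
  have i2: "(\<lambda>t. of_real t * th 2 0 t) integrable_on {0<..}"
    using th_integrable(2)[of 2 0] by (auto simp: absolutely_integrable_on_def)
  have "VI (z, v) \<alpha> \<beta> \<gamma> = integral {0<..} (\<lambda>t. of_real t * ThJ (z, v) \<alpha> \<beta> \<gamma> t + \<alpha> * (of_real t * th 2 0 t))"
    unfolding VI_def by (intro integral_cong) (simp add: ThI_eq[OF v] algebra_simps)
  also have "\<dots> = integral {0<..} (\<lambda>t. of_real t * ThJ (z, v) \<alpha> \<beta> \<gamma> t) + integral {0<..} (\<lambda>t. \<alpha> * (of_real t * th 2 0 t))"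
    using i1 i2 by (intro integral_add integrable_on_mult_right)
  finally show ?thesis unfolding VJ_def G2_eq by simp
qed

text \<open>The period integral is assembled from three coefficient functions, whereas the
  derivative of the primitive is the form applied to one tangent vector. Linearity joins the
  two.\<close>

lemma VI_linear:
  assumes v: "v > 0"
  shows "VI (z, v) 1 0 0 * \<alpha> + VI (z, v) 0 1 0 * \<beta> + VI (z, v) 0 0 1 * \<gamma> = VI (z, v) \<alpha> \<beta> \<gamma>"
proof -
  have i: "(\<lambda>t. of_real t * ThI (z, v) \<alpha> \<beta> \<gamma> t) integrable_on {0<..}" for \<alpha> \<beta> \<gamma>
    using tThI_integrable[OF v] by (auto simp: absolutely_integrable_on_def)
  have s: "(\<lambda>p. Pf (z, v) \<alpha> \<beta> \<gamma> p * complex_of_real (exp (-(t * Qf (z, v) p)))) summable_on I4" if "t > 0" for \<alpha> \<beta> \<gamma> t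
  proof -
    obtain \<delta> where r: "theta_data I4 (Pf (z, v) \<alpha> \<beta> \<gamma>) (Qf (z, v)) \<delta> 4" by (rule Pf_data[OF v order_refl])
    show ?thesis using theta_data.term_summable[OF r that] .
  qed
  have lin: "ThI (z, v) \<alpha> \<beta> \<gamma> t = ThI (z, v) 1 0 0 t * \<alpha> + ThI (z, v) 0 1 0 t * \<beta> + ThI (z, v) 0 0 1 t * \<gamma>" if t: "t > 0" for t
  proof -
    have "ThI (z, v) \<alpha> \<beta> \<gamma> t = (\<Sum>\<^sub>\<infinity>p\<in>I4. Pf (z, v) 1 0 0 p * of_real (exp (-(t * Qf (z, v) p))) * \<alpha>
       + Pf (z, v) 0 1 0 p * of_real (exp (-(t * Qf (z, v) p))) * \<beta> + Pf (z, v) 0 0 1 p * of_real (exp (-(t * Qf (z, v) p))) * \<gamma>)"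
      unfolding ThI_def thsum_def by (intro infsum_cong) (simp add: Pf_def algebra_simps)
    also have "\<dots> = ThI (z, v) 1 0 0 t * \<alpha> + ThI (z, v) 0 1 0 t * \<beta> + ThI (z, v) 0 0 1 t * \<gamma>"
      unfolding ThI_def thsum_def infsum_cmult_left'[symmetric]
      by (simp only: infsum_add[OF summable_on_add[OF summable_on_cmult_left[OF s[OF t]] summable_on_cmult_left[OF s[OF t]]] summable_on_cmult_left[OF s[OF t]]]
          infsum_add[OF summable_on_cmult_left[OF s[OF t]] summable_on_cmult_left[OF s[OF t]]])
    finally show ?thesis .
  qed
  have "VI (z, v) \<alpha> \<beta> \<gamma> = integral {0<..} (\<lambda>t. of_real t * ThI (z, v) 1 0 0 t * \<alpha> + of_real t * ThI (z, v) 0 1 0 t * \<beta> + of_real t * ThI (z, v) 0 0 1 t * \<gamma>)"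
    unfolding VI_def by (intro integral_cong) (simp add: lin algebra_simps)
  also have "\<dots> = integral {0<..} (\<lambda>t. of_real t * ThI (z, v) 1 0 0 t * \<alpha>) + integral {0<..} (\<lambda>t. of_real t * ThI (z, v) 0 1 0 t * \<beta>) + integral {0<..} (\<lambda>t. of_real t * ThI (z, v) 0 0 1 t * \<gamma>)"
    using i by (simp add: integral_add integrable_add integrable_on_mult_left)
  finally show ?thesis by (simp add: VI_def)
qed

text \<open>The exponent \<open>2 + s\<close> of \<open>\<eta>\<close> places the value at
  \<open>s = 0\<close> at the point 2 of \<open>mellin_entire\<close>. The powers of
  \<open>ideal_norm m L\<close> and \<open>v\<close> are entire in \<open>s\<close> and equal 1 at
  \<open>s = 0\<close> because the bases are nonzero; \<open>0 powr 0\<close> would be 0.\<close>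

lemma Ehat_coeff_eq:
  assumes v: "v > 0" and N: "ideal_norm m L \<noteq> 0"
    and eta: "\<And>x y s. eta (z, v) x y s = complex_of_real v powr s * Pf (z, v) \<alpha> \<beta> \<gamma> (x, y) / complex_of_real (eta_den (z, v) x y) powr (2 + s)"
  shows "Ehat_coeff eta m chi L (z, v) = inverse (chi L) * VI (z, v) \<alpha> \<beta> \<gamma>"
proof -
  obtain \<delta> where r: "theta_rapid I4 (Pf (z, v) \<alpha> \<beta> \<gamma>) (Qf (z, v)) \<delta> 4" by (rule ThI_theta_rapid[OF v])
  interpret theta_rapid I4 "Pf (z, v) \<alpha> \<beta> \<gamma>" "Qf (z, v)" \<delta> 4 by (rule r)
  obtain f where f: "f holomorphic_on UNIV"
    "\<And>s. Re s > 0 \<Longrightarrow> (\<lambda>p. norm (Pf (z, v) \<alpha> \<beta> \<gamma> p) * Qf (z, v) p powr (- Re s)) summable_on I4 \<Longrightarrow>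
        f s = (\<Sum>\<^sub>\<infinity>p\<in>I4. Pf (z, v) \<alpha> \<beta> \<gamma> p * of_real (Qf (z, v) p) powr (-s))"
    "f 2 = integral {0<..} (\<lambda>t. of_real t * thsum I4 (Pf (z, v) \<alpha> \<beta> \<gamma>) (Qf (z, v)) t)"
    using mellin_entire by blast
  define g where "g s = inverse (chi L) * complex_of_real (ideal_norm m L) powr s * (complex_of_real v powr s * f (2 + s))" for s
  have "Ehat_coeff eta m chi L (z, v) = g 0"
    unfolding Ehat_coeff_def
  proof (rule acont0_eqI)
    have "(f \<circ> (\<lambda>s. 2 + s)) holomorphic_on UNIV"
      by (rule holomorphic_on_compose) (auto intro!: holomorphic_intros intro: holomorphic_on_subset[OF f(1)])
    then have "(\<lambda>s. f (2 + s)) holomorphic_on UNIV" by (simp add: o_def)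
    then show "g holomorphic_on UNIV"
      unfolding g_def[abs_def] using N v by (intro holomorphic_intros) auto
    fix s :: complex assume s: "1 < Re s"
    have "complex_of_real v powr s * f (2 + s) = (\<Sum>\<^sub>\<infinity>p\<in>I4. complex_of_real v powr s * (Pf (z, v) \<alpha> \<beta> \<gamma> p * of_real (Qf (z, v) p) powr (-(2 + s))))"
      by (subst f(2)) (use s Pf_summable[OF v, of "Re (2 + s)"] in \<open>auto simp: infsum_cmult_right'\<close>)
    also have "\<dots> = (\<Sum>\<^sub>\<infinity>p\<in>I4. case p of (c, d) \<Rightarrow> eta (z, v) c d s)"
      by (intro infsum_cong) (auto simp: eta Qf_def powr_minus divide_inverse simp flip: powr_minus)
    finally show "g s = inverse (chi L) * complex_of_real (ideal_norm m L) powr s * (\<Sum>\<^sub>\<infinity>(c, d)\<in>L \<times> L - {(0, 0)}. eta (z, v) c d s)"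
      unfolding g_def I4_def by simp
  qed
  then show ?thesis using N v by (simp add: g_def f(3) VI_def ThI_def)
qed

lemma Ehat_coeff_eqs:
  assumes v: "v > 0" and N: "ideal_norm m L \<noteq> 0"
  shows "Ehat_coeff eta1 m chi L (z, v) = inverse (chi L) * VI (z, v) 1 0 0"
    "Ehat_coeff eta2 m chi L (z, v) = inverse (chi L) * VI (z, v) 0 1 0"
    "Ehat_coeff eta3 m chi L (z, v) = inverse (chi L) * VI (z, v) 0 0 1"
  by (rule Ehat_coeff_eq[OF v N]; simp add: eta1_def eta2_def eta3_def Pf_def)+

text \<open>The linear term accounts for the rows with \<open>x = 0\<close>, and the
  conjugate-linear one cancels the surplus in the derivative of \<open>H0\<close>.\<close>

definition Hprim :: "complex \<times> real \<Rightarrow> complex" where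
  "Hprim u = H0 u + G2 L * fst u - c0 * N0 * cnj (fst u)"

lemma Hprim_derivative:
  assumes v: "snd u > 0"
  shows "(Hprim has_derivative (\<lambda>h. VI u (fst h) (cnj (fst h)) (of_real (snd h)))) (at u)"
proof -
  obtain z v where u: "u = (z, v)" by force
  have v0: "v > 0" using v u by simp
  have "(Hprim has_derivative (\<lambda>h. (VJ u (fst h) (cnj (fst h)) (of_real (snd h)) + cnj (fst h) * (c0 * N0)) + G2 L * fst h - c0 * N0 * cnj (fst h))) (at u)"
    unfolding Hprim_def[abs_def] u
    by (rule derivative_eq_intros H0_derivative[OF v0] bounded_linear.has_derivative[OF bounded_linear_cnj] refl)+ simp
  then show ?thesis unfolding u VI_eq[OF v0] by (simp add: algebra_simps)
qed

lemma Ehat_gamma_eq: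
  assumes v: "v0 > 0" and N: "ideal_norm m L \<noteq> 0" and det: "a * d - b * c = 1"
  shows "Ehat_gamma m chi L (z0, v0) a b c d = inverse (chi L) * (Hprim (gact a b c d (z0, v0)) - Hprim (z0, v0))"
proof -
  define u1 where "u1 = gact a b c d (z0, v0)"
  define dz where "dz = fst u1 - z0" define dv where "dv = snd u1 - v0"
  define p where "p t = (z0 + complex_of_real t * dz, v0 + t * dv)" for t
  have v1: "snd u1 > 0" unfolding u1_def using gact_snd_pos[of "(z0, v0)"] v det by simp
  have vt: "v0 + t * dv > 0" if "t \<in> {0..1}" for t
  proof -
    \<comment> \<open>The height on the segment is a convex combination of two positive heights, so
      the segment stays inside the half-space.\<close>
    have "v0 + t * dv = (1 - t) * v0 + t * snd u1" by (simp add: dv_def algebra_simps)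
    also have "\<dots> > 0"
    proof (cases "t = 0")
      case False
      then show ?thesis using that v v1 by (intro add_nonneg_pos) auto
    qed (use v in auto)
    finally show ?thesis .
  qed
  have V: "VI (p t) \<alpha> \<beta> \<gamma> = VI (p t) 1 0 0 * \<alpha> + VI (p t) 0 1 0 * \<beta> + VI (p t) 0 0 1 * \<gamma>" if "t \<in> {0..1}" for t \<alpha> \<beta> \<gamma>
    unfolding p_def by (rule VI_linear[OF vt[OF that], symmetric])
  have der: "((\<lambda>t. Hprim (p t)) has_vector_derivative VI (p t) dz (cnj dz) (of_real dv)) (at t within {0..1})" if t: "t \<in> {0..1}" for t
  proof -
    have "(p has_derivative (\<lambda>h. (complex_of_real h * dz, h * dv))) (at t within {0..1})"
      unfolding p_def[abs_def] by (intro has_derivative_Pair) (auto intro!: derivative_eq_intros)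
    moreover have "snd (p t) > 0" using vt[OF t] by (simp add: p_def)
    ultimately have "((\<lambda>t. Hprim (p t)) has_derivative (\<lambda>h. VI (p t) (complex_of_real h * dz) (cnj (complex_of_real h * dz)) (of_real (h * dv)))) (at t within {0..1})"
      using has_derivative_compose[OF _ Hprim_derivative] by fastforce
    moreover have "VI (p t) (complex_of_real h * dz) (cnj (complex_of_real h * dz)) (of_real (h * dv)) = h *\<^sub>R VI (p t) dz (cnj dz) (of_real dv)" for h
      unfolding V[OF t, of "complex_of_real h * dz" "cnj (complex_of_real h * dz)" "of_real (h * dv)"] V[OF t, of dz "cnj dz" "of_real dv"]
      by (simp add: scaleR_conv_of_real algebra_simps)
    ultimately show ?thesis unfolding has_vector_derivative_def by simp
  qed
  have "((\<lambda>t. VI (p t) dz (cnj dz) (of_real dv)) has_integral (Hprim (p 1) - Hprim (p 0))) {0..1}"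
    by (rule fundamental_theorem_of_calculus) (use der in auto)
  then have "((\<lambda>t. inverse (chi L) * VI (p t) dz (cnj dz) (of_real dv)) has_integral inverse (chi L) * (Hprim (p 1) - Hprim (p 0))) {0..1}"
    by (rule has_integral_mult_right)
  then have "((\<lambda>t. Ehat_coeff eta1 m chi L (p t) * dz + Ehat_coeff eta2 m chi L (p t) * cnj dz + Ehat_coeff eta3 m chi L (p t) * complex_of_real dv) has_integral inverse (chi L) * (Hprim (p 1) - Hprim (p 0))) {0..1}"
  proof (rule has_integral_eq[rotated])
    fix t :: real assume t: "t \<in> {0..1}"
    show "inverse (chi L) * VI (p t) dz (cnj dz) (of_real dv) = Ehat_coeff eta1 m chi L (p t) * dz + Ehat_coeff eta2 m chi L (p t) * cnj dz + Ehat_coeff eta3 m chi L (p t) * complex_of_real dv"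
      unfolding V[OF t, of dz "cnj dz" "of_real dv"] unfolding p_def Ehat_coeff_eqs[OF vt[OF t] N]
      by (simp add: algebra_simps)
  qed
  then have "integral {0..1} (\<lambda>t. Ehat_coeff eta1 m chi L (p t) * dz + Ehat_coeff eta2 m chi L (p t) * cnj dz + Ehat_coeff eta3 m chi L (p t) * complex_of_real dv) = inverse (chi L) * (Hprim (p 1) - Hprim (p 0))"
    by (rule integral_unique)
  moreover have "p 1 = u1" "p 0 = (z0, v0)" by (simp_all add: p_def dz_def dv_def)
  ultimately show ?thesis
    unfolding Ehat_gamma_def Let_def u1_def[symmetric] fst_conv snd_conv dz_def[symmetric] dv_def[symmetric] p_def by simp
qed

end

section \<open>Boundary values of the primitive\<close>

lemma infsum_partition:
  fixes F :: "'a \<Rightarrow> 'b::banach"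
  assumes "finite P" "\<And>X Y. X \<in> P \<Longrightarrow> Y \<in> P \<Longrightarrow> X \<noteq> Y \<Longrightarrow> X \<inter> Y = {}" "F summable_on \<Union>P"
  shows "infsum F (\<Union>P) = (\<Sum>X\<in>P. infsum F X)"
  using assms
proof (induction P rule: finite_induct)
  case (insert X P)
  have s: "F summable_on X" "F summable_on \<Union>P"
    using insert.prems(2) by (auto intro: summable_on_subset_banach)
  have "X \<inter> \<Union>P = {}" using insert.prems(1) insert.hyps(2) by blast
  then have "infsum F (X \<union> \<Union>P) = infsum F X + infsum F (\<Union>P)"
    using s by (intro infsum_Un_disjoint)
  then show ?case using insert s by simp
qed simp

text \<open>Half of the exponent is spent on the polynomial: \<open>exp_minus_le_powr\<close> with
  exponent 3 at \<open>s/2 * (1 + t)\<close>. The other half is kept as an integrable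
  majorant.\<close>

lemma poly_exp_bound:
  fixes s t :: real
  assumes s: "s > 0" and t: "t > 0"
  shows "(1 + t) ^ 3 * exp (-(s * t)) \<le> 27 * (2/s) ^ 3 * exp (s/2) * exp (-(s/2 * t))"
proof -
  have "exp (-(s/2 * (1 + t))) \<le> 3 powr 3 * (s/2 * (1 + t)) powr (-3)"
    using s t by (intro exp_minus_le_powr) auto
  also have "\<dots> = 27 * ((2/s) ^ 3 / (1 + t) ^ 3)"
    using s t by (simp add: powr_minus powr_numeral powr_mult power_divide divide_simps)
  finally have "(1 + t) ^ 3 * exp (-(s/2 * (1 + t))) \<le> (1 + t) ^ 3 * (27 * ((2/s) ^ 3 / (1 + t) ^ 3))"
    using t by (intro mult_left_mono) auto
  also have "\<dots> = 27 * (2/s) ^ 3" using t by simp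
  finally have "(1 + t) ^ 3 * exp (-(s/2 * (1 + t))) * (exp (s/2) * exp (-(s/2 * t))) \<le> 27 * (2/s) ^ 3 * (exp (s/2) * exp (-(s/2 * t)))"
    by (rule mult_right_mono) simp
  moreover have e2: "exp (-(s/2 * (1 + t))) * (exp (s/2) * exp (-(s/2 * t))) = exp (-(s * t))"
    by (simp add: field_simps flip: exp_add)
  ultimately show ?thesis by (simp only: mult.assoc e2)
qed

context lattice
begin

text \<open>Right multiplication of rows by the matrix permutes \<open>I4\<close>, because its
  entries preserve \<open>L\<close>. Under it \<open>Qf\<close> is scaled by \<open>1/dn\<close> and
  the numerators by \<open>1/dn^2\<close>, and the substitution of \<open>t/dn\<close> for
  \<open>t\<close> in the integral of \<open>t * ThI\<close> absorbs both factors.\<close>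

lemma VI_equivariance:
  assumes v: "snd u > 0" and det: "a * d - b * c = 1" and D: "(gact a b c d has_derivative D) (at u)"
    and mul: "\<And>x. x \<in> L \<Longrightarrow> a * x \<in> L" "\<And>x. x \<in> L \<Longrightarrow> b * x \<in> L" "\<And>x. x \<in> L \<Longrightarrow> c * x \<in> L" "\<And>x. x \<in> L \<Longrightarrow> d * x \<in> L"
  shows "VI (gact a b c d u) (fst (D h)) (cnj (fst (D h))) (of_real (snd (D h))) = VI u (fst h) (cnj (fst h)) (of_real (snd h))"
proof -
  obtain z w where u: "u = (z, w)" by force
  define g where "g = gact a b c d u"
  define dn where "dn = eta_den u c d"
  have dn: "dn > 0" unfolding dn_def by (rule eta_den_pos'[OF v row_nz[OF det]])
  define \<sigma> where "\<sigma> = (\<lambda>(x, y). (x * a + y * c, x * b + y * d))"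
  have nz\<sigma>: "x * a + y * c \<noteq> 0 \<or> x * b + y * d \<noteq> 0" if "x \<noteq> 0 \<or> y \<noteq> 0" for x y
  proof (rule ccontr)
    assume "\<not> ?thesis"
    then have "x * a + y * c = 0" "x * b + y * d = 0" by auto
    then have "x = 0" "y = 0" using det by algebra+
    then show False using that by auto
  qed
  have bij: "bij_betw \<sigma> I4 I4"
  proof (rule bij_betwI[of _ _ _ "\<lambda>(x, y). (x * d - y * c, y * a - x * b)"])
    show "\<sigma> \<in> I4 \<rightarrow> I4"
    proof
      fix p assume p: "p \<in> I4"
      obtain x y where xy: "p = (x, y)" by force
      have m: "x \<in> L" "y \<in> L" "x \<noteq> 0 \<or> y \<noteq> 0" using p by (auto simp: I4_def xy)
      have "x * a + y * c \<in> L" "x * b + y * d \<in> L"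
        using add_in[OF mul(1)[OF m(1)] mul(3)[OF m(2)]] add_in[OF mul(2)[OF m(1)] mul(4)[OF m(2)]]
        by (simp_all add: mult.commute)
      then show "\<sigma> p \<in> I4" using nz\<sigma>[OF m(3)] by (auto simp: I4_def \<sigma>_def xy)
    qed
    show "(\<lambda>(x, y). (x * d - y * c, y * a - x * b)) \<in> I4 \<rightarrow> I4"
    proof
      fix p assume p: "p \<in> I4"
      obtain x y where xy: "p = (x, y)" by force
      have m: "x \<in> L" "y \<in> L" "x \<noteq> 0 \<or> y \<noteq> 0" using p by (auto simp: I4_def xy)
      have "x * d - y * c \<in> L" "y * a - x * b \<in> L"
        using diff_in[OF mul(4)[OF m(1)] mul(3)[OF m(2)]] diff_in[OF mul(1)[OF m(2)] mul(2)[OF m(1)]]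
        by (simp_all add: mult.commute)
      moreover have "x * d - y * c \<noteq> 0 \<or> y * a - x * b \<noteq> 0"
      proof (rule ccontr)
        assume "\<not> ?thesis"
        then have "x * d - y * c = 0" "y * a - x * b = 0" by auto
        then have "x = 0" "y = 0" using det by algebra+
        then show False using m by auto
      qed
      ultimately show "(\<lambda>(x, y). (x * d - y * c, y * a - x * b)) p \<in> I4"
        by (auto simp: I4_def xy)
    qed
    show "(case \<sigma> p of (x, y) \<Rightarrow> (x * d - y * c, y * a - x * b)) = p" for p
    proof -
      obtain x y where xy: "p = (x, y)" by force
      have "(x * a + y * c) * d - (x * b + y * d) * c = x" "(x * b + y * d) * a - (x * a + y * c) * b = y"
        using det by algebra+
      then show ?thesis by (simp add: xy \<sigma>_def)
    qed
    show "\<sigma> (case p of (x, y) \<Rightarrow> (x * d - y * c, y * a - x * b)) = p" for p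
    proof -
      obtain x y where xy: "p = (x, y)" by force
      have "(x * d - y * c) * a + (y * a - x * b) * c = x" "(x * d - y * c) * b + (y * a - x * b) * d = y"
        using det by algebra+
      then show ?thesis by (simp add: xy \<sigma>_def)
    qed
  qed
  have Q: "Qf g p = Qf u (\<sigma> p) / dn" for p
    unfolding Qf_def g_def dn_def \<sigma>_def case_prod_unfold fst_conv snd_conv by (rule gact_eta_den[OF v det])
  have P: "Pf g (fst (D h)) (cnj (fst (D h))) (of_real (snd (D h))) p = Pf u (fst h) (cnj (fst h)) (of_real (snd h)) (\<sigma> p) / (of_real dn)\<^sup>2"
    if p: "p \<in> I4" for p
  proof -
    obtain x y where xy: "p = (x, y)" by force
    have nz: "x \<noteq> 0 \<or> y \<noteq> 0" using p by (auto simp: I4_def xy)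
    note nz' = nz\<sigma>[OF nz]
    have q0: "Qf u (\<sigma> p) > 0" unfolding Qf_def \<sigma>_def xy using eta_den_pos'[OF v nz'] by simp
    have "Pf g (fst (D h)) (cnj (fst (D h))) (of_real (snd (D h))) p / (of_real (Qf g p))\<^sup>2
        = Pf u (fst h) (cnj (fst h)) (of_real (snd h)) (\<sigma> p) / (of_real (Qf u (\<sigma> p)))\<^sup>2"
      using form_equivariance[OF v det D nz, of h]
      unfolding Pf_def Qf_def g_def[symmetric] \<sigma>_def xy by (simp add: mult_ac)
    then show ?thesis using q0 dn unfolding Q by (simp add: field_simps power2_eq_square)
  qed
  have Th: "ThI g (fst (D h)) (cnj (fst (D h))) (of_real (snd (D h))) t = ThI u (fst h) (cnj (fst h)) (of_real (snd h)) (t / dn) / (of_real dn)\<^sup>2" for t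
  proof -
    have "ThI g (fst (D h)) (cnj (fst (D h))) (of_real (snd (D h))) t
       = (\<Sum>\<^sub>\<infinity>p\<in>I4. (\<lambda>p. Pf u (fst h) (cnj (fst h)) (of_real (snd h)) p * of_real (exp (-(t / dn * Qf u p))) / (of_real dn)\<^sup>2) (\<sigma> p))"
      unfolding ThI_def thsum_def by (intro infsum_cong) (simp add: P Q)
    also have "\<dots> = (\<Sum>\<^sub>\<infinity>p\<in>I4. Pf u (fst h) (cnj (fst h)) (of_real (snd h)) p * of_real (exp (-(t / dn * Qf u p))) / (of_real dn)\<^sup>2)"
      by (rule infsum_reindex_bij_betw[OF bij])
    finally show ?thesis unfolding ThI_def thsum_def by (simp add: divide_inverse infsum_cmult_left')
  qed
  define f where "f t = of_real t * ThI u (fst h) (cnj (fst h)) (of_real (snd h)) t" for t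
  have "f absolutely_integrable_on {0<..}" unfolding f_def u using v u by (intro tThI_integrable) auto
  then have "((\<lambda>t. f (1/dn * t)) has_integral integral {0<..} f / of_real (1/dn)) {0<..}"
    by (rule has_integral_scale_halfline) (use dn in auto)
  from has_integral_mult_right[OF this, of "of_real (1/dn)"]
  have "((\<lambda>t. of_real (1/dn) * f (1/dn * t)) has_integral integral {0<..} f) {0<..}"
    using dn by simp
  moreover have "of_real (1/dn) * f (1/dn * t) = of_real t * ThI g (fst (D h)) (cnj (fst (D h))) (of_real (snd (D h))) t" for t
    unfolding Th f_def using dn by (simp add: power2_eq_square)
  ultimately show ?thesis unfolding VI_def f_def[symmetric] g_def[symmetric] by (simp add: integral_unique)
qed

text \<open>By invariance of the form the difference has derivative zero, and the half-space is
  convex. The base point may therefore be sent to the boundary.\<close>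

lemma Hprim_cocycle_const:
  assumes det: "a * d - b * c = 1"
    and mul: "\<And>x. x \<in> L \<Longrightarrow> a * x \<in> L" "\<And>x. x \<in> L \<Longrightarrow> b * x \<in> L" "\<And>x. x \<in> L \<Longrightarrow> c * x \<in> L" "\<And>x. x \<in> L \<Longrightarrow> d * x \<in> L"
    and u: "snd u > 0" "snd u' > 0"
  shows "Hprim (gact a b c d u) - Hprim u = Hprim (gact a b c d u') - Hprim u'"
proof -
  define S where "S = (UNIV :: complex set) \<times> {0 :: real<..}"
  have S: "convex S" unfolding S_def by (intro convex_Times) auto
  have "((\<lambda>u. Hprim (gact a b c d u) - Hprim u) has_derivative (\<lambda>h. 0)) (at w within S)" if w: "w \<in> S" for w
  proof -
    have v: "snd w > 0" using w by (auto simp: S_def)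
    obtain D where D: "(gact a b c d has_derivative D) (at w)" using gact_differentiable[OF v det] by blast
    have "((\<lambda>u. Hprim (gact a b c d u) - Hprim u) has_derivative
      (\<lambda>h. VI (gact a b c d w) (fst (D h)) (cnj (fst (D h))) (of_real (snd (D h))) - VI w (fst h) (cnj (fst h)) (of_real (snd h)))) (at w)"
      by (rule has_derivative_diff[OF has_derivative_compose[OF D Hprim_derivative[OF gact_snd_pos[OF v det]]] Hprim_derivative[OF v]])
    moreover have "VI (gact a b c d w) (fst (D h)) (cnj (fst (D h))) (of_real (snd (D h))) = VI w (fst h) (cnj (fst h)) (of_real (snd h))" for h
      using VI_equivariance[OF v det D] mul by blast
    ultimately show ?thesis by (simp add: has_derivative_at_withinI)
  qed
  then have "\<exists>k. \<forall>w\<in>S. Hprim (gact a b c d w) - Hprim w = k"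
    by (rule has_derivative_zero_constant[OF S])
  moreover have "u \<in> S" "u' \<in> S" using u by (auto simp: S_def mem_Times_iff)
  ultimately show ?thesis by metis
qed

text \<open>Only \<open>x\<close> with \<open>cmod x \<ge> \<mu>\<close> occur, so the integrand
  tends to 0 pointwise as the height grows. The order 3 of flatness of \<open>th 1\<close> cancels
  the growth of the sum over \<open>x\<close> at \<open>t = 0\<close>, which leaves an integrable
  majorant.\<close>

lemma H0_at_cusp:
  assumes v: "filterlim v at_top sequentially"
  shows "(\<lambda>n. H0 (z, v n)) \<longlonglongrightarrow> 0"
proof -
  obtain \<mu> where \<mu>: "\<mu> > 0" "\<And>x. x \<in> L \<Longrightarrow> x \<noteq> 0 \<Longrightarrow> cmod x \<ge> \<mu>" by (rule L_min) (rule that; blast)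
  obtain C where C: "C \<ge> 0" "\<And>w t. 0 < t \<Longrightarrow> norm (th 1 w t) \<le> C * t ^ 3"
    by (rule th_rapid[of 3]) (rule that; blast)
  obtain Cw where Cw: "Cw \<ge> 0" "\<And>\<tau>. \<tau> > 0 \<Longrightarrow> (\<Sum>\<^sub>\<infinity>x\<in>L. (1 + (cmod x)\<^sup>2) * exp (-(\<tau> * (cmod x)\<^sup>2))) \<le> Cw * (1 + 1/\<tau>) ^ 3"
    by (rule infsum_exp_weight) (rule that; blast)
  define K where "K = 1/\<mu> * C * Cw"
  have K: "K \<ge> 0" unfolding K_def using \<mu> C Cw by simp
  define s where "s = \<mu>\<^sup>2"
  have s: "s > 0" using \<mu> by (simp add: s_def)
  have bd: "norm (Mth (z, w) t) \<le> K * (1 + t) ^ 3 * exp (-(s * t * (w\<^sup>2 - 1)))" if w: "w \<ge> 1" and t: "t > 0" for w t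
  proof -
    define E where "E = exp (-(s * t * (w\<^sup>2 - 1)))"
    have w1: "w\<^sup>2 \<ge> 1" using w by (simp add: one_le_power)
    \<comment> \<open>The Gaussian is split along \<open>w^2 = 1 + (w^2 - 1)\<close>: the first part
      makes the sum over \<open>x\<close> converge, the second is pulled out and tends to 0.\<close>
    have eq: "wt x w t * (- (1/x) * th 1 (x * z) t) = wt x 1 t * (of_real (exp (-(t * (cmod x)\<^sup>2 * (w\<^sup>2 - 1)))) * (- (1/x) * th 1 (x * z) t))" for x
      unfolding wt_def by (simp add: power_mult_distrib algebra_simps flip: of_real_mult exp_add)
    have g: "norm (of_real (exp (-(t * (cmod x)\<^sup>2 * (w\<^sup>2 - 1)))) * (- (1/x) * th 1 (x * z) t)) \<le> (E * (1/\<mu> * (C * t ^ 3))) * (1 + (cmod x)\<^sup>2)"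
      if x: "x \<in> L - {0}" for x
    proof -
      have xm: "\<mu> \<le> cmod x" using \<mu> x by auto
      then have "s \<le> (cmod x)\<^sup>2" unfolding s_def using \<mu> by (intro power_mono) auto
      then have "t * s * (w\<^sup>2 - 1) \<le> t * (cmod x)\<^sup>2 * (w\<^sup>2 - 1)" using t w1 by (intro mult_right_mono mult_left_mono) auto
      then have 1: "exp (-(t * (cmod x)\<^sup>2 * (w\<^sup>2 - 1))) \<le> E" by (simp add: E_def mult_ac)
      have "cmod x > 0" using xm \<mu>(1) by linarith
      then have 2: "1 / cmod x \<le> 1/\<mu>" using xm \<mu>(1) by (intro divide_left_mono) auto
      have "norm (of_real (exp (-(t * (cmod x)\<^sup>2 * (w\<^sup>2 - 1)))) * (- (1/x) * th 1 (x * z) t)) \<le> E * (1/\<mu> * (C * t ^ 3))"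
        unfolding norm_mult norm_minus_cancel norm_divide norm_one norm_of_real abs_exp_cancel
        using 1 2 C t \<mu>(1) by (intro mult_mono C(2)) (auto simp: E_def)
      also have "\<dots> = (E * (1/\<mu> * (C * t ^ 3))) * 1" by simp
      also have "\<dots> \<le> (E * (1/\<mu> * (C * t ^ 3))) * (1 + (cmod x)\<^sup>2)"
        using C t \<mu>(1) by (intro mult_left_mono) (auto simp: E_def)
      finally show ?thesis .
    qed
    have "norm (Mth (z, w) t) \<le> (E * (1/\<mu> * (C * t ^ 3))) * (\<Sum>\<^sub>\<infinity>x\<in>L. (1 + (cmod x)\<^sup>2) * exp (-(t * 1\<^sup>2 * (cmod x)\<^sup>2)))"
      unfolding Mth_eq[OF order.strict_trans2[OF zero_less_one w] t] eq
      by (rule wt_sum(2)[OF zero_less_one order_refl t L0_sub _ g]) (use C t \<mu>(1) in \<open>auto simp: E_def\<close>)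
    also have "\<dots> \<le> (E * (1/\<mu> * (C * t ^ 3))) * (Cw * (1 + 1/t) ^ 3)"
      using Cw(2)[of t] t C \<mu>(1) by (intro mult_left_mono) (auto simp: E_def)
    also have "\<dots> = K * (t * (1 + 1/t)) ^ 3 * E" by (simp add: K_def power_mult_distrib)
    also have "t * (1 + 1/t) = 1 + t" using t by (simp add: field_simps)
    finally show ?thesis unfolding E_def .
  qed
  define B where "B = K * (27 * (2/s) ^ 3 * exp (s/2))"
  have hI: "(\<lambda>t. B * exp (-(s/2 * t))) integrable_on {0<..}"
  proof -
    have "(\<lambda>t. exp (-(s/2) * t)) integrable_on {0..}"
      using s by (intro integrable_on_exp_minus_to_infinity) auto
    then have "(\<lambda>t. exp (-(s/2) * t)) integrable_on {0<..}"
      by (rule integrable_spike_set) (auto intro: negligible_subset[of "{0}"])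
    from integrable_on_mult_right[OF this, of B] show ?thesis by simp
  qed
  \<comment> \<open>From height 2 on, \<open>w^2 - 1 \<ge> 1\<close>, so one exponential majorises
    all members of the shifted sequence.\<close>
  obtain n0 where n0: "\<And>n. n \<ge> n0 \<Longrightarrow> v n \<ge> 2"
    using v unfolding filterlim_at_top by (metis eventually_sequentially)
  have "(\<lambda>n. integral {0<..} (Mth (z, v (n + n0)))) \<longlonglongrightarrow> integral {0<..} (\<lambda>t::real. 0::complex)"
  proof (rule dominated_convergence(2)[OF _ hI])
    show "Mth (z, v (n + n0)) integrable_on {0<..}" for n
      using Mth_integrable[of "v (n + n0)" z] n0[of "n + n0"] by (auto simp: absolutely_integrable_on_def)
    show "norm (Mth (z, v (n + n0)) t) \<le> B * exp (-(s/2 * t))" if "t \<in> {0<..}" for n t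
    proof -
      have t: "t > 0" using that by simp
      have w: "v (n + n0) \<ge> 2" using n0 by simp
      have "(v (n + n0))\<^sup>2 \<ge> 2\<^sup>2" using w by (intro power_mono) auto
      then have "s * t * 1 \<le> s * t * ((v (n + n0))\<^sup>2 - 1)" using s t by (intro mult_left_mono) auto
      then have e: "exp (-(s * t * ((v (n + n0))\<^sup>2 - 1))) \<le> exp (-(s * t))" by simp
      have "norm (Mth (z, v (n + n0)) t) \<le> K * (1 + t) ^ 3 * exp (-(s * t * ((v (n + n0))\<^sup>2 - 1)))"
        using w by (intro bd t) auto
      also have "\<dots> \<le> K * (1 + t) ^ 3 * exp (-(s * t))" using e K t by (intro mult_left_mono) auto
      also have "\<dots> \<le> K * (27 * (2/s) ^ 3 * exp (s/2) * exp (-(s/2 * t)))"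
        using mult_left_mono[OF poly_exp_bound[OF s t] K] by (simp only: mult.assoc)
      finally show ?thesis by (simp add: B_def mult.assoc)
    qed
    show "(\<lambda>n. Mth (z, v (n + n0)) t) \<longlonglongrightarrow> 0" if "t \<in> {0<..}" for t
    proof (rule Lim_null_comparison)
      have t: "t > 0" using that by simp
      show "\<forall>\<^sub>F n in sequentially. norm (Mth (z, v (n + n0)) t) \<le> K * (1 + t) ^ 3 * exp (-(s * t * ((v (n + n0))\<^sup>2 - 1)))"
      proof (intro always_eventually allI bd t)
        show "v (n + n0) \<ge> 1" for n using n0[of "n + n0"] by simp
      qed
      have "filterlim (\<lambda>n. v (n + n0)) at_top sequentially"
        using v by (rule filterlim_compose) (rule filterlim_add_const_nat_at_top)
      moreover have "((\<lambda>w. K * (1 + t) ^ 3 * exp (-(s * t * (w\<^sup>2 - 1)))) \<longlongrightarrow> 0) at_top"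
        using s t by real_asymp
      ultimately show "(\<lambda>n. K * (1 + t) ^ 3 * exp (-(s * t * ((v (n + n0))\<^sup>2 - 1)))) \<longlonglongrightarrow> 0"
        by (rule filterlim_compose[rotated])
    qed
  qed
  then have "(\<lambda>n. H0 (z, v (n + n0))) \<longlonglongrightarrow> 0" by (simp add: H0_def)
  then show ?thesis by (rule LIMSEQ_offset)
qed

section \<open>Residue classes modulo c and the Dedekind sum\<close>

definition mod_rel :: "complex \<Rightarrow> (complex \<times> complex) set" where
  "mod_rel c = {(x, y). x \<in> L \<and> y \<in> L \<and> x - y \<in> (\<lambda>\<omega>. c * \<omega>) ` L}"

lemma mod_rel_equiv: "equiv L (mod_rel c)"
proof (rule equivI)
  show "mod_rel c \<subseteq> L \<times> L" by (auto simp: mod_rel_def)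
  show "refl_on L (mod_rel c)"
    by (rule refl_onI) (auto simp: mod_rel_def intro!: image_eqI[of _ _ 0] zero_in)
  show "sym (mod_rel c)"
  proof (rule symI)
    fix x y assume "(x, y) \<in> mod_rel c"
    then obtain l where "x \<in> L" "y \<in> L" "l \<in> L" "x - y = c * l" by (auto simp: mod_rel_def)
    then show "(y, x) \<in> mod_rel c"
      by (auto simp: mod_rel_def intro!: image_eqI[of _ _ "- l"] uminus_in simp: algebra_simps)
  qed
  show "trans (mod_rel c)"
  proof (rule transI)
    fix x y z assume "(x, y) \<in> mod_rel c" "(y, z) \<in> mod_rel c"
    then obtain l k where "x \<in> L" "y \<in> L" "z \<in> L" "l \<in> L" "x - y = c * l" "k \<in> L" "y - z = c * k" by (auto simp: mod_rel_def)
    then show "(x, z) \<in> mod_rel c"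
      by (auto simp: mod_rel_def intro!: image_eqI[of _ _ "l + k"] add_in simp: algebra_simps)
  qed
qed

lemma mod_rel_class:
  assumes Y: "Y \<in> L // mod_rel c" and r: "r \<in> Y" and c: "\<And>x. x \<in> L \<Longrightarrow> c * x \<in> L"
  shows "Y = (\<lambda>l. r + c * l) ` L" "r \<in> L"
proof -
  show rL: "r \<in> L" using Y r mod_rel_equiv in_quotient_imp_subset by blast
  obtain s where s: "Y = mod_rel c `` {s}" using Y by (auto elim: quotientE)
  then have "(s, r) \<in> mod_rel c" using r by simp
  then have "Y = mod_rel c `` {r}" unfolding s by (rule equiv_class_eq[OF mod_rel_equiv])
  also have "\<dots> = (\<lambda>l. r + c * l) ` L"
  proof (intro equalityI subsetI)
    fix y assume "y \<in> mod_rel c `` {r}"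
    then obtain l where "y \<in> L" "l \<in> L" "r - y = c * l" by (auto simp: mod_rel_def)
    then show "y \<in> (\<lambda>l. r + c * l) ` L" by (intro image_eqI[of _ _ "- l"] uminus_in) (auto simp: algebra_simps)
  next
    fix y assume "y \<in> (\<lambda>l. r + c * l) ` L"
    then obtain l where "l \<in> L" "y = r + c * l" by auto
    then have "y \<in> L" "r - y = c * (- l)" "- l \<in> L" using add_in[OF rL c] uminus_in by auto
    then have "(r, y) \<in> mod_rel c" using rL unfolding mod_rel_def by blast
    then show "y \<in> mod_rel c `` {r}" by simp
  qed
  finally show "Y = (\<lambda>l. r + c * l) ` L" .
qed

text \<open>Reducing \<open>r / c\<close> modulo \<open>L\<close> yields a representative of norm at
  most \<open>R0 * cmod c\<close>, and a ball contains finitely many lattice points.\<close>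

lemma finite_quotient:
  assumes c0: "c \<noteq> 0" and c: "\<And>x. x \<in> L \<Longrightarrow> c * x \<in> L"
  shows "finite (L // mod_rel c)"
proof -
  have "L // mod_rel c \<subseteq> (\<lambda>r. mod_rel c `` {r}) ` {l \<in> L. cmod l \<le> R0 * cmod c}"
  proof
    fix Y assume Y: "Y \<in> L // mod_rel c"
    then obtain r where r: "r \<in> L" "Y = mod_rel c `` {r}" by (auto elim: quotientE)
    obtain l where l: "l \<in> L" "cmod (r / c - l) \<le> R0" by (rule reduce)
    define s where "s = r - c * l"
    have "s \<in> L" using r l c by (auto simp: s_def intro: diff_in)
    moreover have "cmod s \<le> R0 * cmod c"
    proof -
      have "s = (r / c - l) * c" using c0 by (simp add: s_def field_simps)
      then have "cmod s = cmod (r / c - l) * cmod c" by (simp only: norm_mult)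
      then show ?thesis using l(2) by (simp add: mult_right_mono)
    qed
    moreover have "(r, s) \<in> mod_rel c" using r l \<open>s \<in> L\<close> by (auto simp: mod_rel_def s_def)
    then have "Y = mod_rel c `` {s}" unfolding r(2) by (rule equiv_class_eq[OF mod_rel_equiv])
    ultimately show "Y \<in> (\<lambda>r. mod_rel c `` {r}) ` {l \<in> L. cmod l \<le> R0 * cmod c}" by blast
  qed
  then show ?thesis using finite_ball finite_surj by blast
qed

definition SX :: "complex set \<Rightarrow> real \<Rightarrow> complex" where
  "SX Y = thsum (Y - {0}) (\<lambda>x. 1 / x) (\<lambda>x. (cmod x)\<^sup>2)"

lemma subset_theta_data:
  assumes Y: "Y \<subseteq> L"
  obtains \<delta> where "theta_data (Y - {0}) (\<lambda>x. 1 / x) (\<lambda>x. (cmod x)\<^sup>2) \<delta> 3"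
    "theta_data (Y - {0}) cnj (\<lambda>x. (cmod x)\<^sup>2) \<delta> 3"
proof -
  obtain \<mu> where \<mu>: "\<mu> > 0" "\<And>x. x \<in> L \<Longrightarrow> x \<noteq> 0 \<Longrightarrow> cmod x \<ge> \<mu>" by (rule L_min) (rule that; blast)
  have cX: "countable (Y - {0})" using countable_L Y by (meson countable_subset Diff_subset subset_trans)
  have sub: "Y - {0} \<subseteq> Ish 0" using Y by (auto simp: Ish_def)
  have s0: "(\<lambda>x. norm (cnj (0 + x) ^ 1) * ((cmod (0 + x))\<^sup>2) powr (-3)) summable_on Y - {0}"
    by (rule summable_on_subset_banach[OF rank2_summable sub]) auto
  have s: "(\<lambda>x. cmod x * ((cmod x)\<^sup>2) powr (-3)) summable_on Y - {0}" using s0 by simp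
  have s': "(\<lambda>x. cmod (1 / x) * ((cmod x)\<^sup>2) powr (-3)) summable_on Y - {0}"
  proof (rule summable_on_comparison_test[OF summable_on_cmult_right[OF s, of "1/\<mu>\<^sup>2"]])
    fix x assume x: "x \<in> Y - {0}"
    then have "\<mu> \<le> cmod x" using \<mu> Y by auto
    then have "\<mu>\<^sup>2 \<le> (cmod x)\<^sup>2" using \<mu> by (intro power_mono) auto
    then have "cmod (1 / x) \<le> 1/\<mu>\<^sup>2 * cmod x" using x \<mu> by (simp add: norm_divide field_simps power2_eq_square)
    from mult_right_mono[OF this, of "((cmod x)\<^sup>2) powr (-3)"]
    show "cmod (1 / x) * ((cmod x)\<^sup>2) powr (-3) \<le> 1/\<mu>\<^sup>2 * (cmod x * ((cmod x)\<^sup>2) powr (-3))" by simp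
  qed auto
  have q: "\<mu>\<^sup>2 \<le> (cmod x)\<^sup>2" if "x \<in> Y - {0}" for x
    using that \<mu> Y by (intro power_mono) auto
  show ?thesis
    by (rule that[of "\<mu>\<^sup>2"]; unfold_locales) (use cX \<mu> q s s' in auto)
qed

lemma th_bounded: obtains C where "C \<ge> 0" "\<And>w t. 0 < t \<Longrightarrow> norm (th 1 w t) \<le> C"
proof -
  obtain C where "C \<ge> 0" "\<And>w t. 0 < t \<Longrightarrow> norm (th 1 w t) \<le> C * t ^ 0"
    by (rule th_rapid[of 0]) (rule that; blast)
  then show ?thesis by (intro that[of C]) auto
qed

text \<open>From \<open>1 / x = cnj x / (cmod x)^2\<close> the function \<open>SX Y\<close> is a
  tail integral of the theta series of the class with numerators \<open>cnj x\<close>. As the class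
  is \<open>c\<close> times the translate \<open>r / c + L\<close>, that series is a rescaled
  \<open>th 1 (r / c)\<close>, whose full integral is a G_1 value.\<close>

lemma SX_integral:
  assumes c0: "c \<noteq> 0" and c: "\<And>x. x \<in> L \<Longrightarrow> c * x \<in> L" and Y: "Y \<in> L // mod_rel c" and r: "r \<in> Y"
  shows "(\<lambda>t. cnj c * th 1 (r / c) ((cmod c)\<^sup>2 * t)) absolutely_integrable_on {0<..}"
    and "integral {0<..} (\<lambda>t. cnj c * th 1 (r / c) ((cmod c)\<^sup>2 * t)) = Gser 1 (r / c) L / c"
    and "\<tau> > 0 \<Longrightarrow> SX Y \<tau> = integral {\<tau>..} (\<lambda>t. cnj c * th 1 (r / c) ((cmod c)\<^sup>2 * t))"
proof -
  define q where "q = (cmod c)\<^sup>2"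
  have q: "q > 0" using c0 by (simp add: q_def)
  note hi = has_integral_scale_halfline[OF th_integrable(1)[of 1 "r/c"] q]
  have hi': "((\<lambda>t. cnj c * th 1 (r / c) (q * t)) has_integral cnj c * (integral {0<..} (th 1 (r / c)) / of_real q)) {0<..}"
    by (rule has_integral_mult_right[OF hi]) simp
  show "integral {0<..} (\<lambda>t. cnj c * th 1 (r / c) ((cmod c)\<^sup>2 * t)) = Gser 1 (r / c) L / c"
  proof -
    have "integral {0<..} (\<lambda>t. cnj c * th 1 (r / c) (q * t)) = cnj c * (Gser 1 (r / c) L / of_real q)"
      unfolding Gser1 by (rule integral_unique[OF hi'])
    also have "of_real q = c * cnj c" unfolding q_def by (rule complex_norm_square)
    finally show ?thesis using c0 by (simp add: q_def)
  qed
  have Xeq: "Y = (\<lambda>l. r + c * l) ` L" by (rule mod_rel_class(1)[OF Y r]) (rule c)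
  have XL: "Y \<subseteq> L" by (rule in_quotient_imp_subset[OF mod_rel_equiv Y])
  obtain \<delta> where d1: "theta_data (Y - {0}) (\<lambda>x. 1 / x) (\<lambda>x. (cmod x)\<^sup>2) \<delta> 3"
    and d2: "theta_data (Y - {0}) cnj (\<lambda>x. (cmod x)\<^sup>2) \<delta> 3" by (rule subset_theta_data[OF XL]) (rule that; blast)
  have Th: "thsum (Y - {0}) cnj (\<lambda>x. (cmod x)\<^sup>2) t = cnj c * th 1 (r / c) (q * t)" for t
  proof -
    have "thsum (Y - {0}) cnj (\<lambda>x. (cmod x)\<^sup>2) t = (\<Sum>\<^sub>\<infinity>x\<in>Y. cnj x * of_real (exp (-(t * (cmod x)\<^sup>2))))"
      unfolding thsum_def by (rule infsum_cong_neutral) auto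
    also have "\<dots> = (\<Sum>\<^sub>\<infinity>l\<in>L. cnj (r + c * l) * of_real (exp (-(t * (cmod (r + c * l))\<^sup>2))))"
    proof -
      have "inj_on (\<lambda>l. r + c * l) L" using c0 by (auto simp: inj_on_def)
      from infsum_reindex[OF this] show ?thesis by (simp only: Xeq[symmetric] o_def)
    qed
    also have "\<dots> = (\<Sum>\<^sub>\<infinity>l\<in>L. cnj c * (cnj (r / c + l) ^ 1 * of_real (exp (-(q * t * (cmod (r / c + l))\<^sup>2)))))"
    proof (rule infsum_cong)
      fix l
      have "r + c * l = c * (r / c + l)" using c0 by (simp add: field_simps)
      then show "cnj (r + c * l) * of_real (exp (-(t * (cmod (r + c * l))\<^sup>2))) = cnj c * (cnj (r / c + l) ^ 1 * of_real (exp (-(q * t * (cmod (r / c + l))\<^sup>2))))"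
        by (simp only: complex_cnj_mult norm_mult power_mult_distrib q_def power_one_right mult_ac)
    qed
    also have "\<dots> = cnj c * th 1 (r / c) (q * t)" unfolding th_def by (rule infsum_cmult_right')
    finally show ?thesis .
  qed
  have Th': "thsum (Y - {0}) cnj (\<lambda>x. (cmod x)\<^sup>2) = (\<lambda>t. cnj c * th 1 (r / c) (q * t))" using Th by blast
  show "(\<lambda>t. cnj c * th 1 (r / c) ((cmod c)\<^sup>2 * t)) absolutely_integrable_on {0<..}"
  proof -
    obtain C where C: "\<forall>N::nat. \<exists>C. \<forall>t. 0 < t \<and> t \<le> 1 \<longrightarrow> norm (cnj c * th 1 (r / c) (q * t)) \<le> C * t ^ N"
    proof -
      have "\<exists>C. \<forall>t. 0 < t \<and> t \<le> 1 \<longrightarrow> norm (cnj c * th 1 (r / c) (q * t)) \<le> C * t ^ N" for N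
      proof -
        obtain C where C: "\<And>w t. 0 < t \<Longrightarrow> norm (th 1 w t) \<le> C * t ^ N"
          by (rule th_rapid[of N]) (rule that; blast)
        have "norm (cnj c * th 1 (r / c) (q * t)) \<le> (cmod c * C * q ^ N) * t ^ N" if "0 < t" for t
        proof -
          have "norm (th 1 (r / c) (q * t)) \<le> C * (q * t) ^ N" using q that by (intro C) auto
          from mult_left_mono[OF this norm_ge_zero[of c]] show ?thesis by (simp add: norm_mult power_mult_distrib mult_ac)
        qed
        then show ?thesis by blast
      qed
      then show ?thesis using that by blast
    qed
    have "theta_rapid (Y - {0}) cnj (\<lambda>x. (cmod x)\<^sup>2) \<delta> 3"
      using d2 C by (simp add: theta_rapid_def theta_rapid_axioms_def Th')
    from theta_rapid.theta_int0[OF this] show ?thesis unfolding Th' q_def .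
  qed
  show "SX Y \<tau> = integral {\<tau>..} (\<lambda>t. cnj c * th 1 (r / c) ((cmod c)\<^sup>2 * t))" if \<tau>: "\<tau> > 0"
  proof -
    have "((\<lambda>x. cnj x * of_real (exp (-(\<tau> * (cmod x)\<^sup>2)) / (cmod x)\<^sup>2)) has_sum integral {\<tau>..} (\<lambda>t. cnj c * th 1 (r / c) (q * t))) (Y - {0})"
      using theta_data.integral_theta_from(2)[OF d2 \<tau>] unfolding Th' .
    then have "integral {\<tau>..} (\<lambda>t. cnj c * th 1 (r / c) (q * t)) = (\<Sum>\<^sub>\<infinity>x\<in>Y-{0}. cnj x * of_real (exp (-(\<tau> * (cmod x)\<^sup>2)) / (cmod x)\<^sup>2))"
      by (simp add: infsumI)
    also have "\<dots> = SX Y \<tau>" unfolding SX_def thsum_def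
    proof (rule infsum_cong)
      fix x assume x: "x \<in> Y - {0}"
      have "of_real ((cmod x)\<^sup>2) = x * cnj x" by (rule complex_norm_square)
      then show "cnj x * of_real (exp (-(\<tau> * (cmod x)\<^sup>2)) / (cmod x)\<^sup>2) = 1 / x * of_real (exp (-(\<tau> * (cmod x)\<^sup>2)))"
        using x by (simp add: field_simps del: of_real_power)
    qed
    finally show ?thesis unfolding q_def by simp
  qed
qed

text \<open>For \<open>z = a / c\<close> the factor \<open>th 1 (x * z)\<close> in the expansion \<open>Mth_eq\<close> depends on \<open>x\<close> modulo \<open>c L\<close> only, and the
  remaining sums over residue classes tend to \<open>G\<^sub>1(r / c, L) / c\<close> as \<open>v\<close> tends to \<open>0\<close>.\<close>

lemma H0_at_rational:
  assumes c0: "c \<noteq> 0" and c: "\<And>x. x \<in> L \<Longrightarrow> c * x \<in> L" and a: "\<And>x. x \<in> L \<Longrightarrow> a * x \<in> L"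
    and v: "\<And>n. v n > 0" "v \<longlonglongrightarrow> 0"
  shows "(\<lambda>n. H0 (a / c, v n)) \<longlonglongrightarrow> - Dsum a c L"
proof -
  define P where "P = L // mod_rel c"
  have finP: "finite P" unfolding P_def by (rule finite_quotient[OF c0 c])
  \<comment> \<open>The same choice of representative as in \<open>Dsum\<close>, so the limit agrees
    with it term by term.\<close>
  define rep where "rep Y = (SOME r. r \<in> Y)" for Y :: "complex set"
  have rep: "rep Y \<in> Y" if "Y \<in> P" for Y
    using in_quotient_imp_non_empty[OF mod_rel_equiv] that unfolding P_def rep_def by (metis some_in_eq)
  have YL: "Y \<subseteq> L" if "Y \<in> P" for Y
    using that in_quotient_imp_subset[OF mod_rel_equiv] unfolding P_def by blast
  define f where "f Y = (\<lambda>t. cnj c * th 1 (rep Y / c) ((cmod c)\<^sup>2 * t))" for Y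
  have f1: "f Y absolutely_integrable_on {0<..}" and f2: "integral {0<..} (f Y) = Gser 1 (rep Y / c) L / c"
    and f3: "\<tau> > 0 \<Longrightarrow> SX Y \<tau> = integral {\<tau>..} (f Y)" if "Y \<in> P" for Y \<tau>
    unfolding f_def using SX_integral[OF c0 c _ rep[OF that]] that unfolding P_def by blast+
  \<comment> \<open>Bounds every tail integral, hence \<open>SX Y\<close> at all positive arguments;
    with the integrable \<open>th 1\<close> it gives the majorant for dominated convergence.\<close>
  define B where "B Y = integral {0<..} (\<lambda>t. norm (f Y t))" for Y
  have fn: "(\<lambda>t. norm (f Y t)) integrable_on {0<..}" if "Y \<in> P" for Y
    using f1[OF that] by (auto simp: absolutely_integrable_on_def)
  have SXb: "norm (SX Y \<tau>) \<le> B Y" if "Y \<in> P" "\<tau> > 0" for Y \<tau>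
  proof -
    have i: "f Y absolutely_integrable_on {\<tau>..}"
      by (rule set_integrable_subset[OF f1[OF that(1)]]) (use that in auto)
    have "norm (SX Y \<tau>) \<le> integral {\<tau>..} (\<lambda>t. norm (f Y t))"
      unfolding f3[OF that] using i by (intro integral_norm_bound_integral) (auto simp: absolutely_integrable_on_def)
    also have "\<dots> \<le> B Y" unfolding B_def using that i fn[OF that(1)]
      by (intro integral_subset_le) (auto simp: absolutely_integrable_on_def)
    finally show ?thesis .
  qed
  obtain C where C: "C \<ge> 0" "\<And>w t. 0 < t \<Longrightarrow> norm (th 1 w t) \<le> C" by (rule th_bounded) (rule that; blast)
  have SXlim: "(\<lambda>n. SX Y (t * (v n)\<^sup>2)) \<longlonglongrightarrow> Gser 1 (rep Y / c) L / c" if Y: "Y \<in> P" and t: "t > 0" for Y t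
  proof -
    have bd: "norm (integral {0<..} (f Y) - SX Y (t * (v n)\<^sup>2)) \<le> (cmod c * C) * (t * (v n)\<^sup>2)" for n
    proof -
      have tv: "t * (v n)\<^sup>2 > 0" using t v(1)[of n] by simp
      show ?thesis unfolding f3[OF Y tv]
      proof (rule integral_near_zero[OF f1[OF Y] tv])
        fix s :: real assume "0 < s"
        then have "norm (th 1 (rep Y / c) ((cmod c)\<^sup>2 * s)) \<le> C" using c0 by (intro C) auto
        then show "norm (f Y s) \<le> cmod c * C" unfolding f_def by (simp add: norm_mult mult_left_mono)
      qed (use C in auto)
    qed
    have "(\<lambda>n. (cmod c * C) * (t * (v n)\<^sup>2)) \<longlonglongrightarrow> (cmod c * C) * (t * 0\<^sup>2)"
      by (intro tendsto_intros v)
    then have z: "(\<lambda>n. (cmod c * C) * (t * (v n)\<^sup>2)) \<longlonglongrightarrow> 0" by simp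
    have "(\<lambda>n. integral {0<..} (f Y) - SX Y (t * (v n)\<^sup>2)) \<longlonglongrightarrow> 0"
      by (rule Lim_null_comparison[OF _ z]) (rule always_eventually, rule allI, rule bd)
    then have "(\<lambda>n. integral {0<..} (f Y) - (integral {0<..} (f Y) - SX Y (t * (v n)\<^sup>2))) \<longlonglongrightarrow> integral {0<..} (f Y) - 0"
      by (intro tendsto_diff tendsto_const)
    then show ?thesis by (simp add: f2[OF Y])
  qed
  define g where "g Y n = (\<lambda>t. th 1 (a * rep Y / c) t * SX Y (t * (v n)\<^sup>2))" for Y n
  have hI: "(\<lambda>t. norm (th 1 w t) * B Y) integrable_on {0<..}" for w Y
    using th_integrable(1)[of 1 w] by (intro integrable_on_mult_left) (auto simp: absolutely_integrable_on_def)
  have gb: "norm (g Y n t) \<le> norm (th 1 (a * rep Y / c) t) * B Y" if "Y \<in> P" "t \<in> {0<..}" for Y n t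
    unfolding g_def norm_mult using that v(1)[of n] by (intro mult_left_mono SXb) auto
  have gi: "g Y n integrable_on {0<..}" if Y: "Y \<in> P" for Y n
  proof -
    obtain \<delta> where d: "theta_data (Y - {0}) (\<lambda>x. 1 / x) (\<lambda>x. (cmod x)\<^sup>2) \<delta> 3"
      by (rule subset_theta_data[OF YL[OF Y]]) (rule that; blast)
    have "continuous_on {0<..} (SX Y)" unfolding SX_def by (rule theta_data.theta_continuous[OF d])
    then have "continuous_on {0<..} (\<lambda>t. SX Y (t * (v n)\<^sup>2))"
      by (rule continuous_on_compose2) (use v(1)[of n] in \<open>auto intro!: continuous_intros\<close>)
    then have "continuous_on {0<..} (g Y n)" unfolding g_def
      using th_integrable(3)[of 1] by (intro continuous_intros) auto
    then have "g Y n absolutely_integrable_on {0<..}"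
      by (rule absolutely_integrable_continuous_bound[OF _ _ hI[of "a * rep Y / c" Y]]) (use gb[OF Y] in auto)
    then show ?thesis by (auto simp: absolutely_integrable_on_def)
  qed
  have glim: "(\<lambda>n. integral {0<..} (g Y n)) \<longlonglongrightarrow> Gser 1 (a * rep Y / c) L * (Gser 1 (rep Y / c) L / c)" if Y: "Y \<in> P" for Y
  proof -
    have "(\<lambda>n. integral {0<..} (g Y n)) \<longlonglongrightarrow> integral {0<..} (\<lambda>t. th 1 (a * rep Y / c) t * (Gser 1 (rep Y / c) L / c))"
    proof (rule dominated_convergence(2)[OF gi[OF Y] hI gb[OF Y]])
      show "(\<lambda>n. g Y n t) \<longlonglongrightarrow> th 1 (a * rep Y / c) t * (Gser 1 (rep Y / c) L / c)" if "t \<in> {0<..}" for t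
        unfolding g_def using that by (intro tendsto_intros SXlim[OF Y]) auto
    qed
    then show ?thesis unfolding Gser1[of "a * rep Y / c"] by simp
  qed
  have Mg: "Mth (a / c, v n) t = - (\<Sum>Y\<in>P. g Y n t)" if t: "t \<in> {0<..}" for n t
  proof -
    have t0: "t > 0" using t by simp
    \<comment> \<open>Setting the term at \<open>x = 0\<close> to zero allows summation over full
      residue classes, including the class of 0.\<close>
    define F where "F x = (if x = 0 then 0 else wt x (v n) t * (- (1/x) * th 1 (x * (a / c)) t))" for x
    have UP: "\<Union>P = L" unfolding P_def by (rule Union_quotient[OF mod_rel_equiv])
    have "Mth (a / c, v n) t = infsum F (\<Union>P)"
      unfolding Mth_eq[OF v(1) t0] UP by (rule infsum_cong_neutral) (auto simp: F_def)
    also have "\<dots> = (\<Sum>Y\<in>P. infsum F Y)"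
    proof (rule infsum_partition[OF finP])
      show "Y \<inter> Z = {}" if "Y \<in> P" "Z \<in> P" "Y \<noteq> Z" for Y Z
        using quotient_disj[OF mod_rel_equiv] that unfolding P_def by blast
      obtain \<mu> where \<mu>: "\<mu> > 0" "\<And>x. x \<in> L \<Longrightarrow> x \<noteq> 0 \<Longrightarrow> cmod x \<ge> \<mu>" by (rule L_min) (rule that; blast)
      have "(\<lambda>x. wt x (v n) t * (if x = 0 then 0 else - (1/x) * th 1 (x * (a / c)) t)) summable_on L"
      proof (rule wt_sum(1)[OF v(1) order_refl t0 order_refl, of "1/\<mu> * C"])
        fix x assume x: "x \<in> L"
        have "cmod (if x = 0 then 0 else - (1/x) * th 1 (x * (a / c)) t) \<le> 1/\<mu> * C"
        proof (cases "x = 0")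
          case False
          then have "\<mu> \<le> cmod x" "cmod x > 0" using \<mu> x by auto
          then have "1 / cmod x \<le> 1/\<mu>" using \<mu>(1) by (intro divide_left_mono) auto
          then have "1 / cmod x * cmod (th 1 (x * (a / c)) t) \<le> 1/\<mu> * C" using \<mu>(1) t0 by (intro mult_mono C(2)) auto
          then show ?thesis using False by (simp add: norm_mult norm_divide)
        qed (use \<mu> C in auto)
        also have "\<dots> = 1/\<mu> * C * 1" by simp
        also have "\<dots> \<le> 1/\<mu> * C * (1 + (cmod x)\<^sup>2)" using \<mu>(1) C(1) by (intro mult_left_mono) auto
        finally show "cmod (if x = 0 then 0 else - (1/x) * th 1 (x * (a / c)) t) \<le> 1/\<mu> * C * (1 + (cmod x)\<^sup>2)" .
      qed (use \<mu> C in auto)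
      moreover have "(\<lambda>x. wt x (v n) t * (if x = 0 then 0 else - (1/x) * th 1 (x * (a / c)) t)) = F"
        by (auto simp: F_def)
      ultimately show "F summable_on \<Union>P" unfolding UP by simp
    qed
    also have "\<dots> = (\<Sum>Y\<in>P. - g Y n t)"
    proof (rule sum.cong[OF refl])
      fix Y assume Y: "Y \<in> P"
      have "infsum F Y = (\<Sum>\<^sub>\<infinity>x\<in>Y-{0}. - th 1 (a * rep Y / c) t * (1 / x * of_real (exp (-(t * (v n)\<^sup>2 * (cmod x)\<^sup>2)))))"
      proof (rule infsum_cong_neutral)
        fix x assume x: "x \<in> Y \<inter> (Y - {0})"
        obtain l where l: "l \<in> L" "x = rep Y + c * l"
          using mod_rel_class(1)[OF _ rep[OF Y] c] Y x unfolding P_def by blast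
        have "x * (a / c) = a * rep Y / c + a * l" using c0 by (simp add: l field_simps)
        then have "th 1 (x * (a / c)) t = th 1 (a * rep Y / c) t" using th_shift[OF a[OF l(1)]] by simp
        then show "F x = - th 1 (a * rep Y / c) t * (1 / x * of_real (exp (-(t * (v n)\<^sup>2 * (cmod x)\<^sup>2))))"
          using x by (simp add: F_def wt_def power_mult_distrib mult_ac)
      qed (auto simp: F_def)
      also have "\<dots> = - g Y n t" unfolding g_def SX_def thsum_def by (simp only: infsum_cmult_right') (simp only: mult_minus_left)
      finally show "infsum F Y = - g Y n t" .
    qed
    finally show ?thesis by (simp add: sum_negf)
  qed
  have H: "H0 (a / c, v n) = - (\<Sum>Y\<in>P. integral {0<..} (g Y n))" for n
  proof -
    have "H0 (a / c, v n) = integral {0<..} (\<lambda>t. - (\<Sum>Y\<in>P. g Y n t))"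
      unfolding H0_def by (intro integral_cong Mg)
    also have "\<dots> = - (\<Sum>Y\<in>P. integral {0<..} (g Y n))"
      using finP gi by (simp add: integral_neg integral_sum)
    finally show ?thesis .
  qed
  have "(\<lambda>n. H0 (a / c, v n)) \<longlonglongrightarrow> - (\<Sum>Y\<in>P. Gser 1 (a * rep Y / c) L * (Gser 1 (rep Y / c) L / c))"
    unfolding H by (intro tendsto_intros glim)
  moreover have "Dsum a c L = (\<Sum>Y\<in>P. Gser 1 (a * rep Y / c) L * (Gser 1 (rep Y / c) L / c))"
    unfolding Dsum_def mod_rel_def[symmetric] P_def[symmetric] rep_def Let_def by (simp add: sum_distrib_left mult_ac)
  ultimately show ?thesis by simp
qed

text \<open>Above \<open>- d / c\<close> the term \<open>c * z + d\<close> vanishes, so the vertical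
  geodesic there is mapped to the one above \<open>a / c\<close>, with heights inverted up to the
  factor \<open>(cmod c)^2\<close>.\<close>

lemma gact_to_cusp:
  assumes det: "a * d - b * c = 1" and c0: "c \<noteq> 0" and w: "w > 0"
  shows "gact a b c d (- d / c, 1 / ((cmod c)\<^sup>2 * w)) = (a / c, w)"
proof -
  define V where "V = 1 / ((cmod c)\<^sup>2 * w)"
  have z: "c * (- d / c) + d = 0" using c0 by simp
  have cc: "cmod c > 0" using c0 by simp
  have V: "V > 0" unfolding V_def using cc w by simp
  have e: "eta_den (- d / c, V) c d = (cmod c)\<^sup>2 * V\<^sup>2" unfolding eta_den_def fst_conv snd_conv z by simp
  have "snd (gact a b c d (- d / c, V)) = V / ((cmod c)\<^sup>2 * V\<^sup>2)" unfolding gact_simps(2) e by simp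
  also have "\<dots> = w" using cc w by (simp add: V_def power2_eq_square field_simps)
  finally have s: "snd (gact a b c d (- d / c, V)) = w" .
  have "fst (gact a b c d (- d / c, V)) = a * cnj c * of_real (V\<^sup>2) / of_real ((cmod c)\<^sup>2 * V\<^sup>2)"
    unfolding gact_simps(1) e fst_conv snd_conv z by simp
  also have "complex_of_real ((cmod c)\<^sup>2 * V\<^sup>2) = c * cnj c * of_real (V\<^sup>2)"
    unfolding of_real_mult complex_norm_square ..
  also have "a * cnj c * of_real (V\<^sup>2) / (c * cnj c * of_real (V\<^sup>2)) = a / c" using c0 V by simp
  finally show ?thesis using s unfolding V_def by (simp add: prod_eq_iff)
qed

lemma cocycle_value_nonzero_lower_left:
  assumes det: "a * d - b * c = 1" and c0: "c \<noteq> 0"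
    and mul: "\<And>x. x \<in> L \<Longrightarrow> a * x \<in> L" "\<And>x. x \<in> L \<Longrightarrow> b * x \<in> L" "\<And>x. x \<in> L \<Longrightarrow> c * x \<in> L" "\<And>x. x \<in> L \<Longrightarrow> d * x \<in> L"
    and u: "snd u > 0"
  shows "Hprim (gact a b c d u) - Hprim u = G2 L * ((a + d) / c) - local.c0 * N0 * cnj ((a + d) / c) - Dsum a c L"
proof -
  define w where "w n = 1 / (real n + 1)" for n
  have w: "w n > 0" for n by (simp add: w_def)
  have w0: "w \<longlonglongrightarrow> 0" unfolding w_def by real_asymp
  \<comment> \<open>This height over \<open>- d / c\<close> is carried to height \<open>w n\<close>
    over \<open>a / c\<close>, so one sequence approaches both boundary points at once while the
    difference \<open>K\<close> stays constant.\<close>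
  define V where "V n = 1 / ((cmod c)\<^sup>2 * w n)" for n
  have cc: "(cmod c)\<^sup>2 > 0" using c0 by simp
  have V: "V n > 0" for n unfolding V_def using cc w by simp
  have Vtop: "filterlim V at_top sequentially"
  proof -
    have "V n = (1 / (cmod c)\<^sup>2) * (real n + 1)" for n by (simp add: V_def w_def)
    moreover have "filterlim (\<lambda>n. (1 / (cmod c)\<^sup>2) * (real n + 1)) at_top sequentially"
      using cc by (intro filterlim_tendsto_pos_mult_at_top[OF tendsto_const]) (simp, real_asymp)
    ultimately show ?thesis by presburger
  qed
  define K where "K = Hprim (gact a b c d u) - Hprim u"
  have K: "K = (H0 (a / c, w n) + G2 L * (a / c) - local.c0 * N0 * cnj (a / c)) - (H0 (- d / c, V n) + G2 L * (- d / c) - local.c0 * N0 * cnj (- d / c))" for n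
  proof -
    have "K = Hprim (gact a b c d (- d / c, V n)) - Hprim (- d / c, V n)"
      unfolding K_def by (rule Hprim_cocycle_const[OF det mul u]) (simp_all add: V)
    also have "gact a b c d (- d / c, V n) = (a / c, w n)" unfolding V_def by (rule gact_to_cusp[OF det c0 w])
    finally show ?thesis unfolding Hprim_def fst_conv .
  qed
  have "(\<lambda>n. (H0 (a / c, w n) + G2 L * (a / c) - local.c0 * N0 * cnj (a / c)) - (H0 (- d / c, V n) + G2 L * (- d / c) - local.c0 * N0 * cnj (- d / c)))
     \<longlonglongrightarrow> (- Dsum a c L + G2 L * (a / c) - local.c0 * N0 * cnj (a / c)) - (0 + G2 L * (- d / c) - local.c0 * N0 * cnj (- d / c))"
    by (intro tendsto_intros H0_at_rational[OF c0 mul(3,1) w w0] H0_at_cusp[OF Vtop])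
  then have "K = (- Dsum a c L + G2 L * (a / c) - local.c0 * N0 * cnj (a / c)) - (0 + G2 L * (- d / c) - local.c0 * N0 * cnj (- d / c))"
    unfolding K[symmetric] by (simp add: LIMSEQ_const_iff)
  then show ?thesis unfolding K_def[symmetric] by (simp add: add_divide_distrib algebra_simps)
qed

text \<open>The summand is odd under \<open>d \<mapsto> - d\<close>, which permutes
  \<open>L\<close>.\<close>

lemma th1_at_lattice_point: "th 1 l t = 0" if "l \<in> L"
proof -
  have "th 1 0 t = (\<Sum>\<^sub>\<infinity>d\<in>L. cnj (0 + (- d)) ^ 1 * of_real (exp (-(t * (cmod (0 + (- d)))\<^sup>2))))"
    unfolding th_def by (rule infsum_reindex_bij_betw[OF bij_uminus, symmetric])
  also have "\<dots> = (\<Sum>\<^sub>\<infinity>d\<in>L. - (cnj (0 + d) ^ 1 * of_real (exp (-(t * (cmod (0 + d))\<^sup>2)))))"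
    by (intro infsum_cong) simp
  also have "\<dots> = - th 1 0 t" unfolding th_def by (rule infsum_uminus)
  finally have "th 1 0 t = 0" by simp
  then show ?thesis using th_shift[OF that, of 1 0 t] by simp
qed

text \<open>The element of order six of \<open>SL\<^sub>2(\<int>)\<close> has a fixed point, so its period vanishes; since
  \<open>G\<^sub>1(0, L) = 0\<close>, this determines the remaining constant.\<close>

lemma c0_mult_N0: "c0 * N0 = G2 L"
proof -
  \<comment> \<open>The fixed point solves \<open>u = 1 - 1/u\<close>, that is
    \<open>u^2 - u + 1 = 0\<close>, with j in place of the imaginary unit:
    \<open>1/2 + j * sqrt 3 / 2\<close>.\<close>
  define u :: "complex \<times> real" where "u = (1/2, sqrt 3 / 2)"
  have e: "eta_den u 1 0 = 1" unfolding eta_den_def u_def by (simp add: power_divide)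
  have fp: "gact 1 (-1) 1 0 u = u"
    unfolding prod_eq_iff gact_simps e by (simp add: u_def power_divide field_simps)
  have "Hprim (gact 1 (-1) 1 0 u) - Hprim u = G2 L * ((1 + 0) / 1) - c0 * N0 * cnj ((1 + 0) / 1) - Dsum 1 1 L"
    by (rule cocycle_value_nonzero_lower_left) (auto simp: u_def uminus_in zero_in)
  moreover have "Dsum 1 1 L = 0"
  proof -
    have "Gser 1 ((SOME r. r \<in> Y) / 1) L = 0" if Y: "Y \<in> L // mod_rel 1" for Y
    proof -
      have "(SOME r. r \<in> Y) \<in> Y"
        using in_quotient_imp_non_empty[OF mod_rel_equiv Y] by (simp add: some_in_eq)
      then have "(SOME r. r \<in> Y) \<in> L" using in_quotient_imp_subset[OF mod_rel_equiv Y] by blast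
      then have "th 1 ((SOME r. r \<in> Y) / 1) = (\<lambda>_. 0)" by (intro ext) (simp only: div_by_1 th1_at_lattice_point)
      then show ?thesis unfolding Gser1 by simp
    qed
    then show ?thesis unfolding Dsum_def mod_rel_def[symmetric] Let_def by simp
  qed
  ultimately show ?thesis unfolding fp by simp
qed

text \<open>With the constant known, the two multiples of \<open>G2 L\<close> combine to
  \<open>Iop\<close>. For \<open>c = 0\<close> the unit condition makes the action the translation
  by \<open>b / d\<close>, and both endpoints can be moved up to infinity, where \<open>H0\<close>
  vanishes.\<close>

lemma cocycle_value:
  assumes det: "a * d - b * c = 1"
    and mul: "\<And>x. x \<in> L \<Longrightarrow> a * x \<in> L" "\<And>x. x \<in> L \<Longrightarrow> b * x \<in> L" "\<And>x. x \<in> L \<Longrightarrow> c * x \<in> L" "\<And>x. x \<in> L \<Longrightarrow> d * x \<in> L"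
    and u: "snd u > 0" and c: "c = 0 \<Longrightarrow> d = 1 \<or> d = -1"
  shows "Hprim (gact a b c d u) - Hprim u = (if c \<noteq> 0 then Iop ((a + d) / c) * G2 L - Dsum a c L else Iop (b / d) * G2 L)"
proof (cases "c = 0")
  case False
  then show ?thesis
    using cocycle_value_nonzero_lower_left[OF det False mul u] unfolding c0_mult_N0 Iop_def by (simp add: algebra_simps)
next
  case True
  have d: "d = 1 \<or> d = -1" by (rule c[OF True])
  have "a * d = 1" using det True by simp
  moreover have "d * d = 1" using d by auto
  ultimately have ad: "a = d" by algebra
  have g: "gact a b c d (z, v) = (z + b / d, v)" for z v
  proof -
    have e: "eta_den (z, v) c d = 1" using d True by (auto simp: eta_den_def)
    show ?thesis unfolding prod_eq_iff gact_simps e using d True ad by auto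
  qed
  define V where "V n = real n + 1" for n
  have V: "V n > 0" for n by (simp add: V_def)
  have Vtop: "filterlim V at_top sequentially" unfolding V_def by real_asymp
  define K where "K = Hprim (gact a b c d u) - Hprim u"
  have K: "K = H0 (0 + b / d, V n) + G2 L * (0 + b / d) - G2 L * cnj (0 + b / d) - (H0 (0, V n) + G2 L * 0 - G2 L * cnj 0)" for n
  proof -
    have "K = Hprim (gact a b c d (0, V n)) - Hprim (0, V n)"
      unfolding K_def by (rule Hprim_cocycle_const[OF det mul u]) (simp_all add: V)
    then show ?thesis unfolding g Hprim_def fst_conv c0_mult_N0 .
  qed
  have "(\<lambda>n. H0 (0 + b / d, V n) + G2 L * (0 + b / d) - G2 L * cnj (0 + b / d) - (H0 (0, V n) + G2 L * 0 - G2 L * cnj 0))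
    \<longlonglongrightarrow> 0 + G2 L * (0 + b / d) - G2 L * cnj (0 + b / d) - (0 + G2 L * 0 - G2 L * cnj 0)"
    by (intro tendsto_intros H0_at_cusp[OF Vtop])
  then have "K = 0 + G2 L * (0 + b / d) - G2 L * cnj (0 + b / d) - (0 + G2 L * 0 - G2 L * cnj 0)"
    unfolding K[symmetric] by (simp add: LIMSEQ_const_iff)
  then show ?thesis using True unfolding K_def[symmetric] Iop_def by (simp add: algebra_simps)
qed

end

section \<open>Fractional ideals are lattices\<close>

lemma int_subgroup_generator:
  fixes G :: "int set"
  assumes "\<And>x y. x \<in> G \<Longrightarrow> y \<in> G \<Longrightarrow> x - y \<in> G" and "x0 \<in> G" "x0 \<noteq> 0"
  obtains g where "g > 0" "g \<in> G" "\<And>x. x \<in> G \<Longrightarrow> g dvd x"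
proof -
  have z: "0 \<in> G" using assms(1)[OF assms(2,2)] by simp
  have neg: "- x \<in> G" if "x \<in> G" for x using assms(1)[OF z that] by simp
  define P where "P n \<longleftrightarrow> n > 0 \<and> int n \<in> G" for n
  have "P (nat \<bar>x0\<bar>)" using assms neg by (auto simp: P_def abs_if)
  define n where "n = (LEAST n. P n)"
  have n: "P n" unfolding n_def using \<open>P (nat \<bar>x0\<bar>)\<close> by (rule LeastI)
  have least: "P k \<Longrightarrow> n \<le> k" for k unfolding n_def by (rule Least_le)
  have mult: "k * int n \<in> G" for k
  proof (induction k rule: int_induct[of _ 0])
    case (step1 i)
    have "- int n \<in> G" using neg n by (simp add: P_def)
    from assms(1)[OF step1(2) this] have "i * int n - (- int n) \<in> G" .
    then show ?case by (simp add: algebra_simps)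
  next
    case (step2 i)
    then have "i * int n - int n \<in> G" using assms(1) n by (auto simp: P_def)
    then show ?case by (simp add: algebra_simps)
  qed (use z in simp)
  have "int n dvd x" if x: "x \<in> G" for x
  proof (rule ccontr)
    assume nd: "\<not> int n dvd x"
    define r where "r = x mod int n"
    have np: "int n > 0" using n by (simp add: P_def)
    have r: "r > 0" "r < int n" using nd np pos_mod_sign[of "int n" x] pos_mod_bound[of "int n" x] unfolding r_def dvd_eq_mod_eq_0 by linarith+
    have "r = x - (x div int n) * int n" by (simp add: r_def minus_div_mult_eq_mod)
    then have "r \<in> G" using assms(1)[OF x mult] by simp
    then have "P (nat r)" using r by (simp add: P_def)
    then show False using least[of "nat r"] r by linarith
  qed
  then show ?thesis using that[of "int n"] n by (simp add: P_def)
qed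

text \<open>Hermite normal form. The second coordinates of elements of \<open>A\<close> form a
  subgroup of the integers with generator \<open>g\<close>, and the first coordinates of elements on
  the \<open>b1\<close> axis one with generator \<open>h\<close>; the basis consists of
  \<open>(h, 0)\<close> and some \<open>(s, g)\<close>.\<close>

lemma sublattice_basis:
  fixes A :: "complex set"
  assumes sub: "\<And>x. x \<in> A \<Longrightarrow> \<exists>p q. x = of_int p * b1 + of_int q * b2" and b: "Im (cnj b1 * b2) \<noteq> 0"
    and diff: "\<And>x y. x \<in> A \<Longrightarrow> y \<in> A \<Longrightarrow> x - y \<in> A"
    and e: "e1 \<in> A" "e2 \<in> A" "Im (cnj e1 * e2) \<noteq> 0"
  obtains w1 w2 where "lattice A w1 w2"
proof -
  define f where "f p q = of_int p * b1 + of_int q * b2" for p q :: int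
  have fdiff: "f p q - f p' q' = f (p - p') (q - q')" for p q p' q' by (simp add: f_def algebra_simps)
  have fmul: "of_int k * f p q = f (k * p) (k * q)" for k p q by (simp add: f_def algebra_simps)
  have z: "0 \<in> A" using diff[OF e(1) e(1)] by simp
  have neg: "- x \<in> A" if "x \<in> A" for x using diff[OF z that] by simp
  have mult: "of_int k * x \<in> A" if x: "x \<in> A" for k :: int and x
  proof (induction k rule: int_induct[of _ 0])
    case (step1 i)
    then have "of_int i * x - (- x) \<in> A" using diff neg x by blast
    then show ?case by (simp add: algebra_simps)
  next
    case (step2 i)
    then have "of_int i * x - x \<in> A" using diff x by blast
    then show ?case by (simp add: algebra_simps)
  qed (use z in simp)
  obtain p1 q1 where e1: "e1 = f p1 q1" unfolding f_def using sub[OF e(1)] by blast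
  obtain p2 q2 where e2: "e2 = f p2 q2" unfolding f_def using sub[OF e(2)] by blast
  have det: "p1 * q2 - p2 * q1 \<noteq> 0"
  proof
    assume "p1 * q2 - p2 * q1 = 0"
    then have "real_of_int (p1 * q2 - p2 * q1) = 0" by simp
    moreover have "Im (cnj e1 * e2) = real_of_int (p1 * q2 - p2 * q1) * Im (cnj b1 * b2)"
      by (simp add: e1 e2 f_def algebra_simps)
    ultimately show False using e(3) by simp
  qed
  define G where "G = {q. \<exists>p. f p q \<in> A}"
  define E where "E = {p. f p 0 \<in> A}"
  have G1: "x - y \<in> G" if xy: "x \<in> G" "y \<in> G" for x y 
  proof -
    obtain p where p: "f p x \<in> A" using xy(1) unfolding G_def by blast
    obtain q where q: "f q y \<in> A" using xy(2) unfolding G_def by blast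
    have "f (p - q) (x - y) \<in> A" using diff[OF p q] unfolding fdiff .
    then show ?thesis unfolding G_def by blast
  qed
  have E1: "x - y \<in> E" if "x \<in> E" "y \<in> E" for x y using that diff[of "f x 0" "f y 0"] fdiff[of x 0 y 0] unfolding E_def by simp
  have "q1 \<in> G" "q2 \<in> G" using e e1 e2 by (auto simp: G_def)
  moreover have "q1 \<noteq> 0 \<or> q2 \<noteq> 0" using det by auto
  ultimately obtain g where g: "g > 0" "g \<in> G" "\<And>x. x \<in> G \<Longrightarrow> g dvd x"
    using int_subgroup_generator[of G, OF G1] by metis
  \<comment> \<open>This combination eliminates the second coordinate; its first coordinate is the
    determinant, so \<open>E\<close> contains a nonzero element.\<close>
  have "of_int q2 * e1 - of_int q1 * e2 \<in> A" using diff mult e by blast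
  then have "f (q2 * p1 - q1 * p2) 0 \<in> A" unfolding e1 e2 fmul fdiff by (simp add: mult.commute)
  then have "q2 * p1 - q1 * p2 \<in> E" by (simp add: E_def)
  then obtain h where h: "h > 0" "h \<in> E" "\<And>x. x \<in> E \<Longrightarrow> h dvd x"
    using int_subgroup_generator[of E, OF E1] det by (metis mult.commute)
  obtain s where s: "f s g \<in> A" using g by (auto simp: G_def)
  show ?thesis
  proof (rule that[of "f h 0" "f s g"], unfold_locales)
    have hA: "f h 0 \<in> A" using h by (simp add: E_def)
    show "A = {of_int p * f h 0 + of_int q * f s g |p q. True}"
    proof (intro equalityI subsetI)
      fix x assume x: "x \<in> A"
      then obtain p q where xf: "x = f p q" unfolding f_def using sub by blast
      then have "q \<in> G" using x by (auto simp: G_def)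
      then obtain k where k: "q = g * k" using g(3) by (auto elim: dvdE)
      have "x - of_int k * f s g \<in> A" using diff mult x s by blast
      then have "f (p - k * s) 0 \<in> A" unfolding xf fmul fdiff k by (simp add: mult.commute)
      then have "p - k * s \<in> E" by (simp add: E_def)
      then obtain l where l: "p - k * s = h * l" using h(3) by (auto elim: dvdE)
      have "p = h * l + k * s" using l by simp
      then have "x = of_int l * f h 0 + of_int k * f s g" unfolding xf k by (simp add: f_def algebra_simps)
      then show "x \<in> {of_int p * f h 0 + of_int q * f s g |p q. True}" by blast
    next
      fix x assume "x \<in> {of_int p * f h 0 + of_int q * f s g |p q. True}"
      then obtain p q where "x = of_int p * f h 0 - of_int (- q) * f s g" by auto
      then show "x \<in> A" using diff mult hA s by blast
    qed
    have "Im (cnj (f h 0) * f s g) = real_of_int (h * g) * Im (cnj b1 * b2)"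
      by (simp add: f_def algebra_simps)
    then show "Im (cnj (f h 0) * f s g) \<noteq> 0" using b g(1) h(1) by simp
  qed
qed

lemma covol_basis_change:
  assumes "{of_int p * w1 + of_int q * w2 | p q. True} = {of_int p * v1 + of_int q * v2 | p q. True}"
  shows "\<exists>k :: int. Im (cnj v1 * v2) = of_int k * Im (cnj w1 * w2)"
proof -
  have "v1 = of_int 1 * v1 + of_int 0 * v2" "v2 = of_int 0 * v1 + of_int 1 * v2" by simp_all
  then have "v1 \<in> {of_int p * w1 + of_int q * w2 | p q. True}" "v2 \<in> {of_int p * w1 + of_int q * w2 | p q. True}"
    unfolding assms by blast+
  then obtain a b c d where v: "v1 = of_int a * w1 + of_int b * w2" "v2 = of_int c * w1 + of_int d * w2" by blast
  have "Im (cnj v1 * v2) = of_int (a * d - b * c) * Im (cnj w1 * w2)" by (simp add: v algebra_simps)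
  then show ?thesis by blast
qed

text \<open>For two bases the oriented areas are integer multiples of each other, so the factors are
  1 or -1 and the absolute area is well defined.\<close>

lemma (in lattice) covol_eq: "covol L = \<bar>Im (cnj w1 * w2)\<bar>"
  unfolding covol_def
proof (rule the_equality)
  show "\<exists>v1 v2. L = {of_int p * v1 + of_int q * v2 |p q. True} \<and> Im (cnj v1 * v2) \<noteq> 0 \<and> \<bar>Im (cnj w1 * w2)\<bar> = \<bar>Im (cnj v1 * v2)\<bar>"
    using L_def indep by blast
next
  fix r assume "\<exists>v1 v2. L = {of_int p * v1 + of_int q * v2 |p q. True} \<and> Im (cnj v1 * v2) \<noteq> 0 \<and> r = \<bar>Im (cnj v1 * v2)\<bar>"
  then obtain v1 v2 where v: "L = {of_int p * v1 + of_int q * v2 |p q. True}" "Im (cnj v1 * v2) \<noteq> 0" "r = \<bar>Im (cnj v1 * v2)\<bar>" by blast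
  obtain k where k: "Im (cnj v1 * v2) = of_int k * Im (cnj w1 * w2)" using covol_basis_change[of w1 w2 v1 v2] L_def v(1) by blast
  obtain l where l: "Im (cnj w1 * w2) = of_int l * Im (cnj v1 * v2)" using covol_basis_change[of v1 v2 w1 w2] L_def v(1) by blast
  have "Im (cnj w1 * w2) = of_int (l * k) * Im (cnj w1 * w2)" using k l by simp
  then have "real_of_int (l * k) = 1" using indep by simp
  then have "l * k = 1" by linarith
  then have "\<bar>k\<bar> = 1" by (auto simp: zmult_eq_1_iff)
  then have "\<bar>real_of_int k\<bar> = 1" by (metis of_int_1 of_int_abs)
  then show "r = \<bar>Im (cnj w1 * w2)\<bar>" unfolding v(3) k by (simp add: abs_mult)
qed

lemma (in lattice) covol_pos: "covol L > 0" using covol_eq indep by simp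

text \<open>In lowest terms the powers of the denominator all divide \<open>N\<close>, whereas a
  denominator of at least 2 has its N-th power larger than \<open>N\<close>.\<close>

lemma rat_powers_bounded_denominator:
  fixes r :: rat
  assumes N: "N > (0::int)" and int: "\<And>k. of_int N * r ^ k \<in> \<int>"
  shows "r \<in> \<int>"
proof -
  obtain a b where ab: "r = Fract a b" "b > 0" "coprime a b" by (cases r) auto
  have dvd: "b ^ k dvd N" for k
  proof -
    obtain z where z: "of_int N * r ^ k = of_int z" using int[of k] by (auto elim: Ints_cases)
    have "r = of_int a / of_int b" using ab by (simp add: Fract_of_int_quotient)
    then have "of_int a = r * of_int b" using ab(2) by simp
    then have "of_int N * of_int a ^ k = (of_int z :: rat) * of_int b ^ k"
      unfolding z[symmetric] by (simp add: power_mult_distrib mult_ac)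
    then have "N * a ^ k = z * b ^ k" by (metis of_int_eq_iff of_int_mult of_int_power)
    then have "b ^ k dvd N * a ^ k" by simp
    moreover have "coprime (b ^ k) (a ^ k)" using ab(3) by (simp add: coprime_commute)
    ultimately show ?thesis by (simp add: coprime_dvd_mult_left_iff)
  qed
  have "b = 1"
  proof (rule ccontr)
    assume "b \<noteq> 1"
    then have b2: "b \<ge> 2" using ab(2) by linarith
    have "int (nat N) < 2 ^ nat N" by (metis of_nat_less_two_power)
    also have "(2::int) ^ nat N \<le> b ^ nat N" using b2 by (intro power_mono) auto
    also have "\<dots> \<le> N" using dvd[of "nat N"] N by (intro zdvd_imp_le) auto
    finally show False using N by simp
  qed
  then show ?thesis using ab by (simp add: Fract_of_int_quotient)
qed

text \<open>Even powers of \<open>r\<close> are integral, and odd ones become so after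
  multiplication by the denominator \<open>b\<close> once; so the powers of \<open>r\<close> have
  bounded denominators.\<close>

lemma rat_square_int:
  fixes r :: rat
  assumes "r ^ 2 \<in> \<int>" shows "r \<in> \<int>"
proof -
  obtain a b where ab: "r = Fract a b" "b > 0" "coprime a b" by (cases r) auto
  show ?thesis
  proof (rule rat_powers_bounded_denominator[of b])
    fix k
    have br: "of_int b * r \<in> \<int>" using ab by (simp add: Fract_of_int_quotient)
    show "of_int b * r ^ k \<in> \<int>"
    proof (cases "even k")
      case True
      then obtain j where "k = 2 * j" by (auto elim: evenE)
      then show ?thesis using assms by (simp add: power_mult)
    next
      case False
      then obtain j where "k = 2 * j + 1" by (auto elim: oddE)
      then have "of_int b * r ^ k = (of_int b * r) * (r ^ 2) ^ j" by (simp add: power_mult[symmetric] mult_ac)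
      then show ?thesis using Ints_mult[OF br Ints_power[OF assms, of j]] by (simp only:)
    qed
  qed (use ab in simp)
qed

lemma of_real_of_rat_eq: "complex_of_real (of_rat r) = of_rat r"
  by (cases r) (simp add: of_rat_rat)

text \<open>The order Z[sqrt m], in general smaller than the ring of integers. Its explicit basis
  makes it a ring against which denominators can be measured.\<close>

definition Mset :: "int \<Rightarrow> complex set" where
  "Mset m = {of_int p + of_int q * qgen m | p q. True}"

section \<open>Integral elements of the quadratic field and their denominators\<close>

context
  fixes m :: int assumes m: "m < 0"
begin

lemma qgen_square: "qgen m * qgen m = of_int m"
proof -
  have "complex_of_real (sqrt (real_of_int (- m))) * complex_of_real (sqrt (real_of_int (- m))) = of_real (of_int (- m))"
    using m by (simp flip: of_real_mult)
  then show ?thesis by (simp add: qgen_def algebra_simps)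
qed

lemma qgen_cnj: "cnj (qgen m) = - qgen m" by (simp add: qgen_def)

lemma qgen_Im: "Im (qgen m) > 0"
  using m by (simp add: qgen_def)

lemma Mset_iff: "x \<in> Mset m \<longleftrightarrow> (\<exists>p q. x = of_int p + of_int q * qgen m)" by (auto simp: Mset_def)

lemma Mset_add: assumes "x \<in> Mset m" "y \<in> Mset m" shows "x + y \<in> Mset m"
proof -
  obtain p q p' q' where "x = of_int p + of_int q * qgen m" "y = of_int p' + of_int q' * qgen m" using assms by (auto simp: Mset_iff)
  then have "x + y = of_int (p + p') + of_int (q + q') * qgen m" by (simp add: algebra_simps)
  then show ?thesis unfolding Mset_iff by blast
qed

lemma Mset_mult: assumes "x \<in> Mset m" "y \<in> Mset m" shows "x * y \<in> Mset m"
proof -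
  obtain p q p' q' where xy: "x = of_int p + of_int q * qgen m" "y = of_int p' + of_int q' * qgen m" using assms by (auto simp: Mset_iff)
  have "x * y = of_int p * of_int p' + of_int q * of_int q' * (qgen m * qgen m) + (of_int p * of_int q' + of_int q * of_int p') * qgen m"
    unfolding xy by (simp add: algebra_simps)
  then have "x * y = of_int (p * p' + q * q' * m) + of_int (p * q' + q * p') * qgen m" unfolding qgen_square by simp
  then show ?thesis unfolding Mset_iff by blast
qed

lemma Mset_int: "of_int n \<in> Mset m" unfolding Mset_iff by (intro exI[of _ n] exI[of _ 0]) simp

lemma Mset_cnj: assumes "x \<in> Mset m" shows "cnj x \<in> Mset m"
proof -
  obtain p q where "x = of_int p + of_int q * qgen m" using assms by (auto simp: Mset_iff)
  then have "cnj x = of_int p + of_int (- q) * qgen m" by (simp add: qgen_cnj)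
  then show ?thesis unfolding Mset_iff by blast
qed

lemma Mset_sum: "(\<And>i. i \<in> S \<Longrightarrow> f i \<in> Mset m) \<Longrightarrow> sum f S \<in> Mset m"
  by (induction S rule: infinite_finite_induct) (use Mset_int[of 0] Mset_add in auto)

lemma Mset_power: "x \<in> Mset m \<Longrightarrow> x ^ k \<in> Mset m"
  by (induction k) (use Mset_int[of 1] Mset_mult in auto)

lemma Mset_rat: assumes "of_rat r \<in> Mset m" shows "r \<in> \<int>"
proof -
  obtain p q where pq: "of_rat r = of_int p + of_int q * qgen m" using assms by (auto simp: Mset_iff)
  have "complex_of_real (of_rat r) = of_int p + of_int q * qgen m" using pq of_real_of_rat_eq[of r] by metis
  then have "Im (complex_of_real (of_rat r)) = Im (of_int p + of_int q * qgen m)" by (rule arg_cong)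
  then have "of_int q * Im (qgen m) = 0" by simp
  then have "q = 0" using qgen_Im by simp
  then have "(of_rat r :: complex) = of_rat (of_int p)" using pq by simp
  then have "r = of_int p" unfolding of_rat_eq_iff .
  then show ?thesis by simp
qed

text \<open>For elements of \<open>K\<close> this is equivalent to integrality, and the binomial theorem shows that it is
  preserved under differences, which is not evident from the existence of a monic polynomial.\<close>

definition bounded_denominators :: "complex \<Rightarrow> bool" where
  "bounded_denominators x \<longleftrightarrow> (\<exists>N>0. \<forall>k. of_int N * x ^ k \<in> Mset m)"

lemma Kfield_den: assumes "x \<in> Kfield m" obtains D where "D > (0::int)" "of_int D * x \<in> Mset m"
proof -
  obtain p q where x: "x = of_rat p + of_rat q * qgen m" using assms by (auto simp: Kfield_def)
  obtain a b where ab: "p = Fract a b" "b > 0" by (cases p) auto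
  obtain c d where cd: "q = Fract c d" "d > 0" by (cases q) auto
  have "of_int (b * d) * x = of_int (a * d) + of_int (c * b) * qgen m"
    unfolding x ab(1) cd(1) Fract_of_int_quotient of_rat_divide of_rat_of_int_eq using ab(2) cd(2) by (simp add: field_simps)
  then have "of_int (b * d) * x \<in> Mset m" unfolding Mset_iff by blast
  then show ?thesis using that[of "b * d"] ab cd by simp
qed

text \<open>The monic relation expresses \<open>x ^ n\<close> by lower powers with integer
  coefficients, so by induction a denominator that clears the first \<open>n\<close> powers clears
  all; \<open>D ^ n\<close> is such a denominator.\<close>

lemma alg_int_bounded_denominators:
  assumes x: "x \<in> Kfield m" "alg_int x" shows "bounded_denominators x"
proof -
  obtain P :: "complex poly" where P: "lead_coeff P = 1" "\<And>i. coeff P i \<in> \<int>" "poly P x = 0"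
    using x(2) by (auto simp: alg_int_def)
  define n where "n = degree P"
  obtain D where D: "D > 0" "of_int D * x \<in> Mset m" by (rule Kfield_den[OF x(1)])
  have xn: "x ^ n = (\<Sum>i<n. - coeff P i * x ^ i)"
  proof -
    have "0 = (\<Sum>i\<le>n. coeff P i * x ^ i)" using P(3) by (simp add: poly_altdef n_def)
    also have "\<dots> = (\<Sum>i<n. coeff P i * x ^ i) + x ^ n"
      using P(1) by (simp add: n_def lessThan_Suc_atMost[symmetric])
    finally show ?thesis by (simp add: sum_negf eq_neg_iff_add_eq_0 add.commute)
  qed
  have "of_int (D ^ n) * x ^ k \<in> Mset m" for k
  proof (induction k rule: less_induct)
    case (less k)
    show ?case
    proof (cases "k < n")
      case True
      have "of_int (D ^ n) * x ^ k = of_int (D ^ (n - k)) * (of_int D * x) ^ k"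
        using True by (simp add: power_mult_distrib power_add[symmetric] flip: mult.assoc)
      then show ?thesis using Mset_mult[OF Mset_int Mset_power[OF D(2)]] by (simp only:)
    next
      case False
      have "x ^ k = x ^ (k - n) * x ^ n" using False by (simp flip: power_add)
      also have "\<dots> = (\<Sum>i<n. - coeff P i * x ^ (k - n + i))" unfolding xn by (simp add: sum_distrib_left power_add mult_ac)
      finally have "of_int (D ^ n) * x ^ k = (\<Sum>i<n. - coeff P i * (of_int (D ^ n) * x ^ (k - n + i)))"
        by (simp add: sum_distrib_left mult_ac)
      moreover have "- coeff P i * (of_int (D ^ n) * x ^ (k - n + i)) \<in> Mset m" if "i < n" for i
      proof -
        obtain z where "coeff P i = of_int z" using P(2) by (auto elim: Ints_cases)
        then have "- coeff P i \<in> Mset m" using Mset_int[of "- z"] by simp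
        moreover have "k - n + i < k" using that False by simp
        ultimately show ?thesis using Mset_mult less by blast
      qed
      ultimately show ?thesis using Mset_sum[of "{..<n}"] by simp
    qed
  qed
  then show ?thesis unfolding bounded_denominators_def using D(1) by (intro exI[of _ "D ^ n"]) auto
qed

text \<open>The conjugate has bounded denominators too, hence so have sum and product with it, with
  \<open>N ^ 2\<close> as common denominator. These are rational, and a rational number all of whose
  powers have bounded denominators is an integer.\<close>

lemma bounded_denominators_trace_norm:
  assumes x: "x = of_rat p + of_rat q * qgen m" and bd: "bounded_denominators x"
  shows "2 * p \<in> \<int>" "p ^ 2 - of_int m * q ^ 2 \<in> \<int>"
proof -
  obtain N where N: "N > 0" "\<And>k. of_int N * x ^ k \<in> Mset m" using bd by (auto simp: bounded_denominators_def)
  have cx: "cnj x = of_rat p - of_rat q * qgen m"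
  proof -
    have "cnj (of_rat r) = (of_rat r :: complex)" for r
      using complex_cnj_complex_of_real[of "of_rat r"] of_real_of_rat_eq[of r] by metis
    then show ?thesis by (simp add: x qgen_cnj)
  qed
  have Nc: "of_int N * cnj x ^ k \<in> Mset m" for k using Mset_cnj[OF N(2)[of k]] by simp
  have N2: "N ^ 2 > 0" using N by simp
  have tr: "x + cnj x = of_rat (2 * p)" unfolding cx by (simp add: x of_rat_mult)
  have nm: "x * cnj x = of_rat (p ^ 2 - of_int m * q ^ 2)"
  proof -
    have "x * cnj x = of_rat p * of_rat p - of_rat q * of_rat q * (qgen m * qgen m)" unfolding cx by (subst x) (simp only: ring_distribs, simp add: algebra_simps)
    then show ?thesis unfolding qgen_square by (simp add: of_rat_diff of_rat_mult power2_eq_square)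
  qed
  show "2 * p \<in> \<int>"
  proof (rule rat_powers_bounded_denominator[OF N2])
    fix k
    have "of_int (N ^ 2) * (x + cnj x) ^ k = (\<Sum>i\<le>k. of_nat (k choose i) * ((of_int N * x ^ i) * (of_int N * cnj x ^ (k - i))))"
      unfolding binomial_ring by (simp add: sum_distrib_left power2_eq_square mult_ac)
    also have "\<dots> \<in> Mset m"
      using Mset_int[of "int _"] by (intro Mset_sum Mset_mult N(2) Nc) (simp add: Mset_int[of "int _", simplified])
    finally have "of_rat (of_int (N ^ 2) * (2 * p) ^ k) \<in> Mset m" unfolding tr by (simp add: of_rat_mult of_rat_power)
    then show "of_int (N ^ 2) * (2 * p) ^ k \<in> \<int>" by (rule Mset_rat)
  qed
  show "p ^ 2 - of_int m * q ^ 2 \<in> \<int>"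
  proof (rule rat_powers_bounded_denominator[OF N2])
    fix k
    have "of_int (N ^ 2) * (x * cnj x) ^ k = (of_int N * x ^ k) * (of_int N * cnj x ^ k)"
      by (simp add: power_mult_distrib power2_eq_square mult_ac)
    also have "\<dots> \<in> Mset m" by (intro Mset_mult N(2) Nc)
    finally have "of_rat (of_int (N ^ 2) * (p ^ 2 - of_int m * q ^ 2) ^ k) \<in> Mset m" unfolding nm by (simp add: of_rat_mult of_rat_power)
    then show "of_int (N ^ 2) * (p ^ 2 - of_int m * q ^ 2) ^ k \<in> \<int>" by (rule Mset_rat)
  qed
qed

text \<open>Trace and norm being integral, an element with bounded denominators is a root of the
  monic quadratic with these coefficients.\<close>

lemma OK_iff: "x \<in> OK m \<longleftrightarrow> x \<in> Kfield m \<and> bounded_denominators x"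
proof
  assume "x \<in> OK m" then show "x \<in> Kfield m \<and> bounded_denominators x" using alg_int_bounded_denominators by (auto simp: OK_def)
next
  assume a: "x \<in> Kfield m \<and> bounded_denominators x"
  then obtain p q where x: "x = of_rat p + of_rat q * qgen m" by (auto simp: Kfield_def)
  obtain T where T: "2 * p = of_int T" using bounded_denominators_trace_norm(1)[OF x] a by (auto elim: Ints_cases)
  obtain n where n: "p ^ 2 - of_int m * q ^ 2 = of_int n" using bounded_denominators_trace_norm(2)[OF x] a by (auto elim: Ints_cases)
  define P where "P = [:complex_of_int n, - complex_of_int T, 1:]"
  have "complex_of_int T = of_rat (2 * p)" unfolding T by simp
  then have Tc: "complex_of_int T = 2 * of_rat p" by (simp add: of_rat_mult)
  have "complex_of_int n = of_rat (p ^ 2 - of_int m * q ^ 2)" unfolding n by simp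
  then have nc: "complex_of_int n = of_rat p ^ 2 - of_int m * of_rat q ^ 2" by (simp add: of_rat_mult of_rat_diff of_rat_power)
  have "poly P x = 0"
  proof -
    have "poly P x = of_int n - of_int T * x + x * x" by (simp add: P_def algebra_simps)
    also have "\<dots> = of_rat q * of_rat q * (qgen m * qgen m - of_int m)" unfolding nc Tc x by (simp add: algebra_simps power2_eq_square)
    finally show ?thesis unfolding qgen_square by simp
  qed
  moreover have "coeff P i \<in> \<int>" for i
    unfolding P_def by (auto simp: coeff_pCons split: nat.split)
  moreover have "lead_coeff P = 1" by (simp add: P_def)
  ultimately show "x \<in> OK m" using a unfolding OK_def alg_int_def by blast
qed

lemma Kfield_diff: assumes "x \<in> Kfield m" "y \<in> Kfield m" shows "x - y \<in> Kfield m"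
proof -
  obtain p q p' q' where "x = of_rat p + of_rat q * qgen m" "y = of_rat p' + of_rat q' * qgen m" using assms by (auto simp: Kfield_def)
  then have "x - y = of_rat (p - p') + of_rat (q - q') * qgen m" by (simp add: of_rat_diff algebra_simps)
  then show ?thesis unfolding Kfield_def by blast
qed

lemma OK_diff: assumes "x \<in> OK m" "y \<in> OK m" shows "x - y \<in> OK m"
proof -
  obtain N where N: "N > 0" "\<And>k. of_int N * x ^ k \<in> Mset m" using assms(1) by (auto simp: OK_iff bounded_denominators_def)
  obtain N' where N': "N' > 0" "\<And>k. of_int N' * y ^ k \<in> Mset m" using assms(2) by (auto simp: OK_iff bounded_denominators_def)
  have "of_int (N * N') * (x - y) ^ k \<in> Mset m" for k
  proof -
    have "(x - y) ^ k = (x + (- 1) * y) ^ k" by simp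
    also have "of_int (N * N') * \<dots> = (\<Sum>i\<le>k. of_int (int (k choose i) * (- 1) ^ (k - i)) * ((of_int N * x ^ i) * (of_int N' * y ^ (k - i))))"
      unfolding binomial_ring power_mult_distrib by (simp add: sum_distrib_left mult_ac)
    also have "\<dots> \<in> Mset m" by (intro Mset_sum Mset_mult N(2) N'(2) Mset_int)
    finally show ?thesis .
  qed
  then have "bounded_denominators (x - y)" unfolding bounded_denominators_def using N(1) N'(1) by (intro exI[of _ "N * N'"]) auto
  then show ?thesis using assms Kfield_diff by (simp add: OK_iff)
qed

lemma Mset_OK: assumes "x \<in> Mset m" shows "x \<in> OK m"
proof -
  obtain p q where "x = of_int p + of_int q * qgen m" using assms by (auto simp: Mset_iff)
  then have "x = of_rat (of_int p) + of_rat (of_int q) * qgen m" by simp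
  then have "x \<in> Kfield m" unfolding Kfield_def by blast
  moreover have "bounded_denominators x" unfolding bounded_denominators_def using Mset_power[OF assms] by (intro exI[of _ 1]) simp
  ultimately show ?thesis by (simp add: OK_iff)
qed

text \<open>\<open>2 * p\<close> is the trace, and four times the norm subtracted from its square
  leaves \<open>4 * m * q^2\<close>. Multiplied by \<open>m\<close> this is the square of
  \<open>2 * m * q\<close>, so that number is an integer; the bound needs no case distinction on
  \<open>m\<close> modulo 4.\<close>

lemma OK_den: assumes "x \<in> OK m" shows "of_int (2 * m) * x \<in> Mset m"
proof -
  obtain p q where x: "x = of_rat p + of_rat q * qgen m" using assms by (auto simp: OK_def Kfield_def)
  have bd: "bounded_denominators x" using assms by (simp add: OK_iff)
  note tn = bounded_denominators_trace_norm[OF x bd]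
  have "(of_int (2 * m) * q) ^ 2 = of_int m * ((2 * p) ^ 2 - 4 * (p ^ 2 - of_int m * q ^ 2))"
    by (simp add: algebra_simps power2_eq_square)
  also have "\<dots> \<in> \<int>" 
    by (rule Ints_mult[OF Ints_of_int Ints_diff[OF Ints_power[OF tn(1)] Ints_mult[OF Ints_numeral tn(2)]]])
  finally have "of_int (2 * m) * q \<in> \<int>" by (rule rat_square_int)
  then obtain k where k: "of_int (2 * m) * q = of_int k" by (auto elim: Ints_cases)
  obtain T where T: "2 * p = of_int T" using tn(1) by (auto elim: Ints_cases)
  have "of_int (2 * m) * x = of_rat (of_int m * (2 * p)) + of_rat (of_int (2 * m) * q) * qgen m"
    unfolding x by (simp add: of_rat_mult algebra_simps)
  also have "\<dots> = of_int (m * T) + of_int k * qgen m" unfolding k T by (simp add: of_rat_mult)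
  finally show ?thesis unfolding Mset_iff by blast
qed

text \<open>The hypothesis on \<open>t\<close> puts \<open>A\<close> inside a scaled copy of
  Z[sqrt m], and \<open>x0\<close>, \<open>qgen m * x0\<close> are independent over the reals, so
  \<open>sublattice_basis\<close> applies.\<close>

lemma module_lattice:
  assumes t: "t \<noteq> 0" "\<And>x. x \<in> A \<Longrightarrow> t * x \<in> OK m" and diff: "\<And>x y. x \<in> A \<Longrightarrow> y \<in> A \<Longrightarrow> x - y \<in> A"
    and x0: "x0 \<in> A" "x0 \<noteq> 0" "qgen m * x0 \<in> A"
  obtains w1 w2 where "lattice A w1 w2"
proof (rule sublattice_basis[of A "1 / (of_int (2 * m) * t)" "qgen m / (of_int (2 * m) * t)", OF _ _ diff x0(1,3)])
  define s where "s = of_int (2 * m) * t"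
  have s: "s \<noteq> 0" using t m by (simp add: s_def)
  show "\<exists>p q. x = of_int p * (1 / (of_int (2 * m) * t)) + of_int q * (qgen m / (of_int (2 * m) * t))" if "x \<in> A" for x
  proof -
    obtain p q where "s * x = of_int p + of_int q * qgen m"
      using OK_den[OF t(2)[OF \<open>x \<in> A\<close>]] unfolding Mset_iff s_def mult.assoc by blast
    then have "x = of_int p * (1 / s) + of_int q * (qgen m / s)" using s by (simp add: field_simps)
    then show ?thesis unfolding s_def by blast
  qed
  have norm: "Im (cnj y * (qgen m * y)) = (cmod y)\<^sup>2 * Im (qgen m)" for y
  proof -
    have "cnj y * (qgen m * y) = of_real ((cmod y)\<^sup>2) * qgen m" using complex_norm_square[of y] by (simp add: mult_ac)
    then have "Im (cnj y * (qgen m * y)) = Im (of_real ((cmod y)\<^sup>2) * qgen m)" by (rule arg_cong)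
    then show ?thesis unfolding times_complex.sel(2)[of "of_real _"] by simp
  qed
  show "Im (cnj (1 / (of_int (2 * m) * t)) * (qgen m / (of_int (2 * m) * t))) \<noteq> 0"
    using norm[of "1 / s"] s qgen_Im unfolding s_def[symmetric] by simp
  show "Im (cnj x0 * (qgen m * x0)) \<noteq> 0" using norm[of x0] x0 qgen_Im by simp
qed (assumption | rule that)+

lemma frac_ideal_lattice:
  assumes A: "frac_ideal m A" obtains w1 w2 where "lattice A w1 w2"
proof -
  obtain t where t: "t \<noteq> 0" "\<And>x. x \<in> A \<Longrightarrow> t * x \<in> OK m" using A unfolding frac_ideal_def by (elim conjE bexE) blast
  have mul: "r * x \<in> A" if "r \<in> OK m" "x \<in> A" for r x using A that by (auto simp: frac_ideal_def)
  have "-1 \<in> OK m" using Mset_OK[OF Mset_int[of "-1"]] by simp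
  then have diff: "x - y \<in> A" if "x \<in> A" "y \<in> A" for x y
  proof -
    have "x + (-1) * y \<in> A" using A that mul[OF \<open>-1 \<in> OK m\<close> that(2)] unfolding frac_ideal_def by blast
    then show ?thesis by simp
  qed
  obtain x0 where x0: "x0 \<in> A" "x0 \<noteq> 0" using A unfolding frac_ideal_def by blast
  have "qgen m \<in> Mset m" unfolding Mset_iff by (intro exI[of _ 0] exI[of _ 1]) simp
  then have "qgen m * x0 \<in> A" using mul[OF Mset_OK x0(1)] by blast
  from module_lattice[OF t diff x0 this] that show ?thesis by blast
qed

lemma OK_lattice: obtains w1 w2 where "lattice (OK m) w1 w2"
proof -
  have "1 \<in> OK m" using Mset_OK[OF Mset_int[of 1]] by simp
  moreover have "qgen m \<in> Mset m" unfolding Mset_iff by (intro exI[of _ 0] exI[of _ 1]) simp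
  then have "qgen m * 1 \<in> OK m" using Mset_OK by simp
  ultimately show ?thesis using module_lattice[of 1 "OK m" 1, OF _ _ OK_diff] that by auto
qed

lemma ideal_norm_nz: assumes "frac_ideal m A" shows "ideal_norm m A \<noteq> 0"
proof -
  obtain w1 w2 where "lattice A w1 w2" by (rule frac_ideal_lattice[OF assms])
  moreover obtain v1 v2 where "lattice (OK m) v1 v2" by (rule OK_lattice)
  ultimately have "covol A > 0" "covol (OK m) > 0" using lattice.covol_pos by blast+
  then show ?thesis by (simp add: ideal_norm_def)
qed

end

theorem mainTheorem3:
  fixes m :: int and chi :: "complex set \<Rightarrow> complex" and A :: "complex set"
    and a b c d :: complex and z0 :: complex and v0 :: real
  assumes "m < 0" and "squarefree m"
    and "{x \<in> OK m. \<exists>y\<in>OK m. x * y = 1} = {1, -1}"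
    and "class_number_one m \<or> qdisc m mod 8 = 1"
    and "is_chi m chi"
    and "frac_ideal m A"
    and "v0 > 0"
    and "a \<in> OK m" "b \<in> OK m" "c \<in> OK m" "d \<in> OK m" "a * d - b * c = 1"
  shows "Ehat_gamma m chi A (z0, v0) a b c d
           = inverse (chi A) * (if c \<noteq> 0 then Iop ((a + d) / c) * G2 A - Dsum a c A
                               else Iop (b / d) * G2 A)
       \<and> chi A * Ehat_gamma m chi A (z0, v0) a b c d = Phi A a b c d"
proof -
  obtain w1 w2 where lat: "lattice A w1 w2" by (rule frac_ideal_lattice[OF assms(1,6)])
  interpret lattice A w1 w2 by (rule lat)
  have mul: "r * x \<in> A" if "r \<in> OK m" "x \<in> A" for r x using assms(6) that by (auto simp: frac_ideal_def)
  \<comment> \<open>For \<open>c = 0\<close> the determinant condition reads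
    \<open>a * d = 1\<close>, so \<open>d\<close> is a unit of the ring of integers.\<close>
  have unit: "d = 1 \<or> d = -1" if "c = 0"
  proof -
    have "d \<in> {x \<in> OK m. \<exists>y\<in>OK m. x * y = 1}"
      using assms(8,11,12) that by (auto intro!: bexI[of _ a] simp: mult.commute)
    then show ?thesis unfolding assms(3) by simp
  qed
  have E: "Ehat_gamma m chi A (z0, v0) a b c d
           = inverse (chi A) * (if c \<noteq> 0 then Iop ((a + d) / c) * G2 A - Dsum a c A
                               else Iop (b / d) * G2 A)"
    unfolding Ehat_gamma_eq[OF assms(7) ideal_norm_nz[OF assms(1,6)] assms(12)]
    by (subst cocycle_value[OF assms(12)]) (use mul assms(7-11) unit in auto)
  moreover have "chi A \<noteq> 0" using assms(5,6) by (auto simp: is_chi_def)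
  ultimately show ?thesis by (simp add: Phi_def)
qed

end
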